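(* Let $\Omega\subset\mathbb{R}^d$, $d\le 3$, be a bounded convex domain, $\nu>0$, $R>0$, $\varphi(s)=s^3-s$, and let $\mathcal{F}:H_n^2(\Omega)\to H_n^{-2}(\Omega)$ be linear and continuous with $\langle\mathcal{F}z,z\rangle\ge 0$ for all $z\in H_n^2(\Omega)$. Suppose that for some $\gamma>0$ $$\nu\|\Delta z\|_{L^2(\Omega)}^2+2\langle\mathcal{F}z,z\rangle\ge (C^*+\gamma)\|z\|_{L^2(\Omega)}^2\qquad\forall z\in H_n^2(\Omega),$$ where $C^*=\tfrac32\big(R^2+(3R^2)^{4/3}\nu^{-1/3}+\nu^{-1}\big)+1$. Let $V_h\subset H_n^2(\Omega)$ be a finite-dimensional subspace, $\tau>0$, $t^n=n\tau$, and let $h^n,h_r^n\in L^2(\Omega)$ for $n\ge 0$. Let $\{y_{r,h}^n\}_{n\ge0}\subset V_h$ satisfy $\|y_{r,h}^n\|_{W^{1,\infty}(\Omega)}\le R$ and, for all $n\ge1$ and all $v_h\in V_h$, $$\langle d_\tau y_{r,h}^n,v_h\rangle+\langle\nu\Delta y_{r,h}^n,\Delta v_h\rangle-\langle\varphi(y_{r,h}^n),\Delta v_h\rangle=\langle h_r^n,v_h\rangle .$$ Then any sequence $\{y_h^n\}_{n\ge0}\subset V_h$ satisfying, for all $n\ge1$ and all $v_h\in V_h$, $$\langle d_\tau y_h^n,v_h\rangle+\langle\nu\Delta y_h^n,\Delta v_h\rangle=\langle\varphi(y_h^n),\Delta v_h\rangle+\langle h^n,v_h\rangle-\langle\mathcal{F}(y_h^n-y_{r,h}^n),v_h\rangle$$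 obeys $$\|y_h^n-y_{r,h}^n\|_{L^2}^2\le e^{-\tilde\gamma t^n}\|y_h^0-y_{r,h}^0\|_{L^2}^2+\sum_{k=0}^n\tau\,e^{-\tilde\gamma(t^n-t^k)}\|h^k-h_r^k\|_{L^2}^2\qquad\text{for all }n\ge0,$$ where $\tilde\gamma$ is defined by $\tau\tilde\gamma=\log(1+\tau\gamma)$. In particular, if $h^k=h_r^k$ for all $k$, then $y_h^n$ stabilises exponentially around the discrete target trajectory $y_{r,h}^n$.
   Context: $H_n^2(\Omega)=\{v\in H^2(\Omega):\partial_n v=0\text{ on }\partial\Omega\}$ and $H_n^{-2}(\Omega)=H_n^2(\Omega)'$ is its dual; $\langle\cdot,\cdot\rangle$ denotes the $L^2(\Omega)$ inner product and, as appropriate, the duality pairing between $H_n^{-2}$ and $H_n^2$. The backward difference quotient is $d_\tau a^n=\frac1\tau(a^n-a^{n-1})$. The functions $h^n$ are the values at $t^n$ of a given source term (the symbol $h$ in $V_h$, $y_h^n$ is a discretisation index and unrelated to it). *)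

theory Defs
  imports "HOL-Analysis.Analysis" "HOL-Probability.Essential_Supremum"
begin

text \<open>
  Elements of function spaces over \<open>\<Omega>\<close> are represented by functions on the whole space;
  only their values almost everywhere on \<open>\<Omega>\<close> matter. A partial derivative
  \<open>\<partial>\<^sub>i\<^sub>1 \<dots> \<partial>\<^sub>i\<^sub>k\<close> is indexed by the list \<open>[i\<^sub>1, \<dots>, i\<^sub>k]\<close> of basis vectors.
\<close>

subsection \<open>Classical derivatives and test functions\<close>

definition partial_deriv :: "'a \<Rightarrow> ('a::euclidean_space \<Rightarrow> real) \<Rightarrow> 'a \<Rightarrow> real" where
  "partial_deriv i f = (\<lambda>x. frechet_derivative f (at x) i)"

definition partial_derivs :: "'a list \<Rightarrow> ('a::euclidean_space \<Rightarrow> real) \<Rightarrow> 'a \<Rightarrow> real" where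
  "partial_derivs is f = foldr partial_deriv is f"

text \<open>Differentiability of all iterated partial derivatives makes them all continuous.\<close>

definition smooth :: "('a::euclidean_space \<Rightarrow> real) \<Rightarrow> bool" where
  "smooth f \<longleftrightarrow> (\<forall>is\<in>lists Basis. \<forall>x. partial_derivs is f differentiable (at x))"

definition test_functions :: "'a::euclidean_space set \<Rightarrow> ('a \<Rightarrow> real) set" where
  "test_functions \<Omega> = {\<phi>. smooth \<phi> \<and> compact (closure {x. \<phi> x \<noteq> 0}) \<and> closure {x. \<phi> x \<noteq> 0} \<subseteq> \<Omega>}"

subsection \<open>Lebesgue and Sobolev spaces\<close>

definition L2 :: "'a::euclidean_space set \<Rightarrow> ('a \<Rightarrow> real) set" where
  "L2 \<Omega> = {u \<in> borel_measurable (lebesgue_on \<Omega>). integrable (lebesgue_on \<Omega>) (\<lambda>x. (u x)\<^sup>2)}"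

definition L2_inner :: "'a::euclidean_space set \<Rightarrow> ('a \<Rightarrow> real) \<Rightarrow> ('a \<Rightarrow> real) \<Rightarrow> real" where
  "L2_inner \<Omega> u v = (LINT x|lebesgue_on \<Omega>. u x * v x)"

definition L2_norm :: "'a::euclidean_space set \<Rightarrow> ('a \<Rightarrow> real) \<Rightarrow> real" where
  "L2_norm \<Omega> u = sqrt (L2_inner \<Omega> u u)"

definition locally_integrable :: "'a::euclidean_space set \<Rightarrow> ('a \<Rightarrow> real) \<Rightarrow> bool" where
  "locally_integrable \<Omega> u \<longleftrightarrow> (\<forall>K. compact K \<and> K \<subseteq> \<Omega> \<longrightarrow> integrable (lebesgue_on K) u)"

definition has_weak_deriv ::
    "'a::euclidean_space set \<Rightarrow> 'a list \<Rightarrow> ('a \<Rightarrow> real) \<Rightarrow> ('a \<Rightarrow> real) \<Rightarrow> bool" where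
  "has_weak_deriv \<Omega> is u g \<longleftrightarrow> locally_integrable \<Omega> u \<and> locally_integrable \<Omega> g \<and>
     (\<forall>\<phi>\<in>test_functions \<Omega>.
        L2_inner \<Omega> u (partial_derivs is \<phi>) = (-1) ^ length is * L2_inner \<Omega> g \<phi>)"

text \<open>The weak derivative, if there is one, is unique up to a null set.\<close>

definition weak_deriv :: "'a::euclidean_space set \<Rightarrow> 'a list \<Rightarrow> ('a \<Rightarrow> real) \<Rightarrow> 'a \<Rightarrow> real" where
  "weak_deriv \<Omega> is u = (SOME g. has_weak_deriv \<Omega> is u g)"

definition H_space :: "nat \<Rightarrow> 'a::euclidean_space set \<Rightarrow> ('a \<Rightarrow> real) set" where
  "H_space k \<Omega> = {u \<in> L2 \<Omega>. \<forall>is\<in>lists Basis. length is \<le> k \<longrightarrow> (\<exists>g\<in>L2 \<Omega>. has_weak_deriv \<Omega> is u g)}"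

text \<open>
  Mixed derivatives are counted once per ordering, i.e. the second-order part is the Frobenius
  norm of the Hessian. The term for the empty list is the \<open>L\<^sup>2\<close> norm of \<open>u\<close> itself.
\<close>

definition H_norm :: "nat \<Rightarrow> 'a::euclidean_space set \<Rightarrow> ('a \<Rightarrow> real) \<Rightarrow> real" where
  "H_norm k \<Omega> u = sqrt (\<Sum>is | is \<in> lists Basis \<and> length is \<le> k. (L2_norm \<Omega> (weak_deriv \<Omega> is u))\<^sup>2)"

definition laplacian :: "'a::euclidean_space set \<Rightarrow> ('a \<Rightarrow> real) \<Rightarrow> 'a \<Rightarrow> real" where
  "laplacian \<Omega> u = (\<lambda>x. \<Sum>i\<in>Basis. weak_deriv \<Omega> [i, i] u x)"

text \<open>
  The sum over all \<open>|\<alpha>| \<le> 1\<close> of the essential suprema of \<open>|D\<^sup>\<alpha>u|\<close>; extended-real valued, so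
  that a finite bound also expresses that \<open>u\<close> and its gradient are essentially bounded.
\<close>

definition W1inf_norm :: "'a::euclidean_space set \<Rightarrow> ('a \<Rightarrow> real) \<Rightarrow> ereal" where
  "W1inf_norm \<Omega> u =
     (\<Sum>is | is \<in> lists Basis \<and> length is \<le> 1. esssup (lebesgue_on \<Omega>) (\<lambda>x. ereal \<bar>weak_deriv \<Omega> is u x\<bar>))"

definition W1inf :: "'a::euclidean_space set \<Rightarrow> ('a \<Rightarrow> real) set" where
  "W1inf \<Omega> = {u \<in> borel_measurable (lebesgue_on \<Omega>).
     (\<forall>is\<in>lists Basis. length is \<le> 1 \<longrightarrow> (\<exists>g. has_weak_deriv \<Omega> is u g)) \<and> W1inf_norm \<Omega> u < \<infinity>}"

subsection \<open>Surface measure, traces and the normal derivative\<close>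

definition hausdorff_pre :: "nat \<Rightarrow> real \<Rightarrow> 'a::metric_space set \<Rightarrow> ennreal" where
  "hausdorff_pre s \<delta> A =
     (INF C\<in>{C :: nat \<Rightarrow> 'a set. A \<subseteq> (\<Union>i. C i) \<and> (\<forall>i. bounded (C i) \<and> diameter (C i) \<le> \<delta>)}.
        \<Sum>i. if C i = {} then 0 else ennreal (unit_ball_vol (real s) * (diameter (C i) / 2) ^ s))"

definition hausdorff_measure :: "nat \<Rightarrow> 'a::metric_space measure" where
  "hausdorff_measure s = measure_of UNIV (sets borel) (\<lambda>A. SUP \<delta>\<in>{0<..}. hausdorff_pre s \<delta> A)"

definition surface_measure :: "'a::euclidean_space set \<Rightarrow> 'a measure" where
  "surface_measure \<Omega> = restrict_space (hausdorff_measure (DIM('a) - 1)) (frontier \<Omega>)"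

text \<open>
  The trace operator \<open>H\<^sup>1(\<Omega>) \<rightarrow> L\<^sup>2(\<partial>\<Omega>)\<close> as the continuous extension of the restriction of
  functions that are smooth up to the boundary. On bounded convex (more generally Lipschitz)
  domains every \<open>u\<close> in \<open>H\<^sup>1(\<Omega>)\<close> has exactly one trace up to surface null sets.
\<close>

definition has_trace :: "'a::euclidean_space set \<Rightarrow> ('a \<Rightarrow> real) \<Rightarrow> ('a \<Rightarrow> real) \<Rightarrow> bool" where
  "has_trace \<Omega> u g \<longleftrightarrow> u \<in> H_space 1 \<Omega> \<and> g \<in> borel_measurable (surface_measure \<Omega>) \<and>
     (\<exists>U :: nat \<Rightarrow> 'a \<Rightarrow> real. (\<forall>k. smooth (U k)) \<and>
        (\<lambda>k. H_norm 1 \<Omega> (\<lambda>x. U k x - u x)) \<longlonglongrightarrow> 0 \<and>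
        (\<lambda>k. \<integral>\<^sup>+x. ennreal ((U k x - g x)\<^sup>2) \<partial>surface_measure \<Omega>) \<longlonglongrightarrow> 0)"

text \<open>
  The unit outer normal of a convex domain: it is unique at surface-almost every boundary point,
  and the choice at the remaining points is irrelevant.
\<close>

definition outer_normal :: "'a::euclidean_space set \<Rightarrow> 'a \<Rightarrow> 'a" where
  "outer_normal \<Omega> x = (SOME n. norm n = 1 \<and> (\<forall>y\<in>\<Omega>. n \<bullet> (y - x) \<le> 0))"

definition has_normal_deriv :: "'a::euclidean_space set \<Rightarrow> ('a \<Rightarrow> real) \<Rightarrow> ('a \<Rightarrow> real) \<Rightarrow> bool" where
  "has_normal_deriv \<Omega> v g \<longleftrightarrow>
     (\<exists>G :: 'a \<Rightarrow> 'a \<Rightarrow> real. (\<forall>i\<in>Basis. has_trace \<Omega> (weak_deriv \<Omega> [i] v) (G i)) \<and>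
        (AE x in surface_measure \<Omega>. g x = (\<Sum>i\<in>Basis. G i x * (outer_normal \<Omega> x \<bullet> i))))"

definition H2n :: "'a::euclidean_space set \<Rightarrow> ('a \<Rightarrow> real) set" where
  "H2n \<Omega> = {v \<in> H_space 2 \<Omega>. has_normal_deriv \<Omega> v (\<lambda>x. 0)}"

subsection \<open>The dual space and operators into it\<close>

text \<open>
  A functional, and an operator \<open>F\<close> with \<open>\<langle>F z, v\<rangle>\<close> written \<open>F z v\<close>, is only constrained on
  \<open>H2n \<Omega>\<close>. Linearity and boundedness make it independent of the choice of representatives.
\<close>

definition H2n_dual :: "'a::euclidean_space set \<Rightarrow> (('a \<Rightarrow> real) \<Rightarrow> real) set" where
  "H2n_dual \<Omega> = {l.
     (\<forall>v\<in>H2n \<Omega>. \<forall>w\<in>H2n \<Omega>. \<forall>a b. l (\<lambda>x. a * v x + b * w x) = a * l v + b * l w) \<and>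
     (\<exists>C. \<forall>v\<in>H2n \<Omega>. \<bar>l v\<bar> \<le> C * H_norm 2 \<Omega> v)}"

definition H2n_dual_norm :: "'a::euclidean_space set \<Rightarrow> (('a \<Rightarrow> real) \<Rightarrow> real) \<Rightarrow> real" where
  "H2n_dual_norm \<Omega> l = (SUP v\<in>{v \<in> H2n \<Omega>. H_norm 2 \<Omega> v \<le> 1}. \<bar>l v\<bar>)"

definition linear_continuous_into_dual ::
    "'a::euclidean_space set \<Rightarrow> (('a \<Rightarrow> real) \<Rightarrow> ('a \<Rightarrow> real) \<Rightarrow> real) \<Rightarrow> bool" where
  "linear_continuous_into_dual \<Omega> F \<longleftrightarrow>
     (\<forall>z\<in>H2n \<Omega>. F z \<in> H2n_dual \<Omega>) \<and>
     (\<forall>z\<in>H2n \<Omega>. \<forall>w\<in>H2n \<Omega>. \<forall>a b. \<forall>v\<in>H2n \<Omega>.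
        F (\<lambda>x. a * z x + b * w x) v = a * F z v + b * F w v) \<and>
     (\<exists>C. \<forall>z\<in>H2n \<Omega>. H2n_dual_norm \<Omega> (F z) \<le> C * H_norm 2 \<Omega> z)"

subsection \<open>Discretisation\<close>

text \<open>Finite-dimensional as a space of functions modulo equality almost everywhere on \<open>\<Omega>\<close>.\<close>

definition fin_dim_subspace :: "'a::euclidean_space set \<Rightarrow> ('a \<Rightarrow> real) set \<Rightarrow> bool" where
  "fin_dim_subspace \<Omega> V \<longleftrightarrow>
     (\<lambda>x. 0) \<in> V \<and> (\<forall>u\<in>V. \<forall>v\<in>V. \<forall>a b. (\<lambda>x. a * u x + b * v x) \<in> V) \<and>
     (\<exists>B. finite B \<and> B \<subseteq> V \<and>
        (\<forall>v\<in>V. \<exists>c. AE x in lebesgue_on \<Omega>. v x = (\<Sum>b\<in>B. c b * b x)))"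

definition diff_quot :: "real \<Rightarrow> (nat \<Rightarrow> 'a \<Rightarrow> real) \<Rightarrow> nat \<Rightarrow> 'a \<Rightarrow> real" where
  "diff_quot \<tau> a n = (\<lambda>x. (a n x - a (n - 1) x) / \<tau>)"

definition phi :: "real \<Rightarrow> real" where
  "phi s = s ^ 3 - s"

definition C_star :: "real \<Rightarrow> real \<Rightarrow> real" where
  "C_star R \<nu> = 3 / 2 * (R\<^sup>2 + (3 * R\<^sup>2) powr (4 / 3) * \<nu> powr (- 1 / 3) + 1 / \<nu>) + 1"

end

theory Submission
  imports Defs "HOL-Real_Asymp.Real_Asymp"
begin

text \<open>
  Testing the difference of the two equations with \<open>z = y\<^sub>h - y\<^sub>r\<^sub>,\<^sub>h\<close> leaves the term
  \<open>\<langle>\<phi>(y\<^sub>h) - \<phi>(y\<^sub>r\<^sub>,\<^sub>h), \<Delta> z\<rangle>\<close>. Green's formula, available because \<open>\<partial>\<^sub>n z = 0\<close>, moves one derivative off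
  \<open>\<Delta> z\<close>; the cubic then has the favourable sign in its leading part \<open>- 6 y\<^sup>2 \<bar>\<nabla> z\<bar>\<^sup>2\<close>, and Young's inequality
  together with the bound on \<open>y\<^sub>r\<^sub>,\<^sub>h\<close> and \<open>\<parallel>\<nabla> z\<parallel>\<^sup>2 = - \<langle>z, \<Delta> z\<rangle>\<close> absorbs the rest into \<open>\<nu> \<parallel>\<Delta> z\<parallel>\<^sup>2\<close> and
  \<open>(C\<^sup>* - 1) \<parallel>z\<parallel>\<^sup>2\<close>. Coercivity and a discrete Gronwall argument finish the proof.

  Green's formula on a convex domain is obtained with the cutoff
  \<open>\<chi>\<^sub>\<epsilon> = min 1 ((1 - p) / \<epsilon>)\<close>, where \<open>p\<close> is the Minkowski functional. Its gradient lives in the layer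
  \<open>1 - \<epsilon> < p < 1\<close> and is parallel to the outer normal at the radial projection. Since the volume of a part of the
  layer is at most a constant times \<open>\<epsilon>\<close> times the surface measure of its projection, the boundary term
  vanishes as \<open>\<epsilon> \<rightarrow> 0\<close> when the trace of the normal derivative is zero. Cubes of functions in \<open>H\<^sup>2\<close> are
  admissible because in dimension at most three Taylor's formula bounds functions in \<open>H\<^sup>2\<close>.
\<close>

subsection \<open>Bump functions and the fundamental lemma of the calculus of variations\<close>

text \<open>The hypotheses reach the proof only through definitions: a trace is a limit of smooth
  functions, the normal an arbitrary choice at each boundary point, the weak derivative a choice
  among almost equal functions. Green's formula is therefore approached from inside. In the layer a
  derivative \<open>X\<close> of \<open>z\<close> with trace \<open>G\<close> is split, by means of
  a smooth \<open>U\<close>, into \<open>X - U\<close>, \<open>U\<close> minus its value at the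
  projection, \<open>U - G\<close> at the projection, and \<open>G\<close> itself: a trace
  inequality, the Lipschitz constant of \<open>U\<close>, the trace convergence and the vanishing
  normal derivative dispose of them in turn, so \<open>U\<close> has to be fixed before \<epsilon>.
  The constant records how \<nu> is spent. After doubling, the energy identity contains two copies
  of \<open>\<nu> \<parallel>\<Delta> z\<parallel>^2\<close>. One goes to coercivity; of the other,
  one third pays for the gradient produced by the cubic and two thirds for the linear part of
  \<phi>. \<open>R^2\<close> is what remains after \<open>- 6 y^2 |\<nabla> z|^2\<close> is used up,
  the power \<open>4 / 3\<close> comes from a balanced Young inequality, \<open>1 / \<nu>\<close>
  from the linear part, and the final 1 from the source term.\<close>

definition flat_exp :: "nat \<Rightarrow> real \<Rightarrow> real" where
  "flat_exp k t = (if t > 0 then exp (- 1 / t) / t ^ k else 0)"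

text \<open>Differentiating \<open>exp (- 1 / t) / t ^ k\<close> only raises the power in the
  denominator, which is why a whole family indexed by \<open>k\<close> is introduced. At 0 the
  difference quotient tends to 0 because the exponential beats every power.\<close>

lemma flat_exp_has_real_derivative:
  "(flat_exp k has_real_derivative flat_exp (k + 2) t - real k * flat_exp (k + 1) t) (at t)"
proof -
  consider "t < 0" | "t = 0" | "t > 0" by linarith
  then show ?thesis
  proof cases
    case 1
    show ?thesis
      by (rule has_field_derivative_transform_within_open[where S="{..<0}" and f="\<lambda>_. 0"])
        (use 1 in \<open>auto simp: flat_exp_def\<close>)
  next
    case 2
    have "((\<lambda>h. flat_exp k h / h) \<longlongrightarrow> 0) (at_right 0)"
    proof -
      have "((\<lambda>h::real. exp (- 1 / h) / h ^ k / h) \<longlongrightarrow> 0) (at_right 0)"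
        by real_asymp
      then show ?thesis
        by (rule Lim_transform_eventually)
          (auto simp: flat_exp_def eventually_at_filter)
    qed
    moreover have "((\<lambda>h. flat_exp k h / h) \<longlongrightarrow> 0) (at_left 0)"
      by (rule Lim_transform_eventually[OF tendsto_const]) (auto simp: flat_exp_def eventually_at_filter)
    ultimately have "((\<lambda>h. flat_exp k h / h) \<longlongrightarrow> 0) (at 0)"
      by (simp add: filterlim_split_at)
    then show ?thesis
      using 2 by (simp add: has_field_derivative_iff flat_exp_def)
  next
    case 3
    have "((\<lambda>t. exp (- 1 / t) / t ^ k) has_real_derivative
        flat_exp (k + 2) t - real k * flat_exp (k + 1) t) (at t)"
      using 3
      apply (auto intro!: derivative_eq_intros simp: flat_exp_def)
      \<comment> \<open>The power rule leaves \<open>t ^ (k - 1)\<close> with truncated subtraction,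
        so \<open>k = 0\<close> is separated.\<close>
      apply (cases k)
      apply (auto simp: field_simps power2_eq_square)
      done
    then show ?thesis
      by (rule has_field_derivative_transform_within_open[where S="{0<..}"])
        (use 3 in \<open>auto simp: flat_exp_def\<close>)
  qed
qed

lemma flat_exp_nonneg: "flat_exp k t \<ge> 0"
  by (auto simp: flat_exp_def)

lemma flat_exp_0: "flat_exp 0 t = (if t > 0 then exp (- 1 / t) else 0)"
  by (auto simp: flat_exp_def)

text \<open>This algebra is closed under partial derivatives, which makes its members smooth without any
  calculus of iterated derivatives.\<close>

inductive_set bump_alg :: "('a::euclidean_space \<Rightarrow> real) set" where
  const: "(\<lambda>x. k) \<in> bump_alg"
| flat: "(\<lambda>x. flat_exp n (u \<bullet> x + \<beta>)) \<in> bump_alg"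
| add: "f \<in> bump_alg \<Longrightarrow> g \<in> bump_alg \<Longrightarrow> (\<lambda>x. f x + g x) \<in> bump_alg"
| mult: "f \<in> bump_alg \<Longrightarrow> g \<in> bump_alg \<Longrightarrow> (\<lambda>x. f x * g x) \<in> bump_alg"

lemma bump_alg_has_derivative:
  "f \<in> bump_alg \<Longrightarrow> \<exists>D. (\<forall>x. (f has_derivative D x) (at x)) \<and> (\<forall>i. (\<lambda>x. D x i) \<in> bump_alg)"
proof (induction rule: bump_alg.induct)
  case (const k)
  show ?case
    by (rule exI[of _ "\<lambda>x i. 0"]) (auto intro: bump_alg.const)
next
  case (flat n u \<beta>)
  define D where "D = (\<lambda>x i. (u \<bullet> i) * (flat_exp (n + 2) (u \<bullet> x + \<beta>) + (- real n) * flat_exp (n + 1) (u \<bullet> x + \<beta>)))"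
  have "((\<lambda>x. flat_exp n (u \<bullet> x + \<beta>)) has_derivative D x) (at x)" for x
  proof -
    have "((\<lambda>x. u \<bullet> x + \<beta>) has_derivative (\<lambda>i. u \<bullet> i)) (at x)"
      by (auto intro!: derivative_eq_intros)
    from has_derivative_compose[OF this flat_exp_has_real_derivative[unfolded has_field_derivative_def]]
    show ?thesis
      by (rule has_derivative_eq_rhs) (auto simp: D_def field_simps)
  qed
  moreover have "(\<lambda>x. D x i) \<in> bump_alg" for i
    unfolding D_def by (intro bump_alg.intros)
  ultimately show ?case by blast
next
  case (add f g)
  then obtain D E where D: "\<forall>x. (f has_derivative D x) (at x)" "\<forall>i. (\<lambda>x. D x i) \<in> bump_alg"
    and E: "\<forall>x. (g has_derivative E x) (at x)" "\<forall>i. (\<lambda>x. E x i) \<in> bump_alg" by blast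
  show ?case
    by (rule exI[of _ "\<lambda>x i. D x i + E x i"])
      (use D E in \<open>auto intro!: has_derivative_add bump_alg.intros\<close>)
next
  case (mult f g)
  then obtain D E where D: "\<forall>x. (f has_derivative D x) (at x)" "\<forall>i. (\<lambda>x. D x i) \<in> bump_alg"
    and E: "\<forall>x. (g has_derivative E x) (at x)" "\<forall>i. (\<lambda>x. E x i) \<in> bump_alg" by blast
  show ?case
    by (rule exI[of _ "\<lambda>x i. f x * E x i + D x i * g x"])
      (use D E mult in \<open>auto intro!: has_derivative_mult bump_alg.intros\<close>)
qed

lemma bump_alg_differentiable: "f \<in> bump_alg \<Longrightarrow> f differentiable (at x)"
  using bump_alg_has_derivative by (metis differentiableI)

lemma bump_alg_partial: "f \<in> bump_alg \<Longrightarrow> partial_deriv i f \<in> bump_alg"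
proof -
  assume "f \<in> bump_alg"
  then obtain D where D: "\<forall>x. (f has_derivative D x) (at x)" "\<forall>i. (\<lambda>x. D x i) \<in> bump_alg"
    using bump_alg_has_derivative by blast
  then have "partial_deriv i f = (\<lambda>x. D x i)"
    by (metis partial_deriv_def frechet_derivative_at)
  with D show ?thesis by simp
qed

lemma bump_alg_partials: "f \<in> bump_alg \<Longrightarrow> partial_derivs is f \<in> bump_alg"
  by (induction "is") (auto simp: partial_derivs_def bump_alg_partial)

lemma bump_alg_smooth: "f \<in> bump_alg \<Longrightarrow> smooth f"
  by (auto simp: smooth_def bump_alg_partials bump_alg_differentiable)

lemma bump_alg_prod:
  "finite I \<Longrightarrow> (\<And>i. i \<in> I \<Longrightarrow> f i \<in> bump_alg) \<Longrightarrow> (\<lambda>x. \<Prod>i\<in>I. f i x) \<in> bump_alg"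
  by (induction I rule: finite_induct) (auto intro: bump_alg.intros)

section \<open>Smooth functions and test functions\<close>

lemma smooth_continuous_on: "smooth f \<Longrightarrow> is \<in> lists Basis \<Longrightarrow> continuous_on A (partial_derivs is f)"
  by (meson differentiable_imp_continuous_within continuous_at_imp_continuous_on smooth_def)

lemma smooth_has_derivative:
  assumes "smooth f"
  shows "(f has_derivative (\<lambda>v. \<Sum>i\<in>Basis. (v \<bullet> i) * partial_deriv i f x)) (at x)"
proof -
  have "f differentiable (at x)"
    using assms by (auto simp: smooth_def partial_derivs_def dest!: bspec[where x="[]"])
  then have D: "(f has_derivative frechet_derivative f (at x)) (at x)"
    by (simp add: frechet_derivative_works)
  then have l: "linear (frechet_derivative f (at x))"
    by (rule has_derivative_linear)
  have "frechet_derivative f (at x) v = (\<Sum>i\<in>Basis. (v \<bullet> i) * partial_deriv i f x)" for v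
  proof -
    have "frechet_derivative f (at x) v = frechet_derivative f (at x) (\<Sum>i\<in>Basis. (v \<bullet> i) *\<^sub>R i)"
      by (simp add: euclidean_representation)
    also have "\<dots> = (\<Sum>i\<in>Basis. (v \<bullet> i) * frechet_derivative f (at x) i)"
      using l by (simp add: linear_sum linear_cmul)
    finally show ?thesis by (simp add: partial_deriv_def)
  qed
  then have "frechet_derivative f (at x) = (\<lambda>v. \<Sum>i\<in>Basis. (v \<bullet> i) * partial_deriv i f x)"
    by blast
  with D show ?thesis by simp
qed

lemma smooth_partial:
  fixes f :: "'a::euclidean_space \<Rightarrow> real"
  shows "smooth f \<Longrightarrow> i \<in> Basis \<Longrightarrow> smooth (partial_deriv i f)"
  unfolding smooth_def
proof (intro ballI allI)
  fix "is" :: "'a list" and x assume f: "\<forall>is\<in>lists Basis. \<forall>x. partial_derivs is f differentiable at x" and i: "i \<in> Basis"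
    and "is": "is \<in> lists Basis"
  \<comment> \<open>\<open>foldr\<close> applies the last entry of the list first, so the new index
    goes to the end.\<close>
  have "partial_derivs is (partial_deriv i f) = partial_derivs (is @ [i]) f"
    by (simp add: partial_derivs_def)
  with f i "is" show "partial_derivs is (partial_deriv i f) differentiable at x" by simp
qed

lemma partial_derivs_Nil [simp]: "partial_derivs [] f = f"
  and partial_derivs_single [simp]: "partial_derivs [i] f = partial_deriv i f"
  and partial_derivs_pair [simp]: "partial_derivs [i, j] f = partial_deriv i (partial_deriv j f)"
  by (simp_all add: partial_derivs_def)

lemma test_functions_partial:
  assumes f: "f \<in> test_functions \<Omega>" and i: "i \<in> Basis"
  shows "partial_deriv i f \<in> test_functions \<Omega>"
proof -
  let ?K = "closure {x. f x \<noteq> 0}"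
  have "partial_deriv i f x = 0" if "x \<notin> ?K" for x
  proof -
    have "(f has_derivative (\<lambda>_. 0)) (at x)"
      by (rule has_derivative_transform_within_open[where s="- ?K" and f="\<lambda>_. 0"])
        (use that closure_subset[of "{x. f x \<noteq> 0}"] in auto)
    then show ?thesis by (simp add: partial_deriv_def frechet_derivative_at[symmetric])
  qed
  then have "{x. partial_deriv i f x \<noteq> 0} \<subseteq> ?K" by auto
  then have *: "closure {x. partial_deriv i f x \<noteq> 0} \<subseteq> ?K" by (simp add: closure_minimal)
  have K: "compact ?K" "?K \<subseteq> \<Omega>" "smooth f" using f by (auto simp: test_functions_def)
  have "compact (closure {x. partial_deriv i f x \<noteq> 0})"
    using compact_Int_closed[OF K(1) closed_closure, of "{x. partial_deriv i f x \<noteq> 0}"] *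
    by (simp add: Int_absorb1)
  then show ?thesis
    using * K smooth_partial[OF K(3) i] unfolding test_functions_def by blast
qed

text \<open>Each coordinate contributes one factor that switches on at the lower face and one that
  switches off at the upper face; the scaling by \<open>1 + n\<close> steepens both, so that the
  limit is the indicator of the open box. The arguments are kept in the form
  \<open>u \<bullet> x + \<beta>\<close> required by \<open>bump_alg\<close>.\<close>

definition box_bump :: "nat \<Rightarrow> 'a::euclidean_space \<Rightarrow> 'a \<Rightarrow> 'a \<Rightarrow> real" where
  "box_bump n a b x = (\<Prod>i\<in>Basis. flat_exp 0 (((1 + real n) *\<^sub>R i) \<bullet> x + (- (1 + real n) * (a \<bullet> i))) *
                              flat_exp 0 ((- (1 + real n) *\<^sub>R i) \<bullet> x + (1 + real n) * (b \<bullet> i)))"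

lemma box_bump_alg: "box_bump n a b \<in> bump_alg"
  unfolding box_bump_def[abs_def] by (intro bump_alg_prod bump_alg.intros finite_Basis)

lemma box_bump_eq:
  "box_bump n a b x = (\<Prod>i\<in>Basis. flat_exp 0 ((1 + real n) * (x \<bullet> i - a \<bullet> i)) * flat_exp 0 ((1 + real n) * (b \<bullet> i - x \<bullet> i)))"
  unfolding box_bump_def by (intro prod.cong refl) (simp add: inner_commute algebra_simps)

lemma flat_exp_0_le: "flat_exp 0 t \<le> 1"
  by (simp add: flat_exp_0)

lemma box_bump_nonneg: "0 \<le> box_bump n a b x"
  unfolding box_bump_def by (intro prod_nonneg mult_nonneg_nonneg flat_exp_nonneg)

lemma box_bump_le: "box_bump n a b x \<le> 1"
  unfolding box_bump_def
  by (intro prod_le_1 conjI mult_le_one flat_exp_0_le mult_nonneg_nonneg flat_exp_nonneg)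

lemma box_bump_pos_iff: "box_bump n a b x \<noteq> 0 \<longleftrightarrow> x \<in> box a b"
  unfolding box_bump_eq mem_box by (auto simp: prod_zero_iff flat_exp_0 zero_less_mult_iff split: if_splits)

lemma box_bump_test:
  assumes "cbox a b \<subseteq> \<Omega>"
  shows "box_bump n a b \<in> test_functions \<Omega>"
proof -
  have "{x. box_bump n a b x \<noteq> 0} = box a b" by (auto simp: box_bump_pos_iff)
  moreover have "closure (box a b) \<subseteq> cbox a b" by (intro closure_minimal box_subset_cbox closed_cbox)
  ultimately show ?thesis
    using assms bump_alg_smooth[OF box_bump_alg]
    unfolding test_functions_def
    by (auto simp: compact_eq_bounded_closed bounded_closure)
qed

lemma flat_exp_0_tendsto:
  "(\<lambda>n. flat_exp 0 ((1 + real n) * t)) \<longlonglongrightarrow> (if t > 0 then 1 else 0)"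
proof (cases "t > 0")
  case True
  then have "(\<lambda>n. exp (- 1 / ((1 + real n) * t))) \<longlonglongrightarrow> 1"
    by real_asymp
  with True show ?thesis by (simp add: flat_exp_0 zero_less_mult_iff)
next
  case False
  then show ?thesis by (simp add: flat_exp_0 zero_less_mult_iff)
qed

lemma box_bump_tendsto: "(\<lambda>n. box_bump n a b x) \<longlonglongrightarrow> indicator (box a b) x"
proof -
  have "(\<lambda>n. box_bump n a b x) \<longlonglongrightarrow> (\<Prod>i\<in>Basis. (if x \<bullet> i - a \<bullet> i > 0 then 1 else 0) * (if b \<bullet> i - x \<bullet> i > 0 then 1 else 0))"
    unfolding box_bump_eq by (intro tendsto_prod tendsto_mult flat_exp_0_tendsto)
  also have "(\<Prod>i\<in>Basis. (if x \<bullet> i - a \<bullet> i > 0 then 1 else 0) * (if b \<bullet> i - x \<bullet> i > 0 then 1 else 0)) = (indicator (box a b) x :: real)"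
  proof (cases "x \<in> box a b")
    case True
    then show ?thesis by (auto simp: mem_box intro!: prod.neutral)
  next
    case False
    then show ?thesis by (auto simp: mem_box prod_zero_iff indicator_def not_less) (metis not_less)
  qed
  finally show ?thesis .
qed

text \<open>The positive and negative parts of \<open>f\<close> are densities of two finite measures
  that agree on all open boxes. Boxes form an intersection-stable generator of the Borel sets, so
  the measures coincide, and hence so do the densities.\<close>

lemma AE_zero_of_box_integrals:
  fixes f :: "'a::euclidean_space \<Rightarrow> real"
  assumes f: "integrable lborel f" and 0: "\<And>a b. (\<integral>x. indicator (box a b) x * f x \<partial>lborel) = 0"
  shows "AE x in lborel. f x = 0"
proof -
  have [measurable]: "f \<in> borel_measurable borel" using f by (auto dest: borel_measurable_integrable)
  let ?p = "\<lambda>x. ennreal (f x)" and ?n = "\<lambda>x. ennreal (- f x)"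
  have eq: "emeasure (density lborel ?p) (box a b) = emeasure (density lborel ?n) (box a b)" for a b
  proof -
    have i1: "integrable lborel (\<lambda>x. indicator (box a b) x * max 0 (f x))"
      and i2: "integrable lborel (\<lambda>x. indicator (box a b) x * max 0 (- f x))"
      using f by (auto intro!: integrable_real_mult_indicator integrable_max simp: mult.commute[of "indicator _ _"])
    have "(\<integral>x. indicator (box a b) x * max 0 (f x) \<partial>lborel) - (\<integral>x. indicator (box a b) x * max 0 (- f x) \<partial>lborel)
        = (\<integral>x. indicator (box a b) x * f x \<partial>lborel)"
      by (subst Bochner_Integration.integral_diff[symmetric, OF i1 i2])
        (auto intro!: Bochner_Integration.integral_cong simp: indicator_def)
    then have "ennreal (\<integral>x. indicator (box a b) x * max 0 (f x) \<partial>lborel) = ennreal (\<integral>x. indicator (box a b) x * max 0 (- f x) \<partial>lborel)"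
      by (simp add: 0)
    moreover have "emeasure (density lborel ?p) (box a b) = ennreal (\<integral>x. indicator (box a b) x * max 0 (f x) \<partial>lborel)"
      by (subst nn_integral_eq_integral[symmetric, OF i1])
        (auto simp: emeasure_density max_def ennreal_neg intro!: nn_integral_cong split: split_indicator)
    moreover have "emeasure (density lborel ?n) (box a b) = ennreal (\<integral>x. indicator (box a b) x * max 0 (- f x) \<partial>lborel)"
      by (subst nn_integral_eq_integral[symmetric, OF i2])
        (auto simp: emeasure_density max_def ennreal_neg intro!: nn_integral_cong split: split_indicator)
    ultimately show ?thesis by simp
  qed
  have fin: "emeasure (density lborel ?p) A \<noteq> \<infinity>" if "A \<in> sets borel" for A
  proof -
    have "emeasure (density lborel ?p) A \<le> (\<integral>\<^sup>+x. ennreal (norm (f x)) \<partial>lborel)"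
      using that by (auto simp: emeasure_density intro!: nn_integral_mono split: split_indicator intro: ennreal_leI)
    also have "\<dots> < \<infinity>" using f by (simp add: integrable_iff_bounded)
    finally show ?thesis by simp
  qed
  have "density lborel ?p = density lborel ?n"
  proof (rule measure_eqI_generator_eq)
    let ?E = "range (\<lambda>(a, b). box a b::'a set)"
    show "Int_stable ?E"
      by (auto simp: Int_stable_def box_Int_box)
    show "?E \<subseteq> Pow UNIV" "sets (density lborel ?p) = sigma_sets UNIV ?E" "sets (density lborel ?n) = sigma_sets UNIV ?E"
      by (simp_all add: borel_eq_box)
    let ?A = "\<lambda>n::nat. box (- (real n *\<^sub>R One)) (real n *\<^sub>R One) :: 'a set"
    show "range ?A \<subseteq> ?E" "(\<Union>i. ?A i) = UNIV"
      unfolding UN_box_eq_UNIV by auto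
    show "emeasure (density lborel ?p) (?A i) \<noteq> \<infinity>" for i by (rule fin) simp
    show "emeasure (density lborel ?p) X = emeasure (density lborel ?n) X" if "X \<in> ?E" for X
      using that eq by auto
  qed
  then have "AE x in lborel. ?p x = ?n x"
    by (intro sigma_finite_measure.density_unique[OF lborel.sigma_finite_measure_axioms]) auto
  \<comment> \<open>\<open>ennreal\<close> sends negative reals to 0, so equality of
    \<open>ennreal (f x)\<close> and \<open>ennreal (- f x)\<close> forces both to vanish.\<close>
  then show ?thesis
    by eventually_elim (metis add.inverse_inverse add.inverse_neutral ennreal_eq_0_iff ennreal_inj linorder_le_cases neg_le_0_iff_le order_antisym)
qed

lemma AE_lebesgue_on_iff:
  "\<Omega> \<in> sets lebesgue \<Longrightarrow> (AE x in lebesgue_on \<Omega>. P x) \<longleftrightarrow> (AE x in lborel. x \<in> \<Omega> \<longrightarrow> P x)"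
  by (simp add: AE_restrict_space_iff AE_completion_iff)

lemma L2_inner_lebesgue:
  "\<Omega> \<in> sets lebesgue \<Longrightarrow> L2_inner \<Omega> u v = (\<integral>x. indicator \<Omega> x * (u x * v x) \<partial>lebesgue)"
  by (simp add: L2_inner_def integral_restrict_space)

text \<open>Dominated convergence along \<open>box_bump\<close> turns vanishing against test
  functions into vanishing over boxes, first inside one closed box contained in \<Omega>; countably
  many such boxes fill \<Omega>.\<close>

lemma AE_zero_of_test_functions:
  fixes \<Omega> :: "'a::euclidean_space set"
  assumes \<Omega>: "open \<Omega>" and g: "locally_integrable \<Omega> g"
    and 0: "\<And>\<phi>. \<phi> \<in> test_functions \<Omega> \<Longrightarrow> L2_inner \<Omega> g \<phi> = 0"
  shows "AE x in lebesgue_on \<Omega>. g x = 0"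
proof -
  have \<Omega>s: "\<Omega> \<in> sets lebesgue" using \<Omega> by simp
  have K: "AE x in lborel. x \<in> cbox a b \<longrightarrow> g x = 0" if sub: "cbox a b \<subseteq> \<Omega>" for a b
  proof -
    have "integrable (lebesgue_on (cbox a b)) g"
      using g sub by (auto simp: locally_integrable_def)
    then have gK: "integrable lebesgue (\<lambda>x. indicator (cbox a b) x * g x)"
      by (simp add: integrable_restrict_space)
    have int0: "(\<integral>x. indicator (box p q) x * (indicator (cbox a b) x * g x) \<partial>lebesgue) = 0"
      if pq: "cbox p q \<subseteq> cbox a b" for p q
    proof -
      have "(\<lambda>n. \<integral>x. box_bump n p q x * (indicator (cbox a b) x * g x) \<partial>lebesgue)
          \<longlonglongrightarrow> (\<integral>x. indicator (box p q) x * (indicator (cbox a b) x * g x) \<partial>lebesgue)"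
      proof (rule integral_dominated_convergence)
        have [measurable]: "box_bump n p q \<in> borel_measurable lebesgue" for n
          using smooth_continuous_on[OF bump_alg_smooth[OF box_bump_alg], of "[]" UNIV n p q]
          by (intro measurable_completion) (auto intro: borel_measurable_continuous_onI)
        have m[measurable]: "(\<lambda>x. indicator (cbox a b) x * g x) \<in> borel_measurable lebesgue"
          using gK by auto
        show "(\<lambda>x. indicator (box p q) x * (indicator (cbox a b) x * g x)) \<in> borel_measurable lebesgue"
          by (intro borel_measurable_times m borel_measurable_indicator) simp
        show "(\<lambda>x. box_bump n p q x * (indicator (cbox a b) x * g x)) \<in> borel_measurable lebesgue" for n
          by (intro borel_measurable_times m) simp
        show "integrable lebesgue (\<lambda>x. \<bar>indicator (cbox a b) x * g x\<bar>)" using gK by simp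
        show "AE x in lebesgue. (\<lambda>n. box_bump n p q x * (indicator (cbox a b) x * g x))
            \<longlonglongrightarrow> indicator (box p q) x * (indicator (cbox a b) x * g x)"
          by (intro AE_I2 tendsto_mult box_bump_tendsto tendsto_const)
        show "AE x in lebesgue. norm (box_bump n p q x * (indicator (cbox a b) x * g x)) \<le> \<bar>indicator (cbox a b) x * g x\<bar>" for n
          by (intro AE_I2) (simp add: abs_mult box_bump_nonneg box_bump_le mult_left_le_one_le)
      qed
      moreover have "(\<integral>x. box_bump n p q x * (indicator (cbox a b) x * g x) \<partial>lebesgue) = 0" for n
      proof -
        have "L2_inner \<Omega> g (box_bump n p q) = 0"
          using pq sub by (intro 0 box_bump_test) auto
        moreover have "indicator \<Omega> x * (g x * box_bump n p q x) = box_bump n p q x * (indicator (cbox a b) x * g x)" for x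
        proof (cases "x \<in> box p q")
          case True
          then have "x \<in> cbox a b" "x \<in> \<Omega>" using pq sub box_subset_cbox[of p q] by auto
          then show ?thesis by simp
        next
          case False
          then have "box_bump n p q x = 0" using box_bump_pos_iff by blast
          then show ?thesis by simp
        qed
        ultimately show ?thesis by (simp add: L2_inner_lebesgue[OF \<Omega>s])
      qed
      ultimately show ?thesis by (simp add: LIMSEQ_const_iff)
    qed
    \<comment> \<open>The uniqueness of densities is used over \<open>lborel\<close>, so
      \<open>g\<close> is replaced by a Borel representative on the box.\<close>
    obtain f where f[measurable]: "f \<in> borel_measurable borel" and feq: "AE x in lborel. indicator (cbox a b) x * g x = f x"
      using completion_ex_borel_measurable_real[of "\<lambda>x. indicator (cbox a b) x * g x" lborel] gK
      by (auto dest: borel_measurable_integrable)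
    \<comment> \<open>Restricting to the open box makes the integral over an arbitrary box equal to
      one over an intersection, whose closure still lies in \<open>cbox a b\<close> and so carries
      admissible bumps.\<close>
    define f' where "f' = (\<lambda>x. indicator (box a b) x * f x)"
    have [measurable]: "f' \<in> borel_measurable borel" unfolding f'_def by measurable
    have "integrable lebesgue f"
      by (rule Bochner_Integration.integrable_cong_AE_imp[OF gK]) (use feq in \<open>auto dest: AE_completion intro: measurable_completion\<close>)
    then have fint: "integrable lborel f" by (simp add: integrable_completion)
    then have f'int: "integrable lborel f'"
      unfolding f'_def by (subst mult.commute) (auto intro!: integrable_real_mult_indicator)
    have "(\<integral>x. indicator (box c d) x * f' x \<partial>lborel) = 0" for c d
    proof -
      obtain p q where pq: "box c d \<inter> box a b = box p q" by (auto simp: box_Int_box)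
      have eq: "indicator (box c d) x * f' x = indicator (box p q) x * f x" for x
        unfolding pq[symmetric] by (auto simp: f'_def indicator_def)
      show ?thesis
      proof (cases "box p q = {}")
        case True
        then show ?thesis unfolding eq by simp
      next
        case False
        have "cbox p q = closure (box p q)" using False by simp
        also have "\<dots> \<subseteq> cbox a b"
          using pq box_subset_cbox[of a b] by (intro closure_minimal) auto
        finally have sub': "cbox p q \<subseteq> cbox a b" .
        have "(\<integral>x. indicator (box p q) x * f x \<partial>lborel) = (\<integral>x. indicator (box p q) x * f x \<partial>lebesgue)"
          by (rule integral_completion[symmetric]) measurable
        also have "\<dots> = (\<integral>x. indicator (box p q) x * (indicator (cbox a b) x * g x) \<partial>lebesgue)"
        proof (rule integral_cong_AE)
          show "AE x in lebesgue. indicator (box p q) x * f x = indicator (box p q) x * (indicator (cbox a b) x * g x)"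
            using AE_completion[OF feq] by eventually_elim simp
          show "(\<lambda>x. indicator (box p q) x * f x) \<in> borel_measurable lebesgue"
            by (rule measurable_completion) measurable
          show "(\<lambda>x. indicator (box p q) x * (indicator (cbox a b) x * g x)) \<in> borel_measurable lebesgue"
            by (rule borel_measurable_times[OF borel_measurable_indicator borel_measurable_integrable[OF gK]]) simp
        qed
        also have "\<dots> = 0" by (rule int0[OF sub'])
        finally show ?thesis unfolding eq .
      qed
    qed
    then have "AE x in lborel. f' x = 0" by (rule AE_zero_of_box_integrals[OF f'int])
    moreover have "AE x in lborel. x \<in> cbox a b \<longrightarrow> x \<in> box a b"
    proof -
      have "negligible (cbox a b - box a b)" by (rule negligible_frontier_interval)
      then have "AE x in lebesgue. x \<notin> cbox a b - box a b"
        by (auto simp: negligible_iff_null_sets dest: AE_not_in)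
      then show ?thesis unfolding AE_completion_iff by eventually_elim auto
    qed
    ultimately show ?thesis
      using feq by eventually_elim (auto simp: f'_def)
  qed
  obtain \<D> where D: "countable \<D>" "\<D> \<subseteq> Pow \<Omega>" "\<And>X. X \<in> \<D> \<Longrightarrow> \<exists>a b. X = cbox a b" "\<Union>\<D> = \<Omega>"
    using open_countable_Union_open_cbox[OF \<Omega>] by metis
  have "AE x in lborel. \<forall>X\<in>\<D>. x \<in> X \<longrightarrow> g x = 0"
    unfolding AE_ball_countable[OF D(1)]
  proof
    fix X assume X: "X \<in> \<D>"
    then obtain a b where ab: "X = cbox a b" using D(3) by metis
    with X D(2) have "cbox a b \<subseteq> \<Omega>" by auto
    from K[OF this] show "AE x in lborel. x \<in> X \<longrightarrow> g x = 0" unfolding ab .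
  qed
  then show ?thesis
    unfolding AE_lebesgue_on_iff[OF \<Omega>s] using D(4) by (auto elim!: eventually_mono)
qed

subsection \<open>The space \<open>L\<^sup>2\<close>\<close>

lemma L2_mult_integrable:
  assumes "u \<in> L2 \<Omega>" "v \<in> L2 \<Omega>"
  shows "integrable (lebesgue_on \<Omega>) (\<lambda>x. u x * v x)"
proof (rule Bochner_Integration.integrable_bound)
  show "integrable (lebesgue_on \<Omega>) (\<lambda>x. (u x)\<^sup>2 + (v x)\<^sup>2)"
    using assms by (auto simp: L2_def)
  show "(\<lambda>x. u x * v x) \<in> borel_measurable (lebesgue_on \<Omega>)"
    using assms by (auto simp: L2_def)
  have "\<bar>a * b\<bar> \<le> a\<^sup>2 + b\<^sup>2" for a b :: real
  proof -
    have "2 * (\<bar>a\<bar> * \<bar>b\<bar>) \<le> a\<^sup>2 + b\<^sup>2"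
      using sum_squares_bound[of "\<bar>a\<bar>" "\<bar>b\<bar>"] by simp
    moreover have "0 \<le> \<bar>a\<bar> * \<bar>b\<bar>" by simp
    ultimately show ?thesis unfolding abs_mult by linarith
  qed
  then show "AE x in lebesgue_on \<Omega>. norm (u x * v x) \<le> norm ((u x)\<^sup>2 + (v x)\<^sup>2)"
    by (intro AE_I2) (simp add: order_trans[OF _ abs_ge_self])
qed

lemma L2_lincomb:
  assumes "u \<in> L2 \<Omega>" "v \<in> L2 \<Omega>"
  shows "(\<lambda>x. a * u x + b * v x) \<in> L2 \<Omega>"
proof -
  have "integrable (lebesgue_on \<Omega>) (\<lambda>x. a\<^sup>2 * (u x)\<^sup>2 + 2 * a * b * (u x * v x) + b\<^sup>2 * (v x)\<^sup>2)"
    using assms L2_mult_integrable[OF assms] unfolding L2_def by auto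
  then have "integrable (lebesgue_on \<Omega>) (\<lambda>x. (a * u x + b * v x)\<^sup>2)"
    by (rule back_subst[of "integrable (lebesgue_on \<Omega>)"]) (simp add: power2_eq_square algebra_simps fun_eq_iff)
  then show ?thesis using assms by (auto simp: L2_def)
qed

lemma L2_add: "u \<in> L2 \<Omega> \<Longrightarrow> v \<in> L2 \<Omega> \<Longrightarrow> (\<lambda>x. u x + v x) \<in> L2 \<Omega>"
  using L2_lincomb[of u \<Omega> v 1 1] by simp

lemma L2_diff: "u \<in> L2 \<Omega> \<Longrightarrow> v \<in> L2 \<Omega> \<Longrightarrow> (\<lambda>x. u x - v x) \<in> L2 \<Omega>"
  using L2_lincomb[of u \<Omega> v 1 "-1"] by simp

lemma L2_cmult: "u \<in> L2 \<Omega> \<Longrightarrow> (\<lambda>x. a * u x) \<in> L2 \<Omega>"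
  using L2_lincomb[of u \<Omega> u a 0] by simp

lemma L2_zero: "(\<lambda>x. 0) \<in> L2 \<Omega>"
  by (simp add: L2_def)

lemma L2_sum: "(\<And>i. i \<in> I \<Longrightarrow> u i \<in> L2 \<Omega>) \<Longrightarrow> (\<lambda>x. \<Sum>i\<in>I. u i x) \<in> L2 \<Omega>"
  by (induction I rule: infinite_finite_induct) (auto intro: L2_zero L2_add)

lemma L2_measurable: "u \<in> L2 \<Omega> \<Longrightarrow> u \<in> borel_measurable (lebesgue_on \<Omega>)"
  by (simp add: L2_def)

lemma L2_bounded_mult:
  assumes u: "u \<in> L2 \<Omega>" and b: "b \<in> borel_measurable (lebesgue_on \<Omega>)"
    and B: "AE x in lebesgue_on \<Omega>. \<bar>b x\<bar> \<le> B"
  shows "(\<lambda>x. b x * u x) \<in> L2 \<Omega>"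
proof -
  have "integrable (lebesgue_on \<Omega>) (\<lambda>x. (b x * u x)\<^sup>2)"
  proof (rule Bochner_Integration.integrable_bound)
    show "integrable (lebesgue_on \<Omega>) (\<lambda>x. B\<^sup>2 * (u x)\<^sup>2)"
      using u by (simp add: L2_def)
    show "(\<lambda>x. (b x * u x)\<^sup>2) \<in> borel_measurable (lebesgue_on \<Omega>)"
      using u b by (auto simp: L2_def)
    show "AE x in lebesgue_on \<Omega>. norm ((b x * u x)\<^sup>2) \<le> norm (B\<^sup>2 * (u x)\<^sup>2)"
      using B
    proof eventually_elim
      case (elim x)
      then have "(b x)\<^sup>2 \<le> B\<^sup>2" by (metis abs_ge_zero order_trans power2_abs power_mono)
      then show ?case by (simp add: power_mult_distrib mult_right_mono)
    qed
  qed
  then show ?thesis using u b by (auto simp: L2_def)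
qed

lemma L2_inner_commute: "L2_inner \<Omega> u v = L2_inner \<Omega> v u"
  by (simp add: L2_inner_def mult.commute)

lemma L2_inner_add_left:
  "u \<in> L2 \<Omega> \<Longrightarrow> v \<in> L2 \<Omega> \<Longrightarrow> w \<in> L2 \<Omega> \<Longrightarrow> L2_inner \<Omega> (\<lambda>x. u x + v x) w = L2_inner \<Omega> u w + L2_inner \<Omega> v w"
  by (simp add: L2_inner_def distrib_right L2_mult_integrable)

lemma L2_inner_diff_left:
  "u \<in> L2 \<Omega> \<Longrightarrow> v \<in> L2 \<Omega> \<Longrightarrow> w \<in> L2 \<Omega> \<Longrightarrow> L2_inner \<Omega> (\<lambda>x. u x - v x) w = L2_inner \<Omega> u w - L2_inner \<Omega> v w"
  by (simp add: L2_inner_def left_diff_distrib L2_mult_integrable)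

lemma L2_inner_cmult_left: "L2_inner \<Omega> (\<lambda>x. a * u x) w = a * L2_inner \<Omega> u w"
  by (simp add: L2_inner_def mult.assoc)

lemma L2_inner_sum_left:
  assumes "\<And>i. i \<in> I \<Longrightarrow> u i \<in> L2 \<Omega>" "w \<in> L2 \<Omega>"
  shows "L2_inner \<Omega> (\<lambda>x. \<Sum>i\<in>I. u i x) w = (\<Sum>i\<in>I. L2_inner \<Omega> (u i) w)"
  unfolding L2_inner_def sum_distrib_right
  using assms by (intro Bochner_Integration.integral_sum L2_mult_integrable) auto

lemma L2_inner_cong:
  assumes "AE x in lebesgue_on \<Omega>. u x = u' x" "AE x in lebesgue_on \<Omega>. v x = v' x"
    "u \<in> borel_measurable (lebesgue_on \<Omega>)" "u' \<in> borel_measurable (lebesgue_on \<Omega>)"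
    "v \<in> borel_measurable (lebesgue_on \<Omega>)" "v' \<in> borel_measurable (lebesgue_on \<Omega>)"
  shows "L2_inner \<Omega> u v = L2_inner \<Omega> u' v'"
  unfolding L2_inner_def
proof (rule integral_cong_AE)
  show "AE x in lebesgue_on \<Omega>. u x * v x = u' x * v' x"
    using assms(1,2) by eventually_elim simp
qed (use assms in auto)

lemma L2_inner_nonneg: "L2_inner \<Omega> u u \<ge> 0"
  by (simp add: L2_inner_def)

lemma L2_norm_nonneg: "L2_norm \<Omega> u \<ge> 0"
  by (simp add: L2_norm_def L2_inner_nonneg)

lemma L2_norm_sq: "(L2_norm \<Omega> u)\<^sup>2 = L2_inner \<Omega> u u"
  by (simp add: L2_norm_def L2_inner_nonneg)

lemma L2_norm_sq_integral: "(L2_norm \<Omega> u)\<^sup>2 = (LINT x|lebesgue_on \<Omega>. (u x)\<^sup>2)"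
  unfolding L2_norm_sq by (simp add: L2_inner_def power2_eq_square)

text \<open>Discriminant argument for a nonnegative quadratic form in \<open>s\<close> and
  \<open>t\<close>. The choice \<open>s = ?C\<close>, \<open>t = - ?B\<close> gives the claim only
  after division by \<open>?C\<close>, so the degenerate case is treated by itself.\<close>

lemma L2_Cauchy_Schwarz:
  assumes "u \<in> L2 \<Omega>" "v \<in> L2 \<Omega>"
  shows "\<bar>L2_inner \<Omega> u v\<bar> \<le> L2_norm \<Omega> u * L2_norm \<Omega> v"
proof -
  have eq: "L2_inner \<Omega> (\<lambda>x. s * u x + t * v x) (\<lambda>x. s * u x + t * v x)
      = s\<^sup>2 * L2_inner \<Omega> u u + 2 * s * t * L2_inner \<Omega> u v + t\<^sup>2 * L2_inner \<Omega> v v" for s t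
  proof -
    have "L2_inner \<Omega> (\<lambda>x. s * u x + t * v x) w = s * L2_inner \<Omega> u w + t * L2_inner \<Omega> v w" if "w \<in> L2 \<Omega>" for w
      using assms that by (simp add: L2_inner_add_left L2_cmult L2_inner_cmult_left)
    note l = this
    show ?thesis
      unfolding l[OF L2_lincomb[OF assms]]
      unfolding L2_inner_commute[of _ u "\<lambda>x. s * u x + t * v x"] L2_inner_commute[of _ v "\<lambda>x. s * u x + t * v x"]
      unfolding l[OF assms(1)] l[OF assms(2)] L2_inner_commute[of _ v u]
      by (simp add: power2_eq_square algebra_simps)
  qed
  let ?A = "L2_inner \<Omega> u u" and ?B = "L2_inner \<Omega> u v" and ?C = "L2_inner \<Omega> v v"
  have ineq: "0 \<le> s\<^sup>2 * ?A + 2 * s * t * ?B + t\<^sup>2 * ?C" for s t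
    using eq[of s t] L2_inner_nonneg by metis
  have "?B\<^sup>2 \<le> ?A * ?C"
  proof (cases "?C = 0")
    case True
    have "?B = 0"
    proof (rule ccontr)
      assume "?B \<noteq> 0"
      \<comment> \<open>With \<open>?C = 0\<close> the form is affine in \<open>t\<close>, and this
        \<open>t\<close> gives it the value -1.\<close>
      then show False using ineq[of 1 "- (?A + 1) / (2 * ?B)"] True by (simp add: field_simps)
    qed
    with True show ?thesis by simp
  next
    case False
    then have "?C > 0" using L2_inner_nonneg[of \<Omega> v] by simp
    moreover have "0 \<le> ?C * (?C * ?A - ?B\<^sup>2)"
      using ineq[of ?C "- ?B"] by (simp add: power2_eq_square algebra_simps)
    ultimately show ?thesis by (simp add: zero_le_mult_iff mult.commute)
  qed
  then show ?thesis
    unfolding L2_norm_def real_sqrt_mult[symmetric] by (metis real_sqrt_abs real_sqrt_le_mono)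
qed

lemma L2_norm_triangle:
  assumes "u \<in> L2 \<Omega>" "v \<in> L2 \<Omega>"
  shows "L2_norm \<Omega> (\<lambda>x. u x + v x) \<le> L2_norm \<Omega> u + L2_norm \<Omega> v"
proof (rule power2_le_imp_le)
  have s: "(\<lambda>x. u x + v x) \<in> L2 \<Omega>" using assms by (rule L2_add)
  have "(L2_norm \<Omega> (\<lambda>x. u x + v x))\<^sup>2 = L2_inner \<Omega> u u + 2 * L2_inner \<Omega> u v + L2_inner \<Omega> v v"
    unfolding L2_norm_sq L2_inner_add_left[OF assms s]
    unfolding L2_inner_commute[of _ u "\<lambda>x. u x + v x"] L2_inner_commute[of _ v "\<lambda>x. u x + v x"]
    unfolding L2_inner_add_left[OF assms assms(1)] L2_inner_add_left[OF assms assms(2)] L2_inner_commute[of _ v u]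
    by simp
  also have "\<dots> \<le> (L2_norm \<Omega> u)\<^sup>2 + 2 * (L2_norm \<Omega> u * L2_norm \<Omega> v) + (L2_norm \<Omega> v)\<^sup>2"
    using L2_Cauchy_Schwarz[OF assms] by (simp add: L2_norm_sq)
  finally show "(L2_norm \<Omega> (\<lambda>x. u x + v x))\<^sup>2 \<le> (L2_norm \<Omega> u + L2_norm \<Omega> v)\<^sup>2"
    by (simp add: power2_sum)
qed (simp add: L2_norm_nonneg)

lemma L2_norm_cmult: "L2_norm \<Omega> (\<lambda>x. a * u x) = \<bar>a\<bar> * L2_norm \<Omega> u"
proof -
  have "L2_inner \<Omega> (\<lambda>x. a * u x) (\<lambda>x. a * u x) = a\<^sup>2 * L2_inner \<Omega> u u"
    unfolding L2_inner_cmult_left L2_inner_commute[of _ u "\<lambda>x. a * u x"] by (simp add: power2_eq_square)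
  then show ?thesis by (simp add: L2_norm_def real_sqrt_mult)
qed

lemma L2_norm_cong:
  assumes "AE x in lebesgue_on \<Omega>. u x = v x"
    "u \<in> borel_measurable (lebesgue_on \<Omega>)" "v \<in> borel_measurable (lebesgue_on \<Omega>)"
  shows "L2_norm \<Omega> u = L2_norm \<Omega> v"
  unfolding L2_norm_def by (subst L2_inner_cong[OF assms(1,1) assms(2,3,2,3)]) simp

lemma L2_norm_mono:
  assumes "v \<in> L2 \<Omega>" "AE x in lebesgue_on \<Omega>. \<bar>u x\<bar> \<le> \<bar>v x\<bar>"
  shows "L2_norm \<Omega> u \<le> L2_norm \<Omega> v"
proof (rule power2_le_imp_le)
  show "(L2_norm \<Omega> u)\<^sup>2 \<le> (L2_norm \<Omega> v)\<^sup>2"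
    unfolding L2_norm_sq_integral
  proof (cases "integrable (lebesgue_on \<Omega>) (\<lambda>x. (u x)\<^sup>2)")
    case True
    then show "(LINT x|lebesgue_on \<Omega>. (u x)\<^sup>2) \<le> (LINT x|lebesgue_on \<Omega>. (v x)\<^sup>2)"
      using assms by (intro integral_mono_AE) (auto simp: L2_def abs_le_square_iff)
  \<comment> \<open>A non-integrable square has integral 0 by convention, and the inequality still
    holds.\<close>
  qed (simp add: not_integrable_integral_eq)
qed (rule L2_norm_nonneg)

text \<open>\<open>L2_norm\<close> is a total function that returns 0 on functions whose square is
  not integrable, so membership in \<open>L2\<close> is made part of convergence.\<close>

definition L2_tendsto :: "'a::euclidean_space set \<Rightarrow> (nat \<Rightarrow> 'a \<Rightarrow> real) \<Rightarrow> ('a \<Rightarrow> real) \<Rightarrow> bool" where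
  "L2_tendsto \<Omega> f g \<longleftrightarrow> (\<forall>k. f k \<in> L2 \<Omega>) \<and> g \<in> L2 \<Omega> \<and> (\<lambda>k. L2_norm \<Omega> (\<lambda>x. f k x - g x)) \<longlonglongrightarrow> 0"

lemma L2_tendstoD:
  assumes "L2_tendsto \<Omega> f g"
  shows "f k \<in> L2 \<Omega>" "g \<in> L2 \<Omega>" "(\<lambda>k. L2_norm \<Omega> (\<lambda>x. f k x - g x)) \<longlonglongrightarrow> 0"
  using assms by (auto simp: L2_tendsto_def)

lemma L2_tendsto_squeeze:
  assumes "\<And>k. f k \<in> L2 \<Omega>" "g \<in> L2 \<Omega>"
    "eventually (\<lambda>k. L2_norm \<Omega> (\<lambda>x. f k x - g x) \<le> e k) sequentially" "e \<longlonglongrightarrow> 0"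
  shows "L2_tendsto \<Omega> f g"
  unfolding L2_tendsto_def
  using assms by (auto intro!: tendsto_sandwich[OF _ assms(3) tendsto_const assms(4)] simp: L2_norm_nonneg)

lemma L2_tendsto_add:
  assumes "L2_tendsto \<Omega> f g" "L2_tendsto \<Omega> f' g'"
  shows "L2_tendsto \<Omega> (\<lambda>k x. f k x + f' k x) (\<lambda>x. g x + g' x)"
proof (rule L2_tendsto_squeeze)
  show "(\<lambda>k. L2_norm \<Omega> (\<lambda>x. f k x - g x) + L2_norm \<Omega> (\<lambda>x. f' k x - g' x)) \<longlonglongrightarrow> 0"
    using tendsto_add[OF L2_tendstoD(3)[OF assms(1)] L2_tendstoD(3)[OF assms(2)]] by simp
  show "\<forall>\<^sub>F k in sequentially. L2_norm \<Omega> (\<lambda>x. f k x + f' k x - (g x + g' x))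
      \<le> L2_norm \<Omega> (\<lambda>x. f k x - g x) + L2_norm \<Omega> (\<lambda>x. f' k x - g' x)"
  proof (rule always_eventually, rule allI)
    fix k
    show "L2_norm \<Omega> (\<lambda>x. f k x + f' k x - (g x + g' x))
      \<le> L2_norm \<Omega> (\<lambda>x. f k x - g x) + L2_norm \<Omega> (\<lambda>x. f' k x - g' x)"
      using L2_norm_triangle[OF L2_diff[OF L2_tendstoD(1,2)[OF assms(1)]] L2_diff[OF L2_tendstoD(1,2)[OF assms(2)]], of k k]
      by (simp add: algebra_simps)
  qed
qed (use assms in \<open>auto simp: L2_tendsto_def intro: L2_add\<close>)

lemma L2_tendsto_cmult:
  assumes "L2_tendsto \<Omega> f g" "e \<longlonglongrightarrow> a"
  shows "L2_tendsto \<Omega> (\<lambda>k x. e k * f k x) (\<lambda>x. a * g x)"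
proof (rule L2_tendsto_squeeze)
  note D = L2_tendstoD[OF assms(1)]
  show "(\<lambda>k. \<bar>e k\<bar> * L2_norm \<Omega> (\<lambda>x. f k x - g x) + \<bar>e k - a\<bar> * L2_norm \<Omega> g) \<longlonglongrightarrow> 0"
    using assms(2) by (auto intro!: tendsto_eq_intros D(3))
  show "\<forall>\<^sub>F k in sequentially. L2_norm \<Omega> (\<lambda>x. e k * f k x - a * g x)
      \<le> \<bar>e k\<bar> * L2_norm \<Omega> (\<lambda>x. f k x - g x) + \<bar>e k - a\<bar> * L2_norm \<Omega> g"
  proof (rule always_eventually, rule allI)
    fix k
    show "L2_norm \<Omega> (\<lambda>x. e k * f k x - a * g x)
      \<le> \<bar>e k\<bar> * L2_norm \<Omega> (\<lambda>x. f k x - g x) + \<bar>e k - a\<bar> * L2_norm \<Omega> g"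
      using L2_norm_triangle[OF L2_cmult[OF L2_diff[OF D(1,2)], of "e k" k] L2_cmult[OF D(2), of "e k - a"],
          unfolded L2_norm_cmult]
      by (simp add: algebra_simps)
  qed
qed (use assms in \<open>auto simp: L2_tendsto_def intro: L2_cmult\<close>)

lemma L2_tendsto_diff:
  assumes "L2_tendsto \<Omega> f g" "L2_tendsto \<Omega> f' g'"
  shows "L2_tendsto \<Omega> (\<lambda>k x. f k x - f' k x) (\<lambda>x. g x - g' x)"
  using L2_tendsto_add[OF assms(1) L2_tendsto_cmult[OF assms(2) tendsto_const[of "-1"]]] by simp

lemma L2_tendsto_norm:
  assumes "L2_tendsto \<Omega> f g"
  shows "(\<lambda>k. L2_norm \<Omega> (f k)) \<longlonglongrightarrow> L2_norm \<Omega> g"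
proof (rule LIM_zero_cancel, rule Lim_null_comparison[OF _ L2_tendstoD(3)[OF assms]], rule always_eventually, rule allI)
  fix k
  note D = L2_tendstoD[OF assms]
  have "L2_norm \<Omega> (f k) \<le> L2_norm \<Omega> (\<lambda>x. f k x - g x) + L2_norm \<Omega> g"
    using L2_norm_triangle[OF L2_diff[OF D(1,2)] D(2), of k] by simp
  moreover have "L2_norm \<Omega> g \<le> L2_norm \<Omega> (\<lambda>x. f k x - g x) + L2_norm \<Omega> (f k)"
    using L2_norm_triangle[OF L2_cmult[OF L2_diff[OF D(1,2)], of "-1" k] D(1), of k] L2_norm_cmult[of \<Omega> "-1" "\<lambda>x. f k x - g x"] by simp
  ultimately show "norm (L2_norm \<Omega> (f k) - L2_norm \<Omega> g) \<le> L2_norm \<Omega> (\<lambda>x. f k x - g x)"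
    by simp
qed

lemma L2_tendsto_inner:
  assumes "L2_tendsto \<Omega> f g" "L2_tendsto \<Omega> f' g'"
  shows "(\<lambda>k. L2_inner \<Omega> (f k) (f' k)) \<longlonglongrightarrow> L2_inner \<Omega> g g'"
proof -
  note D = L2_tendstoD[OF assms(1)] and D' = L2_tendstoD[OF assms(2)]
  have "(\<lambda>k. L2_inner \<Omega> (f k) (f' k) - L2_inner \<Omega> g g') \<longlonglongrightarrow> 0"
  proof (rule Lim_null_comparison)
    show "\<forall>\<^sub>F k in sequentially. norm (L2_inner \<Omega> (f k) (f' k) - L2_inner \<Omega> g g')
       \<le> L2_norm \<Omega> (\<lambda>x. f k x - g x) * L2_norm \<Omega> (f' k) + L2_norm \<Omega> g * L2_norm \<Omega> (\<lambda>x. f' k x - g' x)"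
    proof (rule always_eventually, rule allI)
      fix k
      have "L2_inner \<Omega> (f k) (f' k) - L2_inner \<Omega> g g'
         = L2_inner \<Omega> (\<lambda>x. f k x - g x) (f' k) + L2_inner \<Omega> g (\<lambda>x. f' k x - g' x)"
        unfolding L2_inner_diff_left[OF D(1) D(2) D'(1)] L2_inner_commute[of _ g "\<lambda>x. f' k x - g' x"]
          L2_inner_diff_left[OF D'(1) D'(2) D(2)] L2_inner_commute[of _ "f' k" g] L2_inner_commute[of _ g' g] by simp
      then show "norm (L2_inner \<Omega> (f k) (f' k) - L2_inner \<Omega> g g')
       \<le> L2_norm \<Omega> (\<lambda>x. f k x - g x) * L2_norm \<Omega> (f' k) + L2_norm \<Omega> g * L2_norm \<Omega> (\<lambda>x. f' k x - g' x)"
        using L2_Cauchy_Schwarz[OF L2_diff[OF D(1,2)] D'(1), of k k] L2_Cauchy_Schwarz[OF D(2) L2_diff[OF D'(1,2)], of k]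
        by simp
    qed
    show "(\<lambda>k. L2_norm \<Omega> (\<lambda>x. f k x - g x) * L2_norm \<Omega> (f' k) + L2_norm \<Omega> g * L2_norm \<Omega> (\<lambda>x. f' k x - g' x)) \<longlonglongrightarrow> 0"
      using L2_tendsto_norm[OF assms(2)] by (auto intro!: tendsto_eq_intros D(3) D'(3))
  qed
  then show ?thesis by (rule LIM_zero_cancel)
qed

lemma L2_tendsto_bounded_mult:
  assumes "L2_tendsto \<Omega> f g" "b \<in> borel_measurable (lebesgue_on \<Omega>)" "AE x in lebesgue_on \<Omega>. \<bar>b x\<bar> \<le> B"
  shows "L2_tendsto \<Omega> (\<lambda>k x. b x * f k x) (\<lambda>x. b x * g x)"
proof (rule L2_tendsto_squeeze)
  note D = L2_tendstoD[OF assms(1)]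
  show "(\<lambda>k. \<bar>B\<bar> * L2_norm \<Omega> (\<lambda>x. f k x - g x)) \<longlonglongrightarrow> 0"
    by (auto intro!: tendsto_eq_intros D(3))
  show "\<forall>\<^sub>F k in sequentially. L2_norm \<Omega> (\<lambda>x. b x * f k x - b x * g x) \<le> \<bar>B\<bar> * L2_norm \<Omega> (\<lambda>x. f k x - g x)"
  proof (rule always_eventually, rule allI)
    fix k
    have "L2_norm \<Omega> (\<lambda>x. b x * f k x - b x * g x) \<le> L2_norm \<Omega> (\<lambda>x. B * (f k x - g x))"
    proof (rule L2_norm_mono)
      show "AE x in lebesgue_on \<Omega>. \<bar>b x * f k x - b x * g x\<bar> \<le> \<bar>B * (f k x - g x)\<bar>"
        using assms(3)
      proof eventually_elim
        case (elim x)
        then have "\<bar>b x\<bar> * \<bar>f k x - g x\<bar> \<le> \<bar>B\<bar> * \<bar>f k x - g x\<bar>" by (intro mult_right_mono) auto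
        then show ?case by (simp add: abs_mult flip: right_diff_distrib)
      qed
    qed (intro L2_cmult L2_diff D)
    then show "L2_norm \<Omega> (\<lambda>x. b x * f k x - b x * g x) \<le> \<bar>B\<bar> * L2_norm \<Omega> (\<lambda>x. f k x - g x)"
      by (simp add: L2_norm_cmult)
  qed
qed (use assms in \<open>auto simp: L2_tendsto_def intro: L2_bounded_mult\<close>)

subsection \<open>Smoothing by averages that stay inside a convex domain\<close>

text \<open>Differentiation under the integral sign. The Lipschitz bound on \<open>K\<close> in its
  first argument and the bound on \<open>d\<close> dominate the normalised remainder uniformly in
  the increment; filters are replaced by sequences so that dominated convergence applies.\<close>

lemma has_derivative_integral_kernel:
  fixes K :: "'a::euclidean_space \<Rightarrow> 'b \<Rightarrow> real"
  assumes D: "\<And>y. ((\<lambda>x. K x y) has_derivative (\<lambda>v. \<Sum>i\<in>Basis. (v \<bullet> i) * d i y)) (at x)"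
    and L: "\<And>x' y. \<bar>K x' y - K x y\<bar> \<le> L * norm (x' - x)"
    and dB: "\<And>i y. i \<in> Basis \<Longrightarrow> \<bar>d i y\<bar> \<le> B"
    and m: "\<And>x. K x \<in> borel_measurable M" "\<And>i. i \<in> Basis \<Longrightarrow> d i \<in> borel_measurable M"
    and KB: "\<And>x y. \<bar>K x y\<bar> \<le> B'"
    and f: "integrable M f"
  shows "((\<lambda>x. \<integral>y. K x y * f y \<partial>M) has_derivative (\<lambda>v. \<Sum>i\<in>Basis. (v \<bullet> i) * (\<integral>y. d i y * f y \<partial>M))) (at x)"
proof -
  have fm[measurable]: "f \<in> borel_measurable M" using f by auto
  have Kf: "integrable M (\<lambda>y. K x y * f y)" for x
  proof (rule Bochner_Integration.integrable_bound[of M "\<lambda>y. B' * f y"])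
    show "AE y in M. norm (K x y * f y) \<le> norm (B' * f y)"
      using KB by (intro AE_I2) (auto simp: abs_mult intro!: mult_right_mono order_trans[OF KB abs_ge_self])
  qed (use f m in auto)
  have df: "integrable M (\<lambda>y. d i y * f y)" if "i \<in> Basis" for i
  proof (rule Bochner_Integration.integrable_bound[of M "\<lambda>y. B * f y"])
    show "AE y in M. norm (d i y * f y) \<le> norm (B * f y)"
      using dB[OF that] by (intro AE_I2) (auto simp: abs_mult intro!: mult_right_mono order_trans[OF dB[OF that] abs_ge_self])
  qed (use f m that in auto)
  let ?F = "\<lambda>x. \<integral>y. K x y * f y \<partial>M" and ?D = "\<lambda>v. \<Sum>i\<in>Basis. (v \<bullet> i) * (\<integral>y. d i y * f y \<partial>M)"
  have bl: "bounded_linear ?D"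
    by (intro bounded_linear_sum bounded_linear_mult_left[THEN bounded_linear_compose, unfolded o_def] bounded_linear_inner_left)
  have "((\<lambda>h. norm (?F (x + h) - ?F x - ?D h) / norm h) \<longlongrightarrow> 0) (at 0)"
    unfolding tendsto_at_iff_sequentially o_def
  proof (intro allI impI)
    fix X :: "nat \<Rightarrow> 'a" assume X0: "\<forall>i. X i \<in> UNIV - {0}" and X: "X \<longlonglongrightarrow> 0"
    have nz: "norm (X n) \<noteq> 0" for n using X0 by auto
    let ?R = "\<lambda>n y. (K (x + X n) y - K x y - (\<Sum>i\<in>Basis. (X n \<bullet> i) * d i y)) / norm (X n)"
    have eq: "(?F (x + X n) - ?F x - ?D (X n)) / norm (X n) = (\<integral>y. ?R n y * f y \<partial>M)" for n
    proof -
      have "?D (X n) = (\<integral>y. (\<Sum>i\<in>Basis. (X n \<bullet> i) * (d i y * f y)) \<partial>M)"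
        using df by (subst Bochner_Integration.integral_sum) auto
      then have "?F (x + X n) - ?F x - ?D (X n)
          = (\<integral>y. K (x + X n) y * f y - K x y * f y - (\<Sum>i\<in>Basis. (X n \<bullet> i) * (d i y * f y)) \<partial>M)"
        using Kf df by (simp add: Bochner_Integration.integral_diff)
      also have "\<dots> / norm (X n) = (\<integral>y. ?R n y * f y \<partial>M)"
        by (subst Bochner_Integration.integral_divide_zero[symmetric])
          (intro Bochner_Integration.integral_cong refl, simp add: field_simps sum_distrib_right nz sum_divide_distrib sum_distrib_left)
      finally show ?thesis .
    qed
    have "(\<lambda>n. \<integral>y. ?R n y * f y \<partial>M) \<longlonglongrightarrow> (\<integral>y. 0 \<partial>M)"
    proof (rule integral_dominated_convergence)
      show "(\<lambda>y. ?R n y * f y) \<in> borel_measurable M" for n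
        using m by (intro borel_measurable_times fm borel_measurable_divide borel_measurable_diff borel_measurable_sum) auto
      show "integrable M (\<lambda>y. (\<bar>L\<bar> + real DIM('a) * \<bar>B\<bar>) * \<bar>f y\<bar>)" using f by auto
      have lim: "(\<lambda>n. ?R n y) \<longlonglongrightarrow> 0" for y
      proof -
        have "((\<lambda>h. norm (K (x + h) y - K x y - (\<Sum>i\<in>Basis. (h \<bullet> i) * d i y)) / norm h) \<longlongrightarrow> 0) (at 0)"
          using D[of y] unfolding has_derivative_at by blast
        then have "(\<lambda>n. norm (K (x + X n) y - K x y - (\<Sum>i\<in>Basis. (X n \<bullet> i) * d i y)) / norm (X n)) \<longlonglongrightarrow> 0"
          unfolding tendsto_at_iff_sequentially o_def using X0 X by blast
        then have "(\<lambda>n. norm (?R n y)) \<longlonglongrightarrow> 0" by (simp add: norm_divide)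
        then show ?thesis by (rule tendsto_norm_zero_cancel)
      qed
      show "AE y in M. (\<lambda>n. ?R n y * f y) \<longlonglongrightarrow> 0"
        by (intro AE_I2 tendsto_mult_left_zero lim)
      show "AE y in M. norm (?R n y * f y) \<le> (\<bar>L\<bar> + real DIM('a) * \<bar>B\<bar>) * \<bar>f y\<bar>" for n
      proof (intro AE_I2)
        fix y
        have "\<bar>\<Sum>i\<in>Basis. (X n \<bullet> i) * d i y\<bar> \<le> (\<Sum>i\<in>(Basis::'a set). norm (X n) * \<bar>B\<bar>)"
          by (rule order_trans[OF sum_abs], rule sum_mono)
            (auto simp: abs_mult intro!: mult_mono Basis_le_norm order_trans[OF dB abs_ge_self])
        then have "\<bar>\<Sum>i\<in>Basis. (X n \<bullet> i) * d i y\<bar> \<le> real DIM('a) * \<bar>B\<bar> * norm (X n)" by (simp add: mult_ac)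
        moreover have "\<bar>K (x + X n) y - K x y\<bar> \<le> \<bar>L\<bar> * norm (X n)"
          using L[of "x + X n" y] by (auto intro: order_trans[OF _ mult_right_mono[OF abs_ge_self]])
        ultimately have "\<bar>K (x + X n) y - K x y - (\<Sum>i\<in>Basis. (X n \<bullet> i) * d i y)\<bar> \<le> (\<bar>L\<bar> + real DIM('a) * \<bar>B\<bar>) * norm (X n)"
          unfolding distrib_right by linarith
        then have "\<bar>?R n y\<bar> \<le> \<bar>L\<bar> + real DIM('a) * \<bar>B\<bar>"
          using nz[of n] by (simp add: abs_divide divide_le_eq)
        then show "norm (?R n y * f y) \<le> (\<bar>L\<bar> + real DIM('a) * \<bar>B\<bar>) * \<bar>f y\<bar>"
          unfolding real_norm_def abs_mult by (rule mult_right_mono) simp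
      qed
    qed simp
    then have "(\<lambda>n. norm ((?F (x + X n) - ?F x - ?D (X n)) / norm (X n))) \<longlonglongrightarrow> 0"
      unfolding eq using tendsto_norm_zero by fastforce
    then show "(\<lambda>n. norm (?F (x + X n) - ?F x - ?D (X n)) / norm (X n)) \<longlonglongrightarrow> 0"
      by (simp add: norm_divide)
  qed
  with bl show ?thesis unfolding has_derivative_at by blast
qed

section \<open>Bounds for bump functions, and the mollifier\<close>

lemma bump_alg_affine:
  "f \<in> bump_alg \<Longrightarrow> (\<lambda>y. f (t *\<^sub>R y + v)) \<in> bump_alg"
proof (induction rule: bump_alg.induct)
  case (flat n u \<beta>)
  have "(\<lambda>y. flat_exp n (u \<bullet> (t *\<^sub>R y + v) + \<beta>)) = (\<lambda>y. flat_exp n ((t *\<^sub>R u) \<bullet> y + (u \<bullet> v + \<beta>)))"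
    by (simp add: inner_add_right algebra_simps)
  then show ?case by (simp only: bump_alg.flat)
qed (auto intro: bump_alg.intros)

lemma bump_alg_continuous: "f \<in> bump_alg \<Longrightarrow> continuous_on A f"
  using smooth_continuous_on[OF bump_alg_smooth, of f "[]"] by simp

lemma bump_alg_bounded:
  assumes f: "f \<in> bump_alg" and 0: "\<And>x. x \<notin> cbox a b \<Longrightarrow> f x = 0"
  shows "\<exists>B. \<forall>x. \<bar>f x\<bar> \<le> B"
proof -
  have "bounded (f ` cbox a b)"
    by (intro compact_imp_bounded compact_continuous_image bump_alg_continuous f compact_cbox)
  then obtain B where B: "\<And>x. x \<in> cbox a b \<Longrightarrow> \<bar>f x\<bar> \<le> B" by (auto simp: bounded_iff)
  have "\<bar>f x\<bar> \<le> max 0 B" for x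
    using B[of x] 0[of x] by (cases "x \<in> cbox a b") auto
  then show ?thesis by blast
qed

lemma partial_deriv_zero_outside:
  fixes f :: "'a::euclidean_space \<Rightarrow> real"
  assumes "closed S" "\<And>x. x \<notin> S \<Longrightarrow> f x = 0" "x \<notin> S"
  shows "partial_deriv i f x = 0"
proof -
  have "(f has_derivative (\<lambda>_. 0)) (at x)"
    by (rule has_derivative_transform_within_open[where s="- S" and f="\<lambda>_. 0"]) (use assms in auto)
  then show ?thesis by (simp add: partial_deriv_def frechet_derivative_at[symmetric])
qed

lemma lipschitz_of_partials:
  fixes f :: "'a::euclidean_space \<Rightarrow> real"
  assumes "convex S" "\<And>x. x \<in> S \<Longrightarrow> (f has_derivative (\<lambda>v. \<Sum>i\<in>Basis. (v \<bullet> i) * D i x)) (at x)"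
    and B: "\<And>x i. x \<in> S \<Longrightarrow> i \<in> Basis \<Longrightarrow> \<bar>D i x\<bar> \<le> B" and "x \<in> S" "y \<in> S"
  shows "\<bar>f x - f y\<bar> \<le> (real DIM('a) * B) * norm (x - y)"
proof -
  have "norm (f x - f y) \<le> (real DIM('a) * B) * norm (x - y)"
  proof (rule differentiable_bound[OF assms(1) _ _ assms(4,5)])
    show "(f has_derivative (\<lambda>v. \<Sum>i\<in>Basis. (v \<bullet> i) * D i x)) (at x within S)" if "x \<in> S" for x
      using assms(2)[OF that] by (rule has_derivative_at_withinI)
    show "onorm (\<lambda>v. \<Sum>i\<in>Basis. (v \<bullet> i) * D i x) \<le> real DIM('a) * B" if "x \<in> S" for x
    proof (rule onorm_le)
      fix v :: 'a
      have "\<bar>\<Sum>i\<in>Basis. (v \<bullet> i) * D i x\<bar> \<le> (\<Sum>i\<in>(Basis::'a set). norm v * B)"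
        by (rule order_trans[OF sum_abs], rule sum_mono)
          (auto simp: abs_mult intro!: mult_mono Basis_le_norm B that)
      then show "norm (\<Sum>i\<in>Basis. (v \<bullet> i) * D i x) \<le> real DIM('a) * B * norm v" by (simp add: mult_ac)
    qed
  qed
  then show ?thesis by simp
qed

text \<open>The half side \<open>1 / (2 d)\<close> puts the box into the closed ball of radius
  \<open>1 / 2\<close>, by comparison of the norm with the sum of the coordinates. Averages then use
  only half of the radius \<open>rad a\<close>, so that even the closed averaging ball stays inside
  the open domain.\<close>

definition mol_corner :: "'a::euclidean_space" where
  "mol_corner = (1 / (2 * real DIM('a))) *\<^sub>R One"

definition mollifier :: "'a::euclidean_space \<Rightarrow> real" where
  "mollifier x = (1 / (\<integral>z. box_bump 0 (- mol_corner) mol_corner (z::'a) \<partial>lborel)) * box_bump 0 (- mol_corner) mol_corner x"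

lemma mol_corner_inner: "i \<in> Basis \<Longrightarrow> mol_corner \<bullet> i = 1 / (2 * real DIM('a))" for i :: "'a::euclidean_space"
  by (simp add: mol_corner_def)

lemma norm_le_half_of_box:
  fixes x :: "'a::euclidean_space"
  assumes "x \<in> cbox (- mol_corner) mol_corner"
  shows "norm x \<le> 1 / 2"
proof -
  have "norm x \<le> (\<Sum>i\<in>Basis. \<bar>x \<bullet> i\<bar>)" by (rule norm_le_l1)
  also have "\<dots> \<le> (\<Sum>i\<in>(Basis::'a set). 1 / (2 * real DIM('a)))"
    using assms by (intro sum_mono) (auto simp: mem_box mol_corner_inner abs_le_iff)
  also have "\<dots> = 1 / 2" by simp
  finally show ?thesis .
qed

lemma box_bump_integrable: "integrable lborel (box_bump n a (b::'a::euclidean_space))"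
proof (rule Bochner_Integration.integrable_bound)
  show "integrable lborel (indicator (box a b) :: 'a \<Rightarrow> real)"
    by (auto intro!: integrable_real_indicator simp: emeasure_lborel_box_eq)
  show "box_bump n a b \<in> borel_measurable lborel"
    using bump_alg_continuous[OF box_bump_alg] by (auto intro!: borel_measurable_continuous_onI)
  show "AE x in lborel. norm (box_bump n a b x) \<le> norm (indicator (box a b) x :: real)"
  proof (intro AE_I2)
    fix x show "norm (box_bump n a b x) \<le> norm (indicator (box a b) x :: real)"
      using box_bump_pos_iff[of n a b x] by (cases "x \<in> box a b") (auto simp: box_bump_nonneg box_bump_le)
  qed
qed

lemma box_bump_integral_pos:
  fixes a b :: "'a::euclidean_space"
  assumes "box a b \<noteq> {}"
  shows "(\<integral>z. box_bump n a b z \<partial>lborel) > 0"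
proof -
  have "(\<integral>z. box_bump n a b z \<partial>lborel) \<noteq> 0"
  proof
    assume "(\<integral>z. box_bump n a b z \<partial>lborel) = 0"
    then have "AE z in lborel. box_bump n a b z = 0"
      by (subst (asm) integral_nonneg_eq_0_iff_AE[OF box_bump_integrable]) (auto simp: box_bump_nonneg)
    then have "AE z in lborel. z \<notin> box a b"
      using box_bump_pos_iff by (auto elim!: eventually_mono)
    then have "box a b \<in> null_sets lborel"
      by (subst (asm) AE_iff_null_sets[symmetric]) auto
    then have "negligible (box a b)" by (simp add: negligible_iff_null_sets null_sets_completionI)
    then show False using assms open_not_negligible[OF open_box] by blast
  qed
  moreover have "(\<integral>z. box_bump n a b z \<partial>lborel) \<ge> 0" by (simp add: box_bump_nonneg)
  ultimately show ?thesis by simp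
qed

lemma mol_box_nonempty: "box (- mol_corner) (mol_corner::'a::euclidean_space) \<noteq> {}"
  by (simp add: box_ne_empty mol_corner_inner)

lemma mollifier_alg: "mollifier \<in> bump_alg"
  unfolding mollifier_def[abs_def] by (intro bump_alg.mult bump_alg.const box_bump_alg)

lemma mollifier_nonneg: "mollifier x \<ge> 0"
  unfolding mollifier_def by (intro mult_nonneg_nonneg box_bump_nonneg) (simp add: box_bump_nonneg)

lemma mollifier_zero: "x \<notin> cbox (- mol_corner) mol_corner \<Longrightarrow> mollifier x = 0"
  using box_bump_pos_iff[of 0 "- mol_corner" mol_corner x] box_subset_cbox[of "- mol_corner" mol_corner]
  by (auto simp: mollifier_def)

lemma mollifier_integral: "(\<integral>z. mollifier (z::'a::euclidean_space) \<partial>lborel) = 1"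
  unfolding mollifier_def using box_bump_integral_pos[OF mol_box_nonempty[where 'a='a], of 0] by simp

lemma mollifier_integrable: "integrable lborel mollifier"
  unfolding mollifier_def[abs_def] using box_bump_integrable by auto

lemma mollifier_nn_integral: "(\<integral>\<^sup>+z. ennreal (mollifier (z::'a::euclidean_space)) \<partial>lborel) = 1"
  by (subst nn_integral_eq_integral) (auto simp: mollifier_integrable mollifier_nonneg mollifier_integral)

lemma nn_integral_lborel_affine:
  fixes f :: "'a::euclidean_space \<Rightarrow> ennreal"
  assumes "f \<in> borel_measurable borel" "c \<noteq> 0"
  shows "(\<integral>\<^sup>+x. f (t + c *\<^sub>R x) \<partial>lborel) = ennreal (1 / \<bar>c\<bar> ^ DIM('a)) * (\<integral>\<^sup>+x. f x \<partial>lborel)"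
proof -
  have "(\<integral>\<^sup>+x. f x \<partial>lborel) = ennreal (\<bar>c\<bar> ^ DIM('a)) * (\<integral>\<^sup>+x. f (t + c *\<^sub>R x) \<partial>lborel)"
    using assms by (subst lborel_affine[OF assms(2), of t]) (simp add: nn_integral_density nn_integral_distr nn_integral_cmult)
  then have "ennreal (1 / \<bar>c\<bar> ^ DIM('a)) * (\<integral>\<^sup>+x. f x \<partial>lborel) = (ennreal (1 / \<bar>c\<bar> ^ DIM('a)) * ennreal (\<bar>c\<bar> ^ DIM('a))) * (\<integral>\<^sup>+x. f (t + c *\<^sub>R x) \<partial>lborel)"
    by (simp add: mult.assoc)
  also have "ennreal (1 / \<bar>c\<bar> ^ DIM('a)) * ennreal (\<bar>c\<bar> ^ DIM('a)) = 1"
    using assms(2) by (subst ennreal_mult[symmetric]) auto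
  finally show ?thesis by simp
qed

text \<open>Tonelli's theorem is applied over \<open>lborel\<close>, where the integrand has to be
  Borel measurable in both variables jointly.\<close>

lemma lebesgue_on_borel_rep:
  fixes f :: "'a::euclidean_space \<Rightarrow> real"
  assumes "\<Omega> \<in> sets lebesgue" "f \<in> borel_measurable (lebesgue_on \<Omega>)"
  obtains f' where "f' \<in> borel_measurable borel" "AE x in lebesgue_on \<Omega>. f x = f' x"
proof -
  have "(\<lambda>x. indicator \<Omega> x * f x) \<in> borel_measurable lebesgue"
    using assms borel_measurable_restrict_space_iff[of \<Omega> lebesgue f] by simp
  then obtain f' where f': "f' \<in> borel_measurable lborel" "AE x in lborel. indicator \<Omega> x * f x = f' x"
    using completion_ex_borel_measurable_real by blast
  then have "AE x in lebesgue_on \<Omega>. f x = f' x"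
    unfolding AE_lebesgue_on_iff[OF assms(1)] by (auto elim!: eventually_mono)
  with f'(1) show thesis by (intro that) auto
qed

lemma nn_integral_lebesgue_on:
  "\<Omega> \<in> sets lebesgue \<Longrightarrow> (\<integral>\<^sup>+x. f x \<partial>lebesgue_on \<Omega>) = (\<integral>\<^sup>+x. f x * indicator \<Omega> x \<partial>lborel)"
  by (simp add: nn_integral_restrict_space nn_integral_completion)

text \<open>One inscribed ball is fixed once and for all: \<open>c\<close> is the centre of the
  contractions, of the Minkowski functional and of the radial projection, and \<open>1 / r\<close>
  is the Lipschitz constant of that functional.\<close>

locale convex_domain =
  fixes \<Omega> :: "'a::euclidean_space set" and c :: 'a and r :: real
  assumes \<Omega>: "open \<Omega>" "bounded \<Omega>" "convex \<Omega>" and r: "r > 0" and ball: "ball c r \<subseteq> \<Omega>"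
begin

abbreviation "M \<equiv> lebesgue_on \<Omega>"

lemma \<Omega>_sets [measurable]: "\<Omega> \<in> sets borel" and \<Omega>_sets' [simp]: "\<Omega> \<in> sets lebesgue"
  using \<Omega>(1) by auto

lemma \<Omega>_lmeasurable: "\<Omega> \<in> lmeasurable"
  using \<Omega> by (simp add: lmeasurable_open)

sublocale finite_measure M
  by (rule finite_measure_lebesgue_on[OF \<Omega>_lmeasurable])

lemma L2_const: "(\<lambda>x. k) \<in> L2 \<Omega>"
  by (simp add: L2_def)

lemma L2_bounded:
  assumes "f \<in> borel_measurable M" "AE x in M. \<bar>f x\<bar> \<le> B"
  shows "f \<in> L2 \<Omega>"
  using L2_bounded_mult[OF L2_const[of 1] assms] by simp

lemma L2_integrable: "f \<in> L2 \<Omega> \<Longrightarrow> integrable M f"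
  using L2_mult_integrable[OF _ L2_const[of 1]] by simp

lemma continuous_measurable: "continuous_on \<Omega> f \<Longrightarrow> f \<in> borel_measurable M"
  by (rule continuous_imp_measurable_on_sets_lebesgue) auto

text \<open>\<open>smoothing a f x\<close> averages \<open>f\<close> over a ball of radius \<open>(1 - a) * r\<close> around \<open>c + a * (x - c)\<close>. By
  convexity this ball lies in \<open>\<Omega>\<close>, so that no extension of \<open>f\<close> is needed.\<close>

definition "rad a = (1 - a) * r"

text \<open>A mollifier in \<open>y\<close>, rescaled to \<open>rad a\<close> and centred at the
  contracted point \<open>c + a (x - c)\<close>; the affine argument is written out in the shape
  that \<open>bump_alg_affine\<close> expects.\<close>

definition ker :: "real \<Rightarrow> 'a \<Rightarrow> 'a \<Rightarrow> real" where
  "ker a x y = (1 / rad a ^ DIM('a)) * mollifier ((1 / rad a) *\<^sub>R y + (- 1 / rad a) *\<^sub>R (c + a *\<^sub>R (x - c)))"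

definition smoothing :: "real \<Rightarrow> ('a \<Rightarrow> real) \<Rightarrow> 'a \<Rightarrow> real" where
  "smoothing a f x = L2_inner \<Omega> (ker a x) f"

lemma ker_alg: "ker a x \<in> bump_alg"
  unfolding ker_def[abs_def] by (intro bump_alg.mult bump_alg.const bump_alg_affine mollifier_alg)

text \<open>All kernels with the same \<open>a\<close> are translates of one function. Uniform
  bounds therefore reduce to the case \<open>x = c\<close>, and a derivative in \<open>x\<close>
  becomes \<open>- a\<close> times the derivative in \<open>y\<close>.\<close>

lemma ker_shift: "ker a x' y = ker a x (y - a *\<^sub>R (x' - x))"
  unfolding ker_def by (rule arg_cong[where f="\<lambda>z. _ * mollifier z"]) (simp add: algebra_simps)

lemma rad_pos: "a < 1 \<Longrightarrow> rad a > 0"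
  using r by (simp add: rad_def)

lemma ker_nonneg: "a < 1 \<Longrightarrow> ker a x y \<ge> 0"
  using rad_pos[of a] by (simp add: ker_def mollifier_nonneg)

lemma ker_zero:
  assumes "a < 1" "norm (y - (c + a *\<^sub>R (x - c))) > rad a / 2"
  shows "ker a x y = 0"
proof -
  have "(1 / rad a) *\<^sub>R y + (- 1 / rad a) *\<^sub>R (c + a *\<^sub>R (x - c)) = (1 / rad a) *\<^sub>R (y - (c + a *\<^sub>R (x - c)))"
    by (simp add: scaleR_diff_right)
  then have "norm ((1 / rad a) *\<^sub>R y + (- 1 / rad a) *\<^sub>R (c + a *\<^sub>R (x - c))) > 1 / 2"
    using assms rad_pos[of a] by (simp only: norm_scaleR) (simp add: less_divide_eq)
  then show ?thesis using norm_le_half_of_box mollifier_zero by (force simp: ker_def)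
qed

lemma cball_sub:
  assumes "0 < a" "a < 1" "x \<in> \<Omega>"
  shows "cball (c + a *\<^sub>R (x - c)) (rad a / 2) \<subseteq> \<Omega>"
proof
  fix y assume y: "y \<in> cball (c + a *\<^sub>R (x - c)) (rad a / 2)"
  \<comment> \<open>The displacement blown up by \<open>1 / (1 - a)\<close>: the point
    \<open>y\<close> is a convex combination of \<open>c + h\<close>, which lies in the inscribed
    ball, and of \<open>x\<close>.\<close>
  define h where "h = (1 / (1 - a)) *\<^sub>R (y - (c + a *\<^sub>R (x - c)))"
  have "norm (y - (c + a *\<^sub>R (x - c))) \<le> (1 - a) * (r / 2)"
    using y by (simp add: dist_norm norm_minus_commute rad_def)
  then have "norm h \<le> r / 2"
    using assms by (simp add: h_def divide_le_eq mult.commute)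
  then have "c + h \<in> \<Omega>" using ball r by (auto simp: subset_eq dist_norm)
  moreover have "y = (1 - a) *\<^sub>R (c + h) + a *\<^sub>R x"
  proof -
    have "(1 - a) *\<^sub>R h = y - (c + a *\<^sub>R (x - c))" using assms by (simp add: h_def)
    then show ?thesis unfolding scaleR_add_right by (simp add: algebra_simps)
  qed
  ultimately show "y \<in> \<Omega>" using assms \<Omega>(3) by (auto simp: convex_alt)
qed

lemma ker_zero_outside: "0 < a \<Longrightarrow> a < 1 \<Longrightarrow> x \<in> \<Omega> \<Longrightarrow> y \<notin> \<Omega> \<Longrightarrow> ker a x y = 0"
  using cball_sub[of a x] ker_zero[of a y x] by (force simp: dist_norm norm_minus_commute)

lemma ker_test:
  assumes "0 < a" "a < 1" "x \<in> \<Omega>"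
  shows "ker a x \<in> test_functions \<Omega>"
proof -
  have "{y. ker a x y \<noteq> 0} \<subseteq> cball (c + a *\<^sub>R (x - c)) (rad a / 2)"
    using ker_zero[OF assms(2)] by (force simp: dist_norm norm_minus_commute)
  then have *: "closure {y. ker a x y \<noteq> 0} \<subseteq> cball (c + a *\<^sub>R (x - c)) (rad a / 2)"
    by (intro closure_minimal) auto
  moreover have "compact (closure {y. ker a x y \<noteq> 0})"
    using compact_Int_closed[OF compact_cball closed_closure] * by (metis inf.absorb2)
  ultimately show ?thesis
    using cball_sub[OF assms] bump_alg_smooth[OF ker_alg] unfolding test_functions_def by blast
qed

lemma ker_continuous: "continuous_on A (ker a x)"
  by (rule bump_alg_continuous[OF ker_alg])

lemma ker_measurable: "ker a x \<in> borel_measurable M"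
  by (rule continuous_measurable[OF ker_continuous])

lemma ker_bounds:
  assumes "a < 1"
  shows "\<exists>B. \<forall>x y. \<bar>ker a x y\<bar> \<le> B \<and> (\<forall>i\<in>Basis. \<bar>partial_deriv i (ker a x) y\<bar> \<le> B)
     \<and> (\<forall>x'. \<bar>ker a x' y - ker a x y\<bar> \<le> B * norm (x' - x))"
proof -
  obtain p q where pq: "cball (c + a *\<^sub>R (c - c)) (rad a / 2) \<subseteq> cbox p q"
    using bounded_subset_cbox_symmetric[OF bounded_cball] by metis
  have z: "ker a c y = 0" if "y \<notin> cbox p q" for y
    using that pq ker_zero[OF assms, of y c] by (force simp: dist_norm norm_minus_commute)
  obtain B0 where B0: "\<And>y. \<bar>ker a c y\<bar> \<le> B0"
    using bump_alg_bounded[OF ker_alg z] by blast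
  have "\<forall>i. \<exists>B. \<forall>y. \<bar>partial_deriv i (ker a c) y\<bar> \<le> B"
  proof
    fix i
    have "partial_deriv i (ker a c) y = 0" if "y \<notin> cbox p q" for y
      by (rule partial_deriv_zero_outside[OF closed_cbox z that])
    from bump_alg_bounded[OF bump_alg_partial[OF ker_alg] this]
    show "\<exists>B. \<forall>y. \<bar>partial_deriv i (ker a c) y\<bar> \<le> B" .
  qed
  then obtain B1 where B1: "\<And>i y. \<bar>partial_deriv i (ker a c) y\<bar> \<le> B1 i" by metis
  define B where "B = B0 + (\<Sum>i\<in>(Basis::'a set). B1 i)"
  have B0': "B0 \<ge> 0" and B1': "\<And>i. B1 i \<ge> 0" using B0[of c] B1[of _ c] by (smt (verit) abs_ge_zero)+
  have B2: "\<bar>partial_deriv i (ker a c) y\<bar> \<le> B" if "i \<in> Basis" for i y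
  proof -
    have "B1 i \<le> (\<Sum>i\<in>(Basis::'a set). B1 i)" using that B1' by (intro member_le_sum) auto
    with B1[of i y] B0' show ?thesis by (simp add: B_def)
  qed
  have shift: "partial_deriv i (ker a x) y = partial_deriv i (ker a c) (y - a *\<^sub>R (x - c))" for i x y
  proof -
    have d: "(ker a c has_derivative frechet_derivative (ker a c) (at (y - a *\<^sub>R (x - c)))) (at (y - a *\<^sub>R (x - c)))"
      using bump_alg_differentiable[OF ker_alg] frechet_derivative_works by blast
    have "((\<lambda>y. y - a *\<^sub>R (x - c)) has_derivative (\<lambda>v. v)) (at y)" by (auto intro!: derivative_eq_intros)
    from has_derivative_compose[OF this d]
    have "(ker a x has_derivative frechet_derivative (ker a c) (at (y - a *\<^sub>R (x - c)))) (at y)"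
      by (simp add: ker_shift[of a x _ c, symmetric])
    then show ?thesis by (simp add: partial_deriv_def frechet_derivative_at[symmetric])
  qed
  have nn: "B \<ge> 0" using B0' B1' by (auto simp: B_def intro!: add_nonneg_nonneg sum_nonneg)
  define L where "L = (1 + \<bar>a\<bar>) * (real DIM('a) * B) + B"
  have BL: "B \<le> L" using nn by (simp add: L_def)
  have "\<bar>ker a x y\<bar> \<le> L" for x y
    using B0[of "y - a *\<^sub>R (x - c)"] BL B1' sum_nonneg[of Basis B1] unfolding ker_shift[of a x y c] by (simp add: B_def)
  moreover have "\<bar>partial_deriv i (ker a x) y\<bar> \<le> L" if "i \<in> Basis" for i x y
    using B2[OF that, of "y - a *\<^sub>R (x - c)"] BL unfolding shift[of i x y] by linarith
  moreover have "\<bar>ker a x' y - ker a x y\<bar> \<le> L * norm (x' - x)" for x x' y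
  proof -
    have "\<bar>ker a x' y - ker a x y\<bar> \<le> real DIM('a) * B * norm (y - a *\<^sub>R (x' - c) - (y - a *\<^sub>R (x - c)))"
      unfolding ker_shift[of a x' y c] ker_shift[of a x y c]
      by (rule lipschitz_of_partials[OF convex_UNIV smooth_has_derivative[OF bump_alg_smooth[OF ker_alg]] B2]) auto
    also have "y - a *\<^sub>R (x' - c) - (y - a *\<^sub>R (x - c)) = (- a) *\<^sub>R (x' - x)" by (simp add: algebra_simps)
    also have "real DIM('a) * B * norm ((- a) *\<^sub>R (x' - x)) \<le> L * norm (x' - x)"
    proof -
      have "real DIM('a) * B * \<bar>a\<bar> \<le> L" using nn by (simp add: L_def algebra_simps)
      then show ?thesis by (simp add: mult.assoc[symmetric] mult_right_mono)
    qed
    finally show ?thesis .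
  qed
  ultimately show ?thesis by blast
qed

lemma ker_has_derivative:
  "((\<lambda>x. ker a x y) has_derivative (\<lambda>v. \<Sum>i\<in>Basis. (v \<bullet> i) * (- a * partial_deriv i (ker a x) y))) (at x)"
proof -
  have d: "(ker a x has_derivative (\<lambda>v. \<Sum>i\<in>Basis. (v \<bullet> i) * partial_deriv i (ker a x) y)) (at (y - a *\<^sub>R (x - x)))"
    using smooth_has_derivative[OF bump_alg_smooth[OF ker_alg], of a x y] by simp
  have "((\<lambda>x'. y - a *\<^sub>R (x' - x)) has_derivative (\<lambda>v. - a *\<^sub>R v)) (at x)" by (auto intro!: derivative_eq_intros)
  from has_derivative_compose[OF this d] show ?thesis
    unfolding ker_shift[of a _ y x, symmetric] by (simp add: sum_negf mult_ac)
qed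

lemma smoothing_has_derivative:
  assumes f: "f \<in> L2 \<Omega>" and a: "a < 1"
  shows "(smoothing a f has_derivative (\<lambda>v. \<Sum>i\<in>Basis. (v \<bullet> i) * (- a * L2_inner \<Omega> (partial_deriv i (ker a x)) f))) (at x)"
proof -
  obtain B where B: "\<And>x y. \<bar>ker a x y\<bar> \<le> B" "\<And>x y i. i \<in> Basis \<Longrightarrow> \<bar>partial_deriv i (ker a x) y\<bar> \<le> B"
     "\<And>x x' y. \<bar>ker a x' y - ker a x y\<bar> \<le> B * norm (x' - x)"
    using ker_bounds[OF a] by metis
  have m: "partial_deriv i (ker a x) \<in> borel_measurable M" for i
    by (intro continuous_measurable bump_alg_continuous bump_alg_partial ker_alg)
  have "((\<lambda>x. LINT y|M. ker a x y * f y) has_derivative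
      (\<lambda>v. \<Sum>i\<in>Basis. (v \<bullet> i) * (LINT y|M. (- a * partial_deriv i (ker a x) y) * f y))) (at x)"
  proof (rule has_derivative_integral_kernel[where L=B and B="\<bar>a\<bar> * B" and B'=B])
    show "((\<lambda>x. ker a x y) has_derivative (\<lambda>v. \<Sum>i\<in>Basis. v \<bullet> i * (- a * partial_deriv i (ker a x) y))) (at x)" for y
      by (rule ker_has_derivative)
    show "\<bar>- a * partial_deriv i (ker a x) y\<bar> \<le> \<bar>a\<bar> * B" if "i \<in> Basis" for i y
      using B(2)[OF that, of x y] by (simp add: abs_mult mult_left_mono)
    show "(\<lambda>y. - a * partial_deriv i (ker a x) y) \<in> borel_measurable M" for i
      by (intro borel_measurable_times borel_measurable_const m)
  qed (use B ker_measurable L2_integrable[OF f] in auto)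
  moreover have "smoothing a f = (\<lambda>x. LINT y|M. ker a x y * f y)"
    by (simp add: smoothing_def L2_inner_def fun_eq_iff)
  moreover have "(LINT y|M. (- a * partial_deriv i (ker a x) y) * f y) = - a * L2_inner \<Omega> (partial_deriv i (ker a x)) f" for i
    by (simp only: L2_inner_def mult.assoc integral_mult_right_zero)
  ultimately show ?thesis by simp
qed

text \<open>For \<open>x\<close> in \<Omega> the kernel is a test function, so the derivative passes
  from the kernel to \<open>f\<close>. The factor \<open>a\<close> survives because \<open>x\<close>
  is contracted before averaging; it is harmless since \<open>a\<close> will tend to 1.\<close>

lemma smoothing_has_derivative_weak:
  assumes f: "f \<in> L2 \<Omega>" and g: "\<And>i. i \<in> Basis \<Longrightarrow> has_weak_deriv \<Omega> [i] f (g i)"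
    and a: "0 < a" "a < 1" and x: "x \<in> \<Omega>"
  shows "(smoothing a f has_derivative (\<lambda>v. \<Sum>i\<in>Basis. (v \<bullet> i) * (a * smoothing a (g i) x))) (at x)"
proof -
  have "- a * L2_inner \<Omega> (partial_deriv i (ker a x)) f = a * smoothing a (g i) x" if "i \<in> Basis" for i
  proof -
    have "L2_inner \<Omega> f (partial_deriv i (ker a x)) = - L2_inner \<Omega> (g i) (ker a x)"
      using g[OF that] ker_test[OF a x] by (auto simp: has_weak_deriv_def)
    then show ?thesis
      unfolding smoothing_def L2_inner_commute[of _ "ker a x"] L2_inner_commute[of _ "partial_deriv i (ker a x)"] by simp
  qed
  then show ?thesis using smoothing_has_derivative[OF f a(2), of x] by (simp cong: sum.cong)
qed

lemma smoothing_continuous: "f \<in> L2 \<Omega> \<Longrightarrow> a < 1 \<Longrightarrow> continuous_on A (smoothing a f)"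
  by (intro continuous_at_imp_continuous_on ballI has_derivative_continuous[OF smoothing_has_derivative])

lemma smoothing_bounded:
  assumes f: "f \<in> L2 \<Omega>" and a: "a < 1"
  shows "\<exists>B. \<forall>x. \<bar>smoothing a f x\<bar> \<le> B"
proof -
  obtain B where B: "\<And>x y. \<bar>ker a x y\<bar> \<le> B" using ker_bounds[OF a] by metis
  have "\<bar>smoothing a f x\<bar> \<le> (LINT y|M. B * \<bar>f y\<bar>)" for x
    unfolding smoothing_def L2_inner_def
  proof (rule order_trans[OF integral_abs_bound integral_mono_AE'])
    show "AE y in M. \<bar>ker a x y * f y\<bar> \<le> B * \<bar>f y\<bar>"
      using B by (intro AE_I2) (auto simp: abs_mult intro: mult_right_mono)
    show "integrable M (\<lambda>y. B * \<bar>f y\<bar>)" using L2_integrable[OF f] by auto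
    have "B \<ge> 0" using order_trans[OF abs_ge_zero B[of c c]] .
    then show "AE y in M. 0 \<le> B * \<bar>f y\<bar>" by (intro AE_I2) simp
  qed
  then show ?thesis by blast
qed

lemma smoothing_L2: "f \<in> L2 \<Omega> \<Longrightarrow> a < 1 \<Longrightarrow> smoothing a f \<in> L2 \<Omega>"
  using smoothing_bounded[of f a] by (metis L2_bounded AE_I2 continuous_measurable smoothing_continuous)

lemma ker_L2: "a < 1 \<Longrightarrow> ker a x \<in> L2 \<Omega>"
  using ker_bounds[of a] by (metis L2_bounded AE_I2 ker_measurable)

lemma smoothing_lincomb:
  "f \<in> L2 \<Omega> \<Longrightarrow> g \<in> L2 \<Omega> \<Longrightarrow> a < 1 \<Longrightarrow> smoothing a (\<lambda>x. f x - g x) y = smoothing a f y - smoothing a g y"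
  unfolding smoothing_def L2_inner_commute[of _ "ker a y"] by (rule L2_inner_diff_left) (auto intro: ker_L2)

lemma ker_nn_integral:
  assumes "0 < a" "a < 1" "x \<in> \<Omega>"
  shows "(\<integral>\<^sup>+y. ennreal (ker a x y) \<partial>lborel) = 1"
proof -
  have [measurable]: "mollifier \<in> borel_measurable borel"
    using bump_alg_continuous[OF mollifier_alg] by (rule borel_measurable_continuous_onI)
  have rp: "rad a > 0" using rad_pos assms by simp
  have "(\<integral>\<^sup>+y. ennreal (ker a x y) \<partial>lborel)
     = ennreal (1 / rad a ^ DIM('a)) * (\<integral>\<^sup>+y. ennreal (mollifier ((- 1 / rad a) *\<^sub>R (c + a *\<^sub>R (x - c)) + (1 / rad a) *\<^sub>R y)) \<partial>lborel)"
  proof -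
    have e: "ennreal (ker a x y) = ennreal (1 / rad a ^ DIM('a)) * ennreal (mollifier ((- 1 / rad a) *\<^sub>R (c + a *\<^sub>R (x - c)) + (1 / rad a) *\<^sub>R y))" for y
      using rp by (subst ennreal_mult[symmetric]) (auto simp: ker_def mollifier_nonneg add.commute)
    show ?thesis unfolding e by (rule nn_integral_cmult) measurable
  qed
  also have "(\<integral>\<^sup>+y. ennreal (mollifier ((- 1 / rad a) *\<^sub>R (c + a *\<^sub>R (x - c)) + (1 / rad a) *\<^sub>R y)) \<partial>lborel)
     = ennreal (1 / \<bar>1 / rad a\<bar> ^ DIM('a)) * (\<integral>\<^sup>+y. ennreal (mollifier (y::'a)) \<partial>lborel)"
    using rp by (intro nn_integral_lborel_affine) auto
  also have "ennreal (1 / rad a ^ DIM('a)) * \<dots> = 1"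
    using rp by (simp add: mollifier_nn_integral ennreal_mult[symmetric] power_divide)
  finally show ?thesis .
qed

lemma ker_nn_integral_M:
  assumes "0 < a" "a < 1" "x \<in> \<Omega>"
  shows "(\<integral>\<^sup>+y. ennreal (ker a x y) \<partial>M) = 1"
proof -
  have "(\<integral>\<^sup>+y. ennreal (ker a x y) \<partial>M) = (\<integral>\<^sup>+y. ennreal (ker a x y) \<partial>lborel)"
    unfolding nn_integral_lebesgue_on[OF \<Omega>_sets']
    by (intro nn_integral_cong) (auto simp: indicator_def ker_zero_outside[OF assms])
  then show ?thesis using ker_nn_integral[OF assms] by simp
qed

lemma ker_integral:
  assumes "0 < a" "a < 1" "x \<in> \<Omega>"
  shows "(LINT y|M. ker a x y) = 1"
  using ker_nn_integral_M[OF assms] ker_nonneg[OF assms(2)] ker_measurable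
  by (subst integral_eq_nn_integral) auto

lemma smoothing_const: "0 < a \<Longrightarrow> a < 1 \<Longrightarrow> x \<in> \<Omega> \<Longrightarrow> smoothing a (\<lambda>y. k) x = k"
  unfolding smoothing_def L2_inner_def by (simp add: ker_integral)

lemma smoothing_mono:
  assumes "f \<in> L2 \<Omega>" "g \<in> L2 \<Omega>" "a < 1" "AE y in M. y \<in> S \<longrightarrow> f y \<le> g y" "\<And>y. y \<notin> S \<Longrightarrow> ker a x y = 0"
  shows "smoothing a f x \<le> smoothing a g x"
  unfolding smoothing_def L2_inner_def
proof (rule integral_mono_AE[OF L2_mult_integrable L2_mult_integrable])
  show "AE y in M. ker a x y * f y \<le> ker a x y * g y"
    using assms(4)
  proof eventually_elim
    case (elim y)
    then show ?case using assms(5)[of y] ker_nonneg[OF assms(3)] by (cases "y \<in> S") (auto intro: mult_left_mono)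
  qed
qed (use assms ker_L2 in auto)

text \<open>On the support of the kernel \<open>f\<close> lies between the constants
  \<open>k - e\<close> and \<open>k + e\<close>, and averaging preserves both constants.\<close>

lemma smoothing_near:
  assumes f: "f \<in> L2 \<Omega>" and a: "0 < a" "a < 1" and x: "x \<in> \<Omega>"
    and S: "\<And>y. y \<in> \<Omega> \<Longrightarrow> norm (y - (c + a *\<^sub>R (x - c))) \<le> rad a / 2 \<Longrightarrow> \<bar>f y - k\<bar> \<le> e"
  shows "\<bar>smoothing a f x - k\<bar> \<le> e"
proof -
  let ?S = "{y \<in> \<Omega>. norm (y - (c + a *\<^sub>R (x - c))) \<le> rad a / 2}"
  have z: "y \<notin> ?S \<Longrightarrow> ker a x y = 0" for y
    using ker_zero[OF a(2), of y x] ker_zero_outside[OF a x, of y] by auto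
  have *: "y \<in> ?S \<longrightarrow> k - e \<le> f y \<and> f y \<le> k + e" for y
    using S[of y] by (auto simp: abs_le_iff)
  have "smoothing a (\<lambda>y. k - e) x \<le> smoothing a f x"
    using * by (intro smoothing_mono[OF L2_const f a(2) _ z, of ?S]) auto
  moreover have "smoothing a f x \<le> smoothing a (\<lambda>y. k + e) x"
    using * by (intro smoothing_mono[OF f L2_const a(2) _ z, of ?S]) auto
  ultimately show ?thesis unfolding smoothing_const[OF a x] by (simp add: abs_le_iff)
qed

lemma smoothing_abs_le:
  assumes f: "f \<in> L2 \<Omega>" and a: "0 < a" "a < 1" and x: "x \<in> \<Omega>" and B: "AE y in M. \<bar>f y\<bar> \<le> B"
  shows "\<bar>smoothing a f x\<bar> \<le> B"
proof -
  have "smoothing a (\<lambda>y. - B) x \<le> smoothing a f x"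
    using B by (intro smoothing_mono[OF L2_const f a(2), of UNIV]) (auto elim!: eventually_mono)
  moreover have "smoothing a f x \<le> smoothing a (\<lambda>y. B) x"
    using B by (intro smoothing_mono[OF f L2_const a(2), of UNIV]) (auto elim!: eventually_mono)
  ultimately show ?thesis unfolding smoothing_const[OF a x] by (simp add: abs_le_iff)
qed

text \<open>Jensen's inequality, from nonnegativity of the variance of \<open>f\<close> under the
  probability density \<open>ker a x\<close>.\<close>

lemma smoothing_sq_le:
  assumes f: "f \<in> L2 \<Omega>" and a: "0 < a" "a < 1" and x: "x \<in> \<Omega>"
  shows "ennreal ((smoothing a f x)\<^sup>2) \<le> (\<integral>\<^sup>+y. ennreal (ker a x y * (f y)\<^sup>2) \<partial>M)"
proof -
  let ?m = "smoothing a f x"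
  obtain B where B: "\<And>x y. \<bar>ker a x y\<bar> \<le> B" using ker_bounds[OF a(2)] by metis
  have kb: "(\<lambda>y. ker a x y * f y) \<in> L2 \<Omega>"
    using B by (intro L2_bounded_mult[OF f ker_measurable]) auto
  have i1: "integrable M (\<lambda>y. ker a x y * (f y)\<^sup>2)"
    using L2_mult_integrable[OF kb f] by (simp add: power2_eq_square mult.assoc)
  have i2: "integrable M (\<lambda>y. ker a x y * f y)" and i3: "integrable M (ker a x)"
    using L2_integrable[OF kb] L2_integrable[OF ker_L2[OF a(2)]] by auto
  have "0 \<le> (LINT y|M. ker a x y * (f y - ?m)\<^sup>2)"
    using ker_nonneg[OF a(2)] by (intro integral_nonneg_AE) auto
  also have "\<dots> = (LINT y|M. ker a x y * (f y)\<^sup>2 - 2 * ?m * (ker a x y * f y) + ?m\<^sup>2 * ker a x y)"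
    by (intro Bochner_Integration.integral_cong refl) (simp add: power2_eq_square algebra_simps)
  also have "\<dots> = (LINT y|M. ker a x y * (f y)\<^sup>2) - 2 * ?m * (LINT y|M. ker a x y * f y) + ?m\<^sup>2 * (LINT y|M. ker a x y)"
    using i1 i2 i3 by simp
  also have "(LINT y|M. ker a x y * f y) = ?m" by (simp add: smoothing_def L2_inner_def)
  finally have "?m\<^sup>2 \<le> (LINT y|M. ker a x y * (f y)\<^sup>2)"
    by (simp add: ker_integral[OF a x] power2_eq_square)
  then show ?thesis
    using i1 ker_nonneg[OF a(2)] by (subst nn_integral_eq_integral) (auto intro: ennreal_leI)
qed

lemma L2_nn_integral: "f \<in> L2 \<Omega> \<Longrightarrow> (\<integral>\<^sup>+x. ennreal ((f x)\<^sup>2) \<partial>M) = ennreal ((L2_norm \<Omega> f)\<^sup>2)"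
  unfolding L2_norm_sq_integral by (rule nn_integral_eq_integral) (auto simp: L2_def)

text \<open>Jensen and Tonelli leave the integral of the kernel over its centre variable; since
  \<open>x\<close> enters only through \<open>a *\<^sub>R x\<close>, that integral is
  \<open>1 / a ^ DIM('a)\<close>.\<close>

lemma smoothing_norm:
  assumes f: "f \<in> L2 \<Omega>" and a: "0 < a" "a < 1"
  shows "(L2_norm \<Omega> (smoothing a f))\<^sup>2 \<le> (1 / a ^ DIM('a)) * (L2_norm \<Omega> f)\<^sup>2"
proof -
  obtain f' where f'[measurable]: "f' \<in> borel_measurable borel" and eq: "AE x in M. f x = f' x"
    using lebesgue_on_borel_rep[OF \<Omega>_sets' L2_measurable[OF f]] .
  have mm[measurable]: "mollifier \<in> borel_measurable borel"
    using bump_alg_continuous[OF mollifier_alg] by (rule borel_measurable_continuous_onI)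
  have km[measurable]: "(\<lambda>(x, y). ker a x y) \<in> borel_measurable (borel \<Otimes>\<^sub>M borel)"
    unfolding ker_def[abs_def] by measurable
  have rp: "rad a > 0" using rad_pos a by simp
  have kx: "(\<integral>\<^sup>+x. ennreal (ker a x y) \<partial>lborel) = ennreal (1 / a ^ DIM('a))" for y
  proof -
    have "(\<integral>\<^sup>+x. ennreal (ker a x y) \<partial>lborel)
       = ennreal (1 / rad a ^ DIM('a)) * (\<integral>\<^sup>+x. ennreal (mollifier ((1 / rad a) *\<^sub>R (y - c + a *\<^sub>R c) + (- a / rad a) *\<^sub>R x)) \<partial>lborel)"
    proof -
      have "(1 / rad a) *\<^sub>R y + (- 1 / rad a) *\<^sub>R (c + a *\<^sub>R (x - c)) = (1 / rad a) *\<^sub>R (y - c + a *\<^sub>R c) + (- a / rad a) *\<^sub>R x" for x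
        by (simp add: algebra_simps)
      then have e: "ennreal (ker a x y) = ennreal (1 / rad a ^ DIM('a)) * ennreal (mollifier ((1 / rad a) *\<^sub>R (y - c + a *\<^sub>R c) + (- a / rad a) *\<^sub>R x))" for x
        using rp by (subst ennreal_mult[symmetric]) (auto simp: ker_def mollifier_nonneg)
      show ?thesis unfolding e by (rule nn_integral_cmult) measurable
    qed
    also have "(\<integral>\<^sup>+x. ennreal (mollifier ((1 / rad a) *\<^sub>R (y - c + a *\<^sub>R c) + (- a / rad a) *\<^sub>R x)) \<partial>lborel)
       = ennreal (1 / \<bar>- a / rad a\<bar> ^ DIM('a)) * (\<integral>\<^sup>+y. ennreal (mollifier (y::'a)) \<partial>lborel)"
      using rp a by (intro nn_integral_lborel_affine) auto
    also have "ennreal (1 / rad a ^ DIM('a)) * \<dots> = ennreal (1 / a ^ DIM('a))"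
      using rp a by (simp add: mollifier_nn_integral ennreal_mult[symmetric] power_divide)
    finally show ?thesis .
  qed
  have "ennreal ((L2_norm \<Omega> (smoothing a f))\<^sup>2) = (\<integral>\<^sup>+x. ennreal ((smoothing a f x)\<^sup>2) \<partial>M)"
    using L2_nn_integral[OF smoothing_L2[OF f a(2)]] by simp
  also have "\<dots> \<le> (\<integral>\<^sup>+x. (\<integral>\<^sup>+y. ennreal (ker a x y * (f y)\<^sup>2) \<partial>M) \<partial>M)"
    using smoothing_sq_le[OF f a] by (intro nn_integral_mono) (simp add: space_restrict_space)
  also have "\<dots> = (\<integral>\<^sup>+x. (\<integral>\<^sup>+y. ennreal (ker a x y * (f' y)\<^sup>2) \<partial>M) \<partial>M)"
    using eq by (intro nn_integral_cong nn_integral_cong_AE) (auto elim!: eventually_mono)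
  also have "\<dots> \<le> (\<integral>\<^sup>+x. (\<integral>\<^sup>+y. ennreal (ker a x y) * (ennreal ((f' y)\<^sup>2) * indicator \<Omega> y) \<partial>lborel) \<partial>lborel)"
    unfolding nn_integral_lebesgue_on[OF \<Omega>_sets'] using ker_nonneg[OF a(2)]
    by (intro nn_integral_mono) (auto simp: indicator_def ennreal_mult intro!: nn_integral_mono)
  also have "\<dots> = (\<integral>\<^sup>+y. (\<integral>\<^sup>+x. ennreal (ker a x y) * (ennreal ((f' y)\<^sup>2) * indicator \<Omega> y) \<partial>lborel) \<partial>lborel)"
    by (rule lborel_pair.Fubini'[symmetric]) measurable
  also have "\<dots> = (\<integral>\<^sup>+y. ennreal (1 / a ^ DIM('a)) * (ennreal ((f' y)\<^sup>2) * indicator \<Omega> y) \<partial>lborel)"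
    by (subst nn_integral_multc) (auto simp: kx)
  also have "\<dots> = ennreal (1 / a ^ DIM('a)) * (\<integral>\<^sup>+y. ennreal ((f' y)\<^sup>2) \<partial>M)"
    unfolding nn_integral_lebesgue_on[OF \<Omega>_sets'] by (rule nn_integral_cmult) measurable
  also have "(\<integral>\<^sup>+y. ennreal ((f' y)\<^sup>2) \<partial>M) = (\<integral>\<^sup>+y. ennreal ((f y)\<^sup>2) \<partial>M)"
    using eq by (intro nn_integral_cong_AE) (auto elim!: eventually_mono)
  also have "\<dots> = ennreal ((L2_norm \<Omega> f)\<^sup>2)" by (rule L2_nn_integral[OF f])
  also have "ennreal (1 / a ^ DIM('a)) * ennreal ((L2_norm \<Omega> f)\<^sup>2) = ennreal ((1 / a ^ DIM('a)) * (L2_norm \<Omega> f)\<^sup>2)"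
    using a by (intro ennreal_mult[symmetric]) auto
  finally show ?thesis using a by (subst (asm) ennreal_le_iff) auto
qed

section \<open>Convergence of the averages\<close>

lemma L2_tendsto_dominated:
  assumes "\<And>k. f k \<in> borel_measurable M" "g \<in> L2 \<Omega>" "w \<in> L2 \<Omega>"
    and lim: "AE x in M. (\<lambda>k. f k x) \<longlonglongrightarrow> g x" and dom: "\<And>k. AE x in M. \<bar>f k x\<bar> \<le> \<bar>w x\<bar>"
  shows "L2_tendsto \<Omega> f g"
proof -
  have fL: "f k \<in> L2 \<Omega>" for k
  proof -
    have "integrable M (\<lambda>x. (f k x)\<^sup>2)"
    proof (rule Bochner_Integration.integrable_bound)
      show "integrable M (\<lambda>x. (w x)\<^sup>2)" using assms by (simp add: L2_def)
      show "AE x in M. norm ((f k x)\<^sup>2) \<le> norm ((w x)\<^sup>2)" using dom[of k] by (auto simp: abs_le_square_iff elim!: eventually_mono)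
    qed (use assms in auto)
    then show ?thesis using assms by (auto simp: L2_def)
  qed
  have wg: "integrable M (\<lambda>x. 2 * (w x)\<^sup>2 + 2 * (g x)\<^sup>2)" using assms by (simp add: L2_def)
  have "(\<lambda>k. LINT x|M. (f k x - g x)\<^sup>2) \<longlonglongrightarrow> (LINT x|M. 0)"
  proof (rule integral_dominated_convergence[OF _ _ wg])
    show "AE x in M. (\<lambda>k. (f k x - g x)\<^sup>2) \<longlonglongrightarrow> 0"
      using lim
    proof eventually_elim
      case (elim x)
      have "(\<lambda>k. (f k x - g x)\<^sup>2) \<longlonglongrightarrow> (g x - g x)\<^sup>2" by (intro tendsto_intros elim)
      then show ?case by simp
    qed
    show "AE x in M. norm ((f k x - g x)\<^sup>2) \<le> 2 * (w x)\<^sup>2 + 2 * (g x)\<^sup>2" for k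
      using dom[of k]
    proof eventually_elim
      case (elim x)
      have "(f k x)\<^sup>2 \<le> (w x)\<^sup>2" using elim by (simp add: abs_le_square_iff)
      moreover have "0 \<le> (f k x + g x)\<^sup>2" by simp
      ultimately have "(f k x - g x)\<^sup>2 \<le> 2 * (w x)\<^sup>2 + 2 * (g x)\<^sup>2" by (simp add: power2_eq_square algebra_simps)
      then show ?case by simp
    qed
  qed (auto intro!: borel_measurable_power borel_measurable_diff assms(1) L2_measurable[OF assms(2)])
  then have "(\<lambda>k. sqrt (LINT x|M. (f k x - g x)\<^sup>2)) \<longlonglongrightarrow> 0" using tendsto_real_sqrt[of _ 0] by simp
  moreover have "L2_norm \<Omega> (\<lambda>x. f k x - g x) = sqrt (LINT x|M. (f k x - g x)\<^sup>2)" for k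
    unfolding L2_norm_def L2_inner_def power2_eq_square ..
  ultimately show ?thesis using fL assms by (simp add: L2_tendsto_def)
qed

text \<open>A truncation of \<open>f\<close> is close to it in L2, and a measurable function is an
  almost everywhere limit of continuous ones; truncating these at the same height gives a constant
  dominating function, integrable because \<Omega> is bounded.\<close>

lemma L2_continuous_dense:
  assumes f: "f \<in> L2 \<Omega>" and e: "e > 0"
  shows "\<exists>g. continuous_on UNIV g \<and> g \<in> L2 \<Omega> \<and> L2_norm \<Omega> (\<lambda>x. f x - g x) < e"
proof -
  have fm: "f \<in> borel_measurable M" using f by (rule L2_measurable)
  let ?t = "\<lambda>n x. max (- real n) (min (real n) (f x))"
  have "L2_tendsto \<Omega> ?t f"
  proof (rule L2_tendsto_dominated[OF _ f f])
    show "AE x in M. (\<lambda>k. ?t k x) \<longlonglongrightarrow> f x"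
    proof (intro AE_I2)
      fix x
      obtain N :: nat where N: "\<bar>f x\<bar> \<le> real N" using real_arch_simple by blast
      have "\<forall>\<^sub>F k in sequentially. f x = ?t k x"
        using eventually_ge_at_top[of N] by eventually_elim (use N in auto)
      then show "(\<lambda>k. ?t k x) \<longlonglongrightarrow> f x" by (rule Lim_transform_eventually[OF tendsto_const])
    qed
  qed (use fm in auto)
  from L2_tendstoD(3)[OF this] obtain n where n: "L2_norm \<Omega> (\<lambda>x. ?t n x - f x) < e / 2"
    using order_tendstoD(2)[of _ 0 sequentially "e / 2"] e by (auto simp: eventually_sequentially)
  have tL: "?t n \<in> L2 \<Omega>" using L2_tendstoD(1)[OF \<open>L2_tendsto \<Omega> ?t f\<close>] .
  have "(?t n) measurable_on \<Omega>"
    using L2_measurable[OF tL] measurable_on_iff_borel_measurable[of \<Omega> "?t n"] by simp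
  then obtain N g where N: "negligible N" and g: "\<And>k. continuous_on UNIV (g k)"
    and lim: "\<And>x. x \<notin> N \<Longrightarrow> (\<lambda>k. g k x) \<longlonglongrightarrow> (if x \<in> \<Omega> then ?t n x else 0)"
    unfolding measurable_on_def by blast
  let ?g = "\<lambda>k x. max (- real n) (min (real n) (g k x))"
  have gc: "continuous_on A (?g k)" for A k
    by (rule continuous_on_subset[of UNIV]) (auto intro!: continuous_intros g)
  have "L2_tendsto \<Omega> ?g (?t n)"
  proof (rule L2_tendsto_dominated[OF _ tL L2_const[of "real n"]])
    show "?g k \<in> borel_measurable M" for k by (rule continuous_measurable[OF gc])
    have "AE x in lborel. x \<notin> N"
      using AE_not_in[OF N[unfolded negligible_iff_null_sets]] unfolding AE_completion_iff .
    then show "AE x in M. (\<lambda>k. ?g k x) \<longlonglongrightarrow> ?t n x"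
      unfolding AE_lebesgue_on_iff[OF \<Omega>_sets']
    proof eventually_elim
      case (elim x)
      show ?case
      proof
        assume "x \<in> \<Omega>"
        with lim[OF elim] have "(\<lambda>k. g k x) \<longlonglongrightarrow> ?t n x" by simp
        then have "(\<lambda>k. ?g k x) \<longlonglongrightarrow> max (- real n) (min (real n) (?t n x))"
          by (intro tendsto_intros)
        also have "max (- real n) (min (real n) (?t n x)) = ?t n x" by auto
        finally show "(\<lambda>k. ?g k x) \<longlonglongrightarrow> ?t n x" .
      qed
    qed
  qed auto
  note D = L2_tendstoD[OF this]
  from D(3) obtain k where k: "L2_norm \<Omega> (\<lambda>x. ?g k x - ?t n x) < e / 2"
    using order_tendstoD(2)[of _ 0 sequentially "e / 2"] e by (auto simp: eventually_sequentially)
  have "L2_norm \<Omega> (\<lambda>x. ?g k x - f x) < e"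
    using L2_norm_triangle[OF L2_diff[OF D(1) D(2)] L2_diff[OF tL f], of k] k n by simp
  moreover have "L2_norm \<Omega> (\<lambda>x. f x - ?g k x) = L2_norm \<Omega> (\<lambda>x. ?g k x - f x)"
    using L2_norm_cmult[of \<Omega> "-1" "\<lambda>x. ?g k x - f x"] by simp
  ultimately show ?thesis using gc D(1) by (intro exI[of _ "?g k"]) auto
qed

text \<open>Contraction factors that tend to 1 and never fall below \<open>1 / 2\<close>, so that
  the factor in \<open>smoothing_norm\<close> is bounded by \<open>2 ^ DIM('a)\<close>.\<close>

definition "scl k = 1 - 1 / (real k + 2)"

lemma scl: "0 < scl k" "scl k < 1" "1 / 2 \<le> scl k" "scl \<longlonglongrightarrow> 1"
proof -
  show "0 < scl k" "scl k < 1" "1 / 2 \<le> scl k" by (auto simp: scl_def field_simps)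
  show "scl \<longlonglongrightarrow> 1" unfolding scl_def[abs_def] by real_asymp
qed

text \<open>The operators are uniformly bounded on L2 and converge uniformly on functions that are
  continuous on the compact closure; density of the latter gives convergence for every
  \<open>f\<close>.\<close>

lemma smoothing_tendsto:
  assumes f: "f \<in> L2 \<Omega>"
  shows "L2_tendsto \<Omega> (\<lambda>k. smoothing (scl k) f) f"
proof -
  define C where "C = sqrt (2 ^ DIM('a))"
  have C: "L2_norm \<Omega> (smoothing (scl k) g) \<le> C * L2_norm \<Omega> g" if g: "g \<in> L2 \<Omega>" for g k
  proof (rule power2_le_imp_le)
    have "(1 / scl k) ^ DIM('a) \<le> 2 ^ DIM('a)"
      using scl(1,3)[of k] by (intro power_mono) (auto simp: field_simps)
    then have "(1 / scl k ^ DIM('a)) * (L2_norm \<Omega> g)\<^sup>2 \<le> 2 ^ DIM('a) * (L2_norm \<Omega> g)\<^sup>2"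
      by (intro mult_right_mono) (auto simp: power_one_over)
    then show "(L2_norm \<Omega> (smoothing (scl k) g))\<^sup>2 \<le> (C * L2_norm \<Omega> g)\<^sup>2"
      using smoothing_norm[OF g scl(1,2), of k] by (simp add: C_def power_mult_distrib)
  qed (simp add: C_def L2_norm_nonneg)
  have "(\<lambda>k. L2_norm \<Omega> (\<lambda>x. smoothing (scl k) f x - f x)) \<longlonglongrightarrow> 0"
  proof (rule LIMSEQ_I)
    fix e :: real assume e: "e > 0"
    have Cp: "C > 0" by (simp add: C_def)
    define e' where "e' = e / (2 * (C + 1))"
    have e': "e' > 0" using e Cp by (simp add: e'_def)
    obtain g where g: "continuous_on UNIV g" "g \<in> L2 \<Omega>" "L2_norm \<Omega> (\<lambda>x. f x - g x) < e'"
      using L2_continuous_dense[OF f e'] by blast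
    define V where "V = L2_norm \<Omega> (\<lambda>x. 1)"
    define \<eta> where "\<eta> = e / (2 * (V + 1))"
    have V: "V \<ge> 0" by (simp add: V_def L2_norm_nonneg)
    have \<eta>: "\<eta> > 0" using e V by (simp add: \<eta>_def)
    have "uniformly_continuous_on (closure \<Omega>) g"
      using \<Omega>(2) g(1) by (intro compact_uniformly_continuous) (auto intro: continuous_on_subset)
    then obtain \<delta> where \<delta>: "\<delta> > 0" "\<And>x y. x \<in> closure \<Omega> \<Longrightarrow> y \<in> closure \<Omega> \<Longrightarrow> dist x y < \<delta> \<Longrightarrow> dist (g x) (g y) < \<eta>"
      using \<eta> unfolding uniformly_continuous_on_def by meson
    obtain D where D: "\<And>x. x \<in> \<Omega> \<Longrightarrow> norm (x - c) \<le> D"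
    proof -
      have "bounded ((\<lambda>x. - c + x) ` \<Omega>)" using \<Omega>(2) by (rule bounded_translation)
      then show thesis using that by (auto simp: bounded_iff)
    qed
    \<comment> \<open>With \<open>a = scl k\<close>, \<open>(1 - a) (D + r)\<close> bounds the
      distance from \<open>x\<close> to any point of the averaging ball: \<open>(1 - a) D\<close>
      for the contraction of the centre and at most \<open>(1 - a) r\<close> for the radius.\<close>
    have "(\<lambda>k. (1 - scl k) * (D + r)) \<longlonglongrightarrow> (1 - 1) * (D + r)" by (intro tendsto_intros scl)
    then have "\<forall>\<^sub>F k in sequentially. (1 - scl k) * (D + r) < \<delta>" using \<delta>(1) by (intro order_tendstoD(2)) auto
    then obtain k0 where k0: "\<And>k. k \<ge> k0 \<Longrightarrow> (1 - scl k) * (D + r) < \<delta>" by (auto simp: eventually_sequentially)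
    have "norm (L2_norm \<Omega> (\<lambda>x. smoothing (scl k) f x - f x) - 0) < e" if kk: "k \<ge> k0" for k
    proof -
      note a = scl(1,2)[of k]
      have near: "\<bar>smoothing (scl k) g x - g x\<bar> \<le> \<eta>" if x: "x \<in> \<Omega>" for x
      proof (rule smoothing_near[OF g(2) a x])
        fix y assume y: "y \<in> \<Omega>" "norm (y - (c + scl k *\<^sub>R (x - c))) \<le> rad (scl k) / 2"
        have yx: "y - x = (y - (c + scl k *\<^sub>R (x - c))) - (1 - scl k) *\<^sub>R (x - c)" by (simp add: algebra_simps)
        have "norm ((1 - scl k) *\<^sub>R (x - c)) \<le> (1 - scl k) * D"
          using mult_left_mono[OF D[OF x], of "1 - scl k"] a by simp
        then have "norm (y - x) \<le> rad (scl k) / 2 + (1 - scl k) * D"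
          unfolding yx by (rule order_trans[OF norm_triangle_ineq4 add_mono[OF y(2)]])
        also have "\<dots> \<le> (1 - scl k) * (D + r)"
          using rad_pos[OF a(2)] unfolding distrib_left rad_def by linarith
        also have "\<dots> < \<delta>" using k0[OF kk] .
        finally have "dist y x < \<delta>" by (simp add: dist_norm)
        from \<delta>(2)[OF _ _ this] y(1) x have "dist (g y) (g x) < \<eta>" using closure_subset by blast
        then show "\<bar>g y - g x\<bar> \<le> \<eta>" by (simp add: dist_real_def)
      qed
      have s: "smoothing (scl k) f \<in> L2 \<Omega>" "smoothing (scl k) g \<in> L2 \<Omega>" using smoothing_L2 f g a by auto
      have "L2_norm \<Omega> (\<lambda>x. smoothing (scl k) g x - g x) \<le> L2_norm \<Omega> (\<lambda>x. \<eta> * 1)"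
        using near by (intro L2_norm_mono L2_const) (auto intro!: AE_I2 order_trans[OF _ abs_ge_self] simp: space_restrict_space)
      also have "\<dots> = \<eta> * V" unfolding L2_norm_cmult V_def using \<eta> by simp
      also have "\<dots> \<le> e / 2" using V e by (simp add: \<eta>_def field_simps)
      finally have 1: "L2_norm \<Omega> (\<lambda>x. smoothing (scl k) g x - g x) \<le> e / 2" .
      have "L2_norm \<Omega> (\<lambda>x. smoothing (scl k) f x - smoothing (scl k) g x) = L2_norm \<Omega> (smoothing (scl k) (\<lambda>x. f x - g x))"
        by (simp only: smoothing_lincomb[OF f g(2) a(2), symmetric])
      also have "\<dots> \<le> C * L2_norm \<Omega> (\<lambda>x. f x - g x)" by (rule C[OF L2_diff[OF f g(2)]])
      also have "\<dots> \<le> C * e'" using g(3) Cp by (intro mult_left_mono) auto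
      finally have 2: "L2_norm \<Omega> (\<lambda>x. smoothing (scl k) f x - smoothing (scl k) g x) \<le> C * e'" .
      have 3: "L2_norm \<Omega> (\<lambda>x. g x - f x) < e'"
        using g(3) L2_norm_cmult[of \<Omega> "-1" "\<lambda>x. g x - f x"] by simp
      have "L2_norm \<Omega> (\<lambda>x. smoothing (scl k) f x - f x)
        \<le> L2_norm \<Omega> (\<lambda>x. smoothing (scl k) f x - g x) + L2_norm \<Omega> (\<lambda>x. g x - f x)"
        using L2_norm_triangle[OF L2_diff[OF s(1) g(2)] L2_diff[OF g(2) f]] by simp
      moreover have "L2_norm \<Omega> (\<lambda>x. smoothing (scl k) f x - g x)
        \<le> L2_norm \<Omega> (\<lambda>x. smoothing (scl k) f x - smoothing (scl k) g x) + L2_norm \<Omega> (\<lambda>x. smoothing (scl k) g x - g x)"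
        using L2_norm_triangle[OF L2_diff[OF s] L2_diff[OF s(2) g(2)]] by simp
      moreover have "C * e' + e / 2 + e' = e"
      proof -
        have "2 * (C + 1) \<noteq> 0" using Cp by simp
        then have "e' * (2 * (C + 1)) = e" by (simp only: e'_def times_divide_eq_left nonzero_mult_div_cancel_right not_False_eq_True)
        then show ?thesis by (simp add: algebra_simps)
      qed
      ultimately show ?thesis using 1 2 3 L2_norm_nonneg[of \<Omega> "\<lambda>x. smoothing (scl k) f x - f x"] by simp
    qed
    then show "\<exists>no. \<forall>k\<ge>no. norm (L2_norm \<Omega> (\<lambda>x. smoothing (scl k) f x - f x) - 0) < e" by blast
  qed
  then show ?thesis using f smoothing_L2[OF f scl(2)] by (simp add: L2_tendsto_def)
qed

end

subsection \<open>Hausdorff measure\<close>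

lemma hausdorff_pre_mono: "A \<subseteq> B \<Longrightarrow> hausdorff_pre s \<delta> A \<le> hausdorff_pre s \<delta> B"
  unfolding hausdorff_pre_def by (rule INF_superset_mono) auto

lemma hausdorff_pre_antimono: "\<delta> \<le> \<delta>' \<Longrightarrow> hausdorff_pre s \<delta>' A \<le> hausdorff_pre s \<delta> A"
  unfolding hausdorff_pre_def by (rule INF_superset_mono) (auto intro: order_trans)

text \<open>The summand in \<open>hausdorff_pre\<close>. The empty set is separated because for
  \<open>s = 0\<close>, the case of a one-dimensional domain, the formula would count it with weight
  1.\<close>

definition hausdorff_weight :: "nat \<Rightarrow> 'a::metric_space set \<Rightarrow> ennreal" where
  "hausdorff_weight s C = (if C = {} then 0 else ennreal (unit_ball_vol (real s) * (diameter C / 2) ^ s))"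

lemma hausdorff_pre_le:
  "A \<subseteq> (\<Union>i. C i) \<Longrightarrow> (\<And>i. bounded (C i) \<and> diameter (C i) \<le> \<delta>) \<Longrightarrow>
     hausdorff_pre s \<delta> A \<le> (\<Sum>i. hausdorff_weight s (C i))"
  unfolding hausdorff_pre_def hausdorff_weight_def by (rule INF_lower) auto

lemma hausdorff_pre_approx:
  assumes "hausdorff_pre s \<delta> A < t"
  obtains C :: "nat \<Rightarrow> 'a::metric_space set"
  where "A \<subseteq> (\<Union>i. C i)" "\<And>i. bounded (C i) \<and> diameter (C i) \<le> \<delta>" "(\<Sum>i. hausdorff_weight s (C i)) < t"
  using assms unfolding hausdorff_pre_def hausdorff_weight_def[symmetric] INF_less_iff by auto

lemma hausdorff_pre_greatest:
  assumes "\<And>C :: nat \<Rightarrow> 'a::metric_space set. A \<subseteq> (\<Union>i. C i) \<Longrightarrow> (\<And>i. bounded (C i) \<and> diameter (C i) \<le> \<delta>) \<Longrightarrow> t \<le> (\<Sum>i. hausdorff_weight s (C i))"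
  shows "t \<le> hausdorff_pre s \<delta> A"
  unfolding hausdorff_pre_def hausdorff_weight_def[symmetric] by (rule INF_greatest) (use assms in blast)

lemma hausdorff_pre_empty: "\<delta> > 0 \<Longrightarrow> hausdorff_pre s \<delta> {} = 0"
  using hausdorff_pre_le[of "{}" "\<lambda>_. {}" \<delta> s] by (simp add: hausdorff_weight_def)

text \<open>Near-optimal covers with excess \<open>e / 2 ^ (i + 1)\<close> are merged into a single
  sequence through \<open>prod_decode\<close>.\<close>

lemma hausdorff_pre_UN_le:
  fixes A :: "nat \<Rightarrow> 'a::metric_space set"
  shows "hausdorff_pre s \<delta> (\<Union>i. A i) \<le> (\<Sum>i. hausdorff_pre s \<delta> (A i))"
proof (rule ennreal_le_epsilon)
  fix e :: real assume e: "e > 0" and fin: "(\<Sum>i. hausdorff_pre s \<delta> (A i)) < top"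
  have f: "hausdorff_pre s \<delta> (A i) < top" for i
  proof -
    have "hausdorff_pre s \<delta> (A i) \<le> (\<Sum>i. hausdorff_pre s \<delta> (A i))"
      using sum_le_suminf[of "\<lambda>i. hausdorff_pre s \<delta> (A i)" "{i}"] by simp
    then show ?thesis using fin by (rule le_less_trans)
  qed
  have "\<exists>C. A i \<subseteq> (\<Union>j. C j) \<and> (\<forall>j. bounded (C j) \<and> diameter (C j) \<le> \<delta>) \<and>
     (\<Sum>j. hausdorff_weight s (C j)) \<le> hausdorff_pre s \<delta> (A i) + ennreal (e * (1 / 2) ^ Suc i)" for i
  proof -
    have "hausdorff_pre s \<delta> (A i) < hausdorff_pre s \<delta> (A i) + ennreal (e * (1 / 2) ^ Suc i)"
      using f[of i] e by (cases "hausdorff_pre s \<delta> (A i)")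
        (auto simp: ennreal_plus[symmetric] intro!: ennreal_lessI add_nonneg_pos simp del: ennreal_plus)
    then obtain C where "A i \<subseteq> (\<Union>j. C j)" "\<And>j. bounded (C j) \<and> diameter (C j) \<le> \<delta>"
      "(\<Sum>j. hausdorff_weight s (C j)) < hausdorff_pre s \<delta> (A i) + ennreal (e * (1 / 2) ^ Suc i)"
      by (rule hausdorff_pre_approx) blast
    then show ?thesis by (intro exI[of _ C]) (simp add: less_imp_le)
  qed
  then obtain C where C: "\<And>i. A i \<subseteq> (\<Union>j. C i j)" "\<And>i j. bounded (C i j) \<and> diameter (C i j) \<le> \<delta>"
    "\<And>i. (\<Sum>j. hausdorff_weight s (C i j)) \<le> hausdorff_pre s \<delta> (A i) + ennreal (e * (1 / 2) ^ Suc i)"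
    by metis
  let ?D = "\<lambda>n. case prod_decode n of (i, j) \<Rightarrow> C i j"
  have "hausdorff_pre s \<delta> (\<Union>i. A i) \<le> (\<Sum>n. hausdorff_weight s (?D n))"
  proof (rule hausdorff_pre_le)
    show "(\<Union>i. A i) \<subseteq> (\<Union>n. ?D n)"
    proof
      fix x assume "x \<in> (\<Union>i. A i)"
      then obtain i j where "x \<in> C i j" using C(1) by blast
      then have "x \<in> ?D (prod_encode (i, j))" by simp
      then show "x \<in> (\<Union>n. ?D n)" by (rule UN_I[OF UNIV_I])
    qed
  qed (use C(2) in \<open>auto split: prod.split\<close>)
  also have "\<dots> = (\<Sum>i. \<Sum>j. hausdorff_weight s (C i j))"
  proof -
    have "(\<Sum>n. (\<lambda>(i, j). hausdorff_weight s (C i j)) (prod_decode n)) = (\<Sum>i. \<Sum>j. hausdorff_weight s (C i j))"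
      by (rule suminf_ennreal_2dimen) simp
    moreover have "hausdorff_weight s (?D n) = (\<lambda>(i, j). hausdorff_weight s (C i j)) (prod_decode n)" for n
      by (simp split: prod.split)
    ultimately show ?thesis by simp
  qed
  also have "\<dots> \<le> (\<Sum>i. hausdorff_pre s \<delta> (A i) + ennreal (e * (1 / 2) ^ Suc i))"
    by (intro suminf_le C) auto
  also have "\<dots> = (\<Sum>i. hausdorff_pre s \<delta> (A i)) + (\<Sum>i. ennreal (e * (1 / 2) ^ Suc i))"
    by (subst suminf_add) auto
  also have "(\<Sum>i. ennreal (e * (1 / 2) ^ Suc i)) = ennreal e"
  proof -
    have "(\<lambda>i. e * (1 / 2) ^ Suc i) sums (e * 1)" by (intro sums_mult power_half_series)
    then show ?thesis using e by (intro suminf_ennreal_eq) auto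
  qed
  finally show "hausdorff_pre s \<delta> (\<Union>i. A i) \<le> (\<Sum>i. hausdorff_pre s \<delta> (A i)) + ennreal e" .
qed

text \<open>A covering set of diameter at most \<delta> meets at most one of the two sets, so every
  cover of the union splits into a cover of each.\<close>

lemma hausdorff_pre_separated:
  fixes A B :: "'a::metric_space set"
  assumes d: "\<And>x y. x \<in> A \<Longrightarrow> y \<in> B \<Longrightarrow> dist x y > \<delta>" and \<delta>: "\<delta> \<ge> 0"
  shows "hausdorff_pre s \<delta> A + hausdorff_pre s \<delta> B \<le> hausdorff_pre s \<delta> (A \<union> B)"
proof (rule hausdorff_pre_greatest)
  fix C :: "nat \<Rightarrow> 'a set" assume C: "A \<union> B \<subseteq> (\<Union>i. C i)" "\<And>i. bounded (C i) \<and> diameter (C i) \<le> \<delta>"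
  let ?CA = "\<lambda>i. if C i \<inter> A = {} then {} else C i" and ?CB = "\<lambda>i. if C i \<inter> B = {} then {} else C i"
  have "A \<subseteq> (\<Union>i. ?CA i)" "B \<subseteq> (\<Union>i. ?CB i)" using C(1) by (fastforce split: if_splits)+
  then have "hausdorff_pre s \<delta> A + hausdorff_pre s \<delta> B \<le> (\<Sum>i. hausdorff_weight s (?CA i)) + (\<Sum>i. hausdorff_weight s (?CB i))"
    using C(2) \<delta> by (intro add_mono hausdorff_pre_le) auto
  also have "\<dots> = (\<Sum>i. hausdorff_weight s (?CA i) + hausdorff_weight s (?CB i))" by (rule suminf_add) auto
  also have "\<dots> \<le> (\<Sum>i. hausdorff_weight s (C i))"
  proof (intro suminf_le)
    fix i
    have "C i \<inter> A = {} \<or> C i \<inter> B = {}"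
    proof (rule ccontr)
      assume "\<not> ?thesis"
      then obtain x y where xy: "x \<in> C i" "x \<in> A" "y \<in> C i" "y \<in> B" by blast
      then have "dist x y \<le> diameter (C i)" using C(2) by (intro diameter_bounded_bound) auto
      with d[OF xy(2,4)] C(2)[of i] show False by linarith
    qed
    then show "hausdorff_weight s (?CA i) + hausdorff_weight s (?CB i) \<le> hausdorff_weight s (C i)"
      by (auto simp: hausdorff_weight_def)
  qed auto
  finally show "hausdorff_pre s \<delta> A + hausdorff_pre s \<delta> B \<le> (\<Sum>i. hausdorff_weight s (C i))" .
qed

definition hausdorff_outer :: "nat \<Rightarrow> 'a::metric_space set \<Rightarrow> ennreal" where
  "hausdorff_outer s A = (SUP \<delta>\<in>{0<..}. hausdorff_pre s \<delta> A)"

lemma hausdorff_pre_le_outer: "\<delta> > 0 \<Longrightarrow> hausdorff_pre s \<delta> A \<le> hausdorff_outer s A"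
  unfolding hausdorff_outer_def by (rule SUP_upper) auto

lemma hausdorff_outer_mono: "A \<subseteq> B \<Longrightarrow> hausdorff_outer s A \<le> hausdorff_outer s B"
  unfolding hausdorff_outer_def by (intro SUP_mono' hausdorff_pre_mono)

lemma hausdorff_outer_empty: "hausdorff_outer s {} = 0"
  unfolding hausdorff_outer_def by (rule antisym) (auto intro!: SUP_least simp: hausdorff_pre_empty)

lemma hausdorff_outer_UN_le: "hausdorff_outer s (\<Union>i::nat. A i) \<le> (\<Sum>i. hausdorff_outer s (A i))"
  unfolding hausdorff_outer_def[of s "\<Union>i. A i"]
proof (rule SUP_least)
  fix \<delta> :: real assume "\<delta> \<in> {0<..}"
  then have "(\<Sum>i. hausdorff_pre s \<delta> (A i)) \<le> (\<Sum>i. hausdorff_outer s (A i))"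
    by (intro suminf_le hausdorff_pre_le_outer) auto
  with hausdorff_pre_UN_le show "hausdorff_pre s \<delta> (\<Union>i. A i) \<le> (\<Sum>i. hausdorff_outer s (A i))"
    by (rule order_trans)
qed

lemma hausdorff_outer_space: "outer_measure_space UNIV (hausdorff_outer s)"
  unfolding outer_measure_space_def positive_def increasing_def countably_subadditive_def
  by (auto simp: hausdorff_outer_empty hausdorff_outer_mono hausdorff_outer_UN_le)

lemma hausdorff_outer_Un_le: "hausdorff_outer s (A \<union> B) \<le> hausdorff_outer s A + hausdorff_outer s B"
proof -
  have "hausdorff_outer s (\<Union>i. binaryset A B i) \<le> (\<Sum>i. hausdorff_outer s (binaryset A B i))"
    by (rule hausdorff_outer_UN_le)
  then show ?thesis
    using suminf_binaryset_eq[of "hausdorff_outer s" A B] by (simp add: UN_binaryset_eq hausdorff_outer_empty)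
qed

text \<open>This makes the set function a metric outer measure, the property from which
  measurability of closed sets follows. The two suprema run over independent scales, so both are
  refined to a common one below \<open>d\<close>.\<close>

lemma hausdorff_outer_separated:
  fixes A B :: "'a::metric_space set"
  assumes d: "d > 0" "\<And>x y. x \<in> A \<Longrightarrow> y \<in> B \<Longrightarrow> dist x y \<ge> d"
  shows "hausdorff_outer s A + hausdorff_outer s B \<le> hausdorff_outer s (A \<union> B)"
proof -
  have *: "hausdorff_pre s \<delta> A + hausdorff_pre s \<delta>' B \<le> hausdorff_outer s (A \<union> B)" if "\<delta> > 0" "\<delta>' > 0" for \<delta> \<delta>'
  proof -
    define m where "m = min (min \<delta> \<delta>') (d / 2)"
    have m: "m > 0" "m \<le> \<delta>" "m \<le> \<delta>'" "m < d" using that d(1) by (auto simp: m_def)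
    have "hausdorff_pre s \<delta> A + hausdorff_pre s \<delta>' B \<le> hausdorff_pre s m A + hausdorff_pre s m B"
      by (intro add_mono hausdorff_pre_antimono m)
    also have "\<dots> \<le> hausdorff_pre s m (A \<union> B)"
      using m d(2) by (intro hausdorff_pre_separated) (auto intro: less_le_trans)
    also have "\<dots> \<le> hausdorff_outer s (A \<union> B)" by (rule hausdorff_pre_le_outer[OF m(1)])
    finally show ?thesis .
  qed
  have ne: "{0::real<..} \<noteq> {}" using zero_less_one by blast
  have "hausdorff_outer s A + hausdorff_pre s \<delta>' B \<le> hausdorff_outer s (A \<union> B)" if "\<delta>' > 0" for \<delta>'
    unfolding hausdorff_outer_def[of s A] ennreal_SUP_add_left[OF ne, symmetric]
    using *[OF _ that] by (intro SUP_least) auto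
  then show ?thesis
    unfolding hausdorff_outer_def[of s B] ennreal_SUP_add_right[OF ne]
    by (intro SUP_least) auto
qed

text \<open>Caratheodory's criterion: split the complement of a closed set into annuli.\<close>

lemma closed_in_lambda_system:
  fixes F :: "'a::metric_space set"
  assumes F: "closed F"
  shows "F \<in> lambda_system UNIV UNIV (hausdorff_outer s)"
proof -
  let ?H = "hausdorff_outer s"
  have "?H (F \<inter> X) + ?H (- F \<inter> X) = ?H X" for X
  proof (rule antisym)
    have "?H X \<le> ?H (F \<inter> X) + ?H (- F \<inter> X)"
      using hausdorff_outer_Un_le[of s "F \<inter> X" "- F \<inter> X"] by (simp add: Int_Un_distrib2[symmetric])
    then show "?H X \<le> ?H (F \<inter> X) + ?H (- F \<inter> X)" .
    show "?H (F \<inter> X) + ?H (- F \<inter> X) \<le> ?H X"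
    proof (cases "F = {} \<or> ?H X = \<infinity>")
      case True
      then show ?thesis by (auto simp: hausdorff_outer_empty)
    next
      case False
      then have Fne: "F \<noteq> {}" and fin: "?H X \<noteq> \<infinity>" by auto
      define Y where "Y n = {x \<in> X. infdist x F \<ge> 1 / (real n + 1)}" for n
      define R where "R n = {x \<in> X. 1 / (real n + 2) \<le> infdist x F \<and> infdist x F < 1 / (real n + 1)}" for n
      have far: "dist x y \<ge> 1 / (real n + 1)" if "x \<in> F \<inter> X" "y \<in> Y n" for x y n
        using that infdist_le[of x F y] by (auto simp: Y_def dist_commute)
      have split: "?H (F \<inter> X) + ?H (Y n) \<le> ?H X" for n
      proof -
        have "?H (F \<inter> X) + ?H (Y n) \<le> ?H (F \<inter> X \<union> Y n)"
          by (rule hausdorff_outer_separated[of "1 / (real n + 1)"]) (use far in auto)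
        also have "\<dots> \<le> ?H X" by (rule hausdorff_outer_mono) (auto simp: Y_def)
        finally show ?thesis .
      qed
      \<comment> \<open>Neighbouring annuli may touch, but two of equal parity are kept apart by the
        one between them. Their measures therefore add up to at most that of \<open>X\<close>, and
        all annuli together to at most twice that.\<close>
      have sep: "(\<Sum>k<m. ?H (R (2 * k + e))) \<le> ?H (\<Union>k<m. R (2 * k + e))" for m e :: nat
      proof (induction m)
        case (Suc m)
        let ?A = "\<Union>k<m. R (2 * k + e)"
        have "(\<Sum>k<Suc m. ?H (R (2 * k + e))) \<le> ?H ?A + ?H (R (2 * m + e))"
          using Suc by (simp add: add_mono)
        also have "\<dots> \<le> ?H (?A \<union> R (2 * m + e))"
        \<comment> \<open>For \<open>m = 0\<close> the union is empty, and the gap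
          \<open>1 / t - 1 / (t + 1)\<close> used otherwise could involve
          \<open>t = 0\<close>.\<close>
        proof (cases "m = 0")
          case True
          then show ?thesis by (simp add: hausdorff_outer_empty)
        next
          case False
          define t where "t = real (2 * m + e)"
          have tp: "t \<ge> 1" using False by (simp add: t_def)
          show ?thesis
          proof (rule hausdorff_outer_separated[of "1 / t - 1 / (t + 1)"])
            show "0 < 1 / t - 1 / (t + 1)" using divide_strict_left_mono[of t "t + 1" 1] tp by simp
            fix x y assume x: "x \<in> ?A" and y: "y \<in> R (2 * m + e)"
            from x obtain k where k: "k < m" "x \<in> R (2 * k + e)" by blast
            have "1 / t \<le> 1 / (real (2 * k + e) + 2)"
              using k(1) by (intro divide_left_mono) (auto simp: t_def)
            also have "\<dots> \<le> infdist x F" using k(2) by (simp add: R_def)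
            finally have "infdist x F \<ge> 1 / t" .
            moreover have "infdist y F < 1 / (t + 1)" using y by (simp add: R_def t_def)
            ultimately show "1 / t - 1 / (t + 1) \<le> dist x y"
              using infdist_triangle_abs[of x F y] by linarith
          qed
        qed
        also have "?A \<union> R (2 * m + e) = (\<Union>k<Suc m. R (2 * k + e))" by (auto simp: lessThan_Suc)
        finally show ?case .
      qed simp
      have RX: "(\<Sum>k<m. ?H (R (2 * k + e))) \<le> ?H X" for m e
        by (rule order_trans[OF sep hausdorff_outer_mono]) (auto simp: R_def)
      have "(\<Sum>n<2 * m. ?H (R n)) = (\<Sum>k<m. ?H (R (2 * k + 0))) + (\<Sum>k<m. ?H (R (2 * k + 1)))" for m
        by (induction m) (auto simp: ac_simps)
      then have "(\<Sum>n<2 * m. ?H (R n)) \<le> ?H X + ?H X" for m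
        using add_mono[OF RX[of 0 m] RX[of 1 m]] by simp
      then have "\<And>m. (\<Sum>n<m. ?H (R n)) \<le> ?H X + ?H X"
      proof -
        fix m
        have "(\<Sum>n<m. ?H (R n)) \<le> (\<Sum>n<2 * m. ?H (R n))" by (intro sum_mono2) auto
        also assume "\<And>m. (\<Sum>n<2 * m. ?H (R n)) \<le> ?H X + ?H X"
        finally show "(\<Sum>n<m. ?H (R n)) \<le> ?H X + ?H X" .
      qed
      then have "(\<Sum>n. ?H (R n)) \<le> ?H X + ?H X" by (intro suminf_le_const) auto
      then have sfin: "(\<Sum>n. ?H (R n)) \<noteq> top" using fin by (auto simp: top_unique)
      define g where "g n = enn2real (?H (R n))" for n
      have "?H (R n) \<noteq> top" for n
      proof -
        have "?H (R n) \<le> ?H X" by (rule hausdorff_outer_mono) (auto simp: R_def)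
        then show ?thesis using fin by (auto simp: top_unique)
      qed
      then have g: "?H (R n) = ennreal (g n)" for n by (simp add: g_def less_top)
      have g0: "g n \<ge> 0" for n by (simp add: g_def)
      have sg: "summable g" using sfin g0 unfolding g by (rule_tac summable_suminf_not_top) auto
      \<comment> \<open>\<open>Y n\<close> and the tail of the annuli exhaust the complement of the
        closed set within \<open>X\<close>, and summability makes the tail negligible.\<close>
      have cover: "- F \<inter> X \<subseteq> Y n \<union> (\<Union>k. R (k + n))" for n
      proof
        fix x assume x: "x \<in> - F \<inter> X"
        then have pos: "infdist x F > 0"
          using F Fne in_closed_iff_infdist_zero[of F x] infdist_nonneg[of x F] by force
        show "x \<in> Y n \<union> (\<Union>k. R (k + n))"
        proof (cases "infdist x F \<ge> 1 / (real n + 1)")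
          case False
          obtain N where N: "inverse (real (Suc N)) < infdist x F" using reals_Archimedean[OF pos] by blast
          define j where "j = (LEAST j. 1 / (real j + 2) \<le> infdist x F)"
          have "1 / (real N + 2) \<le> infdist x F"
          proof -
            have "1 / (real N + 2) \<le> inverse (real (Suc N))" by (simp add: field_simps)
            then show ?thesis using N by linarith
          qed
          then have j: "1 / (real j + 2) \<le> infdist x F" unfolding j_def by (rule LeastI)
          have jn: "j \<ge> n"
          proof (rule ccontr)
            assume "\<not> j \<ge> n"
            then have "1 / (real n + 1) \<le> 1 / (real j + 2)" by (intro divide_left_mono) auto
            with j False show False by linarith
          qed
          have "infdist x F < 1 / (real j + 1)"
          proof (cases "j = n")
            case True
            with False show ?thesis by simp
          next
            case False
            with jn have "j - 1 < j" "real (j - 1) = real j - 1" by auto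
            moreover have "\<not> 1 / (real (j - 1) + 2) \<le> infdist x F"
              using not_less_Least[of "j - 1"] \<open>j - 1 < j\<close> unfolding j_def by blast
            ultimately show ?thesis by (simp add: algebra_simps)
          qed
          with j x have "x \<in> R (j - n + n)" using jn by (simp add: R_def)
          then show ?thesis by blast
        qed (use x in \<open>auto simp: Y_def\<close>)
      qed
      show ?thesis
      proof (rule ennreal_le_epsilon)
        fix e :: real assume e: "e > 0"
        obtain n where n: "norm (\<Sum>i. g (i + n)) < e" using suminf_exist_split[OF e sg] by blast
        have sgn: "summable (\<lambda>i. g (i + n))" using sg by (simp add: summable_iff_shift)
        have "(\<Sum>k. ?H (R (k + n))) = ennreal (\<Sum>i. g (i + n))"
          unfolding g using g0 sgn by (intro suminf_ennreal2) auto
        also have "\<dots> \<le> ennreal e" using n by (intro ennreal_leI) auto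
        finally have t: "(\<Sum>k. ?H (R (k + n))) \<le> ennreal e" .
        have "?H (- F \<inter> X) \<le> ?H (Y n \<union> (\<Union>k. R (k + n)))" by (rule hausdorff_outer_mono[OF cover])
        also have "\<dots> \<le> ?H (Y n) + ?H (\<Union>k. R (k + n))" by (rule hausdorff_outer_Un_le)
        also have "\<dots> \<le> ?H (Y n) + ennreal e"
          by (intro add_mono order_refl order_trans[OF hausdorff_outer_UN_le t])
        finally have "?H (F \<inter> X) + ?H (- F \<inter> X) \<le> ?H (F \<inter> X) + (?H (Y n) + ennreal e)"
          by (intro add_mono order_refl)
        also have "\<dots> \<le> ?H X + ennreal e"
          unfolding add.assoc[symmetric] by (intro add_mono split order_refl)
        finally show "?H (F \<inter> X) + ?H (- F \<inter> X) \<le> ?H X + ennreal e" .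
      qed
    qed
  qed
  then show ?thesis by (auto simp: lambda_system_def Compl_eq_Diff_UNIV)
qed

text \<open>\<open>measure_of\<close> takes over the given set function only if it is countably
  additive on the \<sigma>-algebra. Caratheodory's theorem supplies this: closed sets, hence Borel
  sets, lie in the lambda system.\<close>

lemma emeasure_hausdorff_measure:
  fixes A :: "'a::metric_space set"
  assumes "A \<in> sets borel"
  shows "emeasure (hausdorff_measure s) A = hausdorff_outer s A"
proof -
  let ?L = "lambda_system (UNIV :: 'a set) UNIV (hausdorff_outer s)"
  interpret P: sigma_algebra "UNIV :: 'a set" "UNIV :: 'a set set"
    using sigma_algebra_Pow[of "UNIV :: 'a set"] by simp
  have ms: "measure_space UNIV ?L (hausdorff_outer s)"
    by (rule P.caratheodory_lemma[OF hausdorff_outer_space])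
  then interpret L: sigma_algebra UNIV ?L by (simp add: measure_space_def)
  have sub: "sets borel \<subseteq> ?L"
    using L.sigma_sets_subset[of "Collect closed"] closed_in_lambda_system by (auto simp: borel_eq_closed)
  have "measure_space UNIV (sets (borel :: 'a measure)) (hausdorff_outer s)"
    by (rule measure_down[OF ms _ sub]) (metis sets.sigma_algebra_axioms space_borel)
  then have pc: "positive (sets (borel :: 'a measure)) (hausdorff_outer s)" "countably_additive (sets (borel :: 'a measure)) (hausdorff_outer s)"
    by (auto simp: measure_space_def)
  have eq: "hausdorff_measure s = measure_of UNIV (sets (borel :: 'a measure)) (hausdorff_outer s)"
    unfolding hausdorff_measure_def hausdorff_outer_def[abs_def] ..
  have sets: "sets (hausdorff_measure s :: 'a measure) = sets borel"
    unfolding hausdorff_measure_def by (metis sets.sets_measure_of_eq space_borel)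
  show ?thesis
    by (rule emeasure_measure_of[OF eq]) (use pc assms sets in auto)
qed

lemma sets_hausdorff_measure [simp]: "sets (hausdorff_measure s :: 'a::metric_space measure) = sets borel"
  and space_hausdorff_measure [simp]: "space (hausdorff_measure s :: 'a::metric_space measure) = UNIV"
  unfolding hausdorff_measure_def by (metis sets.sets_measure_of_eq space_borel, simp)

subsection \<open>Almost everywhere differentiability of convex functions\<close>

lemma integral_lborel_translate:
  fixes f :: "'a::euclidean_space \<Rightarrow> real"
  assumes "f \<in> borel_measurable borel"
  shows "(\<integral>x. f (t + x) \<partial>lborel) = (\<integral>x. f x \<partial>lborel)"
proof -
  have "(\<integral>x. f x \<partial>lborel) = (\<integral>x. f x \<partial>distr lborel borel ((+) t))" by (simp add: lborel_distr_plus)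
  also have "\<dots> = (\<integral>x. f (t + x) \<partial>lborel)" using assms by (intro integral_distr) auto
  finally show ?thesis by simp
qed

lemma integrable_lborel_translate:
  fixes f :: "'a::euclidean_space \<Rightarrow> real"
  assumes "integrable lborel f"
  shows "integrable lborel (\<lambda>x. f (t + x))"
proof -
  have "integrable (distr lborel borel ((+) t)) f" using assms by (simp add: lborel_distr_plus)
  then show ?thesis by (subst (asm) integrable_distr_eq) (use assms in auto)
qed

text \<open>Convexity makes the difference quotients monotone in \<open>t\<close>, so both one-sided
  derivatives exist everywhere along sequences of steps, \<open>B x\<close> from the left and
  \<open>A x\<close> from the right, with \<open>B x \<le> A x\<close>. A backward quotient at a
  shifted point is a forward quotient, so translation invariance moves the difference of the two
  onto a Lipschitz weight, where it is of the order of the step; hence \<open>A - B\<close>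
  integrates to 0 against the weight.\<close>

lemma AE_convex_partial:
  fixes p :: "'a::euclidean_space \<Rightarrow> real"
  assumes conv: "convex_on UNIV p" and L: "\<And>x y. \<bar>p x - p y\<bar> \<le> L * norm (x - y)" and i: "i \<in> Basis"
  shows "\<exists>D\<in>borel_measurable borel. (\<forall>x. \<bar>D x\<bar> \<le> L) \<and>
    (AE x in lborel. ((\<lambda>t. p (x + t *\<^sub>R i)) has_real_derivative D x) (at 0))"
proof -
  define s where "s x t = (p (x + t *\<^sub>R i) - p x) / t" for x t
  have L0: "L \<ge> 0"
  proof -
    have "0 \<le> L * norm (i - 0)" using L[of i 0] by (rule order_trans[OF abs_ge_zero])
    then show ?thesis using i by simp
  qed
  have sL: "\<bar>s x t\<bar> \<le> L" for x t
  proof (cases "t = 0")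
    case False
    then show ?thesis using L[of "x + t *\<^sub>R i" x] i by (simp add: s_def abs_divide divide_le_eq mult.commute)
  qed (simp add: s_def L0)
  have cv: "p ((1 - u) *\<^sub>R x + u *\<^sub>R y) \<le> (1 - u) * p x + u * p y" if "0 \<le> u" "u \<le> 1" for u x y
    using convex_onD[OF conv that] by simp
  have mono: "s x t \<le> s x u" if "0 < t" "t \<le> u" for x t u
  proof -
    have "(1 - t / u) *\<^sub>R x + (t / u) *\<^sub>R (x + u *\<^sub>R i) = x + t *\<^sub>R i"
      using that by (simp add: algebra_simps)
    then have "p (x + t *\<^sub>R i) \<le> (1 - t / u) * p x + (t / u) * p (x + u *\<^sub>R i)"
      using cv[of "t / u" x "x + u *\<^sub>R i"] that by simp
    then have "p (x + t *\<^sub>R i) - p x \<le> t * ((p (x + u *\<^sub>R i) - p x) / u)"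
      using that by (simp add: field_simps)
    then show ?thesis using that by (simp add: s_def divide_le_eq mult.commute)
  qed
  have mono': "s x (- u) \<le> s x (- t)" if "0 < t" "t \<le> u" for x t u
  proof -
    have "(1 - t / u) *\<^sub>R x + (t / u) *\<^sub>R (x + (- u) *\<^sub>R i) = x + (- t) *\<^sub>R i"
      using that by (simp add: algebra_simps)
    then have "p (x + (- t) *\<^sub>R i) \<le> (1 - t / u) * p x + (t / u) * p (x + (- u) *\<^sub>R i)"
      using cv[of "t / u" x "x + (- u) *\<^sub>R i"] that by simp
    then have "p (x + (- t) *\<^sub>R i) - p x \<le> t * ((p (x + (- u) *\<^sub>R i) - p x) / u)"
      using that by (simp add: field_simps)
    then show ?thesis using that by (simp add: s_def field_simps)
  qed
  have cross: "s x (- t) \<le> s x u" if "0 < t" "0 < u" for x t u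
  proof -
    have "(1 - t / (t + u)) *\<^sub>R (x + (- t) *\<^sub>R i) + (t / (t + u)) *\<^sub>R (x + u *\<^sub>R i) = x + (t / (t + u) * u - (1 - t / (t + u)) * t) *\<^sub>R i"
      by (simp add: algebra_simps)
    also have "t / (t + u) * u - (1 - t / (t + u)) * t = 0" using that by (simp add: field_simps)
    finally have "p x \<le> (1 - t / (t + u)) * p (x + (- t) *\<^sub>R i) + (t / (t + u)) * p (x + u *\<^sub>R i)"
      using cv[of "t / (t + u)" "x + (- t) *\<^sub>R i" "x + u *\<^sub>R i"] that by simp
    also have "1 - t / (t + u) = u / (t + u)" using that by (simp add: field_simps)
    finally have "p x \<le> (u * p (x + (- t) *\<^sub>R i) + t * p (x + u *\<^sub>R i)) / (t + u)"
      by (simp add: add_divide_distrib)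
    then have "(t + u) * p x \<le> u * p (x + (- t) *\<^sub>R i) + t * p (x + u *\<^sub>R i)"
      using that by (subst (asm) pos_le_divide_eq) (auto simp: mult.commute)
    then have "u * (p x - p (x + (- t) *\<^sub>R i)) \<le> t * (p (x + u *\<^sub>R i) - p x)" by (simp add: algebra_simps)
    then show ?thesis using that by (simp add: s_def field_simps)
  qed
  define u where "u n = 1 / (real n + 1)" for n
  have u: "u n > 0" "u (Suc n) \<le> u n" "u n \<le> 1" for n by (auto simp: u_def field_simps)
  have u0: "u \<longlonglongrightarrow> 0" unfolding u_def[abs_def] by real_asymp
  define a where "a n x = s x (u n)" for n x
  define b where "b n x = s x (- u n)" for n x
  have ab: "b m x \<le> a n x" for m n x using cross u(1) by (simp add: a_def b_def)
  have "decseq (\<lambda>n. a n x)" for x using mono u by (auto simp: decseq_Suc_iff a_def)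
  then have acv: "(\<lambda>n. a n x) \<longlonglongrightarrow> (INF n. a n x)" for x
    using ab[of 0 x] by (intro LIMSEQ_decseq_INF) (auto intro!: bdd_belowI)
  have "incseq (\<lambda>n. b n x)" for x using mono' u by (auto simp: incseq_Suc_iff b_def)
  then have bcv: "(\<lambda>n. b n x) \<longlonglongrightarrow> (SUP n. b n x)" for x
    using ab[of _ x 0] by (intro LIMSEQ_incseq_SUP) (auto intro!: bdd_aboveI)
  define A where "A x = lim (\<lambda>n. a n x)" for x
  define B where "B x = lim (\<lambda>n. b n x)" for x
  have alim: "(\<lambda>n. a n x) \<longlonglongrightarrow> A x" and blim: "(\<lambda>n. b n x) \<longlonglongrightarrow> B x" for x
    unfolding A_def B_def using acv[of x] bcv[of x] by (auto simp: convergent_LIMSEQ_iff[symmetric] convergent_def)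
  have "continuous_on UNIV p"
  proof (rule continuous_at_imp_continuous_on, rule ballI)
    fix x
    have "((\<lambda>y. p y - p x) \<longlongrightarrow> 0) (at x)"
    proof (rule Lim_null_comparison)
      show "\<forall>\<^sub>F y in at x. norm (p y - p x) \<le> L * norm (y - x)" using L by simp
      have "((\<lambda>y. L * norm (y - x)) \<longlongrightarrow> L * norm (x - x)) (at x)" by (intro tendsto_intros)
      then show "((\<lambda>y. L * norm (y - x)) \<longlongrightarrow> 0) (at x)" by simp
    qed
    then show "isCont p x" unfolding continuous_at by (rule LIM_zero_cancel)
  qed
  then have pm[measurable]: "p \<in> borel_measurable borel" by (rule borel_measurable_continuous_onI)
  have [measurable]: "a n \<in> borel_measurable borel" "b n \<in> borel_measurable borel" for n
    unfolding a_def b_def s_def by measurable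
  have Am[measurable]: "A \<in> borel_measurable borel" and Bm[measurable]: "B \<in> borel_measurable borel"
    unfolding A_def B_def by measurable
  have AL: "\<bar>A x\<bar> \<le> L" for x
    using sL by (intro LIMSEQ_le_const2[OF tendsto_rabs[OF alim]]) (auto simp: a_def)
  have BA: "B x \<le> A x" for x
    using ab by (intro LIMSEQ_le[OF blim alim]) auto
  \<comment> \<open>The tent \<open>max 0 (N - norm x)\<close> makes the integrals finite and
    changes by at most \<open>u n\<close> under a shift by \<open>u n\<close>.\<close>
  have zero: "AE x in lborel. (A x - B x) * max 0 (real N - norm x) = 0" for N
  proof -
    let ?\<phi> = "\<lambda>x::'a. max 0 (real N - norm x)"
    have \<phi>int: "integrable lborel ?\<phi>"
    proof (rule Bochner_Integration.integrable_bound)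
      show "integrable lborel (\<lambda>x::'a. real N * indicator (cball 0 (real N)) x)"
        by (auto intro!: integrable_real_indicator emeasure_lborel_cball_finite simp: less_top[symmetric])
    qed (auto simp: indicator_def)
    have i1: "integrable lborel (\<lambda>x. f x * ?\<phi> x)" if "f \<in> borel_measurable borel" "\<And>x. \<bar>f x\<bar> \<le> K" for f :: "'a \<Rightarrow> real" and K
    proof (rule Bochner_Integration.integrable_bound[of _ "\<lambda>x. K * ?\<phi> x"])
      show "integrable lborel (\<lambda>x. K * ?\<phi> x)" using \<phi>int by simp
      show "AE x in lborel. norm (f x * ?\<phi> x) \<le> norm (K * ?\<phi> x)"
        by (intro AE_I2) (auto simp: abs_mult intro!: mult_right_mono order_trans[OF that(2) abs_ge_self])
    qed (use that in auto)
    have lim: "(\<lambda>n. \<integral>x. (a n x - b n x) * ?\<phi> x \<partial>lborel) \<longlonglongrightarrow> (\<integral>x. (A x - B x) * ?\<phi> x \<partial>lborel)"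
    proof (rule integral_dominated_convergence)
      show "integrable lborel (\<lambda>x. 2 * L * ?\<phi> x)" using \<phi>int by simp
      show "AE x in lborel. (\<lambda>n. (a n x - b n x) * ?\<phi> x) \<longlonglongrightarrow> (A x - B x) * ?\<phi> x"
        by (intro AE_I2 tendsto_intros alim blim)
      show "AE x in lborel. norm ((a n x - b n x) * ?\<phi> x) \<le> 2 * L * ?\<phi> x" for n
      proof (intro AE_I2)
        fix x
        have "\<bar>a n x - b n x\<bar> \<le> 2 * L" using sL[of x "u n"] sL[of x "- u n"] by (simp add: a_def b_def)
        then show "norm ((a n x - b n x) * ?\<phi> x) \<le> 2 * L * ?\<phi> x" by (auto simp: abs_mult intro!: mult_right_mono)
      qed
    qed auto
    have bound: "(\<integral>x. (a n x - b n x) * ?\<phi> x \<partial>lborel) \<le> u n * (L * measure lborel (cball (0::'a) (real N + 1)))" for n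
    proof -
      let ?t = "u n *\<^sub>R i"
      have bt: "b n (?t + x) = a n x" for x
        using u(1)[of n] by (simp add: a_def b_def s_def field_simps)
      have ia: "integrable lborel (\<lambda>x. a n x * ?\<phi> x)" and ib: "integrable lborel (\<lambda>x. b n x * ?\<phi> x)"
        by (rule i1[of "a n" L], simp, simp add: a_def sL, rule i1[of "b n" L], simp, simp add: b_def sL)
      have ib': "integrable lborel (\<lambda>x. a n x * ?\<phi> (?t + x))"
        using integrable_lborel_translate[OF ib, of ?t] by (simp add: bt)
      have "(\<integral>x. b n x * ?\<phi> x \<partial>lborel) = (\<integral>x. a n x * ?\<phi> (?t + x) \<partial>lborel)"
        using integral_lborel_translate[of "\<lambda>x. b n x * ?\<phi> x" ?t] by (simp add: bt)
      then have "(\<integral>x. (a n x - b n x) * ?\<phi> x \<partial>lborel) = (\<integral>x. a n x * ?\<phi> x - a n x * ?\<phi> (?t + x) \<partial>lborel)"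
        using ia ib ib' by (simp add: left_diff_distrib)
      also have "\<dots> \<le> (\<integral>x. (L * u n) * indicator (cball 0 (real N + 1)) (x::'a) \<partial>lborel)"
      proof (rule Bochner_Integration.integral_mono)
        show "integrable lborel (\<lambda>x. a n x * ?\<phi> x - a n x * ?\<phi> (?t + x))" using ia ib' by simp
        show "integrable lborel (\<lambda>x::'a. (L * u n) * indicator (cball 0 (real N + 1)) x)"
          by (auto intro!: integrable_real_indicator emeasure_lborel_cball_finite simp: less_top[symmetric])
        fix x
        have nt: "norm ?t \<le> u n" using i u(1)[of n] by simp
        show "a n x * ?\<phi> x - a n x * ?\<phi> (?t + x) \<le> (L * u n) * indicator (cball 0 (real N + 1)) x"
        proof (cases "norm x \<le> real N + 1")
          case True
          have "\<bar>norm x - norm (?t + x)\<bar> \<le> u n" using nt norm_triangle_ineq3[of x "?t + x"] by simp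
          then have "\<bar>?\<phi> x - ?\<phi> (?t + x)\<bar> \<le> u n" by (auto simp: abs_le_iff max_def)
          moreover have "\<bar>a n x\<bar> \<le> L" using sL by (simp add: a_def)
          ultimately have "\<bar>a n x * (?\<phi> x - ?\<phi> (?t + x))\<bar> \<le> L * u n" unfolding abs_mult using L0 by (intro mult_mono) auto
          then show ?thesis using True by (simp add: right_diff_distrib)
        next
          case False
          have "norm x \<le> norm (?t + x) + norm ?t" using norm_triangle_ineq4[of "?t + x" ?t] by simp
          with False nt u(3)[of n] have "?\<phi> x = 0" "?\<phi> (?t + x) = 0" by auto
          then show ?thesis using False by simp
        qed
      qed
      also have "\<dots> = u n * (L * measure lborel (cball (0::'a) (real N + 1)))" by simp
      finally show ?thesis .
    qed
    have "(\<lambda>n. u n * (L * measure lborel (cball (0::'a) (real N + 1)))) \<longlonglongrightarrow> 0 * (L * measure lborel (cball (0::'a) (real N + 1)))"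
      by (intro tendsto_intros u0)
    then have "(\<integral>x. (A x - B x) * ?\<phi> x \<partial>lborel) \<le> 0"
      using bound by (intro LIMSEQ_le[OF lim]) auto
    moreover have nn: "0 \<le> (A x - B x) * ?\<phi> x" for x using BA[of x] by simp
    moreover have "(\<integral>x. (A x - B x) * ?\<phi> x \<partial>lborel) \<ge> 0" using nn by (intro integral_nonneg_AE AE_I2)
    ultimately have eq0: "(\<integral>x. (A x - B x) * ?\<phi> x \<partial>lborel) = 0" by linarith
    have BL: "\<bar>B x\<bar> \<le> L" for x
      using sL by (intro LIMSEQ_le_const2[OF tendsto_rabs[OF blim]]) (auto simp: b_def)
    have "\<bar>A x - B x\<bar> \<le> 2 * L" for x using AL[of x] BL[of x] by linarith
    then have "integrable lborel (\<lambda>x. (A x - B x) * ?\<phi> x)" by (intro i1[of _ "2 * L"]) auto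
    from integral_nonneg_eq_0_iff_AE[OF this] nn eq0 show ?thesis by simp
  qed
  have "AE x in lborel. \<forall>N. (A x - B x) * max 0 (real N - norm x) = 0"
    unfolding AE_all_countable using zero by blast
  then have "AE x in lborel. ((\<lambda>t. p (x + t *\<^sub>R i)) has_real_derivative A x) (at 0)"
  proof eventually_elim
    case (elim x)
    obtain N :: nat where "norm x < real N" using reals_Archimedean2 by blast
    with elim have eq: "B x = A x" using elim[rule_format, of N] by simp
    have "((\<lambda>t. s x t) \<longlongrightarrow> A x) (at 0)"
    proof (rule LIM_I)
      fix e :: real assume e: "e > 0"
      have "\<forall>\<^sub>F n in sequentially. a n x < A x + e \<and> b n x > A x - e"
        using order_tendstoD(2)[OF alim[of x], of "A x + e"] order_tendstoD(1)[OF blim[of x], of "A x - e"] e eq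
        by (auto intro: eventually_conj)
      then obtain n where n: "a n x < A x + e" "b n x > A x - e" by (auto simp: eventually_sequentially)
      show "\<exists>d>0. \<forall>t. t \<noteq> 0 \<and> norm (t - 0) < d \<longrightarrow> norm (s x t - A x) < e"
      proof (intro exI[of _ "u n"] conjI allI impI u(1))
        fix t :: real assume t: "t \<noteq> 0 \<and> norm (t - 0) < u n"
        \<comment> \<open>Monotonicity traps every quotient with a shorter step between the two
          quotients of step \<open>u n\<close>.\<close>
        have "b n x \<le> s x t \<and> s x t \<le> a n x"
        proof (cases "t > 0")
          case True
          then show ?thesis using t mono[of t "u n" x] cross[of "u n" t x] u(1)[of n] by (simp add: a_def b_def)
        next
          case False
          then show ?thesis using t mono'[of "- t" "u n" x] cross[of "- t" "u n" x] u(1)[of n] by (simp add: a_def b_def)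
        qed
        with n show "norm (s x t - A x) < e" by (simp add: abs_less_iff)
      qed
    qed
    then show ?case by (simp add: has_field_derivative_iff s_def)
  qed
  with AL Am show ?thesis by blast
qed

subsection \<open>The Minkowski functional and outer normals\<close>

context convex_domain
begin

definition mink_set :: "'a \<Rightarrow> real set" where
  "mink_set v = {t. t > 0 \<and> c + (1 / t) *\<^sub>R v \<in> \<Omega>}"

definition mink :: "'a \<Rightarrow> real" where
  "mink v = Inf (mink_set v)"

lemma c_in: "c \<in> \<Omega>"
  using ball r by auto

lemma segment_in:
  assumes "c + v \<in> \<Omega>" "0 \<le> s" "s \<le> 1"
  shows "c + s *\<^sub>R v \<in> \<Omega>"
proof -
  have "(1 - s) *\<^sub>R c + s *\<^sub>R (c + v) \<in> \<Omega>"
    using \<Omega>(3) c_in assms by (auto simp: convex_alt)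
  then show ?thesis by (simp add: algebra_simps)
qed

lemma mink_set_up: "t \<in> mink_set v \<Longrightarrow> t \<le> t' \<Longrightarrow> t' \<in> mink_set v"
  using segment_in[of "(1 / t) *\<^sub>R v" "t / t'"] by (auto simp: mink_set_def)

lemma mink_set_norm: "t > 0 \<Longrightarrow> norm v < r * t \<Longrightarrow> t \<in> mink_set v"
  using ball by (auto simp: mink_set_def subset_eq dist_norm divide_less_eq)

lemma mink_set_ne: "mink_set v \<noteq> {}"
proof -
  have "norm v / r + 1 \<in> mink_set v" using r by (intro mink_set_norm) (auto simp: distrib_left add_nonneg_pos)
  then show ?thesis by blast
qed

lemma mink_set_bdd: "bdd_below (mink_set v)"
  by (rule bdd_belowI[of _ 0]) (auto simp: mink_set_def)

lemma mink_nonneg: "mink v \<ge> 0"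
  unfolding mink_def by (rule cInf_greatest[OF mink_set_ne]) (auto simp: mink_set_def)

lemma mink_le: "t \<in> mink_set v \<Longrightarrow> mink v \<le> t"
  unfolding mink_def by (rule cInf_lower[OF _ mink_set_bdd])

lemma mink_less: "mink v < t \<Longrightarrow> t \<in> mink_set v"
proof -
  assume "mink v < t"
  then obtain s where "s \<in> mink_set v" "s < t" unfolding mink_def using cInf_lessD[OF mink_set_ne] by blast
  then show ?thesis by (auto intro: mink_set_up[of s])
qed

lemma mink_norm: "mink v \<le> norm v / r"
proof (rule field_le_epsilon)
  fix e :: real assume e: "e > 0"
  have "norm v / r \<ge> 0" using r by simp
  then show "mink v \<le> norm v / r + e"
    using r e by (intro mink_le mink_set_norm) (auto simp: distrib_left add_nonneg_pos)
qed

lemma mink_0 [simp]: "mink 0 = 0"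
  using mink_norm[of 0] mink_nonneg[of 0] by simp

lemma mink_add: "mink (v + w) \<le> mink v + mink w"
proof (rule field_le_epsilon)
  fix e :: real assume e: "e > 0"
  define t where "t = mink v + e / 2"
  define u where "u = mink w + e / 2"
  have tu: "t \<in> mink_set v" "u \<in> mink_set w" using e by (auto intro!: mink_less simp: t_def u_def)
  then have pos: "t > 0" "u > 0" by (auto simp: mink_set_def)
  \<comment> \<open>The weights \<open>t / (t + u)\<close> and \<open>u / (t + u)\<close> cancel the
    scales \<open>1 / t\<close> and \<open>1 / u\<close> and leave the sum at scale
    \<open>t + u\<close>.\<close>
  have "(1 - u / (t + u)) *\<^sub>R (c + (1 / t) *\<^sub>R v) + (u / (t + u)) *\<^sub>R (c + (1 / u) *\<^sub>R w) \<in> \<Omega>"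
    using tu \<Omega>(3) pos by (auto simp: convex_alt mink_set_def)
  also have "1 - u / (t + u) = t / (t + u)" using pos by (simp add: field_simps)
  also have "(t / (t + u)) *\<^sub>R (c + (1 / t) *\<^sub>R v) + (u / (t + u)) *\<^sub>R (c + (1 / u) *\<^sub>R w)
     = (t / (t + u) + u / (t + u)) *\<^sub>R c + (1 / (t + u)) *\<^sub>R (v + w)"
    using pos by (simp add: algebra_simps)
  also have "t / (t + u) + u / (t + u) = 1" using pos by (simp add: add_divide_distrib[symmetric])
  finally have "t + u \<in> mink_set (v + w)" using pos by (simp add: mink_set_def)
  from mink_le[OF this] show "mink (v + w) \<le> mink v + mink w + e" by (simp add: t_def u_def)
qed

lemma mink_scale_le: "s > 0 \<Longrightarrow> mink (s *\<^sub>R v) \<le> s * mink v"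
proof (rule field_le_epsilon)
  fix e :: real assume e: "e > 0" and s: "s > 0"
  have t: "mink v + e / s \<in> mink_set v" using e s by (intro mink_less) simp
  then have "s * (mink v + e / s) \<in> mink_set (s *\<^sub>R v)" using s by (auto simp: mink_set_def)
  from mink_le[OF this] show "mink (s *\<^sub>R v) \<le> s * mink v + e" using s by (simp add: distrib_left)
qed

lemma mink_scale: "s \<ge> 0 \<Longrightarrow> mink (s *\<^sub>R v) = s * mink v"
proof (cases "s = 0")
  case False
  assume "s \<ge> 0"
  with False have s: "s > 0" by simp
  have "mink ((1 / s) *\<^sub>R (s *\<^sub>R v)) \<le> (1 / s) * mink (s *\<^sub>R v)" using s by (intro mink_scale_le) simp
  then have "s * mink v \<le> mink (s *\<^sub>R v)" using s by (simp add: field_simps)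
  with mink_scale_le[OF s, of v] show ?thesis by simp
qed simp

text \<open>Openness is what makes the inequality strict: from a point of \<Omega> one can move a
  little further out along the ray.\<close>

lemma mink_lt_1_iff: "mink v < 1 \<longleftrightarrow> c + v \<in> \<Omega>"
proof
  assume "mink v < 1"
  then show "c + v \<in> \<Omega>" using mink_less[of v 1] by (simp add: mink_set_def)
next
  assume "c + v \<in> \<Omega>"
  then obtain e where e: "e > 0" "ball (c + v) e \<subseteq> \<Omega>" using \<Omega>(1) openE by blast
  define k where "k = e / 2"
  \<comment> \<open>The denominator \<open>norm v + 1\<close> avoids a case distinction at
    \<open>v = 0\<close>; the dilated point moves by less than \<open>e\<close>.\<close>
  define s where "s = 1 + k / (norm v + 1)"
  have np: "norm v + 1 > 0" by (simp add: add_nonneg_pos)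
  then have np': "norm v + 1 \<noteq> 0" by simp
  have s: "s > 1" using e np by (simp add: s_def k_def)
  have "(s - 1) * norm v \<le> (s - 1) * (norm v + 1)" using s by (intro mult_left_mono) auto
  also have "\<dots> = k" using np' by (simp add: s_def)
  also have "\<dots> < e" using e by (simp add: k_def)
  finally have "(s - 1) * norm v < e" .
  moreover have "c + v - (c + s *\<^sub>R v) = (1 - s) *\<^sub>R v" by (simp add: algebra_simps)
  ultimately have "c + s *\<^sub>R v \<in> ball (c + v) e" using s by (simp add: dist_norm)
  then have "1 / s \<in> mink_set v" using e s by (auto simp: mink_set_def)
  from mink_le[OF this] s show "mink v < 1" by (simp add: le_less_trans)
qed

lemma mink_lipschitz: "\<bar>mink v - mink w\<bar> \<le> (1 / r) * norm (v - w)"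
proof -
  have "mink v - mink w \<le> norm (v - w) / r" for v w
    using mink_add[of w "v - w"] mink_norm[of "v - w"] by simp
  from this[of v w] this[of w v] show ?thesis by (simp add: norm_minus_commute)
qed

text \<open>Boundedness of \<Omega> enters here: a scale \<open>t\<close> in
  \<open>mink_set v\<close> cannot be smaller than \<open>norm v\<close> divided by a bound for the
  distances from \<open>c\<close>.\<close>

lemma mink_pos: "v \<noteq> 0 \<Longrightarrow> mink v > 0"
proof -
  assume v: "v \<noteq> 0"
  have "bounded ((\<lambda>x. - c + x) ` \<Omega>)" using \<Omega>(2) by (rule bounded_translation)
  then obtain D where D: "D > 0" "\<And>x. x \<in> \<Omega> \<Longrightarrow> norm (- c + x) \<le> D" by (auto simp: bounded_pos)
  have "norm v / D \<le> t" if "t \<in> mink_set v" for t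
  proof -
    have t: "c + (1 / t) *\<^sub>R v \<in> \<Omega>" "t > 0" using that by (auto simp: mink_set_def)
    have "norm v / t \<le> D" using D(2)[OF t(1)] t(2) by simp
    then show ?thesis using D(1) t(2) by (simp add: field_simps)
  qed
  then have "norm v / D \<le> mink v" unfolding mink_def by (intro cInf_greatest mink_set_ne)
  moreover have "norm v / D > 0" using v D(1) by simp
  ultimately show ?thesis by linarith
qed

lemma mink_continuous: "continuous_on A (\<lambda>x. mink (x - c))"
proof (rule continuous_at_imp_continuous_on, rule ballI)
  fix x
  have "((\<lambda>y. mink (y - c) - mink (x - c)) \<longlongrightarrow> 0) (at x)"
  proof (rule Lim_null_comparison)
    show "\<forall>\<^sub>F y in at x. norm (mink (y - c) - mink (x - c)) \<le> (1 / r) * norm (y - x)"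
      using mink_lipschitz[of "y - c" "x - c" for y] by simp
    have "((\<lambda>y. (1 / r) * norm (y - x)) \<longlongrightarrow> (1 / r) * norm (x - x)) (at x)" by (intro tendsto_intros)
    then show "((\<lambda>y. (1 / r) * norm (y - x)) \<longlongrightarrow> 0) (at x)" by simp
  qed
  then show "isCont (\<lambda>x. mink (x - c)) x" unfolding continuous_at by (rule LIM_zero_cancel)
qed

lemma mink_measurable [measurable]: "(\<lambda>x. mink (x - c)) \<in> borel_measurable borel"
  using mink_continuous by (rule borel_measurable_continuous_onI)

lemma mink_convex: "convex_on UNIV (\<lambda>x. mink (x - c))"
proof (rule convex_onI)
  fix t :: real and x y :: 'a assume t: "0 < t" "t < 1"
  have "(1 - t) *\<^sub>R x + t *\<^sub>R y - c = (1 - t) *\<^sub>R (x - c) + t *\<^sub>R (y - c)" by (simp add: algebra_simps)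
  then show "mink ((1 - t) *\<^sub>R x + t *\<^sub>R y - c) \<le> (1 - t) * mink (x - c) + t * mink (y - c)"
    using mink_add[of "(1 - t) *\<^sub>R (x - c)" "t *\<^sub>R (y - c)"] t by (simp add: mink_scale)
qed simp

definition radial :: "'a \<Rightarrow> 'a" where
  "radial x = c + (1 / mink (x - c)) *\<^sub>R (x - c)"

lemma radial_frontier:
  assumes "x \<noteq> c"
  shows "radial x \<in> frontier \<Omega>"
proof -
  define v where "v = (1 / mink (x - c)) *\<^sub>R (x - c)"
  have "mink (x - c) > 0" using mink_pos assms by simp
  then have v1: "mink v = 1" by (simp add: v_def mink_scale)
  have "c + v \<notin> \<Omega>" using v1 by (simp add: mink_lt_1_iff[symmetric])
  moreover have "c + v \<in> closure \<Omega>"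
  proof -
    have "(\<lambda>n. c + (1 - 1 / (real n + 1)) *\<^sub>R v) \<longlonglongrightarrow> c + (1 - 0) *\<^sub>R v"
      by (intro tendsto_intros) real_asymp
    moreover have "c + (1 - 1 / (real n + 1)) *\<^sub>R v \<in> \<Omega>" for n
      unfolding mink_lt_1_iff[symmetric] by (subst mink_scale) (auto simp: v1 field_simps)
    ultimately show ?thesis unfolding closure_sequential by (intro exI[of _ "\<lambda>n. c + (1 - 1 / (real n + 1)) *\<^sub>R v"]) simp
  qed
  ultimately show ?thesis using \<Omega>(1) by (simp add: frontier_def interior_open radial_def v_def)
qed

text \<open>The supporting hyperplane at a boundary point shows that the choice in
  \<open>outer_normal\<close> is made from a nonempty set.\<close>

lemma outer_normal:
  assumes "y \<in> frontier \<Omega>"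
  shows "norm (outer_normal \<Omega> y) = 1" "\<And>x. x \<in> \<Omega> \<Longrightarrow> outer_normal \<Omega> y \<bullet> (x - y) \<le> 0"
proof -
  have "\<exists>n. norm n = 1 \<and> (\<forall>x\<in>\<Omega>. n \<bullet> (x - y) \<le> 0)"
  proof -
    have y: "y \<notin> \<Omega>" using assms \<Omega>(1) by (simp add: frontier_def interior_open)
    obtain a b where ab: "a \<noteq> 0" "a \<bullet> y \<le> b" "\<And>x. x \<in> \<Omega> \<Longrightarrow> b \<le> a \<bullet> x"
      using separating_hyperplane_sets[of "{y}" \<Omega>] y \<Omega>(3) c_in by auto
    show ?thesis
    proof (intro exI[of _ "(- 1 / norm a) *\<^sub>R a"] conjI ballI)
      show "norm ((- 1 / norm a) *\<^sub>R a) = 1" using ab(1) by simp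
      fix x assume "x \<in> \<Omega>"
      then have "a \<bullet> (x - y) \<ge> 0" using ab(2) ab(3)[of x] by (simp add: inner_diff_right)
      then show "((- 1 / norm a) *\<^sub>R a) \<bullet> (x - y) \<le> 0" by (simp add: mult_nonneg_nonneg divide_nonneg_nonneg)
    qed
  qed
  then have "norm (outer_normal \<Omega> y) = 1 \<and> (\<forall>x\<in>\<Omega>. outer_normal \<Omega> y \<bullet> (x - y) \<le> 0)"
    unfolding outer_normal_def by (rule someI_ex)
  then show "norm (outer_normal \<Omega> y) = 1" "\<And>x. x \<in> \<Omega> \<Longrightarrow> outer_normal \<Omega> y \<bullet> (x - y) \<le> 0" by auto
qed

text \<open>Wherever the Minkowski functional has partial derivatives, they are proportional to the
  chosen outer normal at the radial projection; this makes the choice of normals irrelevant.\<close>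

lemma mink_partial_normal:
  assumes x: "x \<noteq> c"
  shows "\<exists>\<mu>\<ge>r. \<forall>i D. ((\<lambda>t. mink (x + t *\<^sub>R i - c)) has_real_derivative D) (at 0)
           \<longrightarrow> D = (outer_normal \<Omega> (radial x) \<bullet> i) / \<mu>"
proof -
  define n where "n = outer_normal \<Omega> (radial x)"
  \<comment> \<open>The distance from \<open>c\<close> to the supporting hyperplane at the
    projection; it is at least \<open>r\<close> because the inscribed ball lies on the inner
    side.\<close>
  define \<mu> where "\<mu> = n \<bullet> (radial x - c)"
  note N = outer_normal[OF radial_frontier[OF x], folded n_def]
  have mp: "mink (x - c) > 0" using mink_pos x by simp
  have \<mu>r: "\<mu> \<ge> r"
  proof (rule field_le_mult_one_interval)
    fix s :: real assume s: "0 < s" "s < 1"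
    have "c + (s * r) *\<^sub>R n \<in> \<Omega>" using s r N(1) by (intro subsetD[OF ball]) (simp add: dist_norm)
    from N(2)[OF this] have "n \<bullet> (c + (s * r) *\<^sub>R n - radial x) \<le> 0" .
    moreover have "n \<bullet> n = 1" using N(1) by (simp add: norm_eq_1)
    ultimately show "s * r \<le> \<mu>" by (simp add: \<mu>_def inner_diff_right inner_add_right)
  qed
  then have \<mu>p: "\<mu> > 0" using r by simp
  have le: "n \<bullet> v \<le> \<mu> * mink v" for v
  proof -
    have "(n \<bullet> v) / \<mu> \<le> t" if t: "t \<in> mink_set v" for t
    proof -
      have "n \<bullet> (c + (1 / t) *\<^sub>R v - radial x) \<le> 0" "t > 0" using t N(2) by (auto simp: mink_set_def)
      then have "n \<bullet> ((1 / t) *\<^sub>R v) \<le> \<mu>" "t > 0" unfolding \<mu>_def by (auto simp: inner_diff_right inner_add_right)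
      then show ?thesis using \<mu>p by (simp add: field_simps)
    qed
    then have "(n \<bullet> v) / \<mu> \<le> mink v" unfolding mink_def by (intro cInf_greatest mink_set_ne)
    then show ?thesis using \<mu>p by (simp add: field_simps)
  qed
  have eq: "n \<bullet> (x - c) = \<mu> * mink (x - c)"
    using mp by (simp add: \<mu>_def radial_def)
  have "D = (n \<bullet> i) / \<mu>" if D: "((\<lambda>t. mink (x + t *\<^sub>R i - c)) has_real_derivative D) (at 0)" for i D
  proof -
    define k where "k = (n \<bullet> i) / \<mu>"
    \<comment> \<open>By \<open>le\<close> and \<open>eq\<close>, the linear function
      \<open>(n \<bullet> v) / \<mu>\<close> of \<open>v\<close> lies below the Minkowski functional
      and touches it at \<open>v = x - c\<close>. Up to a constant \<open>f\<close> is the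
      difference of the two along the line, so it has a minimum at 0 and its derivative vanishes
      there.\<close>
    define f where "f t = mink (x + t *\<^sub>R i - c) - t * k" for t
    have "(f has_real_derivative D - k) (at 0)"
      unfolding f_def[abs_def] by (auto intro!: derivative_eq_intros D)
    moreover have "f 0 \<le> f t" for t
    proof -
      have "n \<bullet> (x - c) + t * (n \<bullet> i) \<le> \<mu> * mink (x + t *\<^sub>R i - c)"
        using le[of "x + t *\<^sub>R i - c"] by (simp add: inner_diff_right inner_add_right)
      then show ?thesis unfolding eq f_def k_def using \<mu>p by (simp add: field_simps)
    qed
    ultimately have "D - k = 0"
      by (intro DERIV_local_min[of f _ 0 1]) auto
    then show ?thesis by (simp add: k_def)
  qed
  with \<mu>r show ?thesis unfolding n_def by blast
qed

end

subsection \<open>Boundary layers\<close>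

context convex_domain
begin

definition layer :: "real \<Rightarrow> 'a set" where
  "layer \<epsilon> = {x. 1 - \<epsilon> < mink (x - c) \<and> mink (x - c) < 1}"

lemma layer_sets [measurable]: "layer \<epsilon> \<in> sets borel"
  unfolding layer_def by measurable

lemma in_\<Omega>_iff: "x \<in> \<Omega> \<longleftrightarrow> mink (x - c) < 1"
  using mink_lt_1_iff[of "x - c"] by simp

lemma layer_sub: "layer \<epsilon> \<subseteq> \<Omega>"
  by (auto simp: layer_def in_\<Omega>_iff)

lemma layer_ne_c: "x \<in> layer \<epsilon> \<Longrightarrow> \<epsilon> \<le> 1 / 2 \<Longrightarrow> x \<noteq> c"
  by (auto simp: layer_def)

lemma domain_radius: obtains D where "D > 0" "\<And>x. x \<in> closure \<Omega> \<Longrightarrow> norm (x - c) \<le> D"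
proof -
  have "bounded ((\<lambda>x. - c + x) ` closure \<Omega>)" using \<Omega>(2) by (intro bounded_translation bounded_closure)
  then obtain D where "D > 0" "\<And>x. x \<in> closure \<Omega> \<Longrightarrow> norm (- c + x) \<le> D" by (auto simp: bounded_pos)
  then show thesis by (intro that[of D]) auto
qed

lemma radial_measurable [measurable]: "radial \<in> borel_measurable borel"
  unfolding radial_def by measurable

lemma radial_eq: "x \<noteq> c \<Longrightarrow> x = c + mink (x - c) *\<^sub>R (radial x - c)"
  using mink_pos[of "x - c"] by (simp add: radial_def)

text \<open>The part of the layer over a set of diameter at most \<open>\<rho>\<close> is a tube of length proportional to
  \<open>\<epsilon>\<close>; it is covered by about \<open>\<epsilon> / \<rho>\<close> balls of radius proportional to \<open>\<rho>\<close>.\<close>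

lemma layer_tube_cover:
  obtains K where "K > 0"
    "\<And>C \<rho> \<epsilon>. bounded C \<Longrightarrow> diameter C \<le> \<rho> \<Longrightarrow> 0 < \<rho> \<Longrightarrow> \<rho> \<le> \<epsilon> \<Longrightarrow> \<epsilon> \<le> 1 / 2 \<Longrightarrow>
       \<exists>U\<in>sets borel. {x \<in> layer \<epsilon>. radial x \<in> C} \<subseteq> U \<and> emeasure lborel U \<le> ennreal (K * \<epsilon> * \<rho> ^ (DIM('a) - 1))"
proof -
  obtain D where D: "D > 0" "\<And>x. x \<in> closure \<Omega> \<Longrightarrow> norm (x - c) \<le> D" by (rule domain_radius, rule that)
  define V where "V = unit_ball_vol (real DIM('a))"
  have V: "V > 0" by (simp add: V_def)
  \<comment> \<open>At most \<open>\<epsilon> / \<rho> + 1 \<le> 2 * \<epsilon> / \<rho>\<close>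
    balls occur, each of volume \<open>V * ((1 + D) * \<rho>) ^ DIM('a)\<close>.\<close>
  define K where "K = 2 * V * (1 + D) ^ DIM('a)"
  show thesis
  proof (rule that[of K])
    show "K > 0" using V D(1) by (simp add: K_def)
    fix C :: "'a set" and \<rho> \<epsilon> :: real
    assume C: "bounded C" "diameter C \<le> \<rho>" and \<rho>: "0 < \<rho>" "\<rho> \<le> \<epsilon>" and \<epsilon>: "\<epsilon> \<le> 1 / 2"
    let ?L = "{x \<in> layer \<epsilon>. radial x \<in> C}"
    show "\<exists>U\<in>sets borel. ?L \<subseteq> U \<and> emeasure lborel U \<le> ennreal (K * \<epsilon> * \<rho> ^ (DIM('a) - 1))"
    proof (cases "?L = {}")
      case True
      then show ?thesis by (intro bexI[of _ "{}"]) auto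
    next
      case False
      then obtain x0 where x0: "x0 \<in> layer \<epsilon>" "radial x0 \<in> C" by blast
      define a where "a = radial x0"
      have "a \<in> frontier \<Omega>" unfolding a_def using x0 \<epsilon> by (intro radial_frontier layer_ne_c)
      then have aD: "norm (a - c) \<le> D" by (intro D(2)) (auto simp: frontier_def)
      define N where "N = nat \<lfloor>\<epsilon> / \<rho>\<rfloor>"
      \<comment> \<open>Centres at spacing \<rho> on the ray through the boundary point
        \<open>a\<close>. The radius \<open>(1 + D) * \<rho>\<close> allows \<rho> for the variation
        of the projection within \<open>C\<close> and \<open>D * \<rho>\<close> for the position
        along the ray.\<close>
      define z where "z j = c + (1 - \<epsilon> + real j * \<rho>) *\<^sub>R (a - c)" for j :: nat
      define U where "U = (\<Union>j\<in>{..N}. cball (z j) ((1 + D) * \<rho>))"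
      have "?L \<subseteq> U"
      proof
        fix x assume x: "x \<in> ?L"
        define s where "s = mink (x - c)"
        have s: "1 - \<epsilon> < s" "s < 1" using x by (auto simp: layer_def s_def)
        define j where "j = nat \<lfloor>(s - (1 - \<epsilon>)) / \<rho>\<rfloor>"
        have q0: "(s - (1 - \<epsilon>)) / \<rho> \<ge> 0" using s \<rho> by simp
        have "real j = of_int \<lfloor>(s - (1 - \<epsilon>)) / \<rho>\<rfloor>" using q0 by (simp add: j_def)
        then have "real j \<le> (s - (1 - \<epsilon>)) / \<rho>" "(s - (1 - \<epsilon>)) / \<rho> < real j + 1" by linarith+
        then have j: "real j * \<rho> \<le> s - (1 - \<epsilon>)" "s - (1 - \<epsilon>) < real j * \<rho> + \<rho>"
          using \<rho> by (simp_all add: field_simps)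
        have "(s - (1 - \<epsilon>)) / \<rho> \<le> \<epsilon> / \<rho>" using s \<rho> by (intro divide_right_mono) auto
        then have jN: "j \<le> N" unfolding j_def N_def by (intro nat_mono floor_mono)
        have "radial x \<in> C" "a \<in> C" using x x0 by (auto simp: a_def)
        then have "dist (radial x) a \<le> \<rho>" using diameter_bounded_bound[OF C(1)] C(2) by fastforce
        then have d: "norm (radial x - a) \<le> \<rho>" by (simp add: dist_norm)
        have "x = c + s *\<^sub>R (radial x - c)" unfolding s_def using x \<epsilon> by (intro radial_eq layer_ne_c) auto
        then have "x - z j = s *\<^sub>R (radial x - a) + (s - (1 - \<epsilon> + real j * \<rho>)) *\<^sub>R (a - c)"
          by (simp add: z_def algebra_simps)
        then have "norm (x - z j) \<le> \<bar>s\<bar> * norm (radial x - a) + \<bar>s - (1 - \<epsilon> + real j * \<rho>)\<bar> * norm (a - c)"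
          by (metis norm_triangle_ineq norm_scaleR)
        also have "\<dots> \<le> 1 * \<rho> + \<rho> * D"
          using s \<epsilon> j \<rho> d aD by (intro add_mono mult_mono) auto
        finally have "x \<in> cball (z j) ((1 + D) * \<rho>)" by (simp add: dist_norm norm_minus_commute algebra_simps)
        then show "x \<in> U" unfolding U_def using jN by blast
      qed
      moreover have "U \<in> sets borel" unfolding U_def by (intro sets.finite_UN) auto
      moreover have "emeasure lborel U \<le> ennreal (K * \<epsilon> * \<rho> ^ (DIM('a) - 1))"
      proof -
        have "emeasure lborel U \<le> (\<Sum>j\<in>{..N}. emeasure lborel (cball (z j) ((1 + D) * \<rho>)))"
          unfolding U_def by (rule emeasure_subadditive_finite) auto
        also have "\<dots> = (\<Sum>j\<in>{..N}. ennreal (V * ((1 + D) * \<rho>) ^ DIM('a)))"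
          using D(1) \<rho> by (intro sum.cong refl) (simp add: emeasure_cball V_def)
        also have "\<dots> = ennreal (real (N + 1) * (V * ((1 + D) * \<rho>) ^ DIM('a)))"
          using V D(1) \<rho> by (simp add: ennreal_mult'[symmetric] ennreal_of_nat_eq_real_of_nat algebra_simps)
        also have "\<dots> \<le> ennreal ((2 * \<epsilon> / \<rho>) * (V * ((1 + D) * \<rho>) ^ DIM('a)))"
        proof (intro ennreal_leI mult_right_mono)
          have "1 \<le> \<epsilon> / \<rho>" "real N \<le> \<epsilon> / \<rho>" using \<rho> by (auto simp: N_def)
          then show "real (N + 1) \<le> 2 * \<epsilon> / \<rho>" by simp
        qed (use V D(1) \<rho> in auto)
        also have "(2 * \<epsilon> / \<rho>) * (V * ((1 + D) * \<rho>) ^ DIM('a)) = K * \<epsilon> * \<rho> ^ (DIM('a) - 1)"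
        proof -
          have "\<rho> ^ DIM('a) = \<rho> * \<rho> ^ (DIM('a) - 1)" by (metis DIM_positive power_eq_if less_numeral_extra(3))
          then show ?thesis using \<rho> by (simp add: K_def power_mult_distrib)
        qed
        finally show ?thesis .
      qed
      ultimately show ?thesis by blast
    qed
  qed
qed

text \<open>Each set of a cover at scale \<open>\<epsilon> / 2\<close> is replaced by the tube above
  it. The tube estimate wants a positive \<rho>, which a set of diameter 0 does not offer, so \<rho>
  is taken slightly above the diameter at the price of an arbitrarily small
  \<open>e\<close>.\<close>

lemma layer_hausdorff_bound:
  obtains K where "K > 0"
    "\<And>A \<epsilon>. A \<in> sets borel \<Longrightarrow> 0 < \<epsilon> \<Longrightarrow> \<epsilon> \<le> 1 / 2 \<Longrightarrow>
       emeasure lborel {x \<in> layer \<epsilon>. radial x \<in> A} \<le> ennreal (K * \<epsilon>) * hausdorff_outer (DIM('a) - 1) A"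
proof -
  obtain K where K: "K > 0" "\<And>C \<rho> \<epsilon>. bounded C \<Longrightarrow> diameter C \<le> \<rho> \<Longrightarrow> 0 < \<rho> \<Longrightarrow> \<rho> \<le> \<epsilon> \<Longrightarrow> \<epsilon> \<le> 1 / 2 \<Longrightarrow>
       \<exists>U\<in>sets borel. {x \<in> layer \<epsilon>. radial x \<in> C} \<subseteq> U \<and> emeasure lborel U \<le> ennreal (K * \<epsilon> * \<rho> ^ (DIM('a) - 1))"
    by (rule layer_tube_cover, rule that)
  let ?s = "DIM('a) - 1"
  define w where "w = unit_ball_vol (real ?s)"
  have w: "w > 0" by (simp add: w_def)
  define K' where "K' = K * 2 ^ ?s / w"
  have K': "K' > 0" using K w by (simp add: K'_def)
  show thesis
  proof (rule that[OF K'])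
    fix A :: "'a set" and \<epsilon> :: real assume A: "A \<in> sets borel" and \<epsilon>: "0 < \<epsilon>" "\<epsilon> \<le> 1 / 2"
    have single: "\<exists>U\<in>sets borel. {x \<in> layer \<epsilon>. radial x \<in> C} \<subseteq> U \<and> emeasure lborel U \<le> ennreal (K' * \<epsilon>) * hausdorff_weight ?s C + ennreal e"
      if C: "bounded C" "diameter C \<le> \<epsilon> / 2" and e: "e > 0" for C :: "'a set" and e
    proof (cases "C = {}")
      case True
      then show ?thesis by (intro bexI[of _ "{}"]) auto
    next
      case False
      have dC: "diameter C \<ge> 0" by (rule diameter_ge_0[OF C(1)])
      have "((\<lambda>\<rho>. K * \<epsilon> * \<rho> ^ ?s) \<longlongrightarrow> K * \<epsilon> * diameter C ^ ?s) (at_right (diameter C))"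
        by (intro tendsto_intros)
      then have "\<forall>\<^sub>F \<rho> in at_right (diameter C). K * \<epsilon> * \<rho> ^ ?s < K * \<epsilon> * diameter C ^ ?s + e"
        using e by (intro order_tendstoD(2)) auto
      moreover have "\<forall>\<^sub>F \<rho> in at_right (diameter C). \<rho> < \<epsilon>"
        using C(2) \<epsilon> by (intro eventually_at_right_less[THEN eventually_mono] eventually_at_rightI[of _ \<epsilon>]) auto
      moreover have "\<forall>\<^sub>F \<rho> in at_right (diameter C). \<rho> > diameter C" by (rule eventually_at_right_less)
      ultimately have "\<forall>\<^sub>F \<rho> in at_right (diameter C). K * \<epsilon> * \<rho> ^ ?s < K * \<epsilon> * diameter C ^ ?s + e \<and> \<rho> < \<epsilon> \<and> \<rho> > diameter C"
        by eventually_elim auto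
      from eventually_happens'[OF _ this] obtain \<rho> where \<rho>: "K * \<epsilon> * \<rho> ^ ?s < K * \<epsilon> * diameter C ^ ?s + e" "\<rho> < \<epsilon>" "\<rho> > diameter C"
        by (auto simp: trivial_limit_at_right_real)
      obtain U where U: "U \<in> sets borel" "{x \<in> layer \<epsilon>. radial x \<in> C} \<subseteq> U" "emeasure lborel U \<le> ennreal (K * \<epsilon> * \<rho> ^ ?s)"
        using K(2)[of C \<rho> \<epsilon>] C \<rho> dC \<epsilon> by auto
      note U(3)
      also have "ennreal (K * \<epsilon> * \<rho> ^ ?s) \<le> ennreal (K * \<epsilon> * diameter C ^ ?s + e)" using \<rho> by (intro ennreal_leI) auto
      also have "\<dots> = ennreal (K * \<epsilon> * diameter C ^ ?s) + ennreal e"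
        using K(1) \<epsilon> dC e by (intro ennreal_plus) auto
      also have "K * \<epsilon> * diameter C ^ ?s = (K' * \<epsilon>) * (w * (diameter C / 2) ^ ?s)"
        using w by (simp add: K'_def power_divide)
      also have "ennreal \<dots> = ennreal (K' * \<epsilon>) * hausdorff_weight ?s C"
        using K' \<epsilon> w dC False by (subst ennreal_mult) (auto simp: hausdorff_weight_def w_def)
      finally show ?thesis using U by blast
    qed
    have "emeasure lborel {x \<in> layer \<epsilon>. radial x \<in> A} \<le> ennreal (K' * \<epsilon>) * hausdorff_pre ?s (\<epsilon> / 2) A"
    proof -
      \<comment> \<open>Multiplying by the reciprocal constant brings the claim into the form of a
        lower bound for the infimum over covers.\<close>
      define kk where "kk = ennreal (K' * \<epsilon>)"
      define k1 where "k1 = ennreal (1 / (K' * \<epsilon>))"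
      have k1: "k1 * (kk * t) = t" "kk * (k1 * t) = t" for t
        using K' \<epsilon> unfolding kk_def k1_def mult.assoc[symmetric] by (simp_all add: ennreal_mult[symmetric])
      let ?m = "emeasure lborel {x \<in> layer \<epsilon>. radial x \<in> A}"
      have "k1 * ?m \<le> hausdorff_pre ?s (\<epsilon> / 2) A"
      proof (rule hausdorff_pre_greatest)
        fix C :: "nat \<Rightarrow> 'a set"
        assume C: "A \<subseteq> (\<Union>i. C i)" "\<And>i::nat. bounded (C i) \<and> diameter (C i) \<le> \<epsilon> / 2"
      have "emeasure lborel {x \<in> layer \<epsilon>. radial x \<in> A} \<le> kk * (\<Sum>i. hausdorff_weight ?s (C i))"
      proof (rule ennreal_le_epsilon)
        fix e :: real assume e: "e > 0"
        have "\<forall>i. \<exists>U\<in>sets borel. {x \<in> layer \<epsilon>. radial x \<in> C i} \<subseteq> U \<and> emeasure lborel U \<le> kk * hausdorff_weight ?s (C i) + ennreal (e * (1 / 2) ^ Suc i)"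
          unfolding kk_def using C(2) e by (intro allI single) auto
        then obtain U where U: "\<And>i. U i \<in> sets borel" "\<And>i. {x \<in> layer \<epsilon>. radial x \<in> C i} \<subseteq> U i"
          "\<And>i. emeasure lborel (U i) \<le> kk * hausdorff_weight ?s (C i) + ennreal (e * (1 / 2) ^ Suc i)"
          unfolding Bex_def by (drule_tac choice) blast
        have "emeasure lborel {x \<in> layer \<epsilon>. radial x \<in> A} \<le> emeasure lborel (\<Union>i. U i)"
        proof (rule emeasure_mono)
          show "{x \<in> layer \<epsilon>. radial x \<in> A} \<subseteq> (\<Union>i. U i)"
          proof
            fix x assume x: "x \<in> {x \<in> layer \<epsilon>. radial x \<in> A}"
            then obtain i where "radial x \<in> C i" using C(1) by blast
            with x have "x \<in> U i" by (intro subsetD[OF U(2)]) simp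
            then show "x \<in> (\<Union>i. U i)" by (rule UN_I[OF UNIV_I])
          qed
        qed (use U(1) in simp)
        also have "\<dots> \<le> (\<Sum>i. emeasure lborel (U i))"
          using U(1) by (intro emeasure_subadditive_countably) auto
        also have "\<dots> \<le> (\<Sum>i. kk * hausdorff_weight ?s (C i) + ennreal (e * (1 / 2) ^ Suc i))"
          by (intro suminf_le U) auto
        also have "\<dots> = kk * (\<Sum>i. hausdorff_weight ?s (C i)) + (\<Sum>i. ennreal (e * (1 / 2) ^ Suc i))"
          by (subst suminf_add[symmetric]) auto
        also have "(\<Sum>i. ennreal (e * (1 / 2) ^ Suc i)) = ennreal e"
        proof -
          have "(\<lambda>i. e * (1 / 2) ^ Suc i) sums (e * 1)" by (intro sums_mult power_half_series)
          then show ?thesis using e by (intro suminf_ennreal_eq) auto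
        qed
        finally show "emeasure lborel {x \<in> layer \<epsilon>. radial x \<in> A} \<le> kk * (\<Sum>i. hausdorff_weight ?s (C i)) + ennreal e" .
      qed
      then have "k1 * ?m \<le> k1 * (kk * (\<Sum>i. hausdorff_weight ?s (C i)))" by (intro mult_left_mono) auto
      then show "k1 * ?m \<le> (\<Sum>i. hausdorff_weight ?s (C i))" unfolding k1 .
      qed
      then have "kk * (k1 * ?m) \<le> kk * hausdorff_pre ?s (\<epsilon> / 2) A" by (intro mult_left_mono) auto
      then show ?thesis unfolding k1(2) by (simp only: kk_def)
    qed
    also have "\<dots> \<le> ennreal (K' * \<epsilon>) * hausdorff_outer ?s A"
      using \<epsilon> by (intro mult_left_mono hausdorff_pre_le_outer) auto
    finally show "emeasure lborel {x \<in> layer \<epsilon>. radial x \<in> A} \<le> ennreal (K' * \<epsilon>) * hausdorff_outer ?s A" .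
  qed
qed

section \<open>Integrals over the layer\<close>

lemma frontier_sets: "frontier \<Omega> \<in> sets (hausdorff_measure s)"
  by (simp add: frontier_closed borel_closed)

lemma space_surface: "space (surface_measure \<Omega>) = frontier \<Omega>"
  by (simp add: surface_measure_def space_restrict_space)

text \<open>By \<open>layer_hausdorff_bound\<close>, the image of Lebesgue measure on the layer
  under \<open>radial\<close> is dominated by a multiple of the surface measure; the comparison of
  measures carries over to integrals.\<close>

lemma layer_surface_bound:
  obtains K where "K > 0"
    "\<And>\<psi> \<epsilon>. \<psi> \<in> borel_measurable (surface_measure \<Omega>) \<Longrightarrow> 0 < \<epsilon> \<Longrightarrow> \<epsilon> \<le> 1 / 2 \<Longrightarrow>
       (\<integral>\<^sup>+x. \<psi> (radial x) * indicator (layer \<epsilon>) x \<partial>lborel) \<le> ennreal (K * \<epsilon>) * (\<integral>\<^sup>+x. \<psi> x \<partial>surface_measure \<Omega>)"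
proof -
  obtain K where K: "K > 0" "\<And>A \<epsilon>. A \<in> sets borel \<Longrightarrow> 0 < \<epsilon> \<Longrightarrow> \<epsilon> \<le> 1 / 2 \<Longrightarrow>
       emeasure lborel {x \<in> layer \<epsilon>. radial x \<in> A} \<le> ennreal (K * \<epsilon>) * hausdorff_outer (DIM('a) - 1) A"
    by (rule layer_hausdorff_bound, rule that)
  show thesis
  proof (rule that[OF K(1)])
    fix \<psi> :: "'a \<Rightarrow> ennreal" and \<epsilon> :: real
    assume \<psi>: "\<psi> \<in> borel_measurable (surface_measure \<Omega>)" and \<epsilon>: "0 < \<epsilon>" "\<epsilon> \<le> 1 / 2"
    let ?R = "restrict_space lborel (layer \<epsilon>)" and ?S = "surface_measure \<Omega>"
    have lb: "layer \<epsilon> \<in> sets lborel" by simp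
    have rm: "radial \<in> measurable ?R ?S"
      unfolding surface_measure_def
    proof (rule measurable_restrict_space2)
      show "radial \<in> space ?R \<rightarrow> frontier \<Omega>"
        using radial_frontier layer_ne_c \<epsilon>(2) by (auto simp: space_restrict_space)
      show "radial \<in> measurable ?R (hausdorff_measure (DIM('a) - 1))"
        by (subst measurable_cong_sets[OF refl sets_hausdorff_measure]) (intro measurable_restrict_space1, simp)
    qed
    let ?D = "distr ?R ?S radial"
    have "emeasure ?D A \<le> emeasure (scale_measure (ennreal (K * \<epsilon>)) ?S) A" for A
      proof (cases "A \<in> sets ?S")
        case True
        then have A: "A \<in> sets borel" "A \<subseteq> frontier \<Omega>"
          using frontier_sets by (auto simp: surface_measure_def sets_restrict_space_iff)
        have "emeasure ?D A = emeasure ?R (radial -` A \<inter> space ?R)"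
          using True rm by (intro emeasure_distr) auto
        also have "\<dots> = emeasure lborel {x \<in> layer \<epsilon>. radial x \<in> A}"
          using lb by (subst emeasure_restrict_space) (auto simp: space_restrict_space intro!: arg_cong2[where f=emeasure])
        also have "\<dots> \<le> ennreal (K * \<epsilon>) * hausdorff_outer (DIM('a) - 1) A" by (rule K(2)[OF A(1) \<epsilon>])
        also have "hausdorff_outer (DIM('a) - 1) A = emeasure ?S A"
          unfolding surface_measure_def using frontier_sets A
          by (subst emeasure_restrict_space) (auto simp: emeasure_hausdorff_measure)
        finally show ?thesis by simp
      qed (simp add: emeasure_notin_sets)
    then have "?D \<le> scale_measure (ennreal (K * \<epsilon>)) ?S"
      unfolding le_measure_iff by (simp add: le_fun_def space_scale_measure)
    then have "nn_integral ?D \<psi> \<le> nn_integral (scale_measure (ennreal (K * \<epsilon>)) ?S) \<psi>"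
      by (intro nn_integral_mono_measure) auto
    also have "\<dots> = ennreal (K * \<epsilon>) * nn_integral ?S \<psi>" by (rule nn_integral_scale_measure[OF \<psi>])
    also have "nn_integral ?D \<psi> = (\<integral>\<^sup>+x. \<psi> (radial x) * indicator (layer \<epsilon>) x \<partial>lborel)"
      using lb \<psi> by (subst nn_integral_distr[OF rm], simp, subst nn_integral_restrict_space) auto
    finally show "(\<integral>\<^sup>+x. \<psi> (radial x) * indicator (layer \<epsilon>) x \<partial>lborel) \<le> ennreal (K * \<epsilon>) * (\<integral>\<^sup>+x. \<psi> x \<partial>surface_measure \<Omega>)" .
  qed
qed

text \<open>Substitute \<open>y = c + s (x - c)\<close> and let \<open>p\<close> be the Minkowski
  functional at \<open>y\<close>. Then \<open>x\<close> lies in the layer only for \<open>s\<close>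
  between \<open>p\<close> and \<open>p / (1 - \<epsilon>)\<close>, an interval of length at most
  \<open>2 * \<epsilon>\<close>. The Jacobian costs at most \<open>2 ^ DIM('a)\<close> because
  \<open>s \<ge> 1 / 2\<close>.\<close>

lemma layer_scaling:
  fixes G :: "'a \<Rightarrow> ennreal"
  assumes G[measurable]: "G \<in> borel_measurable borel" and \<epsilon>: "0 < \<epsilon>" "\<epsilon> \<le> 1 / 2"
  shows "(\<integral>\<^sup>+x. (\<integral>\<^sup>+s. G (c + s *\<^sub>R (x - c)) * indicator {1/2..1} s \<partial>lborel) * indicator (layer \<epsilon>) x \<partial>lborel)
     \<le> ennreal (2 ^ (DIM('a) + 1) * \<epsilon>) * (\<integral>\<^sup>+x. G x * indicator \<Omega> x \<partial>lborel)"
proof -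
  have "(\<integral>\<^sup>+x. (\<integral>\<^sup>+s. G (c + s *\<^sub>R (x - c)) * indicator {1/2..1} s \<partial>lborel) * indicator (layer \<epsilon>) x \<partial>lborel)
    = (\<integral>\<^sup>+x. (\<integral>\<^sup>+s. G (c + s *\<^sub>R (x - c)) * indicator {1/2..1} s * indicator (layer \<epsilon>) x \<partial>lborel) \<partial>lborel)"
    by (subst nn_integral_multc[symmetric]) auto
  also have "\<dots> = (\<integral>\<^sup>+s. (\<integral>\<^sup>+x. G (c + s *\<^sub>R (x - c)) * indicator {1/2..1} s * indicator (layer \<epsilon>) x \<partial>lborel) \<partial>lborel)"
    by (rule pair_sigma_finite.Fubini') (auto intro!: pair_sigma_finite.intro lborel.sigma_finite_measure_axioms)
  also have "\<dots> \<le> (\<integral>\<^sup>+s. (\<integral>\<^sup>+y. ennreal (2 ^ DIM('a)) * (G y * indicator \<Omega> y * indicator {mink (y - c)<..<mink (y - c) / (1 - \<epsilon>)} s) \<partial>lborel) \<partial>lborel)"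
  proof (rule nn_integral_mono)
    fix s :: real
    show "(\<integral>\<^sup>+x. G (c + s *\<^sub>R (x - c)) * indicator {1/2..1} s * indicator (layer \<epsilon>) x \<partial>lborel)
      \<le> (\<integral>\<^sup>+y. ennreal (2 ^ DIM('a)) * (G y * indicator \<Omega> y * indicator {mink (y - c)<..<mink (y - c) / (1 - \<epsilon>)} s) \<partial>lborel)"
    proof (cases "s \<in> {1/2..1}")
      case s: True
      let ?H = "\<lambda>y. G y * indicator \<Omega> y * indicator {mink (y - c)<..<mink (y - c) / (1 - \<epsilon>)} s"
      have Hm: "?H \<in> borel_measurable borel" unfolding greaterThanLessThan_iff indicator_def by measurable
      have "G (c + s *\<^sub>R (x - c)) * indicator {1/2..1} s * indicator (layer \<epsilon>) x \<le> ?H (c - s *\<^sub>R c + s *\<^sub>R x)" for x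
      proof (cases "x \<in> layer \<epsilon>")
        case True
        have eq: "c - s *\<^sub>R c + s *\<^sub>R x = c + s *\<^sub>R (x - c)" by (simp add: algebra_simps)
        have m: "mink (c + s *\<^sub>R (x - c) - c) = s * mink (x - c)" using s by (simp add: mink_scale)
        have l: "1 - \<epsilon> < mink (x - c)" "mink (x - c) < 1" using True by (auto simp: layer_def)
        have "s * mink (x - c) < s" using s l by simp
        moreover have "s * (1 - \<epsilon>) < s * mink (x - c)" using s l by (intro mult_strict_left_mono) auto
        then have "s < s * mink (x - c) / (1 - \<epsilon>)" using \<epsilon> by (simp add: less_divide_eq)
        moreover have "c + s *\<^sub>R (x - c) \<in> \<Omega>" unfolding in_\<Omega>_iff m
          by (rule less_le_trans[OF \<open>s * mink (x - c) < s\<close>]) (use s in auto)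
        ultimately show ?thesis using s True unfolding eq m by simp
      qed simp
      then have "(\<integral>\<^sup>+x. G (c + s *\<^sub>R (x - c)) * indicator {1/2..1} s * indicator (layer \<epsilon>) x \<partial>lborel) \<le> (\<integral>\<^sup>+x. ?H (c - s *\<^sub>R c + s *\<^sub>R x) \<partial>lborel)"
        by (intro nn_integral_mono)
      also have "\<dots> = ennreal (1 / \<bar>s\<bar> ^ DIM('a)) * (\<integral>\<^sup>+y. ?H y \<partial>lborel)"
        using s by (intro nn_integral_lborel_affine[OF Hm]) auto
      also have "\<dots> \<le> ennreal (2 ^ DIM('a)) * (\<integral>\<^sup>+y. ?H y \<partial>lborel)"
      proof (intro mult_right_mono ennreal_leI)
        have "(1 / s) ^ DIM('a) \<le> 2 ^ DIM('a)" using s by (intro power_mono) (auto simp: field_simps)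
        then show "1 / \<bar>s\<bar> ^ DIM('a) \<le> 2 ^ DIM('a)" using s by (simp add: power_one_over)
      qed simp
      also have "\<dots> = (\<integral>\<^sup>+y. ennreal (2 ^ DIM('a)) * ?H y \<partial>lborel)"
        by (rule nn_integral_cmult[symmetric]) (use Hm in simp)
      finally show ?thesis .
    qed simp
  qed
  also have "\<dots> = (\<integral>\<^sup>+y. (\<integral>\<^sup>+s. ennreal (2 ^ DIM('a)) * (G y * indicator \<Omega> y * indicator {mink (y - c)<..<mink (y - c) / (1 - \<epsilon>)} s) \<partial>lborel) \<partial>lborel)"
    unfolding greaterThanLessThan_iff indicator_def
    by (rule pair_sigma_finite.Fubini') (auto intro!: pair_sigma_finite.intro lborel.sigma_finite_measure_axioms)
  also have "\<dots> = (\<integral>\<^sup>+y. ennreal (2 ^ DIM('a)) * (G y * indicator \<Omega> y * emeasure lborel {mink (y - c)<..<mink (y - c) / (1 - \<epsilon>)}) \<partial>lborel)"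
    by (simp add: nn_integral_cmult)
  also have "\<dots> \<le> (\<integral>\<^sup>+y. ennreal (2 ^ (DIM('a) + 1) * \<epsilon>) * (G y * indicator \<Omega> y) \<partial>lborel)"
  proof (rule nn_integral_mono)
    fix y
    show "ennreal (2 ^ DIM('a)) * (G y * indicator \<Omega> y * emeasure lborel {mink (y - c)<..<mink (y - c) / (1 - \<epsilon>)})
      \<le> ennreal (2 ^ (DIM('a) + 1) * \<epsilon>) * (G y * indicator \<Omega> y)"
    proof (cases "y \<in> \<Omega>")
      case True
      define m where "m = mink (y - c)"
      have m: "0 \<le> m" "m < 1" using True mink_nonneg by (auto simp: in_\<Omega>_iff m_def)
      have "m * (1 - \<epsilon>) \<le> m * 1" using m \<epsilon> by (intro mult_left_mono) auto
      then have le: "m \<le> m / (1 - \<epsilon>)" using \<epsilon> by (simp add: le_divide_eq)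
      have "m \<le> (2 * \<epsilon> + m) * (1 - \<epsilon>)"
      proof -
        have "m * \<epsilon> \<le> 1 * \<epsilon>" using m \<epsilon> by (intro mult_right_mono) auto
        moreover have "\<epsilon> * \<epsilon> \<le> \<epsilon> * (1 / 2)" using \<epsilon> by (intro mult_left_mono) auto
        ultimately show ?thesis by (simp add: algebra_simps)
      qed
      then have "m / (1 - \<epsilon>) \<le> 2 * \<epsilon> + m" using \<epsilon> by (simp add: divide_le_eq)
      then have "emeasure lborel {m<..<m / (1 - \<epsilon>)} \<le> ennreal (2 * \<epsilon>)"
        using le by (auto intro!: ennreal_leI)
      then have "ennreal (2 ^ DIM('a)) * (G y * indicator \<Omega> y * emeasure lborel {m<..<m / (1 - \<epsilon>)})
         \<le> ennreal (2 ^ DIM('a)) * (G y * indicator \<Omega> y * ennreal (2 * \<epsilon>))" by (intro mult_left_mono) auto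
      also have "\<dots> = (ennreal (2 ^ DIM('a)) * ennreal (2 * \<epsilon>)) * (G y * indicator \<Omega> y)" by (simp add: ac_simps)
      also have "ennreal (2 ^ DIM('a)) * ennreal (2 * \<epsilon>) = ennreal (2 ^ (DIM('a) + 1) * \<epsilon>)"
        using \<epsilon> by (subst ennreal_mult[symmetric]) (auto simp: mult_ac)
      finally show ?thesis unfolding m_def .
    qed simp
  qed
  also have "\<dots> = ennreal (2 ^ (DIM('a) + 1) * \<epsilon>) * (\<integral>\<^sup>+x. G x * indicator \<Omega> x \<partial>lborel)"
    by (rule nn_integral_cmult) measurable
  finally show ?thesis .
qed

text \<open>The partial derivatives form a separate argument so that their limits in L2 can be
  followed. Everything is required on \<Omega> only, where the derivatives of smoothings are given
  by averages of weak derivatives.\<close>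

definition C1b :: "('a \<Rightarrow> real) \<Rightarrow> ('a \<Rightarrow> 'a \<Rightarrow> real) \<Rightarrow> bool" where
  "C1b u U \<longleftrightarrow> (\<forall>x\<in>\<Omega>. (u has_derivative (\<lambda>v. \<Sum>i\<in>Basis. (v \<bullet> i) * U i x)) (at x)) \<and>
     (\<forall>i\<in>Basis. continuous_on \<Omega> (U i)) \<and> (\<exists>B. \<forall>x\<in>\<Omega>. \<bar>u x\<bar> \<le> B \<and> (\<forall>i\<in>Basis. \<bar>U i x\<bar> \<le> B))"

lemma C1bD:
  assumes "C1b u U"
  shows "\<And>x. x \<in> \<Omega> \<Longrightarrow> (u has_derivative (\<lambda>v. \<Sum>i\<in>Basis. (v \<bullet> i) * U i x)) (at x)"
    "\<And>i. i \<in> Basis \<Longrightarrow> continuous_on \<Omega> (U i)"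
    "\<exists>B\<ge>0. \<forall>x\<in>\<Omega>. \<bar>u x\<bar> \<le> B \<and> (\<forall>i\<in>Basis. \<bar>U i x\<bar> \<le> B)"
    "continuous_on \<Omega> u"
proof -
  show d: "\<And>x. x \<in> \<Omega> \<Longrightarrow> (u has_derivative (\<lambda>v. \<Sum>i\<in>Basis. (v \<bullet> i) * U i x)) (at x)"
    and "\<And>i. i \<in> Basis \<Longrightarrow> continuous_on \<Omega> (U i)" using assms by (auto simp: C1b_def)
  obtain B where B: "\<And>x. x \<in> \<Omega> \<Longrightarrow> \<bar>u x\<bar> \<le> B \<and> (\<forall>i\<in>Basis. \<bar>U i x\<bar> \<le> B)" using assms unfolding C1b_def by metis
  have "B \<ge> 0" using B[OF c_in] by (meson abs_ge_zero order_trans)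
  with B show "\<exists>B\<ge>0. \<forall>x\<in>\<Omega>. \<bar>u x\<bar> \<le> B \<and> (\<forall>i\<in>Basis. \<bar>U i x\<bar> \<le> B)" by blast
  show "continuous_on \<Omega> u"
    using has_derivative_continuous[OF d] by (intro continuous_at_imp_continuous_on ballI)
qed

lemma AE_M: "(\<And>x. x \<in> \<Omega> \<Longrightarrow> P x) \<Longrightarrow> AE x in M. P x"
  by (intro AE_I2) (simp add: space_restrict_space)

lemma C1b_L2: "C1b u U \<Longrightarrow> u \<in> L2 \<Omega>" "C1b u U \<Longrightarrow> i \<in> Basis \<Longrightarrow> U i \<in> L2 \<Omega>"
proof -
  assume u: "C1b u U"
  then obtain B where B: "\<And>x. x \<in> \<Omega> \<Longrightarrow> \<bar>u x\<bar> \<le> B \<and> (\<forall>i\<in>Basis. \<bar>U i x\<bar> \<le> B)" using C1bD(3) by metis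
  show "u \<in> L2 \<Omega>"
    by (rule L2_bounded[OF continuous_measurable[OF C1bD(4)[OF u]] AE_M]) (use B in blast)
  show "U i \<in> L2 \<Omega>" if "i \<in> Basis"
    by (rule L2_bounded[OF continuous_measurable[OF C1bD(2)[OF u that]] AE_M]) (use B that in blast)
qed

text \<open>The fundamental theorem of calculus along the ray, averaged over the starting point
  \<open>s\<close> in \<open>[1/2, 1]\<close>; the length \<open>1 / 2\<close> of that interval
  causes the factor 2.\<close>

lemma C1b_radial_bound:
  assumes u: "C1b u U" and x: "x \<in> \<Omega>" and D: "norm (x - c) \<le> D"
  shows "ennreal \<bar>u x\<bar> \<le> (\<integral>\<^sup>+s. ennreal (indicator \<Omega> (c + s *\<^sub>R (x - c)) * (2 * \<bar>u (c + s *\<^sub>R (x - c))\<bar> + D * (\<Sum>i\<in>Basis. \<bar>U i (c + s *\<^sub>R (x - c))\<bar>))) * indicator {1/2..1} s \<partial>lborel)"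
proof -
  let ?g = "\<lambda>s. c + s *\<^sub>R (x - c)"
  define h where "h s = u (?g s)" for s
  define P where "P s = D * (\<Sum>i\<in>Basis. \<bar>U i (?g s)\<bar>)" for s
  have D0: "D \<ge> 0" using D norm_ge_zero order_trans by blast
  have in\<Omega>: "?g s \<in> \<Omega>" if "s \<in> {1/2..1}" for s
    using segment_in[of "x - c" s] x that by simp
  have gc: "continuous_on {1/2..1} ?g" by (intro continuous_intros)
  have uc: "continuous_on {1/2..1} (\<lambda>s. u (?g s))"
    by (rule continuous_on_compose2[OF C1bD(4)[OF u] gc]) (use in\<Omega> in auto)
  have Uc: "continuous_on {1/2..1} (\<lambda>s. U i (?g s))" if "i \<in> Basis" for i
    by (rule continuous_on_compose2[OF C1bD(2)[OF u that] gc]) (use in\<Omega> in auto)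
  have hc: "continuous_on {1/2..1} (\<lambda>s. \<bar>h s\<bar>)" unfolding h_def by (intro continuous_intros uc)
  have Pc: "continuous_on {1/2..1} P" unfolding P_def[abs_def] by (intro continuous_intros Uc)
  have P0: "P s \<ge> 0" for s using D0 by (simp add: P_def sum_nonneg)
  define J where "J = integral {1/2..1} P"
  have hs: "\<bar>h 1\<bar> - J \<le> \<bar>h s\<bar>" if s: "s \<in> {1/2..1}" for s
  proof -
    let ?h' = "\<lambda>t. \<Sum>i\<in>Basis. ((x - c) \<bullet> i) * U i (?g t)"
    have "(h has_vector_derivative ?h' t) (at t within {s..1})" if t: "t \<in> {s..1}" for t
    proof -
      have "(u has_derivative (\<lambda>v. \<Sum>i\<in>Basis. (v \<bullet> i) * U i (?g t))) (at (?g t))"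
        using C1bD(1)[OF u in\<Omega>] s t by auto
      moreover have "(?g has_derivative (\<lambda>q. q *\<^sub>R (x - c))) (at t within {s..1})" by (auto intro!: derivative_eq_intros)
      ultimately have "(h has_derivative (\<lambda>q. \<Sum>i\<in>Basis. ((q *\<^sub>R (x - c)) \<bullet> i) * U i (?g t))) (at t within {s..1})"
        unfolding h_def[abs_def] by (rule has_derivative_compose[rotated])
      then show ?thesis
        unfolding has_vector_derivative_def by (rule has_derivative_eq_rhs) (simp add: fun_eq_iff sum_distrib_left mult.assoc)
    qed
    then have I: "(?h' has_integral (h 1 - h s)) {s..1}"
      using s by (intro fundamental_theorem_of_calculus) auto
    have Pi: "P integrable_on {s..1}" using s by (intro integrable_continuous_interval continuous_on_subset[OF Pc]) auto
    have "norm (h 1 - h s) \<le> integral {s..1} P"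
      unfolding integral_unique[OF I, symmetric]
    proof (rule integral_norm_bound_integral)
      show "?h' integrable_on {s..1}" using I by blast
      show "P integrable_on {s..1}" by (rule Pi)
      fix t
      have "\<bar>\<Sum>i\<in>Basis. ((x - c) \<bullet> i) * U i (?g t)\<bar> \<le> (\<Sum>i\<in>Basis. D * \<bar>U i (?g t)\<bar>)"
        by (rule order_trans[OF sum_abs], rule sum_mono)
          (auto simp: abs_mult intro!: mult_right_mono order_trans[OF Basis_le_norm D])
      then show "norm (?h' t) \<le> P t" by (simp add: P_def sum_distrib_left)
    qed
    also have "\<dots> \<le> J" unfolding J_def using s Pi P0
      by (intro integral_subset_le Pi integrable_continuous_interval[OF Pc]) auto
    finally show ?thesis by (simp add: abs_le_iff) linarith
  qed
  have "integral {1/2..1::real} (\<lambda>s. \<bar>h 1\<bar> - J) \<le> integral {1/2..1} (\<lambda>s. \<bar>h s\<bar>)"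
    by (intro integral_le hs integrable_continuous_interval hc) auto
  then have le: "\<bar>h 1\<bar> \<le> 2 * integral {1/2..1} (\<lambda>s. \<bar>h s\<bar>) + J" by simp
  have wI: "((\<lambda>s. 2 * \<bar>h s\<bar> + P s) has_integral (2 * integral {1/2..1} (\<lambda>s. \<bar>h s\<bar>) + J)) {1/2..1}"
    unfolding J_def
    by (intro has_integral_add has_integral_mult_right integrable_integral integrable_continuous_interval hc Pc)
  have "(\<integral>\<^sup>+s. ennreal (indicator {1/2..1} s * (2 * \<bar>h s\<bar> + P s)) \<partial>lborel) = ennreal (2 * integral {1/2..1} (\<lambda>s. \<bar>h s\<bar>) + J)"
    using P0 by (intro nn_integral_has_integral_lebesgue[OF _ wI]) auto
  moreover have "(\<integral>\<^sup>+s. ennreal (indicator {1/2..1} s * (2 * \<bar>h s\<bar> + P s)) \<partial>lborel)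
     = (\<integral>\<^sup>+s. ennreal (indicator \<Omega> (?g s) * (2 * \<bar>u (?g s)\<bar> + D * (\<Sum>i\<in>Basis. \<bar>U i (?g s)\<bar>))) * indicator {1/2..1} s \<partial>lborel)"
    by (intro nn_integral_cong) (auto simp: h_def P_def indicator_def in\<Omega>[simplified])
  ultimately show ?thesis using ennreal_leI[OF le] by (simp add: h_def)
qed

lemma borel_indicator_continuous:
  fixes f :: "'a \<Rightarrow> real"
  shows "continuous_on \<Omega> f \<Longrightarrow> (\<lambda>x. indicator \<Omega> x * f x) \<in> borel_measurable borel"
  using borel_measurable_continuous_on_indicator[OF \<Omega>_sets, of f] by simp

lemma LINT_nonneg_bounded:
  assumes "f \<in> borel_measurable M" "\<And>x. x \<in> \<Omega> \<Longrightarrow> 0 \<le> f x" "\<And>x. x \<in> \<Omega> \<Longrightarrow> f x \<le> B"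
  shows "ennreal (LINT x|M. f x) = (\<integral>\<^sup>+x. ennreal (f x) \<partial>M)"
proof (rule nn_integral_eq_integral[symmetric])
  show "integrable M f"
    using assms by (intro integrable_const_bound[of _ B]) (auto intro!: AE_M)
qed (use assms in \<open>auto intro!: AE_M\<close>)

text \<open>Integrating the radial bound over the layer and applying \<open>layer_scaling\<close>
  gives the volume version of the L1 trace inequality, with a constant that is independent of
  \<epsilon>.\<close>

lemma layer_trace_C1b:
  obtains C where "C > 0"
    "\<And>u U \<epsilon>. C1b u U \<Longrightarrow> 0 < \<epsilon> \<Longrightarrow> \<epsilon> \<le> 1 / 2 \<Longrightarrow>
       (LINT x|M. indicator (layer \<epsilon>) x * \<bar>u x\<bar>) \<le> C * \<epsilon> * ((LINT x|M. \<bar>u x\<bar>) + (\<Sum>i\<in>Basis. LINT x|M. \<bar>U i x\<bar>))"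
proof -
  obtain D where D: "D > 0" "\<And>x. x \<in> closure \<Omega> \<Longrightarrow> norm (x - c) \<le> D" by (rule domain_radius, rule that)
  define C where "C = 2 ^ (DIM('a) + 1) * (2 + D)"
  show thesis
  proof (rule that[of C])
    show "C > 0" using D(1) by (simp add: C_def)
    fix u U and \<epsilon> :: real assume u: "C1b u U" and \<epsilon>: "0 < \<epsilon>" "\<epsilon> \<le> 1 / 2"
    define w where "w y = 2 * \<bar>u y\<bar> + D * (\<Sum>i\<in>Basis. \<bar>U i y\<bar>)" for y
    obtain B where B: "B \<ge> 0" "\<And>x. x \<in> \<Omega> \<Longrightarrow> \<bar>u x\<bar> \<le> B \<and> (\<forall>i\<in>Basis. \<bar>U i x\<bar> \<le> B)" using C1bD(3)[OF u] by blast
    have wc: "continuous_on \<Omega> w"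
      unfolding w_def[abs_def] by (intro continuous_intros C1bD(4)[OF u] C1bD(2)[OF u])
    have w0: "w y \<ge> 0" for y using D(1) by (simp add: w_def sum_nonneg)
    have wB: "w y \<le> 2 * B + D * (\<Sum>i\<in>(Basis::'a set). B)" if "y \<in> \<Omega>" for y
      unfolding w_def using B(2)[OF that] D(1) by (intro add_mono mult_left_mono sum_mono) auto
    let ?G = "\<lambda>y. ennreal (indicator \<Omega> y * w y)"
    have [measurable]: "?G \<in> borel_measurable borel"
      using borel_indicator_continuous[OF wc] by measurable
    have um: "u \<in> borel_measurable M" by (rule continuous_measurable[OF C1bD(4)[OF u]])
    have lm: "indicator (layer \<epsilon>) \<in> borel_measurable M"
      by (intro borel_measurable_indicator) (simp add: sets_restrict_space_iff layer_sub sets_completionI_sets)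
    have "ennreal (LINT x|M. indicator (layer \<epsilon>) x * \<bar>u x\<bar>) = (\<integral>\<^sup>+x. ennreal (indicator (layer \<epsilon>) x * \<bar>u x\<bar>) \<partial>M)"
    proof (rule LINT_nonneg_bounded[of _ B])
      show "(\<lambda>x. indicator (layer \<epsilon>) x * \<bar>u x\<bar>) \<in> borel_measurable M"
        by (intro borel_measurable_times lm borel_measurable_abs um)
    qed (use B in \<open>auto simp: indicator_def\<close>)
    also have "\<dots> \<le> (\<integral>\<^sup>+x. (\<integral>\<^sup>+s. ?G (c + s *\<^sub>R (x - c)) * indicator {1/2..1} s \<partial>lborel) * indicator (layer \<epsilon>) x \<partial>lborel)"
      unfolding nn_integral_lebesgue_on[OF \<Omega>_sets']
    proof (rule nn_integral_mono)
      fix x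
      show "ennreal (indicator (layer \<epsilon>) x * \<bar>u x\<bar>) * indicator \<Omega> x
         \<le> (\<integral>\<^sup>+s. ?G (c + s *\<^sub>R (x - c)) * indicator {1/2..1} s \<partial>lborel) * indicator (layer \<epsilon>) x"
      proof (cases "x \<in> layer \<epsilon>")
        case True
        then have x: "x \<in> \<Omega>" using layer_sub by blast
        have "norm (x - c) \<le> D" using x closure_subset by (intro D(2)) auto
        from C1b_radial_bound[OF u x this] True x show ?thesis by (simp add: w_def)
      qed simp
    qed
    also have "\<dots> \<le> ennreal (2 ^ (DIM('a) + 1) * \<epsilon>) * (\<integral>\<^sup>+x. ?G x * indicator \<Omega> x \<partial>lborel)"
      by (rule layer_scaling[OF _ \<epsilon>]) measurable
    also have "(\<integral>\<^sup>+x. ?G x * indicator \<Omega> x \<partial>lborel) = (\<integral>\<^sup>+x. ennreal (w x) \<partial>M)"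
      unfolding nn_integral_lebesgue_on[OF \<Omega>_sets'] by (intro nn_integral_cong) (auto simp: indicator_def)
    also have "\<dots> = ennreal (LINT x|M. w x)"
      using w0 wB by (intro LINT_nonneg_bounded[symmetric] continuous_measurable wc) auto
    also have "ennreal (2 ^ (DIM('a) + 1) * \<epsilon>) * ennreal (LINT x|M. w x) = ennreal (2 ^ (DIM('a) + 1) * \<epsilon> * (LINT x|M. w x))"
      using \<epsilon> w0 by (intro ennreal_mult[symmetric]) auto
    finally have "(LINT x|M. indicator (layer \<epsilon>) x * \<bar>u x\<bar>) \<le> 2 ^ (DIM('a) + 1) * \<epsilon> * (LINT x|M. w x)"
      using \<epsilon> w0 by (subst (asm) ennreal_le_iff) auto
    also have "(LINT x|M. w x) = 2 * (LINT x|M. \<bar>u x\<bar>) + D * (\<Sum>i\<in>Basis. LINT x|M. \<bar>U i x\<bar>)"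
    proof -
      have "integrable M u" "\<And>i. i \<in> Basis \<Longrightarrow> integrable M (U i)"
        using C1b_L2[OF u] L2_integrable by auto
      then show ?thesis unfolding w_def by simp
    qed
    also have "\<dots> \<le> (2 + D) * ((LINT x|M. \<bar>u x\<bar>) + (\<Sum>i\<in>Basis. LINT x|M. \<bar>U i x\<bar>))"
    proof -
      have "(LINT x|M. \<bar>u x\<bar>) \<ge> 0" "(\<Sum>i\<in>Basis. LINT x|M. \<bar>U i x\<bar>) \<ge> 0" by (auto intro!: sum_nonneg)
      then have "D * (LINT x|M. \<bar>u x\<bar>) \<ge> 0" "2 * (\<Sum>i\<in>Basis. LINT x|M. \<bar>U i x\<bar>) \<ge> 0" using D(1) by auto
      then show ?thesis by (simp add: distrib_left distrib_right)
    qed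
    finally show "(LINT x|M. indicator (layer \<epsilon>) x * \<bar>u x\<bar>) \<le> C * \<epsilon> * ((LINT x|M. \<bar>u x\<bar>) + (\<Sum>i\<in>Basis. LINT x|M. \<bar>U i x\<bar>))"
      using \<epsilon> by (simp add: C_def mult_ac)
  qed
qed

text \<open>The closure of \<open>C1b\<close> in the H1 norm, with the gradient as second component.
  Limits of products and of integrations by parts are simpler in this form than through test
  functions.\<close>

definition H1_approx :: "('a \<Rightarrow> real) \<Rightarrow> ('a \<Rightarrow> 'a \<Rightarrow> real) \<Rightarrow> bool" where
  "H1_approx u U \<longleftrightarrow> (\<exists>f F. (\<forall>k. C1b (f k) (F k)) \<and> L2_tendsto \<Omega> f u \<and> (\<forall>i\<in>Basis. L2_tendsto \<Omega> (\<lambda>k. F k i) (U i)))"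

lemma L2_tendsto_abs:
  assumes "L2_tendsto \<Omega> f g"
  shows "L2_tendsto \<Omega> (\<lambda>k x. \<bar>f k x\<bar>) (\<lambda>x. \<bar>g x\<bar>)"
proof (rule L2_tendsto_squeeze[OF _ _ _ L2_tendstoD(3)[OF assms]])
  note D = L2_tendstoD[OF assms]
  have abs: "(\<lambda>x. \<bar>u x\<bar>) \<in> L2 \<Omega>" if "u \<in> L2 \<Omega>" for u using that by (auto simp: L2_def)
  show "(\<lambda>x. \<bar>f k x\<bar>) \<in> L2 \<Omega>" for k by (rule abs[OF D(1)])
  show "(\<lambda>x. \<bar>g x\<bar>) \<in> L2 \<Omega>" by (rule abs[OF D(2)])
  show "\<forall>\<^sub>F k in sequentially. L2_norm \<Omega> (\<lambda>x. \<bar>f k x\<bar> - \<bar>g x\<bar>) \<le> L2_norm \<Omega> (\<lambda>x. f k x - g x)"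
    by (intro always_eventually allI L2_norm_mono L2_diff D AE_I2) auto
qed

lemma L2_tendsto_integral:
  assumes "L2_tendsto \<Omega> f g"
  shows "(\<lambda>k. LINT x|M. f k x) \<longlonglongrightarrow> (LINT x|M. g x)"
proof -
  have "L2_tendsto \<Omega> (\<lambda>k x. 1) (\<lambda>x. 1)" by (simp add: L2_tendsto_def L2_const L2_norm_def L2_inner_def)
  from L2_tendsto_inner[OF assms this] show ?thesis by (simp add: L2_inner_def)
qed

lemma layer_measurable_M: "indicator (layer \<epsilon>) \<in> borel_measurable M"
  by (intro borel_measurable_indicator) (simp add: sets_restrict_space_iff layer_sub sets_completionI_sets)

lemma layer_trace_H1:
  obtains C where "C > 0"
    "\<And>u U \<epsilon>. H1_approx u U \<Longrightarrow> 0 < \<epsilon> \<Longrightarrow> \<epsilon> \<le> 1 / 2 \<Longrightarrow>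
       (LINT x|M. indicator (layer \<epsilon>) x * \<bar>u x\<bar>) \<le> C * \<epsilon> * ((LINT x|M. \<bar>u x\<bar>) + (\<Sum>i\<in>Basis. LINT x|M. \<bar>U i x\<bar>))"
proof -
  obtain C where C: "C > 0" "\<And>u U \<epsilon>. C1b u U \<Longrightarrow> 0 < \<epsilon> \<Longrightarrow> \<epsilon> \<le> 1 / 2 \<Longrightarrow>
       (LINT x|M. indicator (layer \<epsilon>) x * \<bar>u x\<bar>) \<le> C * \<epsilon> * ((LINT x|M. \<bar>u x\<bar>) + (\<Sum>i\<in>Basis. LINT x|M. \<bar>U i x\<bar>))"
    by (rule layer_trace_C1b, rule that)
  show thesis
  proof (rule that[OF C(1)])
    fix u U \<epsilon> assume "H1_approx u U" and \<epsilon>: "0 < (\<epsilon>::real)" "\<epsilon> \<le> 1 / 2"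
    then obtain f F where f: "\<And>k. C1b (f k) (F k)" "L2_tendsto \<Omega> f u" "\<And>i. i \<in> Basis \<Longrightarrow> L2_tendsto \<Omega> (\<lambda>k. F k i) (U i)"
      by (auto simp: H1_approx_def)
    have "(\<lambda>k. LINT x|M. indicator (layer \<epsilon>) x * \<bar>f k x\<bar>) \<longlonglongrightarrow> (LINT x|M. indicator (layer \<epsilon>) x * \<bar>u x\<bar>)"
      by (intro L2_tendsto_integral L2_tendsto_bounded_mult[of _ _ _ _ 1] L2_tendsto_abs f layer_measurable_M) (auto simp: indicator_def)
    moreover have "(\<lambda>k. C * \<epsilon> * ((LINT x|M. \<bar>f k x\<bar>) + (\<Sum>i\<in>Basis. LINT x|M. \<bar>F k i x\<bar>))) \<longlonglongrightarrow>
        C * \<epsilon> * ((LINT x|M. \<bar>u x\<bar>) + (\<Sum>i\<in>Basis. LINT x|M. \<bar>U i x\<bar>))"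
      by (intro tendsto_intros L2_tendsto_integral L2_tendsto_abs f)
    ultimately show "(LINT x|M. indicator (layer \<epsilon>) x * \<bar>u x\<bar>) \<le> C * \<epsilon> * ((LINT x|M. \<bar>u x\<bar>) + (\<Sum>i\<in>Basis. LINT x|M. \<bar>U i x\<bar>))"
      by (rule LIMSEQ_le) (use C(2)[OF f(1) \<epsilon>] in blast)
  qed
qed

end

subsection \<open>Green's formula\<close>

context convex_domain
begin

definition dmink :: "'a \<Rightarrow> 'a \<Rightarrow> real" where
  "dmink i = (SOME D. D \<in> borel_measurable borel \<and> (\<forall>x. \<bar>D x\<bar> \<le> 1 / r) \<and>
     (AE x in lborel. ((\<lambda>t. mink (x + t *\<^sub>R i - c)) has_real_derivative D x) (at 0)))"

lemma dmink:
  assumes "i \<in> Basis"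
  shows "dmink i \<in> borel_measurable borel" "\<bar>dmink i x\<bar> \<le> 1 / r"
    "AE x in lborel. ((\<lambda>t. mink (x + t *\<^sub>R i - c)) has_real_derivative dmink i x) (at 0)"
proof -
  have "\<exists>D. D \<in> borel_measurable borel \<and> (\<forall>x. \<bar>D x\<bar> \<le> 1 / r) \<and>
     (AE x in lborel. ((\<lambda>t. mink (x + t *\<^sub>R i - c)) has_real_derivative D x) (at 0))"
  proof -
    have "\<bar>mink (x - c) - mink (y - c)\<bar> \<le> (1 / r) * norm (x - y)" for x y
      using mink_lipschitz[of "x - c" "y - c"] by simp
    from AE_convex_partial[OF mink_convex this assms] show ?thesis by blast
  qed
  from someI_ex[OF this, folded dmink_def]
  show "dmink i \<in> borel_measurable borel" "\<bar>dmink i x\<bar> \<le> 1 / r"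
    "AE x in lborel. ((\<lambda>t. mink (x + t *\<^sub>R i - c)) has_real_derivative dmink i x) (at 0)" by auto
qed

text \<open>Level sets are dilates of a part of the boundary, which is negligible for a convex set.
  The cutoff has its kinks on two of them.\<close>

lemma mink_level_null:
  assumes "t > 0"
  shows "AE x in lborel. mink (x - c) \<noteq> t"
proof -
  let ?S = "{x. mink (x - c) = 1}"
  have S: "?S \<in> sets borel" by measurable
  have "?S \<subseteq> frontier \<Omega>"
  proof
    fix x assume x: "x \<in> ?S"
    then have "x \<noteq> c" by auto
    from radial_frontier[OF this] show "x \<in> frontier \<Omega>" using x by (simp add: radial_def)
  qed
  moreover have "negligible (frontier \<Omega>)" using \<Omega>(3) by (rule negligible_convex_frontier)
  ultimately have "negligible ?S" by (rule negligible_subset[rotated])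
  then have "?S \<in> null_sets lborel"
    using S by (simp add: negligible_iff_null_sets null_sets_completion_iff)
  then have "(\<integral>\<^sup>+x. indicator ?S x \<partial>lborel) = 0" using S by (simp add: null_sets_def)
  then have "(\<integral>\<^sup>+x. indicator ?S ((c - (1 / t) *\<^sub>R c) + (1 / t) *\<^sub>R x) \<partial>lborel) = 0"
    using S assms by (subst nn_integral_lborel_affine) auto
  moreover have "indicator ?S ((c - (1 / t) *\<^sub>R c) + (1 / t) *\<^sub>R x) = (indicator {x. mink (x - c) = t} x :: ennreal)" for x
  proof -
    have "(c - (1 / t) *\<^sub>R c) + (1 / t) *\<^sub>R x - c = (1 / t) *\<^sub>R (x - c)" by (simp add: algebra_simps)
    then have "mink ((c - (1 / t) *\<^sub>R c) + (1 / t) *\<^sub>R x - c) = mink (x - c) / t" using assms by (simp add: mink_scale)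
    then show ?thesis using assms by (simp add: indicator_def)
  qed
  ultimately have "{x. mink (x - c) = t} \<in> null_sets lborel" by (intro null_setsI) (auto simp: nn_integral_indicator[symmetric] simp del: nn_integral_indicator)
  from AE_not_in[OF this] show ?thesis by simp
qed

text \<open>The outer \<open>max 0\<close> continues the function by 0 beyond \<Omega>, so that its
  product with a function in \<open>C1b\<close> extends by zero to a Lipschitz function on the whole
  space.\<close>

definition cutoff :: "real \<Rightarrow> 'a \<Rightarrow> real" where
  "cutoff \<epsilon> x = max 0 (min 1 ((1 - mink (x - c)) / \<epsilon>))"

lemma cutoff_bounds: "0 \<le> cutoff \<epsilon> x" "cutoff \<epsilon> x \<le> 1" "\<bar>cutoff \<epsilon> x\<bar> \<le> 1"
  by (auto simp: cutoff_def)

lemma cutoff_outside: "\<epsilon> > 0 \<Longrightarrow> x \<notin> \<Omega> \<Longrightarrow> cutoff \<epsilon> x = 0"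
  by (auto simp: cutoff_def in_\<Omega>_iff divide_le_0_iff)

lemma cutoff_lipschitz:
  assumes "\<epsilon> > 0"
  shows "\<bar>cutoff \<epsilon> x - cutoff \<epsilon> y\<bar> \<le> (1 / (r * \<epsilon>)) * norm (x - y)"
proof -
  have "\<bar>cutoff \<epsilon> x - cutoff \<epsilon> y\<bar> \<le> \<bar>(1 - mink (x - c)) / \<epsilon> - (1 - mink (y - c)) / \<epsilon>\<bar>"
    by (auto simp: cutoff_def max_def min_def)
  also have "\<dots> = \<bar>mink (x - c) - mink (y - c)\<bar> / \<epsilon>"
    using assms by (simp add: diff_divide_distrib[symmetric] abs_divide abs_minus_commute)
  also have "\<dots> \<le> ((1 / r) * norm (x - y)) / \<epsilon>"
    using mink_lipschitz[of "x - c" "y - c"] assms by (intro divide_right_mono) auto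
  finally show ?thesis by simp
qed

lemma cutoff_measurable [measurable]: "cutoff \<epsilon> \<in> borel_measurable borel"
  unfolding cutoff_def by measurable

lemma directional_derivative:
  assumes "(u has_derivative (\<lambda>v. \<Sum>j\<in>Basis. (v \<bullet> j) * U j x)) (at x)" "i \<in> Basis"
  shows "((\<lambda>t. u (x + t *\<^sub>R i)) has_real_derivative U i x) (at 0)"
proof -
  have "((\<lambda>t. x + t *\<^sub>R i) has_derivative (\<lambda>t. t *\<^sub>R i)) (at 0)" by (auto intro!: derivative_eq_intros)
  moreover have "(u has_derivative (\<lambda>v. \<Sum>j\<in>Basis. (v \<bullet> j) * U j x)) (at (x + 0 *\<^sub>R i))" using assms by simp
  ultimately have "((\<lambda>t. u (x + t *\<^sub>R i)) has_derivative (\<lambda>t. \<Sum>j\<in>Basis. ((t *\<^sub>R i) \<bullet> j) * U j x)) (at 0)"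
    by (rule has_derivative_compose)
  moreover have "(\<lambda>t. \<Sum>j\<in>Basis. ((t *\<^sub>R i) \<bullet> j) * U j x) = (*) (U i x)"
  proof
    fix t
    have "(\<Sum>j\<in>Basis. ((t *\<^sub>R i) \<bullet> j) * U j x) = (\<Sum>j\<in>Basis. if j = i then t * U i x else 0)"
      using assms(2) by (intro sum.cong refl) (auto simp: inner_Basis)
    then show "(\<Sum>j\<in>Basis. ((t *\<^sub>R i) \<bullet> j) * U j x) = U i x * t" using assms(2) by simp
  qed
  ultimately show ?thesis by (simp add: has_field_derivative_def)
qed

text \<open>Integration by parts against the Lipschitz cutoff, by translation invariance of the integral
  of the difference quotients of \<open>cutoff \<epsilon> * u\<close> extended by zero.\<close>

lemma cutoff_integration_by_parts_C1:
  assumes u: "C1b u U" and \<epsilon>: "0 < \<epsilon>" "\<epsilon> \<le> 1 / 2" and i: "i \<in> Basis"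
  shows "(LINT x|M. cutoff \<epsilon> x * U i x) = (1 / \<epsilon>) * (LINT x|M. indicator (layer \<epsilon>) x * (dmink i x * u x))"
proof -
  obtain B where B: "B \<ge> 0" "\<And>x. x \<in> \<Omega> \<Longrightarrow> \<bar>u x\<bar> \<le> B" "\<And>x j. x \<in> \<Omega> \<Longrightarrow> j \<in> Basis \<Longrightarrow> \<bar>U j x\<bar> \<le> B"
    using C1bD(3)[OF u] by blast
  define P where "P x = indicator \<Omega> x * (cutoff \<epsilon> x * u x)" for x
  have [measurable]: "P \<in> borel_measurable borel"
  proof -
    have "(\<lambda>x. cutoff \<epsilon> x * (indicator \<Omega> x * u x)) \<in> borel_measurable borel"
      using borel_indicator_continuous[OF C1bD(4)[OF u]] by measurable
    then show ?thesis by (simp add: P_def[abs_def] mult_ac)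
  qed
  define L where "L = (1 / (r * \<epsilon>)) * B + real DIM('a) * B"
  have L0: "L \<ge> 0" using B(1) r \<epsilon> by (simp add: L_def)
  have PL1: "\<bar>P x - P y\<bar> \<le> L * norm (x - y)" if "x \<in> \<Omega>" for x y
  proof (cases "y \<in> \<Omega>")
    case True
    have "P x - P y = (cutoff \<epsilon> x - cutoff \<epsilon> y) * u x + cutoff \<epsilon> y * (u x - u y)"
      using that True by (simp add: P_def algebra_simps)
    then have "\<bar>P x - P y\<bar> \<le> \<bar>cutoff \<epsilon> x - cutoff \<epsilon> y\<bar> * \<bar>u x\<bar> + \<bar>cutoff \<epsilon> y\<bar> * \<bar>u x - u y\<bar>"
      by (metis abs_mult abs_triangle_ineq)
    also have "\<dots> \<le> ((1 / (r * \<epsilon>)) * norm (x - y)) * B + 1 * (real DIM('a) * B * norm (x - y))"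
      using r \<epsilon> by (intro add_mono mult_mono cutoff_lipschitz B(2) cutoff_bounds
          lipschitz_of_partials[OF \<Omega>(3) C1bD(1)[OF u] B(3)] that True) auto
    finally show ?thesis by (simp add: L_def algebra_simps)
  next
    case False
    \<comment> \<open>Across the boundary the cutoff vanishes at \<open>y\<close>, so its own
      Lipschitz bound compensates for the jump of \<open>u\<close>.\<close>
    then have "\<bar>P x - P y\<bar> = \<bar>cutoff \<epsilon> x - cutoff \<epsilon> y\<bar> * \<bar>u x\<bar>"
      using that cutoff_outside[OF \<epsilon>(1) False] by (simp add: P_def abs_mult)
    also have "\<dots> \<le> ((1 / (r * \<epsilon>)) * norm (x - y)) * B"
      using r \<epsilon> by (intro mult_mono cutoff_lipschitz B(2) that) auto
    also have "\<dots> \<le> L * norm (x - y)" using B(1) by (simp add: L_def algebra_simps)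
    finally show ?thesis .
  qed
  have PL: "\<bar>P x - P y\<bar> \<le> L * norm (x - y)" for x y
  proof (cases "x \<in> \<Omega> \<or> y \<in> \<Omega>")
    case True
    then show ?thesis using PL1[of x y] PL1[of y x] by (auto simp: abs_minus_commute norm_minus_commute)
  next
    case False
    then show ?thesis using L0 by (simp add: P_def)
  qed
  obtain D where D: "D > 0" "\<And>x. x \<in> closure \<Omega> \<Longrightarrow> norm (x - c) \<le> D" by (rule domain_radius, rule that)
  define \<delta> where "\<delta> n = 1 / (real n + 1)" for n :: nat
  have \<delta>: "\<delta> n > 0" "\<delta> n \<le> 1" for n by (auto simp: \<delta>_def)
  have \<delta>0: "\<delta> \<longlonglongrightarrow> 0" unfolding \<delta>_def[abs_def] by real_asymp
  define q where "q n x = (P (\<delta> n *\<^sub>R i + x) - P x) / \<delta> n" for n x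
  \<comment> \<open>The product rule for the cutoff times \<open>u\<close>: on the layer the
    gradient of the cutoff is \<open>- 1 / \<epsilon>\<close> times that of the Minkowski
    functional, and it is 0 elsewhere apart from the two null levels.\<close>
  define ql where "ql x = indicator \<Omega> x * (cutoff \<epsilon> x * U i x) - (1 / \<epsilon>) * (indicator (layer \<epsilon>) x * (dmink i x * (indicator \<Omega> x * u x)))" for x
  have [measurable]: "(\<lambda>x. indicator \<Omega> x * u x) \<in> borel_measurable borel" "(\<lambda>x. indicator \<Omega> x * U i x) \<in> borel_measurable borel"
    using borel_indicator_continuous[OF C1bD(4)[OF u]] borel_indicator_continuous[OF C1bD(2)[OF u i]] .
  have [measurable]: "dmink i \<in> borel_measurable borel" by (rule dmink[OF i])
  have "(\<lambda>x. cutoff \<epsilon> x * (indicator \<Omega> x * U i x)) \<in> borel_measurable borel" by measurable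
  then have m1[measurable]: "(\<lambda>x. indicator \<Omega> x * (cutoff \<epsilon> x * U i x)) \<in> borel_measurable borel" by (simp add: mult_ac)
  have m2[measurable]: "(\<lambda>x. indicator (layer \<epsilon>) x * (dmink i x * (indicator \<Omega> x * u x))) \<in> borel_measurable borel" by measurable
  have lm: "ql \<in> borel_measurable borel" unfolding ql_def by measurable
  have Pint: "integrable lborel P"
  proof (rule Bochner_Integration.integrable_bound)
    show "integrable lborel (\<lambda>x. B * indicator (cball c D) x)"
      by (auto intro!: integrable_real_indicator emeasure_lborel_cball_finite simp: less_top[symmetric])
    show "AE x in lborel. norm (P x) \<le> norm (B * indicator (cball c D) x)"
    proof (intro AE_I2)
      fix x show "norm (P x) \<le> norm (B * indicator (cball c D) x)"
      proof (cases "x \<in> \<Omega>")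
        case True
        then have "x \<in> cball c D" using D(2)[of x] closure_subset by (auto simp: dist_norm norm_minus_commute)
        moreover have "\<bar>cutoff \<epsilon> x\<bar> * \<bar>u x\<bar> \<le> 1 * B" using True by (intro mult_mono cutoff_bounds B(2)) auto
        ultimately show ?thesis using True B(1) by (simp add: P_def abs_mult)
      qed (simp add: P_def)
    qed
  qed simp
  have q0: "(\<integral>x. q n x \<partial>lborel) = 0" for n
    unfolding q_def using Pint integrable_lborel_translate[OF Pint, of "\<delta> n *\<^sub>R i"] integral_lborel_translate[of P "\<delta> n *\<^sub>R i"]
    by simp
  have "(\<lambda>n. \<integral>x. q n x \<partial>lborel) \<longlonglongrightarrow> (\<integral>x. ql x \<partial>lborel)"
  proof (rule integral_dominated_convergence)
    show "integrable lborel (\<lambda>x. L * indicator (cball c (D + 1)) x)"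
      by (auto intro!: integrable_real_indicator emeasure_lborel_cball_finite simp: less_top[symmetric])
    show "AE x in lborel. norm (q n x) \<le> L * indicator (cball c (D + 1)) x" for n
    proof (intro AE_I2)
      fix x
      have nt: "norm (\<delta> n *\<^sub>R i) = \<delta> n" using i \<delta>(1)[of n] by simp
      show "norm (q n x) \<le> L * indicator (cball c (D + 1)) x"
      proof (cases "x \<in> cball c (D + 1)")
        case True
        have "\<bar>P (\<delta> n *\<^sub>R i + x) - P x\<bar> \<le> L * \<delta> n" using PL[of "\<delta> n *\<^sub>R i + x" x] nt by simp
        then show ?thesis using True \<delta>(1)[of n] by (simp add: q_def divide_le_eq)
      next
        case False
        then have far: "norm (x - c) > D + 1" by (simp add: dist_norm norm_minus_commute)
        then have "x \<notin> \<Omega>" using D(2)[of x] closure_subset by fastforce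
        moreover have "norm (\<delta> n *\<^sub>R i + x - c) > D"
        proof -
          have "norm (x - c) \<le> norm (\<delta> n *\<^sub>R i + x - c) + norm (\<delta> n *\<^sub>R i)"
            using norm_triangle_ineq4[of "\<delta> n *\<^sub>R i + x - c" "\<delta> n *\<^sub>R i"] by (simp add: algebra_simps)
          then show ?thesis using far nt \<delta>(2)[of n] by linarith
        qed
        then have "\<delta> n *\<^sub>R i + x \<notin> \<Omega>" using D(2)[of "\<delta> n *\<^sub>R i + x"] closure_subset by fastforce
        ultimately show ?thesis using False by (simp add: q_def P_def)
      qed
    qed
    show "AE x in lborel. (\<lambda>n. q n x) \<longlonglongrightarrow> ql x"
    proof -
      have "AE x in lborel. mink (x - c) \<noteq> 1" "AE x in lborel. mink (x - c) \<noteq> 1 - \<epsilon>"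
        using \<epsilon> by (auto intro!: mink_level_null)
      with dmink(3)[OF i] show ?thesis
    proof eventually_elim
      case (elim x)
      note n1 = elim(2,3)
      have mc: "isCont (\<lambda>t. mink (x + t *\<^sub>R i - c)) 0" using elim(1) by (rule DERIV_isCont)
      have mlim: "((\<lambda>t. mink (x + t *\<^sub>R i - c)) \<longlongrightarrow> mink (x - c)) (nhds 0)"
      proof -
        have "((\<lambda>t. mink (x + t *\<^sub>R i - c)) \<longlongrightarrow> mink (x + 0 *\<^sub>R i - c)) (nhds 0)"
          using tendsto_at_iff_tendsto_nhds[of "\<lambda>t. mink (x + t *\<^sub>R i - c)" 0] mc by (simp only: isCont_def)
        then show ?thesis by simp
      qed
      have "((\<lambda>t. P (x + t *\<^sub>R i)) has_real_derivative ql x) (at 0)"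
      proof -
        consider "mink (x - c) > 1" | "mink (x - c) < 1 - \<epsilon>" | "1 - \<epsilon> < mink (x - c)" "mink (x - c) < 1"
          using n1 by linarith
        then show ?thesis
        proof cases
          case 1
          have "eventually (\<lambda>t. P (x + t *\<^sub>R i) = 0) (nhds 0)"
            using order_tendstoD(1)[OF mlim 1] by eventually_elim (simp add: P_def in_\<Omega>_iff)
          moreover have "((\<lambda>t. 0) has_real_derivative 0) (at (0::real))" by simp
          moreover have "ql x = 0" using 1 by (simp add: ql_def in_\<Omega>_iff layer_def)
          ultimately show ?thesis by (simp add: DERIV_cong_ev[OF refl _ refl])
        next
          case 2
          then have x: "x \<in> \<Omega>" using \<epsilon> by (simp add: in_\<Omega>_iff)
          have "eventually (\<lambda>t. P (x + t *\<^sub>R i) = u (x + t *\<^sub>R i)) (nhds 0)"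
            using order_tendstoD(2)[OF mlim 2] by eventually_elim (use \<epsilon> in \<open>simp add: P_def in_\<Omega>_iff cutoff_def le_divide_eq max_def min_def\<close>)
          moreover have "ql x = U i x" using 2 x \<epsilon> by (simp add: ql_def layer_def cutoff_def le_divide_eq max_def min_def)
          ultimately show ?thesis using directional_derivative[where u=u and U=U and x=x and i=i, OF C1bD(1)[OF u x] i] by (simp add: DERIV_cong_ev[OF refl _ refl])
        next
          case 3
          then have x: "x \<in> \<Omega>" using \<epsilon> by (simp add: in_\<Omega>_iff)
          have "eventually (\<lambda>t. P (x + t *\<^sub>R i) = ((1 - mink (x + t *\<^sub>R i - c)) * (1 / \<epsilon>)) * u (x + t *\<^sub>R i)) (nhds 0)"
            using order_tendstoD(1)[OF mlim 3(1)] order_tendstoD(2)[OF mlim 3(2)]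
            by eventually_elim (use \<epsilon> in \<open>simp add: P_def in_\<Omega>_iff cutoff_def divide_le_eq le_divide_eq max_def min_def\<close>)
          moreover have "((\<lambda>t. ((1 - mink (x + t *\<^sub>R i - c)) * (1 / \<epsilon>)) * u (x + t *\<^sub>R i)) has_real_derivative ql x) (at 0)"
          proof -
            have cf: "(1 - mink (x + 0 *\<^sub>R i - c)) * (1 / \<epsilon>) = cutoff \<epsilon> x"
              using 3 \<epsilon> by (simp add: cutoff_def divide_le_eq max_def min_def)
            have A: "ql x = ((0 - dmink i x) * (1 / \<epsilon>)) * u (x + 0 *\<^sub>R i) + U i x * ((1 - mink (x + 0 *\<^sub>R i - c)) * (1 / \<epsilon>))"
              unfolding cf using 3 x by (simp add: ql_def layer_def)
            have Bd: "((\<lambda>t. (1 - mink (x + t *\<^sub>R i - c)) * (1 / \<epsilon>)) has_real_derivative (0 - dmink i x) * (1 / \<epsilon>)) (at 0)"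
              by (intro DERIV_cmult_right DERIV_diff DERIV_const elim(1))
            show ?thesis unfolding A
              by (rule DERIV_mult[OF Bd directional_derivative[where u=u and U=U and x=x and i=i, OF C1bD(1)[OF u x] i]])
          qed
          ultimately show ?thesis by (simp add: DERIV_cong_ev[OF refl _ refl])
        qed
      qed
      then have "((\<lambda>t. (P (x + t *\<^sub>R i) - P x) / t) \<longlongrightarrow> ql x) (at 0)"
        by (simp add: has_field_derivative_iff)
      moreover have "filterlim \<delta> (at 0) sequentially"
        using \<delta>0 \<delta>(1) by (auto simp: filterlim_at less_imp_neq[symmetric] intro!: always_eventually) 
      ultimately have "(\<lambda>n. (P (x + \<delta> n *\<^sub>R i) - P x) / \<delta> n) \<longlonglongrightarrow> ql x" by (rule filterlim_compose)
      then show ?case by (simp add: q_def add.commute)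
    qed
    qed
  qed (use lm in \<open>auto simp: q_def\<close>)
  then have l0: "(\<integral>x. ql x \<partial>lborel) = 0" by (simp add: q0 LIMSEQ_const_iff)
  have toM: "(LINT x|M. f x) = (\<integral>x. indicator \<Omega> x * f x \<partial>lborel)" if "(\<lambda>x. indicator \<Omega> x * f x) \<in> borel_measurable borel" for f :: "'a \<Rightarrow> real"
    using that by (simp add: integral_restrict_space integral_completion)
  have b1: "integrable lborel (\<lambda>x. f x)" if "f \<in> borel_measurable borel" "\<And>x. \<bar>f x\<bar> \<le> K * indicator \<Omega> x" for f :: "'a \<Rightarrow> real" and K
  proof (rule Bochner_Integration.integrable_bound)
    show "integrable lborel (\<lambda>x. K * indicator \<Omega> x)"
      using emeasure_bounded_finite[OF \<Omega>(2)] by (auto intro!: integrable_real_indicator)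
    show "AE x in lborel. norm (f x) \<le> norm (K * indicator \<Omega> x)"
      by (intro AE_I2) (auto intro: order_trans[OF that(2) abs_ge_self])
  qed (use that in simp)
  have i1: "integrable lborel (\<lambda>x. indicator \<Omega> x * (cutoff \<epsilon> x * U i x))"
  proof (rule b1[OF m1, of "1 * B"])
    fix x show "\<bar>indicator \<Omega> x * (cutoff \<epsilon> x * U i x)\<bar> \<le> 1 * B * indicator \<Omega> x"
      using mult_mono[OF cutoff_bounds(3) B(3)[OF _ i], of x \<epsilon> x] by (cases "x \<in> \<Omega>") (auto simp: abs_mult)
  qed
  have i2: "integrable lborel (\<lambda>x. indicator (layer \<epsilon>) x * (dmink i x * (indicator \<Omega> x * u x)))"
  proof (rule b1[OF m2, of "(1 / r) * B"])
    fix x show "\<bar>indicator (layer \<epsilon>) x * (dmink i x * (indicator \<Omega> x * u x))\<bar> \<le> (1 / r) * B * indicator \<Omega> x"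
      using mult_mono[OF dmink(2)[OF i] B(2), of x x] r B(1) by (cases "x \<in> \<Omega>"; cases "x \<in> layer \<epsilon>") (auto simp: abs_mult)
  qed
  have "0 = (\<integral>x. indicator \<Omega> x * (cutoff \<epsilon> x * U i x) \<partial>lborel) - (1 / \<epsilon>) * (\<integral>x. indicator (layer \<epsilon>) x * (dmink i x * (indicator \<Omega> x * u x)) \<partial>lborel)"
    using l0 i1 i2 unfolding ql_def by simp
  moreover have "(LINT x|M. cutoff \<epsilon> x * U i x) = (\<integral>x. indicator \<Omega> x * (cutoff \<epsilon> x * U i x) \<partial>lborel)"
    by (rule toM[OF m1])
  moreover have "(LINT x|M. indicator (layer \<epsilon>) x * (dmink i x * u x)) = (\<integral>x. indicator (layer \<epsilon>) x * (dmink i x * (indicator \<Omega> x * u x)) \<partial>lborel)"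
  proof -
    have eq: "(\<lambda>x. indicator \<Omega> x * (indicator (layer \<epsilon>) x * (dmink i x * u x)))
        = (\<lambda>x. indicator (layer \<epsilon>) x * (dmink i x * (indicator \<Omega> x * u x)))"
      by (rule ext) (simp add: mult_ac)
    have "(LINT x|M. indicator (layer \<epsilon>) x * (dmink i x * u x)) = (\<integral>x. indicator \<Omega> x * (indicator (layer \<epsilon>) x * (dmink i x * u x)) \<partial>lborel)"
      by (rule toM) (simp only: eq m2)
    then show ?thesis by (simp only: eq)
  qed
  ultimately show ?thesis by simp
qed

lemma C1b_mult:
  assumes "C1b f F" "C1b g G"
  shows "C1b (\<lambda>x. f x * g x) (\<lambda>i x. F i x * g x + f x * G i x)"
proof -
  obtain A where A: "A \<ge> 0" "\<And>x. x \<in> \<Omega> \<Longrightarrow> \<bar>f x\<bar> \<le> A" "\<And>x i. x \<in> \<Omega> \<Longrightarrow> i \<in> Basis \<Longrightarrow> \<bar>F i x\<bar> \<le> A"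
    using C1bD(3)[OF assms(1)] by blast
  obtain B where B: "B \<ge> 0" "\<And>x. x \<in> \<Omega> \<Longrightarrow> \<bar>g x\<bar> \<le> B" "\<And>x i. x \<in> \<Omega> \<Longrightarrow> i \<in> Basis \<Longrightarrow> \<bar>G i x\<bar> \<le> B"
    using C1bD(3)[OF assms(2)] by blast
  show ?thesis
    unfolding C1b_def
  proof (intro conjI ballI)
    fix x assume x: "x \<in> \<Omega>"
    from has_derivative_mult[OF C1bD(1)[OF assms(1) x] C1bD(1)[OF assms(2) x]]
    show "((\<lambda>x. f x * g x) has_derivative (\<lambda>v. \<Sum>i\<in>Basis. v \<bullet> i * (F i x * g x + f x * G i x))) (at x)"
      by (rule has_derivative_eq_rhs) (simp add: fun_eq_iff sum_distrib_left sum_distrib_right sum.distrib[symmetric] algebra_simps)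
  next
    fix i :: 'a assume "i \<in> Basis"
    then show "continuous_on \<Omega> (\<lambda>x. F i x * g x + f x * G i x)"
      by (intro continuous_intros C1bD(2)[OF assms(1)] C1bD(2)[OF assms(2)] C1bD(4)[OF assms(1)] C1bD(4)[OF assms(2)])
  next
    show "\<exists>B. \<forall>x\<in>\<Omega>. \<bar>f x * g x\<bar> \<le> B \<and> (\<forall>i\<in>Basis. \<bar>F i x * g x + f x * G i x\<bar> \<le> B)"
    proof (intro exI[of _ "A * B + A * B"] ballI conjI)
      fix x assume x: "x \<in> \<Omega>"
      have 1: "\<bar>f x * g x\<bar> \<le> A * B" unfolding abs_mult using A B x by (intro mult_mono) auto
      then show "\<bar>f x * g x\<bar> \<le> A * B + A * B" using A(1) B(1) by (simp add: add_increasing)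
      fix i :: 'a assume i: "i \<in> Basis"
      have "\<bar>F i x * g x\<bar> \<le> A * B" "\<bar>f x * G i x\<bar> \<le> A * B"
        unfolding abs_mult using A B x i by (intro mult_mono; auto)+
      then show "\<bar>F i x * g x + f x * G i x\<bar> \<le> A * B + A * B" by linarith
    qed
  qed
qed

lemma H1_approxD:
  assumes "H1_approx u U"
  shows "u \<in> L2 \<Omega>" "i \<in> Basis \<Longrightarrow> U i \<in> L2 \<Omega>"
  using assms by (auto simp: H1_approx_def dest: L2_tendstoD(2))

lemma cutoff_measurable_M: "cutoff \<epsilon> \<in> borel_measurable M"
proof -
  have "cutoff \<epsilon> \<in> borel_measurable lebesgue" by (rule measurable_completion) simp
  then show ?thesis by (rule measurable_restrict_space1)
qed

lemma dmink_measurable_M: "i \<in> Basis \<Longrightarrow> dmink i \<in> borel_measurable M"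
proof -
  assume "i \<in> Basis"
  then have "dmink i \<in> borel_measurable lebesgue" by (intro measurable_completion) (simp add: dmink)
  then show ?thesis by (rule measurable_restrict_space1)
qed

text \<open>Both sides are bilinear in the two pairs and continuous in L2, the factors
  \<open>cutoff \<epsilon>\<close> and \<open>dmink i\<close> being bounded, so the identity passes
  from products of approximating functions to the limit.\<close>

lemma cutoff_integration_by_parts:
  assumes w: "H1_approx w W" and X: "H1_approx X Y" and \<epsilon>: "0 < \<epsilon>" "\<epsilon> \<le> 1 / 2" and i: "i \<in> Basis"
  shows "(LINT x|M. cutoff \<epsilon> x * (W i x * X x + w x * Y i x)) = (1 / \<epsilon>) * (LINT x|M. indicator (layer \<epsilon>) x * (dmink i x * (w x * X x)))"
proof -
  obtain f F where f: "\<And>k. C1b (f k) (F k)" "L2_tendsto \<Omega> f w" "\<And>i. i \<in> Basis \<Longrightarrow> L2_tendsto \<Omega> (\<lambda>k. F k i) (W i)"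
    using w by (auto simp: H1_approx_def)
  obtain g G where g: "\<And>k. C1b (g k) (G k)" "L2_tendsto \<Omega> g X" "\<And>i. i \<in> Basis \<Longrightarrow> L2_tendsto \<Omega> (\<lambda>k. G k i) (Y i)"
    using X by (auto simp: H1_approx_def)
  have cB: "AE x in M. \<bar>cutoff \<epsilon> x\<bar> \<le> 1" by (intro AE_I2 cutoff_bounds)
  have dm: "(\<lambda>x. indicator (layer \<epsilon>) x * dmink i x) \<in> borel_measurable M"
    by (intro borel_measurable_times layer_measurable_M dmink_measurable_M i)
  have dB: "AE x in M. \<bar>indicator (layer \<epsilon>) x * dmink i x\<bar> \<le> 1 / r"
    using dmink(2)[OF i] r by (intro AE_I2) (auto simp: indicator_def)
  have L: "(LINT x|M. cutoff \<epsilon> x * (a x * b x + p x * q x)) = L2_inner \<Omega> (\<lambda>x. cutoff \<epsilon> x * a x) b + L2_inner \<Omega> (\<lambda>x. cutoff \<epsilon> x * p x) q"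
    if "a \<in> L2 \<Omega>" "b \<in> L2 \<Omega>" "p \<in> L2 \<Omega>" "q \<in> L2 \<Omega>" for a b p q
  proof -
    have "integrable M (\<lambda>x. cutoff \<epsilon> x * a x * b x)" "integrable M (\<lambda>x. cutoff \<epsilon> x * p x * q x)"
      using that cB cutoff_measurable_M by (auto intro!: L2_mult_integrable L2_bounded_mult)
    then show ?thesis by (simp add: L2_inner_def distrib_left mult.assoc)
  qed
  have R: "(LINT x|M. indicator (layer \<epsilon>) x * (dmink i x * (a x * b x))) = L2_inner \<Omega> (\<lambda>x. (indicator (layer \<epsilon>) x * dmink i x) * a x) b" for a b
    by (simp add: L2_inner_def mult.assoc)
  have "(\<lambda>k. L2_inner \<Omega> (\<lambda>x. cutoff \<epsilon> x * F k i x) (g k) + L2_inner \<Omega> (\<lambda>x. cutoff \<epsilon> x * f k x) (G k i))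
     \<longlonglongrightarrow> L2_inner \<Omega> (\<lambda>x. cutoff \<epsilon> x * W i x) X + L2_inner \<Omega> (\<lambda>x. cutoff \<epsilon> x * w x) (Y i)"
    by (intro tendsto_add L2_tendsto_inner L2_tendsto_bounded_mult[OF _ cutoff_measurable_M cB] f g i)
  moreover have "(\<lambda>k. (1 / \<epsilon>) * L2_inner \<Omega> (\<lambda>x. (indicator (layer \<epsilon>) x * dmink i x) * f k x) (g k))
     \<longlonglongrightarrow> (1 / \<epsilon>) * L2_inner \<Omega> (\<lambda>x. (indicator (layer \<epsilon>) x * dmink i x) * w x) X"
    by (intro tendsto_mult tendsto_const L2_tendsto_inner L2_tendsto_bounded_mult[OF _ dm dB] f g)
  moreover have "L2_inner \<Omega> (\<lambda>x. cutoff \<epsilon> x * F k i x) (g k) + L2_inner \<Omega> (\<lambda>x. cutoff \<epsilon> x * f k x) (G k i)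
     = (1 / \<epsilon>) * L2_inner \<Omega> (\<lambda>x. (indicator (layer \<epsilon>) x * dmink i x) * f k x) (g k)" for k
    using cutoff_integration_by_parts_C1[OF C1b_mult[OF f(1) g(1)] \<epsilon> i, of k k]
    unfolding R L[OF C1b_L2(2)[OF f(1) i] C1b_L2(1)[OF g(1)] C1b_L2(1)[OF f(1)] C1b_L2(2)[OF g(1) i]] .
  ultimately have "L2_inner \<Omega> (\<lambda>x. cutoff \<epsilon> x * W i x) X + L2_inner \<Omega> (\<lambda>x. cutoff \<epsilon> x * w x) (Y i)
     = (1 / \<epsilon>) * L2_inner \<Omega> (\<lambda>x. (indicator (layer \<epsilon>) x * dmink i x) * w x) X"
    using LIMSEQ_unique by fastforce
  then show ?thesis
    unfolding R L[OF H1_approxD(2)[OF w i] H1_approxD(1)[OF X] H1_approxD(1)[OF w] H1_approxD(2)[OF X i]] .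
qed

text \<open>The part of \<^const>\<open>has_trace\<close> that Green's formula uses, freed from weak derivatives.\<close>

definition has_trace_approx :: "('a \<Rightarrow> real) \<Rightarrow> ('a \<Rightarrow> 'a \<Rightarrow> real) \<Rightarrow> ('a \<Rightarrow> real) \<Rightarrow> bool" where
  "has_trace_approx X Y G \<longleftrightarrow> G \<in> borel_measurable (surface_measure \<Omega>) \<and>
     (\<exists>U :: nat \<Rightarrow> 'a \<Rightarrow> real. \<exists>V. (\<forall>k. continuous_on UNIV (U k) \<and>
        (\<exists>L\<ge>0. \<forall>x\<in>closure \<Omega>. \<forall>y\<in>closure \<Omega>. \<bar>U k x - U k y\<bar> \<le> L * norm (x - y)) \<and>
        H1_approx (\<lambda>x. X x - U k x) (\<lambda>i x. Y i x - V k i x)) \<and>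
      (\<lambda>k. L2_norm \<Omega> (\<lambda>x. X x - U k x)) \<longlonglongrightarrow> 0 \<and>
      (\<forall>i\<in>Basis. (\<lambda>k. L2_norm \<Omega> (\<lambda>x. Y i x - V k i x)) \<longlonglongrightarrow> 0) \<and>
      (\<lambda>k. \<integral>\<^sup>+x. ennreal ((U k x - G x)\<^sup>2) \<partial>surface_measure \<Omega>) \<longlonglongrightarrow> 0)"

lemma L1_le_L2: "f \<in> L2 \<Omega> \<Longrightarrow> (LINT x|M. \<bar>f x\<bar>) \<le> L2_norm \<Omega> (\<lambda>x. 1) * L2_norm \<Omega> f"
proof -
  assume f: "f \<in> L2 \<Omega>"
  then have a: "(\<lambda>x. \<bar>f x\<bar>) \<in> L2 \<Omega>" by (auto simp: L2_def)
  have "L2_norm \<Omega> (\<lambda>x. \<bar>f x\<bar>) = L2_norm \<Omega> f" by (simp add: L2_norm_def L2_inner_def)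
  then show ?thesis using L2_Cauchy_Schwarz[OF L2_const[of 1] a] by (simp add: L2_inner_def)
qed

text \<open>The vanishing of the normal derivative is known up to a surface null set; the part of
  the layer above that set must not count.\<close>

lemma layer_surface_null:
  assumes "N \<in> null_sets (surface_measure \<Omega>)" "0 < \<epsilon>" "\<epsilon> \<le> 1 / 2"
  shows "AE x in lborel. x \<in> layer \<epsilon> \<longrightarrow> radial x \<notin> N"
proof -
  obtain K where K: "K > 0" "\<And>\<psi> \<epsilon>. \<psi> \<in> borel_measurable (surface_measure \<Omega>) \<Longrightarrow> 0 < \<epsilon> \<Longrightarrow> \<epsilon> \<le> 1 / 2 \<Longrightarrow>
       (\<integral>\<^sup>+x. \<psi> (radial x) * indicator (layer \<epsilon>) x \<partial>lborel) \<le> ennreal (K * \<epsilon>) * (\<integral>\<^sup>+x. \<psi> x \<partial>surface_measure \<Omega>)"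
    by (rule layer_surface_bound, rule that)
  have N: "N \<in> sets (surface_measure \<Omega>)" "emeasure (surface_measure \<Omega>) N = 0" using assms by auto
  then have Nb: "N \<in> sets borel"
    using frontier_sets by (auto simp: surface_measure_def sets_restrict_space_iff)
  have "(\<integral>\<^sup>+x. indicator N (radial x) * indicator (layer \<epsilon>) x \<partial>lborel) \<le> ennreal (K * \<epsilon>) * (\<integral>\<^sup>+x. indicator N x \<partial>surface_measure \<Omega>)"
    using N(1) assms by (intro K) auto
  then have "(\<integral>\<^sup>+x. indicator N (radial x) * indicator (layer \<epsilon>) x \<partial>lborel) = (0::ennreal)" using N by simp
  moreover have "(\<lambda>x. indicator N (radial x) * indicator (layer \<epsilon>) x :: ennreal) \<in> borel_measurable lborel" using Nb by measurable
  ultimately have "AE x in lborel. indicator N (radial x) * indicator (layer \<epsilon>) x = (0::ennreal)"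
    by (subst (asm) nn_integral_0_iff_AE) auto
  then show ?thesis by (auto elim!: eventually_mono simp: indicator_def split: if_splits)
qed

lemma radial_comp_measurable:
  assumes "\<psi> \<in> borel_measurable (surface_measure \<Omega>)" "\<epsilon> \<le> 1 / 2"
  shows "(\<lambda>x. \<psi> (radial x) * indicator (layer \<epsilon>) x :: ennreal) \<in> borel_measurable lborel"
proof -
  have "radial \<in> measurable (restrict_space lborel (layer \<epsilon>)) (surface_measure \<Omega>)"
    unfolding surface_measure_def
  proof (rule measurable_restrict_space2)
    show "radial \<in> space (restrict_space lborel (layer \<epsilon>)) \<rightarrow> frontier \<Omega>"
      using radial_frontier layer_ne_c assms(2) by (auto simp: space_restrict_space)
    show "radial \<in> measurable (restrict_space lborel (layer \<epsilon>)) (hausdorff_measure (DIM('a) - 1))"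
      by (subst measurable_cong_sets[OF refl sets_hausdorff_measure]) (intro measurable_restrict_space1, simp)
  qed
  then have "(\<lambda>x. \<psi> (radial x)) \<in> borel_measurable (restrict_space lborel (layer \<epsilon>))"
    using assms(1) by (rule measurable_compose)
  then show ?thesis by (subst (asm) borel_measurable_restrict_space_iff_ennreal) auto
qed

lemma H1_approx_C1b: "C1b u U \<Longrightarrow> H1_approx u U"
  unfolding H1_approx_def
  by (rule exI[of _ "\<lambda>_. u"], rule exI[of _ "\<lambda>_. U"])
    (auto simp: L2_tendsto_def C1b_L2 L2_norm_def L2_inner_def)

lemma C1b_const: "C1b (\<lambda>x. k) (\<lambda>i x. 0)"
  unfolding C1b_def by (auto intro!: exI[of _ "\<bar>k\<bar>"])

text \<open>The \<open>G\<close> part of the splitting sums to 0 because all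
  \<open>dmink i x\<close> are normal components divided by one common number; in the other parts
  \<open>dmink\<close> is simply bounded by \<open>1 / r\<close>.\<close>

lemma trace_layer_pointwise:
  assumes x: "x \<in> layer \<epsilon>" and \<epsilon>: "0 < \<epsilon>" "\<epsilon> \<le> 1 / 2" and \<eta>: "\<eta> > 0" and L: "L \<ge> 0"
    and D: "\<And>x. x \<in> closure \<Omega> \<Longrightarrow> norm (x - c) \<le> D"
    and dm: "\<forall>i\<in>Basis. ((\<lambda>t. mink (x + t *\<^sub>R i - c)) has_real_derivative dmink i x) (at 0)"
    and G: "0 = (\<Sum>i\<in>Basis. G i (radial x) * (outer_normal \<Omega> (radial x) \<bullet> i))"
    and U: "\<And>i x y. i \<in> Basis \<Longrightarrow> x \<in> closure \<Omega> \<Longrightarrow> y \<in> closure \<Omega> \<Longrightarrow> \<bar>U i x - U i y\<bar> \<le> L * norm (x - y)"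
  shows "\<bar>\<Sum>i\<in>Basis. dmink i x * X i x\<bar>
    \<le> (\<Sum>i\<in>Basis. (1 / r) * (\<bar>X i x - U i x\<bar> + ((L * \<epsilon> * D + \<eta>) + (1 / \<eta>) * (U i (radial x) - G i (radial x))\<^sup>2)))"
proof -
  let ?q = "radial x"
  define n where "n = outer_normal \<Omega> ?q"
  have xc: "x \<noteq> c" using x \<epsilon>(2) by (rule layer_ne_c)
  have q: "?q \<in> frontier \<Omega>" by (rule radial_frontier[OF xc])
  then have qc: "?q \<in> closure \<Omega>" by (simp add: frontier_def)
  have xcl: "x \<in> closure \<Omega>" using x layer_sub closure_subset by blast
  obtain \<mu> where \<mu>: "\<mu> \<ge> r" "\<And>i. i \<in> Basis \<Longrightarrow> dmink i x = (n \<bullet> i) / \<mu>"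
    using mink_partial_normal[OF xc] dm unfolding n_def by blast
  have \<mu>0: "\<mu> > 0" using \<mu>(1) r by simp
  have n1: "norm n = 1" unfolding n_def by (rule outer_normal(1)[OF q])
  have dist: "norm (x - ?q) \<le> \<epsilon> * D"
  proof -
    have "x - ?q = (mink (x - c) - 1) *\<^sub>R (?q - c)"
      using radial_eq[OF xc] by (simp add: algebra_simps)
    then have "norm (x - ?q) = \<bar>mink (x - c) - 1\<bar> * norm (?q - c)" by simp
    also have "\<dots> \<le> \<epsilon> * D" using x \<epsilon> D[OF qc] by (intro mult_mono) (auto simp: layer_def)
    finally show ?thesis .
  qed
  have "(\<Sum>i\<in>Basis. dmink i x * X i x) = (\<Sum>i\<in>Basis. dmink i x * (X i x - U i x) + dmink i x * (U i x - U i ?q) + dmink i x * (U i ?q - G i ?q)) + (\<Sum>i\<in>Basis. dmink i x * G i ?q)"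
    by (simp add: sum.distrib[symmetric] algebra_simps)
  also have "(\<Sum>i\<in>Basis. dmink i x * G i ?q) = (\<Sum>i\<in>Basis. G i ?q * (n \<bullet> i)) / \<mu>"
    unfolding sum_divide_distrib by (intro sum.cong refl) (simp add: \<mu>(2))
  also have "\<dots> = 0" using G by (simp add: n_def)
  finally have "\<bar>\<Sum>i\<in>Basis. dmink i x * X i x\<bar> \<le> (\<Sum>i\<in>Basis. \<bar>dmink i x * (X i x - U i x) + dmink i x * (U i x - U i ?q) + dmink i x * (U i ?q - G i ?q)\<bar>)"
    by simp
  also have "\<dots> \<le> (\<Sum>i\<in>Basis. (1 / r) * (\<bar>X i x - U i x\<bar> + ((L * \<epsilon> * D + \<eta>) + (1 / \<eta>) * (U i ?q - G i ?q)\<^sup>2)))"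
  proof (rule sum_mono)
    fix i :: 'a assume i: "i \<in> Basis"
    \<comment> \<open>The trace converges in mean square, so a linear error is traded for a small
      \<eta> plus a large multiple of its square.\<close>
    have sq: "\<bar>t\<bar> \<le> \<eta> + (1 / \<eta>) * t\<^sup>2" for t :: real
    proof -
      have "0 \<le> (\<bar>t\<bar> - \<eta>)\<^sup>2 + \<bar>t\<bar> * \<eta>" using \<eta> by simp
      then have "\<bar>t\<bar> * \<eta> \<le> \<eta> * \<eta> + t\<^sup>2" by (simp add: power2_eq_square algebra_simps)
      then show ?thesis using \<eta> by (simp add: field_simps)
    qed
    have "\<bar>U i x - U i ?q\<bar> \<le> L * norm (x - ?q)" by (rule U[OF i xcl qc])
    also have "\<dots> \<le> L * (\<epsilon> * D)" using dist L by (rule mult_left_mono)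
    finally have 2: "\<bar>U i x - U i ?q\<bar> \<le> L * \<epsilon> * D" by simp
    let ?a = "X i x - U i x" and ?b = "U i x - U i ?q" and ?d = "U i ?q - G i ?q"
    have "\<bar>dmink i x * ?a + dmink i x * ?b + dmink i x * ?d\<bar> = \<bar>dmink i x\<bar> * \<bar>?a + ?b + ?d\<bar>"
      by (simp only: abs_mult[symmetric] distrib_left)
    also have "\<dots> \<le> (1 / r) * (\<bar>?a\<bar> + \<bar>?b\<bar> + \<bar>?d\<bar>)"
      using dmink(2)[OF i] r by (intro mult_mono) auto
    also have "\<dots> \<le> (1 / r) * (\<bar>?a\<bar> + ((L * \<epsilon> * D + \<eta>) + (1 / \<eta>) * ?d\<^sup>2))"
      using 2 sq[of ?d] r by (intro mult_left_mono) auto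
    finally show "\<bar>dmink i x * ?a + dmink i x * ?b + dmink i x * ?d\<bar> \<le> (1 / r) * (\<bar>?a\<bar> + ((L * \<epsilon> * D + \<eta>) + (1 / \<eta>) * ?d\<^sup>2))" .
  qed
  finally show ?thesis .
qed

text \<open>The order of choices is decisive: \<eta> first, then an index \<open>k\<close> for which
  the smooth approximations are close to \<open>X\<close> and \<open>G\<close>, and only then
  \<open>\<epsilon>0\<close>, which depends on their Lipschitz constant.\<close>

lemma normal_flux_layer:
  assumes X: "\<And>i. i \<in> Basis \<Longrightarrow> has_trace_approx (X i) (Y i) (G i)" "\<And>i. i \<in> Basis \<Longrightarrow> X i \<in> L2 \<Omega>"
    and n: "AE q in surface_measure \<Omega>. 0 = (\<Sum>i\<in>Basis. G i q * (outer_normal \<Omega> q \<bullet> i))"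
    and e: "e > 0"
  shows "\<exists>\<epsilon>0>0. \<forall>\<epsilon>. 0 < \<epsilon> \<and> \<epsilon> < \<epsilon>0 \<longrightarrow>
     (LINT x|M. indicator (layer \<epsilon>) x * \<bar>\<Sum>i\<in>Basis. dmink i x * X i x\<bar>) \<le> e * \<epsilon>"
proof -
  obtain C where C: "C > 0" "\<And>u U \<epsilon>. H1_approx u U \<Longrightarrow> 0 < \<epsilon> \<Longrightarrow> \<epsilon> \<le> 1 / 2 \<Longrightarrow>
       (LINT x|M. indicator (layer \<epsilon>) x * \<bar>u x\<bar>) \<le> C * \<epsilon> * ((LINT x|M. \<bar>u x\<bar>) + (\<Sum>i\<in>Basis. LINT x|M. \<bar>U i x\<bar>))"
    by (rule layer_trace_H1, rule that)
  obtain K where K: "K > 0" "\<And>\<psi> \<epsilon>. \<psi> \<in> borel_measurable (surface_measure \<Omega>) \<Longrightarrow> 0 < \<epsilon> \<Longrightarrow> \<epsilon> \<le> 1 / 2 \<Longrightarrow>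
       (\<integral>\<^sup>+x. \<psi> (radial x) * indicator (layer \<epsilon>) x \<partial>lborel) \<le> ennreal (K * \<epsilon>) * (\<integral>\<^sup>+x. \<psi> x \<partial>surface_measure \<Omega>)"
    by (rule layer_surface_bound, rule that)
  obtain D where D: "D > 0" "\<And>x. x \<in> closure \<Omega> \<Longrightarrow> norm (x - c) \<le> D" by (rule domain_radius, rule that)
  let ?P = "\<lambda>i U V. (\<forall>k::nat. continuous_on UNIV (U k) \<and>
        (\<exists>L\<ge>0. \<forall>x\<in>closure \<Omega>. \<forall>y\<in>closure \<Omega>. \<bar>U k x - U k y\<bar> \<le> L * norm (x - y)) \<and>
        H1_approx (\<lambda>x. X i x - U k x) (\<lambda>j x. Y i j x - V k j x)) \<and>
      (\<lambda>k. L2_norm \<Omega> (\<lambda>x. X i x - U k x)) \<longlonglongrightarrow> 0 \<and>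
      (\<forall>j\<in>Basis. (\<lambda>k. L2_norm \<Omega> (\<lambda>x. Y i j x - V k j x)) \<longlonglongrightarrow> 0) \<and>
      (\<lambda>k. \<integral>\<^sup>+x. ennreal ((U k x - G i x)\<^sup>2) \<partial>surface_measure \<Omega>) \<longlonglongrightarrow> 0"
  have "\<forall>i. \<exists>U. \<exists>V. i \<in> Basis \<longrightarrow> ?P i U V" using X(1) unfolding has_trace_approx_def by blast
  from choice[OF this] obtain U where "\<forall>i. \<exists>V. i \<in> Basis \<longrightarrow> ?P i (U i) V" by blast
  from choice[OF this] obtain V where "\<forall>i. i \<in> Basis \<longrightarrow> ?P i (U i) (V i)" by blast
  then have P: "\<And>i. i \<in> Basis \<Longrightarrow> ?P i (U i) (V i)" by blast
  have Gm: "\<And>i. i \<in> Basis \<Longrightarrow> G i \<in> borel_measurable (surface_measure \<Omega>)" using X(1) unfolding has_trace_approx_def by blast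
  define d where "d = real DIM('a)"
  have d: "d > 0" by (simp add: d_def)
  define m where "m = L2_norm \<Omega> (\<lambda>x. 1)"
  define V1 where "V1 = (LINT x|M. (1::real))"
  have V1: "V1 \<ge> 0" by (simp add: V1_def)
  \<comment> \<open>Each coordinate produces errors \<open>e1\<close>, \<open>2 * e1\<close> and
    \<open>e1\<close> times \<epsilon>; their sum is multiplied by \<open>1 / r\<close> and added up
    over \<open>d\<close> coordinates.\<close>
  define e1 where "e1 = e * r / (4 * d)"
  have e1: "e1 > 0" using e r d by (simp add: e1_def)
  define \<eta> where "\<eta> = e1 / (C * V1 + 1)"
  have CV: "C * V1 + 1 > 0" using C(1) V1 by (simp add: add_nonneg_pos)
  have \<eta>: "\<eta> > 0" using e1 CV by (simp add: \<eta>_def)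
  have \<eta>CV: "\<eta> * (C * V1) \<le> e1"
  proof -
    have "\<eta> * (C * V1) \<le> \<eta> * (C * V1 + 1)" using \<eta> by (intro mult_left_mono) auto
    also have "\<dots> = e1" using CV by (simp add: \<eta>_def)
    finally show ?thesis .
  qed
  define a where "a i k = m * (L2_norm \<Omega> (\<lambda>x. X i x - U i k x) + (\<Sum>j\<in>Basis. L2_norm \<Omega> (\<lambda>x. Y i j x - V i k j x)))" for i k
  have "\<forall>\<^sub>F k in sequentially. \<forall>i\<in>Basis. C * a i k < e1 \<and> (\<integral>\<^sup>+x. ennreal ((U i k x - G i x)\<^sup>2) \<partial>surface_measure \<Omega>) < ennreal (e1 * \<eta> / K)"
  proof (rule eventually_ball_finite[OF finite_Basis], rule ballI)
    fix i :: 'a assume i: "i \<in> Basis"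
    have "(\<lambda>k. C * a i k) \<longlonglongrightarrow> C * (m * (0 + (\<Sum>j\<in>(Basis::'a set). 0)))"
      unfolding a_def using P[OF i] by (intro tendsto_intros) auto
    then have "\<forall>\<^sub>F k in sequentially. C * a i k < e1" using e1 by (intro order_tendstoD(2)) auto
    moreover have "\<forall>\<^sub>F k in sequentially. (\<integral>\<^sup>+x. ennreal ((U i k x - G i x)\<^sup>2) \<partial>surface_measure \<Omega>) < ennreal (e1 * \<eta> / K)"
      using P[OF i] e1 \<eta> K(1) by (intro order_tendstoD(2)[of _ 0]) auto
    ultimately show "\<forall>\<^sub>F k in sequentially. C * a i k < e1 \<and> (\<integral>\<^sup>+x. ennreal ((U i k x - G i x)\<^sup>2) \<partial>surface_measure \<Omega>) < ennreal (e1 * \<eta> / K)"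
      by eventually_elim simp
  qed
  then obtain k where k: "\<And>i. i \<in> Basis \<Longrightarrow> C * a i k < e1"
    "\<And>i. i \<in> Basis \<Longrightarrow> (\<integral>\<^sup>+x. ennreal ((U i k x - G i x)\<^sup>2) \<partial>surface_measure \<Omega>) < ennreal (e1 * \<eta> / K)"
    by (auto simp: eventually_sequentially)
  have "\<forall>i. \<exists>L. i \<in> Basis \<longrightarrow> L \<ge> 0 \<and> (\<forall>x\<in>closure \<Omega>. \<forall>y\<in>closure \<Omega>. \<bar>U i k x - U i k y\<bar> \<le> L * norm (x - y))" using P by blast
  from choice[OF this] obtain L' where L': "\<And>i. i \<in> Basis \<Longrightarrow> L' i \<ge> 0"
    "\<And>i x y. i \<in> Basis \<Longrightarrow> x \<in> closure \<Omega> \<Longrightarrow> y \<in> closure \<Omega> \<Longrightarrow> \<bar>U i k x - U i k y\<bar> \<le> L' i * norm (x - y)" by blast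
  define L where "L = (\<Sum>i\<in>Basis. L' i)"
  have L0: "L \<ge> 0" using L' by (simp add: L_def sum_nonneg)
  have UL: "\<bar>U i k x - U i k y\<bar> \<le> L * norm (x - y)" if "i \<in> Basis" "x \<in> closure \<Omega>" "y \<in> closure \<Omega>" for i x y
  proof -
    have "L' i \<le> L" unfolding L_def using that L' by (intro member_le_sum) auto
    then have "L' i * norm (x - y) \<le> L * norm (x - y)" by (intro mult_right_mono) auto
    with L'(2)[OF that] show ?thesis by linarith
  qed
  have LD: "L * D * (C * V1) + 1 > 0" using L0 D(1) C(1) V1 by (simp add: add_nonneg_pos)
  \<comment> \<open>Chosen so that the Lipschitz error \<open>L * \<epsilon> * D\<close>, weighted
    with the bound \<open>C * V1 * \<epsilon>\<close> for the volume of the layer, stays below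
    \<open>e1 * \<epsilon>\<close>.\<close>
  define \<epsilon>0 where "\<epsilon>0 = min (1 / 2) (e1 / (L * D * (C * V1) + 1))"
  show ?thesis
  proof (intro exI[of _ \<epsilon>0] conjI allI impI)
    show "\<epsilon>0 > 0" using e1 LD by (simp add: \<epsilon>0_def)
    fix \<epsilon> assume \<epsilon>': "0 < \<epsilon> \<and> \<epsilon> < \<epsilon>0"
    then have \<epsilon>: "0 < \<epsilon>" "\<epsilon> \<le> 1 / 2" by (auto simp: \<epsilon>0_def)
    have "\<epsilon> < e1 / (L * D * (C * V1) + 1)" using \<epsilon>' by (simp add: \<epsilon>0_def)
    then have "\<epsilon> * (L * D * (C * V1) + 1) < e1" using LD by (simp add: less_divide_eq)
    then have \<epsilon>L: "L * \<epsilon> * D * (C * V1) \<le> e1" using \<epsilon>(1) by (simp add: algebra_simps)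
    obtain N where N: "N \<in> null_sets (surface_measure \<Omega>)" "{q \<in> space (surface_measure \<Omega>). \<not> 0 = (\<Sum>i\<in>Basis. G i q * (outer_normal \<Omega> q \<bullet> i))} \<subseteq> N"
      using n unfolding eventually_ae_filter by blast
    have lay: "AE x in M. \<forall>i\<in>Basis. ((\<lambda>t. mink (x + t *\<^sub>R i - c)) has_real_derivative dmink i x) (at 0)"
    proof -
      have "AE x in lborel. \<forall>i\<in>Basis. ((\<lambda>t. mink (x + t *\<^sub>R i - c)) has_real_derivative dmink i x) (at 0)"
        by (subst AE_finite_all) (auto intro: dmink(3))
      then show ?thesis unfolding AE_lebesgue_on_iff[OF \<Omega>_sets'] by eventually_elim simp
    qed
    have nul: "AE x in M. x \<in> layer \<epsilon> \<longrightarrow> radial x \<notin> N"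
      using layer_surface_null[OF N(1) \<epsilon>] unfolding AE_lebesgue_on_iff[OF \<Omega>_sets'] by eventually_elim simp
    let ?S = "\<lambda>x. \<Sum>i\<in>Basis. dmink i x * X i x"
    define f1 where "f1 i x = ennreal (indicator (layer \<epsilon>) x * \<bar>X i x - U i k x\<bar>)" for i x
    define f2 where "f2 x = ennreal (indicator (layer \<epsilon>) x * (L * \<epsilon> * D + \<eta>))" for x
    define f3 where "f3 i x = ennreal ((U i k (radial x) - G i (radial x))\<^sup>2) * indicator (layer \<epsilon>) x" for i x
    have SL: "?S \<in> L2 \<Omega>"
      using dmink(2) by (intro L2_sum L2_bounded_mult[OF X(2) dmink_measurable_M, of _ _ "1 / r"]) auto
    have Sint: "integrable M (\<lambda>x. indicator (layer \<epsilon>) x * \<bar>?S x\<bar>)"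
    proof -
      have "(\<lambda>x. indicator (layer \<epsilon>) x * ?S x) \<in> L2 \<Omega>"
        by (rule L2_bounded_mult[OF SL layer_measurable_M, of _ 1]) (auto simp: indicator_def)
      from L2_integrable[OF this] have "integrable M (\<lambda>x. \<bar>indicator (layer \<epsilon>) x * ?S x\<bar>)" by (rule integrable_abs)
      then show ?thesis by (simp add: abs_mult)
    qed
    have UkL: "U i k \<in> L2 \<Omega>" if "i \<in> Basis" for i
    proof -
      have "(\<lambda>x. X i x - U i k x) \<in> L2 \<Omega>" using P[OF that] H1_approxD(1) by blast
      from L2_diff[OF X(2)[OF that] this] show ?thesis by simp
    qed
    have f1m: "f1 i \<in> borel_measurable M" if "i \<in> Basis" for i
      unfolding f1_def
      by (intro measurable_compose[OF _ measurable_ennreal] borel_measurable_times layer_measurable_M borel_measurable_abs borel_measurable_diff L2_measurable X(2) UkL that)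
    have f2m: "f2 \<in> borel_measurable M"
      unfolding f2_def
      by (intro measurable_compose[OF _ measurable_ennreal] borel_measurable_times layer_measurable_M borel_measurable_const)
    have Uks: "U i k \<in> borel_measurable (surface_measure \<Omega>)" if "i \<in> Basis" for i
    proof -
      have "U i k \<in> borel_measurable borel" using P[OF that] by (intro borel_measurable_continuous_onI) blast
      then have "U i k \<in> borel_measurable (hausdorff_measure (DIM('a) - 1))"
        by (subst measurable_cong_sets[OF sets_hausdorff_measure refl])
      then show ?thesis unfolding surface_measure_def by (rule measurable_restrict_space1)
    qed
    have psm: "(\<lambda>q. ennreal ((U i k q - G i q)\<^sup>2)) \<in> borel_measurable (surface_measure \<Omega>)" if "i \<in> Basis" for i
      by (intro measurable_compose[OF _ measurable_ennreal] borel_measurable_power borel_measurable_diff Uks Gm that)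
    have f3b: "f3 i \<in> borel_measurable lborel" if "i \<in> Basis" for i
      unfolding f3_def by (rule radial_comp_measurable[OF psm[OF that] \<epsilon>(2)])
    then have f3m: "f3 i \<in> borel_measurable M" if "i \<in> Basis" for i
      using that by (intro measurable_restrict_space1 measurable_completion)
    have "ennreal (LINT x|M. indicator (layer \<epsilon>) x * \<bar>?S x\<bar>) = (\<integral>\<^sup>+x. ennreal (indicator (layer \<epsilon>) x * \<bar>?S x\<bar>) \<partial>M)"
      by (rule nn_integral_eq_integral[OF Sint, symmetric]) simp
    also have "\<dots> \<le> (\<integral>\<^sup>+x. (\<Sum>i\<in>Basis. ennreal (1 / r) * (f1 i x + (f2 x + ennreal (1 / \<eta>) * f3 i x))) \<partial>M)"
    proof (rule nn_integral_mono_AE)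
      show "AE x in M. ennreal (indicator (layer \<epsilon>) x * \<bar>?S x\<bar>) \<le> (\<Sum>i\<in>Basis. ennreal (1 / r) * (f1 i x + (f2 x + ennreal (1 / \<eta>) * f3 i x)))"
        using lay nul
      proof eventually_elim
        case (elim x)
        show ?case
        proof (cases "x \<in> layer \<epsilon>")
          case True
          have "radial x \<in> frontier \<Omega>" by (rule radial_frontier[OF layer_ne_c[OF True \<epsilon>(2)]])
          then have G0: "0 = (\<Sum>i\<in>Basis. G i (radial x) * (outer_normal \<Omega> (radial x) \<bullet> i))"
            using N(2) elim(2) True space_surface by auto
          have le: "\<bar>?S x\<bar> \<le> (\<Sum>i\<in>Basis. (1 / r) * (\<bar>X i x - U i k x\<bar> + ((L * \<epsilon> * D + \<eta>) + (1 / \<eta>) * (U i k (radial x) - G i (radial x))\<^sup>2)))"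
            by (rule trace_layer_pointwise[where U="\<lambda>i. U i k" and x=x and G=G and X=X, OF True \<epsilon> \<eta> L0 D(2) elim(1) G0 UL])
          have nn: "L * \<epsilon> * D + \<eta> \<ge> 0" using L0 \<epsilon> D(1) \<eta> by simp
          have "ennreal (\<Sum>i\<in>Basis. (1 / r) * (\<bar>X i x - U i k x\<bar> + ((L * \<epsilon> * D + \<eta>) + (1 / \<eta>) * (U i k (radial x) - G i (radial x))\<^sup>2)))
             = (\<Sum>i\<in>Basis. ennreal (1 / r) * (f1 i x + (f2 x + ennreal (1 / \<eta>) * f3 i x)))"
          proof (subst sum_ennreal[symmetric])
            show "0 \<le> (1 / r) * (\<bar>X i x - U i k x\<bar> + ((L * \<epsilon> * D + \<eta>) + (1 / \<eta>) * (U i k (radial x) - G i (radial x))\<^sup>2))" for i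
              using r \<eta> nn by simp
            show "(\<Sum>i\<in>Basis. ennreal ((1 / r) * (\<bar>X i x - U i k x\<bar> + ((L * \<epsilon> * D + \<eta>) + (1 / \<eta>) * (U i k (radial x) - G i (radial x))\<^sup>2))))
               = (\<Sum>i\<in>Basis. ennreal (1 / r) * (f1 i x + (f2 x + ennreal (1 / \<eta>) * f3 i x)))"
            proof (rule sum.cong[OF refl])
              fix i
              have "0 \<le> (1 / \<eta>) * (U i k (radial x) - G i (radial x))\<^sup>2" using \<eta> by simp
              then show "ennreal ((1 / r) * (\<bar>X i x - U i k x\<bar> + ((L * \<epsilon> * D + \<eta>) + (1 / \<eta>) * (U i k (radial x) - G i (radial x))\<^sup>2)))
                = ennreal (1 / r) * (f1 i x + (f2 x + ennreal (1 / \<eta>) * f3 i x))"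
                using True r \<eta> nn unfolding f1_def f2_def f3_def
                by (simp add: ennreal_mult[symmetric] ennreal_plus[symmetric] del: ennreal_plus)
            qed
          qed
          with ennreal_leI[OF le] True show ?thesis by simp
        qed simp
      qed
    qed
    also have "\<dots> = (\<Sum>i\<in>Basis. (\<integral>\<^sup>+x. ennreal (1 / r) * (f1 i x + (f2 x + ennreal (1 / \<eta>) * f3 i x)) \<partial>M))"
      by (rule nn_integral_sum)
        (intro borel_measurable_times_ennreal borel_measurable_add borel_measurable_const f1m f2m f3m; assumption)
    also have "\<dots> \<le> (\<Sum>i\<in>(Basis::'a set). ennreal (e * \<epsilon> / d))"
    proof (rule sum_mono)
      fix i :: 'a assume i: "i \<in> Basis"
      have H: "H1_approx (\<lambda>x. X i x - U i k x) (\<lambda>j x. Y i j x - V i k j x)" using P[OF i] by blast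
      have I1: "(\<integral>\<^sup>+x. f1 i x \<partial>M) \<le> ennreal (e1 * \<epsilon>)"
      proof -
        have "(\<lambda>x. indicator (layer \<epsilon>) x * (X i x - U i k x)) \<in> L2 \<Omega>"
          by (rule L2_bounded_mult[OF H1_approxD(1)[OF H] layer_measurable_M, of _ 1]) (auto simp: indicator_def)
        from L2_integrable[OF this] have "integrable M (\<lambda>x. \<bar>indicator (layer \<epsilon>) x * (X i x - U i k x)\<bar>)" by (rule integrable_abs)
        then have int: "integrable M (\<lambda>x. indicator (layer \<epsilon>) x * \<bar>X i x - U i k x\<bar>)" by (simp add: abs_mult)
        have "(\<integral>\<^sup>+x. f1 i x \<partial>M) = ennreal (LINT x|M. indicator (layer \<epsilon>) x * \<bar>X i x - U i k x\<bar>)"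
          unfolding f1_def by (rule nn_integral_eq_integral[OF int]) simp
        also have "\<dots> \<le> ennreal (e1 * \<epsilon>)"
        proof (rule ennreal_leI)
          have "(LINT x|M. \<bar>X i x - U i k x\<bar>) + (\<Sum>j\<in>Basis. LINT x|M. \<bar>Y i j x - V i k j x\<bar>) \<le> a i k"
            unfolding a_def distrib_left sum_distrib_left m_def
            by (intro add_mono sum_mono L1_le_L2 H1_approxD(1)[OF H] H1_approxD(2)[OF H])
          then have "C * \<epsilon> * ((LINT x|M. \<bar>X i x - U i k x\<bar>) + (\<Sum>j\<in>Basis. LINT x|M. \<bar>Y i j x - V i k j x\<bar>)) \<le> C * \<epsilon> * a i k"
            using C(1) \<epsilon> by (intro mult_left_mono) auto
          also have "C * \<epsilon> * a i k = (C * a i k) * \<epsilon>" by simp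
          also have "\<dots> \<le> e1 * \<epsilon>" using k(1)[OF i] \<epsilon> by (intro mult_right_mono) auto
          finally show "(LINT x|M. indicator (layer \<epsilon>) x * \<bar>X i x - U i k x\<bar>) \<le> e1 * \<epsilon>"
            using C(2)[OF H \<epsilon>] by linarith
        qed
        finally show ?thesis .
      qed
      have I2: "(\<integral>\<^sup>+x. f2 x \<partial>M) \<le> ennreal (2 * e1 * \<epsilon>)"
      proof -
        have "(\<integral>\<^sup>+x. f2 x \<partial>M) = ennreal (LINT x|M. indicator (layer \<epsilon>) x * (L * \<epsilon> * D + \<eta>))"
          unfolding f2_def using L0 \<epsilon> D(1) \<eta>
          by (intro nn_integral_eq_integral L2_integrable L2_bounded_mult[OF L2_const layer_measurable_M, of _ 1]) (auto simp: indicator_def)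
        also have "\<dots> \<le> ennreal (2 * e1 * \<epsilon>)"
        proof (rule ennreal_leI)
          have "(LINT x|M. indicator (layer \<epsilon>) x * (L * \<epsilon> * D + \<eta>)) = (LINT x|M. indicator (layer \<epsilon>) x * \<bar>1\<bar>) * (L * \<epsilon> * D + \<eta>)"
            by simp
          \<comment> \<open>The volume of the layer is estimated by the trace inequality for the
            constant function 1.\<close>
          also have "\<dots> \<le> (C * \<epsilon> * V1) * (L * \<epsilon> * D + \<eta>)"
            using C(2)[OF H1_approx_C1b[OF C1b_const] \<epsilon>, of 1] L0 \<epsilon> D(1) \<eta> by (intro mult_right_mono) (auto simp: V1_def)
          also have "\<dots> = \<epsilon> * (L * \<epsilon> * D * (C * V1) + \<eta> * (C * V1))" by (simp add: algebra_simps)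
          also have "\<dots> \<le> \<epsilon> * (e1 + e1)" using \<epsilon> \<epsilon>L \<eta>CV by (intro mult_left_mono add_mono) auto
          also have "\<epsilon> * (e1 + e1) = 2 * e1 * \<epsilon>" by simp
          finally show "(LINT x|M. indicator (layer \<epsilon>) x * (L * \<epsilon> * D + \<eta>)) \<le> 2 * e1 * \<epsilon>" .
        qed
        finally show ?thesis .
      qed
      have I3: "(\<integral>\<^sup>+x. ennreal (1 / \<eta>) * f3 i x \<partial>M) \<le> ennreal (e1 * \<epsilon>)"
      proof -
        have "(\<integral>\<^sup>+x. f3 i x \<partial>M) = (\<integral>\<^sup>+x. f3 i x \<partial>lborel)"
          unfolding nn_integral_lebesgue_on[OF \<Omega>_sets']
          by (intro nn_integral_cong) (use layer_sub in \<open>auto simp: f3_def indicator_def\<close>)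
        also have "\<dots> \<le> ennreal (K * \<epsilon>) * (\<integral>\<^sup>+x. ennreal ((U i k x - G i x)\<^sup>2) \<partial>surface_measure \<Omega>)"
          unfolding f3_def by (rule K(2)[OF psm[OF i] \<epsilon>])
        also have "\<dots> \<le> ennreal (K * \<epsilon>) * ennreal (e1 * \<eta> / K)"
          using k(2)[OF i] by (intro mult_left_mono) auto
        also have "\<dots> = ennreal ((K * \<epsilon>) * (e1 * \<eta> / K))" using K(1) \<epsilon> e1 \<eta> by (intro ennreal_mult[symmetric]) auto
        also have "(K * \<epsilon>) * (e1 * \<eta> / K) = \<epsilon> * e1 * \<eta>" using K(1) by simp
        finally have b: "(\<integral>\<^sup>+x. f3 i x \<partial>M) \<le> ennreal (\<epsilon> * e1 * \<eta>)" .
        have "(\<integral>\<^sup>+x. ennreal (1 / \<eta>) * f3 i x \<partial>M) = ennreal (1 / \<eta>) * (\<integral>\<^sup>+x. f3 i x \<partial>M)"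
          by (rule nn_integral_cmult[OF f3m[OF i]])
        also have "\<dots> \<le> ennreal (1 / \<eta>) * ennreal (\<epsilon> * e1 * \<eta>)" by (rule mult_left_mono[OF b]) simp
        also have "\<dots> = ennreal ((1 / \<eta>) * (\<epsilon> * e1 * \<eta>))" using \<epsilon> e1 \<eta> by (intro ennreal_mult[symmetric]) auto
        also have "(1 / \<eta>) * (\<epsilon> * e1 * \<eta>) = e1 * \<epsilon>" using \<eta> by simp
        finally show ?thesis .
      qed
      have f3m': "(\<lambda>x. ennreal (1 / \<eta>) * f3 i x) \<in> borel_measurable M"
        by (intro borel_measurable_times_ennreal borel_measurable_const f3m[OF i])
      have "(\<integral>\<^sup>+x. ennreal (1 / r) * (f1 i x + (f2 x + ennreal (1 / \<eta>) * f3 i x)) \<partial>M)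
        = ennreal (1 / r) * ((\<integral>\<^sup>+x. f1 i x \<partial>M) + ((\<integral>\<^sup>+x. f2 x \<partial>M) + (\<integral>\<^sup>+x. ennreal (1 / \<eta>) * f3 i x \<partial>M)))"
        by (subst nn_integral_cmult, intro borel_measurable_add f1m[OF i] f2m f3m',
            subst nn_integral_add, rule f1m[OF i], intro borel_measurable_add f2m f3m',
            subst nn_integral_add, rule f2m, rule f3m', rule refl)
      also have "\<dots> \<le> ennreal (1 / r) * (ennreal (e1 * \<epsilon>) + (ennreal (2 * e1 * \<epsilon>) + ennreal (e1 * \<epsilon>)))"
        by (intro mult_left_mono add_mono I1 I2 I3) simp
      also have "\<dots> = ennreal ((1 / r) * (e1 * \<epsilon> + (2 * e1 * \<epsilon> + e1 * \<epsilon>)))"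
        using r e1 \<epsilon> by (simp add: ennreal_mult[symmetric] ennreal_plus[symmetric] del: ennreal_plus)
      also have "(1 / r) * (e1 * \<epsilon> + (2 * e1 * \<epsilon> + e1 * \<epsilon>)) = e * \<epsilon> / d"
        using r d by (simp add: e1_def field_simps)
      finally show "(\<integral>\<^sup>+x. ennreal (1 / r) * (f1 i x + (f2 x + ennreal (1 / \<eta>) * f3 i x)) \<partial>M) \<le> ennreal (e * \<epsilon> / d)" .
    qed
    also have "\<dots> = ennreal (e * \<epsilon>)"
    proof -
      have "(\<Sum>i\<in>(Basis::'a set). ennreal (e * \<epsilon> / d)) = ennreal (\<Sum>i\<in>(Basis::'a set). e * \<epsilon> / d)"
        using e \<epsilon> d by (intro sum_ennreal) auto
      also have "(\<Sum>i\<in>(Basis::'a set). e * \<epsilon> / d) = e * \<epsilon>" using d by (simp add: d_def)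
      finally show ?thesis .
    qed
    finally show "(LINT x|M. indicator (layer \<epsilon>) x * \<bar>?S x\<bar>) \<le> e * \<epsilon>"
      using e \<epsilon> by (subst (asm) ennreal_le_iff) auto
  qed
qed

text \<open>The flux through the layer is controlled in L1, so \<open>w\<close> has to be bounded in
  order to be pulled out of the integral.\<close>

theorem green_formula:
  assumes w: "H1_approx w W" "AE x in M. \<bar>w x\<bar> \<le> B"
    and X: "\<And>i. i \<in> Basis \<Longrightarrow> H1_approx (X i) (Y i)" "\<And>i. i \<in> Basis \<Longrightarrow> has_trace_approx (X i) (Y i) (G i)"
    and n: "AE q in surface_measure \<Omega>. 0 = (\<Sum>i\<in>Basis. G i q * (outer_normal \<Omega> q \<bullet> i))"
  shows "(\<Sum>i\<in>Basis. LINT x|M. W i x * X i x + w x * Y i i x) = 0"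
proof -
  define \<epsilon> where "\<epsilon> k = 1 / (real k + 2)" for k :: nat
  have \<epsilon>: "0 < \<epsilon> k" "\<epsilon> k \<le> 1 / 2" for k by (auto simp: \<epsilon>_def field_simps)
  have \<epsilon>0: "\<epsilon> \<longlonglongrightarrow> 0" unfolding \<epsilon>_def[abs_def] by real_asymp
  define I where "I k = (\<Sum>i\<in>Basis. LINT x|M. cutoff (\<epsilon> k) x * (W i x * X i x + w x * Y i i x))" for k
  have int: "integrable M (\<lambda>x. W i x * X i x + w x * Y i i x)" if "i \<in> Basis" for i
    using H1_approxD(2)[OF w(1) that] H1_approxD[OF X(1)[OF that]] H1_approxD(1)[OF w(1)] that
    by (intro Bochner_Integration.integrable_add L2_mult_integrable) auto
  have lim: "I \<longlonglongrightarrow> (\<Sum>i\<in>Basis. LINT x|M. W i x * X i x + w x * Y i i x)"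
    unfolding I_def
  proof (rule tendsto_sum)
    fix i :: 'a assume i: "i \<in> Basis"
    let ?h = "\<lambda>x. W i x * X i x + w x * Y i i x"
    show "(\<lambda>k. LINT x|M. cutoff (\<epsilon> k) x * ?h x) \<longlonglongrightarrow> (LINT x|M. ?h x)"
    proof (rule integral_dominated_convergence)
      show "integrable M (\<lambda>x. \<bar>?h x\<bar>)" using int[OF i] by (rule integrable_abs)
      show hm: "?h \<in> borel_measurable M" using int[OF i] by (rule borel_measurable_integrable)
      show "(\<lambda>x. cutoff (\<epsilon> k) x * ?h x) \<in> borel_measurable M" for k
        by (rule borel_measurable_times[OF cutoff_measurable_M hm])
      show "AE x in M. norm (cutoff (\<epsilon> k) x * ?h x) \<le> \<bar>?h x\<bar>" for k
        using cutoff_bounds(3)[of "\<epsilon> k"] by (intro AE_I2) (auto simp: abs_mult mult_left_le_one_le)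
      show "AE x in M. (\<lambda>k. cutoff (\<epsilon> k) x * ?h x) \<longlonglongrightarrow> ?h x"
      proof (rule AE_M)
        fix x assume "x \<in> \<Omega>"
        then have m: "1 - mink (x - c) > 0" by (simp add: in_\<Omega>_iff)
        have "\<forall>\<^sub>F k in sequentially. \<epsilon> k < 1 - mink (x - c)" using order_tendstoD(2)[OF \<epsilon>0 m] .
        then have "\<forall>\<^sub>F k in sequentially. ?h x = cutoff (\<epsilon> k) x * ?h x"
        proof eventually_elim
          case (elim k)
          have "(1 - mink (x - c)) / \<epsilon> k \<ge> 1" using elim \<epsilon>(1)[of k] by (simp add: le_divide_eq)
          then have "cutoff (\<epsilon> k) x = 1" by (simp add: cutoff_def)
          then show ?case by simp
        qed
        then show "(\<lambda>k. cutoff (\<epsilon> k) x * ?h x) \<longlonglongrightarrow> ?h x" by (rule Lim_transform_eventually[OF tendsto_const])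
      qed
    qed
  qed
  have XL: "X i \<in> L2 \<Omega>" if "i \<in> Basis" for i using H1_approxD(1)[OF X(1)[OF that]] .
  let ?S = "\<lambda>x. \<Sum>i\<in>Basis. dmink i x * X i x"
  have dX: "(\<lambda>x. dmink i x * X i x) \<in> L2 \<Omega>" if "i \<in> Basis" for i
    using dmink(2)[OF that] by (intro L2_bounded_mult[OF XL dmink_measurable_M, of _ _ "1 / r"] that) auto
  have Ib: "\<bar>I k\<bar> \<le> \<bar>B\<bar> * ((1 / \<epsilon> k) * (LINT x|M. indicator (layer (\<epsilon> k)) x * \<bar>?S x\<bar>))" for k
  proof -
    have lw: "(\<lambda>x. indicator (layer (\<epsilon> k)) x * v x) \<in> L2 \<Omega>" if "v \<in> L2 \<Omega>" for v
      by (rule L2_bounded_mult[OF that layer_measurable_M, of _ 1]) (auto simp: indicator_def)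
    have i1: "integrable M (\<lambda>x. indicator (layer (\<epsilon> k)) x * (dmink i x * (w x * X i x)))" if "i \<in> Basis" for i
      using L2_mult_integrable[OF lw[OF dX[OF that]] H1_approxD(1)[OF w(1)]] by (simp add: mult_ac)
    have "I k = (\<Sum>i\<in>Basis. (1 / \<epsilon> k) * (LINT x|M. indicator (layer (\<epsilon> k)) x * (dmink i x * (w x * X i x))))"
      unfolding I_def by (intro sum.cong refl cutoff_integration_by_parts w X \<epsilon>)
    also have "\<dots> = (1 / \<epsilon> k) * (\<Sum>i\<in>Basis. LINT x|M. indicator (layer (\<epsilon> k)) x * (dmink i x * (w x * X i x)))"
      by (rule sum_distrib_left[symmetric])
    also have "(\<Sum>i\<in>Basis. LINT x|M. indicator (layer (\<epsilon> k)) x * (dmink i x * (w x * X i x)))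
       = (LINT x|M. (\<Sum>i\<in>Basis. indicator (layer (\<epsilon> k)) x * (dmink i x * (w x * X i x))))"
      by (rule Bochner_Integration.integral_sum[OF i1, symmetric])
    also have "(\<lambda>x. \<Sum>i\<in>Basis. indicator (layer (\<epsilon> k)) x * (dmink i x * (w x * X i x))) = (\<lambda>x. (indicator (layer (\<epsilon> k)) x * ?S x) * w x)"
      by (simp add: fun_eq_iff sum_distrib_left sum_distrib_right mult_ac)
    finally have "\<bar>I k\<bar> = (1 / \<epsilon> k) * \<bar>LINT x|M. (indicator (layer (\<epsilon> k)) x * ?S x) * w x\<bar>"
      using \<epsilon>(1)[of k] by (simp add: abs_mult)
    also have "\<bar>LINT x|M. (indicator (layer (\<epsilon> k)) x * ?S x) * w x\<bar> \<le> (LINT x|M. \<bar>B\<bar> * (indicator (layer (\<epsilon> k)) x * \<bar>?S x\<bar>))"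
    proof (rule order_trans[OF integral_abs_bound integral_mono_AE'])
      have "integrable M (\<lambda>x. \<bar>indicator (layer (\<epsilon> k)) x * ?S x\<bar>)"
        by (intro integrable_abs L2_integrable lw L2_sum dX)
      then show "integrable M (\<lambda>x. \<bar>B\<bar> * (indicator (layer (\<epsilon> k)) x * \<bar>?S x\<bar>))" by (simp add: abs_mult)
      show "AE x in M. \<bar>indicator (layer (\<epsilon> k)) x * ?S x * w x\<bar> \<le> \<bar>B\<bar> * (indicator (layer (\<epsilon> k)) x * \<bar>?S x\<bar>)"
        using w(2)
      proof eventually_elim
        case (elim x)
        then have "\<bar>w x\<bar> * (indicator (layer (\<epsilon> k)) x * \<bar>?S x\<bar>) \<le> \<bar>B\<bar> * (indicator (layer (\<epsilon> k)) x * \<bar>?S x\<bar>)"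
          by (intro mult_right_mono) auto
        then show ?case by (simp add: abs_mult mult_ac)
      qed
    qed simp
    finally show ?thesis using \<epsilon>(1)[of k] by (simp add: mult_left_mono divide_right_mono mult_ac)
  qed
  have "I \<longlonglongrightarrow> 0"
  proof (rule LIMSEQ_I)
    fix e :: real assume e: "e > 0"
    define e' where "e' = e / (2 * (\<bar>B\<bar> + 1))"
    have e': "e' > 0" using e by (simp add: e'_def add_nonneg_pos)
    obtain \<epsilon>1 where \<epsilon>1: "\<epsilon>1 > 0" "\<And>\<epsilon>. 0 < \<epsilon> \<Longrightarrow> \<epsilon> < \<epsilon>1 \<Longrightarrow> (LINT x|M. indicator (layer \<epsilon>) x * \<bar>?S x\<bar>) \<le> e' * \<epsilon>"
      using normal_flux_layer[OF X(2) XL n e'] by blast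
    from order_tendstoD(2)[OF \<epsilon>0 \<epsilon>1(1)] obtain k0 where k0: "\<And>k. k \<ge> k0 \<Longrightarrow> \<epsilon> k < \<epsilon>1" by (auto simp: eventually_sequentially)
    have "norm (I k - 0) < e" if "k \<ge> k0" for k
    proof -
      have "(1 / \<epsilon> k) * (LINT x|M. indicator (layer (\<epsilon> k)) x * \<bar>?S x\<bar>) \<le> (1 / \<epsilon> k) * (e' * \<epsilon> k)"
        using \<epsilon>(1)[of k] by (intro mult_left_mono \<epsilon>1(2) k0[OF that]) auto
      also have "\<dots> = e'" using \<epsilon>(1)[of k] by simp
      finally have "\<bar>I k\<bar> \<le> \<bar>B\<bar> * e'" using Ib[of k] by (meson abs_ge_zero mult_left_mono order_trans)
      also have "\<dots> < (\<bar>B\<bar> + 1) * e' * 2" using e' by (simp add: algebra_simps add_nonneg_pos)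
      also have "\<dots> = e"
      proof -
        have "2 * (\<bar>B\<bar> + 1) \<noteq> 0" by (simp add: add_nonneg_pos less_imp_neq[symmetric])
        then have "e' * (2 * (\<bar>B\<bar> + 1)) = e"
          by (simp only: e'_def times_divide_eq_left nonzero_mult_div_cancel_right not_False_eq_True)
        then show ?thesis by (simp add: algebra_simps)
      qed
      finally show ?thesis by simp
    qed
    then show "\<exists>no. \<forall>k\<ge>no. norm (I k - 0) < e" by blast
  qed
  then show ?thesis using LIMSEQ_unique[OF lim] by simp
qed

end

subsection \<open>Boundedness of functions with square-integrable second derivatives\<close>

context convex_domain
begin

text \<open>Taylor's formula at \<open>x\<close> from a variable point \<open>z\<close> of \<open>\<Omega>\<close>; averaging over \<open>z\<close> below leaves the
  weight \<open>s * s powr (- DIM('a) / 2)\<close>, which is integrable on \<open>[0, 1]\<close> in dimension at most three.\<close>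

lemma C2_taylor_bound:
  assumes u: "C1b u U" and U: "\<And>i. i \<in> Basis \<Longrightarrow> C1b (U i) (H i)" and x: "x \<in> \<Omega>" and z: "z \<in> \<Omega>"
    and D: "norm (z - x) \<le> D"
  shows "ennreal \<bar>u x\<bar> \<le> ennreal (\<bar>u z\<bar> + D * (\<Sum>i\<in>Basis. \<bar>U i z\<bar>))
     + ennreal (D\<^sup>2) * (\<integral>\<^sup>+s. ennreal (indicator {0..1} s * (s * (indicator \<Omega> (x + s *\<^sub>R (z - x)) * (\<Sum>i\<in>Basis. \<Sum>j\<in>Basis. \<bar>H i j (x + s *\<^sub>R (z - x))\<bar>)))) \<partial>lborel)"
proof -
  let ?g = "\<lambda>s. x + s *\<^sub>R (z - x)"
  let ?v = "z - x"
  define w where "w y = (\<Sum>i\<in>Basis. \<Sum>j\<in>Basis. \<bar>H i j y\<bar>)" for y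
  have D0: "D \<ge> 0" using D norm_ge_zero order_trans by blast
  have in\<Omega>: "?g s \<in> \<Omega>" if "s \<in> {0..1}" for s
  proof -
    have "(1 - s) *\<^sub>R x + s *\<^sub>R z \<in> \<Omega>" using \<Omega>(3) x z that by (auto simp: convex_alt)
    then show ?thesis by (simp add: algebra_simps)
  qed
  define h1 where "h1 s = (\<Sum>i\<in>Basis. (?v \<bullet> i) * U i (?g s))" for s
  define h2 where "h2 s = (\<Sum>i\<in>Basis. (?v \<bullet> i) * (\<Sum>j\<in>Basis. (?v \<bullet> j) * H i j (?g s)))" for s
  \<comment> \<open>Its derivative is \<open>- s\<close> times the second derivative along the
    segment, while \<open>k 0 = u x\<close> and \<open>k 1\<close> involves only data at
    \<open>z\<close>. The gain of this form of the remainder is the factor \<open>s\<close>, which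
    vanishes at \<open>x\<close>.\<close>
  define k where "k s = u (?g s) - s * h1 s" for s
  have chain: "((\<lambda>s. f (?g s)) has_real_derivative (\<Sum>j\<in>Basis. (?v \<bullet> j) * F j (?g s))) (at s within {0..1})"
    if f: "C1b f F" and s: "s \<in> {0..1}" for f F s
  proof -
    have "(?g has_derivative (\<lambda>q. q *\<^sub>R ?v)) (at s within {0..1})" by (auto intro!: derivative_eq_intros)
    from has_derivative_compose[OF this C1bD(1)[OF f in\<Omega>[OF s]]]
    have "((\<lambda>s. f (?g s)) has_derivative (\<lambda>q. \<Sum>j\<in>Basis. ((q *\<^sub>R ?v) \<bullet> j) * F j (?g s))) (at s within {0..1})" .
    then show ?thesis
      unfolding has_field_derivative_def by (rule has_derivative_eq_rhs) (simp add: fun_eq_iff sum_distrib_left mult_ac)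
  qed
  have dk: "(k has_real_derivative - s * h2 s) (at s within {0..1})" if s: "s \<in> {0..1}" for s
  proof -
    have "((\<lambda>s. u (?g s)) has_real_derivative h1 s) (at s within {0..1})"
      unfolding h1_def by (rule chain[OF u s])
    moreover have "(h1 has_real_derivative h2 s) (at s within {0..1})"
      unfolding h1_def[abs_def] h2_def by (intro DERIV_sum DERIV_cmult chain[OF U s])
    ultimately have "((\<lambda>s. u (?g s) - s * h1 s) has_real_derivative h1 s - (1 * h1 s + h2 s * s)) (at s within {0..1})"
      by (intro DERIV_diff DERIV_mult DERIV_ident)
    then show ?thesis by (simp add: k_def[abs_def] mult.commute)
  qed
  then have I: "((\<lambda>s. - s * h2 s) has_integral (k 1 - k 0)) {0..1}"
    by (intro fundamental_theorem_of_calculus) (auto simp: has_real_derivative_iff_has_vector_derivative)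
  have gc: "continuous_on {0..1} ?g" by (intro continuous_intros)
  have wc: "continuous_on {0..1} (\<lambda>s. w (?g s))"
    unfolding w_def
    by (intro continuous_intros continuous_on_compose2[OF C1bD(2)[OF U] gc]) (use in\<Omega> in auto)
  have h2b: "\<bar>h2 s\<bar> \<le> D\<^sup>2 * w (?g s)" for s
  proof -
    have vi: "\<bar>?v \<bullet> i\<bar> \<le> D" if "i \<in> Basis" for i using Basis_le_norm[OF that, of ?v] D by linarith
    have "\<bar>h2 s\<bar> \<le> (\<Sum>i\<in>Basis. D * (\<Sum>j\<in>Basis. D * \<bar>H i j (?g s)\<bar>))"
      unfolding h2_def
    proof (rule order_trans[OF sum_abs], rule sum_mono)
      fix i :: 'a assume i: "i \<in> Basis"
      have "\<bar>\<Sum>j\<in>Basis. (?v \<bullet> j) * H i j (?g s)\<bar> \<le> (\<Sum>j\<in>Basis. D * \<bar>H i j (?g s)\<bar>)"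
        by (rule order_trans[OF sum_abs], rule sum_mono) (auto simp: abs_mult intro!: mult_right_mono vi)
      then show "\<bar>(?v \<bullet> i) * (\<Sum>j\<in>Basis. (?v \<bullet> j) * H i j (?g s))\<bar> \<le> D * (\<Sum>j\<in>Basis. D * \<bar>H i j (?g s)\<bar>)"
        unfolding abs_mult using vi[OF i] D0 by (intro mult_mono) auto
    qed
    also have "\<dots> = D\<^sup>2 * w (?g s)" by (simp add: w_def sum_distrib_left power2_eq_square mult.assoc)
    finally show ?thesis .
  qed
  have wint: "(\<lambda>s. s * w (?g s)) integrable_on {0..1}"
    by (intro integrable_continuous_interval continuous_intros wc)
  define J where "J = integral {0..1} (\<lambda>s. s * w (?g s))"
  have w0: "w y \<ge> 0" for y by (simp add: w_def sum_nonneg)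
  have "norm (k 1 - k 0) \<le> integral {0..1} (\<lambda>s. D\<^sup>2 * (s * w (?g s)))"
    unfolding integral_unique[OF I, symmetric]
  proof (rule integral_norm_bound_integral)
    show "(\<lambda>s. - s * h2 s) integrable_on {0..1}" using I by blast
    show "(\<lambda>s. D\<^sup>2 * (s * w (?g s))) integrable_on {0..1}"
      by (intro integrable_continuous_interval continuous_intros wc)
    fix s :: real assume "s \<in> {0..1}"
    then show "norm (- s * h2 s) \<le> D\<^sup>2 * (s * w (?g s))"
      using mult_left_mono[OF h2b[of s], of s] by (simp add: abs_mult mult_ac)
  qed
  then have "\<bar>k 1 - k 0\<bar> \<le> D\<^sup>2 * J" by (simp add: J_def)
  moreover have "k 0 = u x" "k 1 = u z - h1 1" by (simp_all add: k_def)
  moreover have "\<bar>h1 1\<bar> \<le> D * (\<Sum>i\<in>Basis. \<bar>U i z\<bar>)"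
    unfolding h1_def sum_distrib_left
    by (rule order_trans[OF sum_abs], rule sum_mono)
      (auto simp: abs_mult intro!: mult_right_mono order_trans[OF Basis_le_norm D])
  ultimately have le: "\<bar>u x\<bar> \<le> (\<bar>u z\<bar> + D * (\<Sum>i\<in>Basis. \<bar>U i z\<bar>)) + D\<^sup>2 * J" by linarith
  have J0: "J \<ge> 0" unfolding J_def using w0 by (intro integral_nonneg wint) auto
  have "(\<integral>\<^sup>+s. ennreal (indicator {0..1} s * (s * w (?g s))) \<partial>lborel) = ennreal J"
    unfolding J_def using w0 by (intro nn_integral_has_integral_lebesgue integrable_integral wint) auto
  moreover have "(\<integral>\<^sup>+s. ennreal (indicator {0..1} s * (s * w (?g s))) \<partial>lborel)
    = (\<integral>\<^sup>+s. ennreal (indicator {0..1} s * (s * (indicator \<Omega> (?g s) * w (?g s)))) \<partial>lborel)"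
    by (intro nn_integral_cong) (use in\<Omega> in \<open>auto simp: indicator_def\<close>)
  moreover have "ennreal ((\<bar>u z\<bar> + D * (\<Sum>i\<in>Basis. \<bar>U i z\<bar>)) + D\<^sup>2 * J) = ennreal (\<bar>u z\<bar> + D * (\<Sum>i\<in>Basis. \<bar>U i z\<bar>)) + ennreal (D\<^sup>2) * ennreal J"
    using D0 J0 by (simp add: ennreal_mult[symmetric] ennreal_plus[symmetric] sum_nonneg del: ennreal_plus)
  ultimately show ?thesis using ennreal_leI[OF le] unfolding w_def by simp
qed

lemma powr_half_nn_integral: "(\<integral>\<^sup>+s. ennreal (indicator {0..1} s * s powr (- (1 / 2))) \<partial>lborel) = ennreal 2"
proof -
  have "((\<lambda>s. s powr (- (1 / 2))) has_integral (1 powr (- (1 / 2) + 1) / (- (1 / 2) + 1))) {0..1::real}"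
    by (rule has_integral_powr_from_0) auto
  then have "((\<lambda>s. s powr (- (1 / 2))) has_integral 2) {0..1::real}" by simp
  from nn_integral_has_integral_lebesgue[OF _ this] show ?thesis by simp
qed

text \<open>The exponents are fitted to dimension three: the substitution in
  \<open>sobolev_average\<close> multiplies the second term by at most \<open>s powr (- 3)\<close>,
  after which both terms have the integrable weight \<open>s powr (- (1 / 2))\<close>.\<close>

lemma young_weight:
  fixes s w :: real
  assumes s: "0 < s"
  shows "s * w \<le> s powr (- (1 / 2)) + s powr (5 / 2) * w\<^sup>2"
proof -
  define t where "t = s powr (3 / 2)"
  have t: "t > 0" using s by (simp add: t_def)
  have "0 \<le> (w * t - 1)\<^sup>2 + (w * t)\<^sup>2 + 1" by simp
  then have "w * t \<le> 1 + (w * t)\<^sup>2" by (simp add: power2_eq_square algebra_simps)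
  define p where "p = s powr (- (1 / 2))"
  have a: "p * t = s" using s by (simp add: p_def t_def powr_add[symmetric])
  have "p * t\<^sup>2 = s powr (- (1 / 2) + (3 / 2 + 3 / 2))"
    unfolding p_def t_def power2_eq_square powr_add ..
  also have "- (1 / 2) + (3 / 2 + 3 / 2) = (5 / 2 :: real)" by simp
  finally have b: "p * t\<^sup>2 = s powr (5 / 2)" .
  have "p * (w * t) \<le> p * (1 + (w * t)\<^sup>2)" using \<open>w * t \<le> 1 + (w * t)\<^sup>2\<close> by (rule mult_left_mono) (simp add: p_def)
  also have "p * (1 + (w * t)\<^sup>2) = p + (p * t\<^sup>2) * w\<^sup>2" by (simp add: power_mult_distrib algebra_simps)
  also have "p * (w * t) = (p * t) * w" by simp
  finally show ?thesis unfolding a b unfolding p_def .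
qed

lemma sobolev_average:
  fixes w :: "'a \<Rightarrow> real"
  assumes dim: "DIM('a) \<le> 3" and w: "continuous_on \<Omega> w" "\<And>y. w y \<ge> 0" "w \<in> L2 \<Omega>" and x: "x \<in> \<Omega>"
  shows "(\<integral>\<^sup>+z. (\<integral>\<^sup>+s. ennreal (indicator {0..1} s * (s * (indicator \<Omega> (x + s *\<^sub>R (z - x)) * w (x + s *\<^sub>R (z - x))))) \<partial>lborel) \<partial>M)
    \<le> 2 * (emeasure lborel \<Omega> + ennreal ((L2_norm \<Omega> w)\<^sup>2))"
proof -
  define v where "v y = indicator \<Omega> y * w y" for y
  have vm[measurable]: "v \<in> borel_measurable borel" unfolding v_def[abs_def] by (rule borel_indicator_continuous[OF w(1)])
  have v0: "v y \<ge> 0" for y using w(2) by (simp add: v_def)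
  have Q: "(\<integral>\<^sup>+y. ennreal ((v y)\<^sup>2) \<partial>lborel) = ennreal ((L2_norm \<Omega> w)\<^sup>2)"
    unfolding L2_nn_integral[OF w(3), symmetric] nn_integral_lebesgue_on[OF \<Omega>_sets']
    by (intro nn_integral_cong) (auto simp: v_def indicator_def)
  let ?T = "emeasure lborel \<Omega> + ennreal ((L2_norm \<Omega> w)\<^sup>2)"
  have "(\<integral>\<^sup>+z. (\<integral>\<^sup>+s. ennreal (indicator {0..1} s * (s * v (x + s *\<^sub>R (z - x)))) \<partial>lborel) \<partial>M)
    = (\<integral>\<^sup>+z. (\<integral>\<^sup>+s. ennreal (indicator {0..1} s * (s * v (x + s *\<^sub>R (z - x)))) * indicator \<Omega> z \<partial>lborel) \<partial>lborel)"
    unfolding nn_integral_lebesgue_on[OF \<Omega>_sets'] by (subst nn_integral_multc[symmetric]) auto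
  also have "\<dots> = (\<integral>\<^sup>+s. (\<integral>\<^sup>+z. ennreal (indicator {0..1} s * (s * v (x + s *\<^sub>R (z - x)))) * indicator \<Omega> z \<partial>lborel) \<partial>lborel)"
    by (rule pair_sigma_finite.Fubini') (auto intro!: pair_sigma_finite.intro lborel.sigma_finite_measure_axioms)
  also have "\<dots> \<le> (\<integral>\<^sup>+s. ennreal (indicator {0..1} s * s powr (- (1 / 2))) * ?T \<partial>lborel)"
  proof (rule nn_integral_mono)
    fix s :: real
    show "(\<integral>\<^sup>+z. ennreal (indicator {0..1} s * (s * v (x + s *\<^sub>R (z - x)))) * indicator \<Omega> z \<partial>lborel)
       \<le> ennreal (indicator {0..1} s * s powr (- (1 / 2))) * ?T"
    proof (cases "0 < s \<and> s \<le> 1")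
      case False
      then have z: "indicator {0..1} s * (s * v y) = 0" for y by (auto simp: indicator_def)
      show ?thesis unfolding z by simp
    next
      case s: True
      have "(\<integral>\<^sup>+z. ennreal (indicator {0..1} s * (s * v (x + s *\<^sub>R (z - x)))) * indicator \<Omega> z \<partial>lborel)
        \<le> (\<integral>\<^sup>+z. ennreal (s powr (- (1 / 2))) * indicator \<Omega> z + ennreal (s powr (5 / 2)) * ennreal ((v ((x - s *\<^sub>R x) + s *\<^sub>R z))\<^sup>2) \<partial>lborel)"
      proof (rule nn_integral_mono)
        fix z
        have "ennreal (s * v (x + s *\<^sub>R (z - x))) \<le> ennreal (s powr (- (1 / 2)) + s powr (5 / 2) * (v (x + s *\<^sub>R (z - x)))\<^sup>2)"
          using young_weight s by (intro ennreal_leI) auto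
        also have "\<dots> = ennreal (s powr (- (1 / 2))) + ennreal (s powr (5 / 2)) * ennreal ((v (x + s *\<^sub>R (z - x)))\<^sup>2)"
          by (simp add: ennreal_mult[symmetric] ennreal_plus[symmetric] del: ennreal_plus)
        also have "x + s *\<^sub>R (z - x) = (x - s *\<^sub>R x) + s *\<^sub>R z" by (simp add: algebra_simps)
        finally have le: "ennreal (s * v ((x - s *\<^sub>R x) + s *\<^sub>R z)) \<le> ennreal (s powr (- (1 / 2))) + ennreal (s powr (5 / 2)) * ennreal ((v ((x - s *\<^sub>R x) + s *\<^sub>R z))\<^sup>2)" .
        have eq: "x + s *\<^sub>R (z - x) = (x - s *\<^sub>R x) + s *\<^sub>R z" by (simp add: algebra_simps)
        show "ennreal (indicator {0..1} s * (s * v (x + s *\<^sub>R (z - x)))) * indicator \<Omega> z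
           \<le> ennreal (s powr (- (1 / 2))) * indicator \<Omega> z + ennreal (s powr (5 / 2)) * ennreal ((v ((x - s *\<^sub>R x) + s *\<^sub>R z))\<^sup>2)"
          unfolding eq using le s by (cases "z \<in> \<Omega>") simp_all
      qed
      also have "\<dots> = ennreal (s powr (- (1 / 2))) * emeasure lborel \<Omega> + ennreal (s powr (5 / 2)) * (\<integral>\<^sup>+z. ennreal ((v ((x - s *\<^sub>R x) + s *\<^sub>R z))\<^sup>2) \<partial>lborel)"
        by (subst nn_integral_add) (auto simp: nn_integral_cmult nn_integral_cmult_indicator)
      also have "(\<integral>\<^sup>+z. ennreal ((v ((x - s *\<^sub>R x) + s *\<^sub>R z))\<^sup>2) \<partial>lborel) = ennreal (1 / \<bar>s\<bar> ^ DIM('a)) * (\<integral>\<^sup>+y. ennreal ((v y)\<^sup>2) \<partial>lborel)"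
        using s by (intro nn_integral_lborel_affine) auto
      also have "ennreal (s powr (5 / 2)) * \<dots> = ennreal (s powr (5 / 2) * (1 / \<bar>s\<bar> ^ DIM('a))) * ennreal ((L2_norm \<Omega> w)\<^sup>2)"
      proof -
        have AB: "ennreal (s powr (5 / 2) * (1 / \<bar>s\<bar> ^ DIM('a))) = ennreal (s powr (5 / 2)) * ennreal (1 / \<bar>s\<bar> ^ DIM('a))"
          by (rule ennreal_mult) auto
        show ?thesis unfolding Q AB mult.assoc ..
      qed
      also have "\<dots> \<le> ennreal (s powr (- (1 / 2))) * ennreal ((L2_norm \<Omega> w)\<^sup>2)"
      proof (intro mult_right_mono ennreal_leI)
        \<comment> \<open>The restriction on the dimension is used here: since
          \<open>s \<le> 1\<close>, the Jacobian is at worst that of dimension three.\<close>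
        have "s ^ 3 \<le> s ^ DIM('a)" using s dim by (intro power_decreasing) auto
        then have "1 / s ^ DIM('a) \<le> 1 / s ^ 3" using s by (intro divide_left_mono) auto
        also have "\<dots> = s powr (- 3)" using s by (simp add: powr_minus divide_inverse powr_numeral)
        finally have "s powr (5 / 2) * (1 / \<bar>s\<bar> ^ DIM('a)) \<le> s powr (5 / 2) * s powr (- 3)" using s by (intro mult_left_mono) auto
        also have "\<dots> = s powr (- (1 / 2))" using s by (simp add: powr_add[symmetric])
        finally show "s powr (5 / 2) * (1 / \<bar>s\<bar> ^ DIM('a)) \<le> s powr (- (1 / 2))" .
      qed simp
      finally show ?thesis using s by (simp add: distrib_left)
    qed
  qed
  also have "\<dots> = ennreal 2 * ?T"
    by (subst nn_integral_multc) (auto simp: powr_half_nn_integral)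
  finally show ?thesis unfolding v_def by simp
qed

text \<open>Averaging Taylor's formula over \<open>z\<close> gives a bound whose constants do not
  depend on \<open>u\<close>, so it can be applied to all smoothings at once. The Hessian enters
  squared because Young's inequality replaces Cauchy-Schwarz; for mere boundedness this is
  enough.\<close>

lemma sobolev_C2:
  assumes dim: "DIM('a) \<le> 3"
  shows "\<exists>D>0. \<forall>u U H. \<forall>x\<in>\<Omega>. C1b u U \<longrightarrow> (\<forall>i\<in>Basis. C1b (U i) (H i)) \<longrightarrow>
     \<bar>u x\<bar> * measure lborel \<Omega> \<le> (LINT z|M. \<bar>u z\<bar> + D * (\<Sum>i\<in>Basis. \<bar>U i z\<bar>)) +
        D\<^sup>2 * (2 * (measure lborel \<Omega> + (L2_norm \<Omega> (\<lambda>y. \<Sum>i\<in>Basis. \<Sum>j\<in>Basis. \<bar>H i j y\<bar>))\<^sup>2))"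
proof -
  obtain D0 where D0: "D0 > 0" "\<And>x. x \<in> closure \<Omega> \<Longrightarrow> norm (x - c) \<le> D0" by (rule domain_radius, rule that)
  define D where "D = 2 * D0"
  have D: "D > 0" "\<And>x z. x \<in> \<Omega> \<Longrightarrow> z \<in> \<Omega> \<Longrightarrow> norm (z - x) \<le> D"
  proof -
    show "D > 0" using D0 by (simp add: D_def)
    fix x z assume xz: "x \<in> \<Omega>" "z \<in> \<Omega>"
    have "norm (z - x) \<le> norm (z - c) + norm (x - c)" using norm_triangle_ineq4[of "z - c" "x - c"] by simp
    also have "\<dots> \<le> D0 + D0" using xz closure_subset by (intro add_mono D0(2)) auto
    finally show "norm (z - x) \<le> D" by (simp add: D_def)
  qed
  show ?thesis
  proof (intro exI[of _ D] conjI D(1) allI ballI impI)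
    fix u U H x assume x: "x \<in> \<Omega>" and u: "C1b u U" and "\<forall>i\<in>Basis. C1b (U i) (H i)"
    then have U: "\<And>i. i \<in> Basis \<Longrightarrow> C1b (U i) (H i)" by blast
    define w where "w y = (\<Sum>i\<in>Basis. \<Sum>j\<in>Basis. \<bar>H i j y\<bar>)" for y
    have wc: "continuous_on \<Omega> w" unfolding w_def by (intro continuous_intros C1bD(2)[OF U])
    have w0: "w y \<ge> 0" for y by (simp add: w_def sum_nonneg)
    have "(\<lambda>y. \<bar>H i j y\<bar>) \<in> L2 \<Omega>" if "i \<in> Basis" "j \<in> Basis" for i j
      using C1b_L2(2)[OF U[OF that(1)] that(2)] by (auto simp: L2_def)
    then have wL: "w \<in> L2 \<Omega>" unfolding w_def by (intro L2_sum)
    define e where "e z = \<bar>u z\<bar> + D * (\<Sum>i\<in>Basis. \<bar>U i z\<bar>)" for z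
    have ec: "continuous_on \<Omega> e" unfolding e_def by (intro continuous_intros C1bD(4)[OF u] C1bD(2)[OF u])
    have e0: "e z \<ge> 0" for z using D(1) by (simp add: e_def sum_nonneg)
    obtain B where B: "\<And>x. x \<in> \<Omega> \<Longrightarrow> \<bar>u x\<bar> \<le> B \<and> (\<forall>i\<in>Basis. \<bar>U i x\<bar> \<le> B)" using C1bD(3)[OF u] by blast
    have eB: "e z \<le> B + D * (\<Sum>i\<in>(Basis::'a set). B)" if "z \<in> \<Omega>" for z
      unfolding e_def using B[OF that] D(1) by (intro add_mono mult_left_mono sum_mono) auto
    have vol: "emeasure lborel \<Omega> = ennreal (measure lborel \<Omega>)"
      using emeasure_bounded_finite[OF \<Omega>(2)] by (intro emeasure_eq_ennreal_measure) auto
    have em: "emeasure M \<Omega> = emeasure lborel \<Omega>" by (simp add: emeasure_restrict_space)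
    let ?I = "\<lambda>z. \<integral>\<^sup>+s. ennreal (indicator {0..1} s * (s * (indicator \<Omega> (x + s *\<^sub>R (z - x)) * w (x + s *\<^sub>R (z - x))))) \<partial>lborel"
    have [measurable]: "(\<lambda>y. indicator \<Omega> y * w y) \<in> borel_measurable borel" by (rule borel_indicator_continuous[OF wc])
    have Im: "?I \<in> borel_measurable M"
    proof -
      have "?I \<in> borel_measurable lborel" by measurable
      then show ?thesis by (intro measurable_restrict_space1 measurable_completion)
    qed
    have "ennreal (\<bar>u x\<bar> * measure lborel \<Omega>) = (\<integral>\<^sup>+z. ennreal \<bar>u x\<bar> \<partial>M)"
      using em vol by (simp add: space_restrict_space ennreal_mult)
    also have "\<dots> \<le> (\<integral>\<^sup>+z. ennreal (e z) + ennreal (D\<^sup>2) * ?I z \<partial>M)"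
    proof (rule nn_integral_mono)
      fix z assume "z \<in> space M"
      then have z: "z \<in> \<Omega>" by (simp add: space_restrict_space)
      show "ennreal \<bar>u x\<bar> \<le> ennreal (e z) + ennreal (D\<^sup>2) * ?I z"
        using C2_taylor_bound[OF u U x z D(2)[OF x z]] unfolding e_def w_def .
    qed
    also have "\<dots> = (\<integral>\<^sup>+z. ennreal (e z) \<partial>M) + ennreal (D\<^sup>2) * (\<integral>\<^sup>+z. ?I z \<partial>M)"
      using Im continuous_measurable[OF ec] by (subst nn_integral_add) (auto simp: nn_integral_cmult)
    also have "\<dots> \<le> ennreal (LINT z|M. e z) + ennreal (D\<^sup>2) * (2 * (emeasure lborel \<Omega> + ennreal ((L2_norm \<Omega> w)\<^sup>2)))"
      using LINT_nonneg_bounded[OF continuous_measurable[OF ec] e0 eB]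
      by (intro add_mono mult_left_mono sobolev_average[OF dim wc w0 wL x]) auto
    also have "\<dots> = ennreal ((LINT z|M. e z) + D\<^sup>2 * (2 * (measure lborel \<Omega> + (L2_norm \<Omega> w)\<^sup>2)))"
    proof -
      define T where "T = measure lborel \<Omega> + (L2_norm \<Omega> w)\<^sup>2"
      have T0: "T \<ge> 0" by (simp add: T_def)
      have "emeasure lborel \<Omega> + ennreal ((L2_norm \<Omega> w)\<^sup>2) = ennreal T"
        unfolding vol T_def by (intro ennreal_plus[symmetric]) auto
      moreover have "2 * ennreal T = ennreal (2 * T)" using T0 by (subst ennreal_mult) auto
      moreover have "ennreal (D\<^sup>2) * ennreal (2 * T) = ennreal (D\<^sup>2 * (2 * T))"
        using T0 by (intro ennreal_mult[symmetric]) auto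
      moreover have "ennreal (LINT z|M. e z) + ennreal (D\<^sup>2 * (2 * T)) = ennreal ((LINT z|M. e z) + D\<^sup>2 * (2 * T))"
        using e0 T0 by (intro ennreal_plus[symmetric]) auto
      ultimately show ?thesis unfolding T_def by simp
    qed
    finally have "ennreal (\<bar>u x\<bar> * measure lborel \<Omega>) \<le> \<dots>" .
    then have "\<bar>u x\<bar> * measure lborel \<Omega> \<le> (LINT z|M. e z) + D\<^sup>2 * (2 * (measure lborel \<Omega> + (L2_norm \<Omega> w)\<^sup>2))"
      using e0 by (subst (asm) ennreal_le_iff) auto
    then show "\<bar>u x\<bar> * measure lborel \<Omega> \<le> (LINT z|M. \<bar>u z\<bar> + D * (\<Sum>i\<in>Basis. \<bar>U i z\<bar>)) +
        D\<^sup>2 * (2 * (measure lborel \<Omega> + (L2_norm \<Omega> (\<lambda>y. \<Sum>i\<in>Basis. \<Sum>j\<in>Basis. \<bar>H i j y\<bar>))\<^sup>2))"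
      unfolding e_def w_def .
  qed
qed

section \<open>From C1 functions to weak derivatives\<close>

lemma smoothing_C1b:
  assumes f: "f \<in> L2 \<Omega>" and g: "\<And>i. i \<in> Basis \<Longrightarrow> g i \<in> L2 \<Omega>" "\<And>i. i \<in> Basis \<Longrightarrow> has_weak_deriv \<Omega> [i] f (g i)"
  shows "C1b (smoothing (scl k) f) (\<lambda>i x. scl k * smoothing (scl k) (g i) x)"
  unfolding C1b_def
proof (intro conjI ballI)
  note a = scl(1,2)[of k]
  show "(smoothing (scl k) f has_derivative (\<lambda>v. \<Sum>i\<in>Basis. v \<bullet> i * (scl k * smoothing (scl k) (g i) x))) (at x)" if "x \<in> \<Omega>" for x
    by (rule smoothing_has_derivative_weak[OF f g(2) a that])
  show "continuous_on \<Omega> (\<lambda>x. scl k * smoothing (scl k) (g i) x)" if "i \<in> Basis" for i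
    by (intro continuous_intros smoothing_continuous g(1) that a)
  obtain B0 where B0: "\<And>x. \<bar>smoothing (scl k) f x\<bar> \<le> B0" using smoothing_bounded[OF f a(2)] by blast
  have "\<forall>i. \<exists>B. i \<in> Basis \<longrightarrow> (\<forall>x. \<bar>smoothing (scl k) (g i) x\<bar> \<le> B)" using smoothing_bounded[OF g(1) a(2)] by blast
  from choice[OF this] obtain B where B: "\<And>i x. i \<in> Basis \<Longrightarrow> \<bar>smoothing (scl k) (g i) x\<bar> \<le> B i" by blast
  have B00: "B0 \<ge> 0" using order_trans[OF abs_ge_zero B0] .
  have B0': "B i \<ge> 0" if "i \<in> Basis" for i using order_trans[OF abs_ge_zero B[OF that]] .
  show "\<exists>B. \<forall>x\<in>\<Omega>. \<bar>smoothing (scl k) f x\<bar> \<le> B \<and> (\<forall>i\<in>Basis. \<bar>scl k * smoothing (scl k) (g i) x\<bar> \<le> B)"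
  proof (intro exI[of _ "B0 + (\<Sum>i\<in>Basis. B i)"] ballI conjI)
    fix x
    have "(\<Sum>i\<in>Basis. B i) \<ge> 0" using B0' by (intro sum_nonneg) auto
    then show "\<bar>smoothing (scl k) f x\<bar> \<le> B0 + (\<Sum>i\<in>Basis. B i)" using B0[of x] by linarith
    fix i :: 'a assume i: "i \<in> Basis"
    have "\<bar>scl k * smoothing (scl k) (g i) x\<bar> \<le> 1 * B i"
      unfolding abs_mult using a B[OF i] by (intro mult_mono) auto
    also have "\<dots> \<le> (\<Sum>i\<in>Basis. B i)" using member_le_sum[OF i, of B] B0' by auto
    finally show "\<bar>scl k * smoothing (scl k) (g i) x\<bar> \<le> B0 + (\<Sum>i\<in>Basis. B i)" using B00 by simp
  qed
qed

lemma H1_approx_weak: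
  assumes f: "f \<in> L2 \<Omega>" and g: "\<And>i. i \<in> Basis \<Longrightarrow> g i \<in> L2 \<Omega>" "\<And>i. i \<in> Basis \<Longrightarrow> has_weak_deriv \<Omega> [i] f (g i)"
  shows "H1_approx f g"
  unfolding H1_approx_def
  using smoothing_C1b[OF assms] smoothing_tendsto[OF f] L2_tendsto_cmult[OF smoothing_tendsto[OF g(1)] scl(4)]
  by (intro exI[of _ "\<lambda>k. smoothing (scl k) f"] exI[of _ "\<lambda>k i x. scl k * smoothing (scl k) (g i) x"]) auto

lemma L2_tendsto_AE_subseq:
  assumes "L2_tendsto \<Omega> f g"
  obtains s :: "nat \<Rightarrow> nat" where "strict_mono s" "AE x in M. (\<lambda>k. f (s k) x) \<longlonglongrightarrow> g x"
proof -
  note D = L2_tendstoD[OF assms]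
  have d: "(\<lambda>x. f k x - g x) \<in> L2 \<Omega>" for k by (rule L2_diff[OF D(1,2)])
  have "(\<lambda>k. LINT x|M. norm (f k x - g x)) \<longlonglongrightarrow> 0"
  proof (rule Lim_null_comparison)
    show "\<forall>\<^sub>F k in sequentially. norm (LINT x|M. norm (f k x - g x)) \<le> L2_norm \<Omega> (\<lambda>x. 1) * L2_norm \<Omega> (\<lambda>x. f k x - g x)"
      using L1_le_L2[OF d] by (auto intro!: always_eventually)
    show "(\<lambda>k. L2_norm \<Omega> (\<lambda>x. 1) * L2_norm \<Omega> (\<lambda>x. f k x - g x)) \<longlonglongrightarrow> 0"
      by (auto intro!: tendsto_eq_intros D(3))
  qed
  then obtain s :: "nat \<Rightarrow> nat" where s: "strict_mono s" "AE x in M. (\<lambda>k. f (s k) x - g x) \<longlonglongrightarrow> 0"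
    using tendsto_L1_AE_subseq[of M "\<lambda>k x. f k x - g x", OF L2_integrable[OF d]] by blast
  have "AE x in M. (\<lambda>k. f (s k) x) \<longlonglongrightarrow> g x"
    using s(2) by eventually_elim (rule LIM_zero_cancel)
  with s(1) show thesis by (rule that)
qed

text \<open>The right-hand side of \<open>sobolev_C2\<close> converges along the smoothings of
  \<open>f\<close> and is therefore bounded, which bounds the smoothings uniformly; a subsequence
  converging almost everywhere passes the bound on to \<open>f\<close>.\<close>

theorem sobolev_bounded:
  assumes dim: "DIM('a) \<le> 3" and f: "f \<in> L2 \<Omega>"
    and g: "\<And>i. i \<in> Basis \<Longrightarrow> g i \<in> L2 \<Omega>" "\<And>i. i \<in> Basis \<Longrightarrow> has_weak_deriv \<Omega> [i] f (g i)"
    and h: "\<And>i j. i \<in> Basis \<Longrightarrow> j \<in> Basis \<Longrightarrow> h i j \<in> L2 \<Omega>" "\<And>i j. i \<in> Basis \<Longrightarrow> j \<in> Basis \<Longrightarrow> has_weak_deriv \<Omega> [j] (g i) (h i j)"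
  shows "\<exists>B. AE x in M. \<bar>f x\<bar> \<le> B"
proof -
  obtain D where D: "D > 0" "\<And>u U H x. x \<in> \<Omega> \<Longrightarrow> C1b u U \<Longrightarrow> (\<And>i. i \<in> Basis \<Longrightarrow> C1b (U i) (H i)) \<Longrightarrow>
     \<bar>u x\<bar> * measure lborel \<Omega> \<le> (LINT z|M. \<bar>u z\<bar> + D * (\<Sum>i\<in>Basis. \<bar>U i z\<bar>)) +
        D\<^sup>2 * (2 * (measure lborel \<Omega> + (L2_norm \<Omega> (\<lambda>y. \<Sum>i\<in>Basis. \<Sum>j\<in>Basis. \<bar>H i j y\<bar>))\<^sup>2))"
    using sobolev_C2[OF dim] by blast
  define u where "u k = smoothing (scl k) f" for k
  define U where "U k i x = scl k * smoothing (scl k) (g i) x" for k i x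
  define H where "H k i j x = scl k * (scl k * smoothing (scl k) (h i j) x)" for k i j x
  have cu: "C1b (u k) (U k)" for k unfolding u_def U_def by (rule smoothing_C1b[OF f g])
  have cU: "C1b (U k i) (H k i)" if i: "i \<in> Basis" for k i
  proof -
    have "C1b (\<lambda>x. (\<lambda>x. scl k) x * smoothing (scl k) (g i) x) (\<lambda>j x. (\<lambda>i x. 0) j x * smoothing (scl k) (g i) x + (\<lambda>x. scl k) x * (scl k * smoothing (scl k) (h i j) x))"
      by (rule C1b_mult[OF C1b_const smoothing_C1b]) (use g h i in auto)
    then show ?thesis unfolding U_def H_def by simp
  qed
  have tu: "L2_tendsto \<Omega> u f" unfolding u_def by (rule smoothing_tendsto[OF f])
  have tU: "L2_tendsto \<Omega> (\<lambda>k x. \<bar>U k i x\<bar>) (\<lambda>x. \<bar>1 * g i x\<bar>)" if "i \<in> Basis" for i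
    unfolding U_def by (intro L2_tendsto_abs L2_tendsto_cmult smoothing_tendsto g that scl)
  have tH: "L2_tendsto \<Omega> (\<lambda>k x. \<bar>H k i j x\<bar>) (\<lambda>x. \<bar>1 * (1 * h i j x)\<bar>)" if "i \<in> Basis" "j \<in> Basis" for i j
    unfolding H_def by (intro L2_tendsto_abs L2_tendsto_cmult smoothing_tendsto h that scl)
  have tsum: "L2_tendsto \<Omega> (\<lambda>k x. \<Sum>i\<in>I. F k i x) (\<lambda>x. \<Sum>i\<in>I. G i x)"
    if "finite I" "\<And>i. i \<in> I \<Longrightarrow> L2_tendsto \<Omega> (\<lambda>k. F k i) (G i)" for I :: "'a set" and F G
    using that
  proof (induction I rule: finite_induct)
    case empty
    then show ?case by (simp add: L2_tendsto_def L2_zero L2_norm_def L2_inner_def)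
  next
    case (insert i I)
    then show ?case using L2_tendsto_add[of \<Omega> "\<lambda>k. F k i" "G i" "\<lambda>k x. \<Sum>i\<in>I. F k i x" "\<lambda>x. \<Sum>i\<in>I. G i x"] by simp
  qed
  define R where "R k = (LINT z|M. \<bar>u k z\<bar> + D * (\<Sum>i\<in>Basis. \<bar>U k i z\<bar>)) +
        D\<^sup>2 * (2 * (measure lborel \<Omega> + (L2_norm \<Omega> (\<lambda>y. \<Sum>i\<in>Basis. \<Sum>j\<in>Basis. \<bar>H k i j y\<bar>))\<^sup>2))" for k
  have lim1: "(\<lambda>k. LINT z|M. \<bar>u k z\<bar> + D * (\<Sum>i\<in>Basis. \<bar>U k i z\<bar>)) \<longlonglongrightarrow> (LINT z|M. \<bar>f z\<bar> + D * (\<Sum>i\<in>Basis. \<bar>1 * g i z\<bar>))"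
    by (intro L2_tendsto_integral L2_tendsto_add L2_tendsto_abs[OF tu] L2_tendsto_cmult[OF _ tendsto_const] tsum tU finite_Basis)
  have lim2: "(\<lambda>k. L2_norm \<Omega> (\<lambda>y. \<Sum>i\<in>Basis. \<Sum>j\<in>Basis. \<bar>H k i j y\<bar>)) \<longlonglongrightarrow> L2_norm \<Omega> (\<lambda>y. \<Sum>i\<in>Basis. \<Sum>j\<in>Basis. \<bar>1 * (1 * h i j y)\<bar>)"
    by (intro L2_tendsto_norm tsum tH finite_Basis)
  have "convergent R"
    unfolding R_def by (rule convergentI[OF tendsto_add[OF lim1 tendsto_mult[OF tendsto_const tendsto_mult[OF tendsto_const
          tendsto_add[OF tendsto_const tendsto_power[OF lim2]]]]]])
  then obtain B where B: "\<And>k. R k \<le> B"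
    using convergent_imp_Bseq[of R] unfolding Bseq_def by (metis abs_le_D1 real_norm_def)
  define m where "m = measure lborel \<Omega>"
  have m: "m > 0"
  proof -
    have "emeasure lborel \<Omega> \<noteq> 0"
    proof
      assume "emeasure lborel \<Omega> = 0"
      then have "\<Omega> \<in> null_sets lborel" by auto
      then have "negligible \<Omega>" by (simp add: negligible_iff_null_sets null_sets_completionI)
      then show False using open_not_negligible[OF \<Omega>(1)] c_in by blast
    qed
    moreover have "emeasure lborel \<Omega> = ennreal m" unfolding m_def
      using emeasure_bounded_finite[OF \<Omega>(2)] by (intro emeasure_eq_ennreal_measure) auto
    ultimately show ?thesis by (simp add: m_def zero_less_measure_iff)
  qed
  have ub: "\<bar>u k x\<bar> \<le> B / m" if "x \<in> \<Omega>" for k x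
  proof -
    have "\<bar>u k x\<bar> * m \<le> R k" unfolding R_def m_def by (rule D(2)[OF that cu cU])
    then have "\<bar>u k x\<bar> * m \<le> B" using B[of k] by linarith
    then show ?thesis using m by (simp add: le_divide_eq)
  qed
  obtain s :: "nat \<Rightarrow> nat" where s: "strict_mono s" "AE x in M. (\<lambda>k. u (s k) x) \<longlonglongrightarrow> f x"
    by (rule L2_tendsto_AE_subseq[OF tu], rule that)
  have "AE x in M. \<bar>f x\<bar> \<le> B / m"
    using s(2) AE_space
  proof eventually_elim
    case (elim x)
    then have "x \<in> \<Omega>" by (simp add: space_restrict_space)
    then show ?case using ub by (intro LIMSEQ_le_const2[OF tendsto_rabs[OF elim(1)]]) auto
  qed
  then show ?thesis by blast
qed

end

subsection \<open>Calculus of weak derivatives\<close>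

lemma locally_integrable_test:
  fixes g :: "'a::euclidean_space \<Rightarrow> real"
  assumes \<Omega>: "open \<Omega>" and g: "locally_integrable \<Omega> g" and \<phi>: "\<phi> \<in> test_functions \<Omega>"
  shows "integrable (lebesgue_on \<Omega>) (\<lambda>x. g x * \<phi> x)"
proof -
  let ?K = "closure {x. \<phi> x \<noteq> 0}"
  have K: "compact ?K" "?K \<subseteq> \<Omega>" and s: "smooth \<phi>" using \<phi> by (auto simp: test_functions_def)
  have \<phi>c: "continuous_on A \<phi>" for A using smooth_continuous_on[OF s, of "[]"] by simp
  have "bounded (\<phi> ` ?K)" by (intro compact_imp_bounded compact_continuous_image \<phi>c K)
  then obtain B where B: "\<And>x. x \<in> ?K \<Longrightarrow> \<bar>\<phi> x\<bar> \<le> B" by (auto simp: bounded_iff)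
  have "integrable (lebesgue_on ?K) g" using g K by (auto simp: locally_integrable_def)
  then have gK: "integrable lebesgue (\<lambda>x. indicator ?K x * g x)"
    using K by (simp add: integrable_restrict_space lmeasurable_compact fmeasurableD)
  have "integrable lebesgue (\<lambda>x. (indicator ?K x * g x) * \<phi> x)"
  proof (rule Bochner_Integration.integrable_bound[of _ "\<lambda>x. B * (indicator ?K x * g x)"])
    show "integrable lebesgue (\<lambda>x. B * (indicator ?K x * g x))" using gK by simp
    have "\<phi> \<in> borel_measurable lebesgue"
      by (intro measurable_completion) (use \<phi>c in \<open>auto intro: borel_measurable_continuous_onI\<close>)
    then show "(\<lambda>x. (indicator ?K x * g x) * \<phi> x) \<in> borel_measurable lebesgue"
      using borel_measurable_integrable[OF gK] by (rule borel_measurable_times[rotated])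
    show "AE x in lebesgue. norm (indicator ?K x * g x * \<phi> x) \<le> norm (B * (indicator ?K x * g x))"
    proof (intro AE_I2)
      fix x show "norm (indicator ?K x * g x * \<phi> x) \<le> norm (B * (indicator ?K x * g x))"
      proof (cases "x \<in> ?K")
        case True
        then have "\<bar>g x\<bar> * \<bar>\<phi> x\<bar> \<le> \<bar>g x\<bar> * \<bar>B\<bar>" using B[OF True] by (intro mult_left_mono) auto
        then show ?thesis using True by (simp add: abs_mult mult.commute)
      qed simp
    qed
  qed
  moreover have "(indicator ?K x * g x) * \<phi> x = indicator \<Omega> x *\<^sub>R (g x * \<phi> x)" for x
    using K(2) closure_subset[of "{x. \<phi> x \<noteq> 0}"] by (cases "x \<in> ?K"; cases "\<phi> x = 0") auto
  ultimately show ?thesis using \<Omega> by (simp add: integrable_restrict_space)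
qed

lemma locally_integrable_diff:
  assumes "locally_integrable \<Omega> u" "locally_integrable \<Omega> v"
  shows "locally_integrable \<Omega> (\<lambda>x. u x - v x)"
  using assms by (auto simp: locally_integrable_def)

lemma test_functions_partials: "\<phi> \<in> test_functions \<Omega> \<Longrightarrow> is \<in> lists Basis \<Longrightarrow> partial_derivs is \<phi> \<in> test_functions \<Omega>"
proof (induction "is")
  case (Cons i "is")
  then show ?case using test_functions_partial[of "partial_derivs is \<phi>" \<Omega> i] by (simp add: partial_derivs_def)
qed simp

lemma has_weak_deriv_diff:
  assumes \<Omega>: "open \<Omega>" and "is": "is \<in> lists Basis"
    and u: "has_weak_deriv \<Omega> is u g" and v: "has_weak_deriv \<Omega> is v h"
  shows "has_weak_deriv \<Omega> is (\<lambda>x. u x - v x) (\<lambda>x. g x - h x)"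
proof -
  have li: "locally_integrable \<Omega> u" "locally_integrable \<Omega> v" "locally_integrable \<Omega> g" "locally_integrable \<Omega> h"
    using u v by (auto simp: has_weak_deriv_def)
  have d: "L2_inner \<Omega> (\<lambda>x. a x - b x) \<phi> = L2_inner \<Omega> a \<phi> - L2_inner \<Omega> b \<phi>"
    if "locally_integrable \<Omega> a" "locally_integrable \<Omega> b" "\<phi> \<in> test_functions \<Omega>" for a b \<phi>
    using locally_integrable_test[OF \<Omega> that(1,3)] locally_integrable_test[OF \<Omega> that(2,3)]
    by (simp add: L2_inner_def left_diff_distrib)
  show ?thesis
    unfolding has_weak_deriv_def
  proof (intro conjI locally_integrable_diff li ballI)
    fix \<phi> assume \<phi>: "\<phi> \<in> test_functions \<Omega>"
    show "L2_inner \<Omega> (\<lambda>x. u x - v x) (partial_derivs is \<phi>) = (- 1) ^ length is * L2_inner \<Omega> (\<lambda>x. g x - h x) \<phi>"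
      using u v \<phi> unfolding d[OF li(1,2) test_functions_partials[OF \<phi> "is"]] d[OF li(3,4) \<phi>]
      by (simp add: has_weak_deriv_def right_diff_distrib)
  qed
qed

text \<open>The difference of two candidates is a weak derivative of \<open>u - u\<close>, so it
  vanishes against every test function.\<close>

lemma has_weak_deriv_unique:
  assumes \<Omega>: "open \<Omega>" and "is": "is \<in> lists Basis"
    and g: "has_weak_deriv \<Omega> is u g" and h: "has_weak_deriv \<Omega> is u h"
  shows "AE x in lebesgue_on \<Omega>. g x = h x"
proof -
  have w: "has_weak_deriv \<Omega> is (\<lambda>x. u x - u x) (\<lambda>x. g x - h x)"
    by (rule has_weak_deriv_diff[OF \<Omega> "is" g h])
  have "AE x in lebesgue_on \<Omega>. g x - h x = 0"
  proof (rule AE_zero_of_test_functions[OF \<Omega>])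
    show "locally_integrable \<Omega> (\<lambda>x. g x - h x)" using w by (simp add: has_weak_deriv_def)
    fix \<phi> assume "\<phi> \<in> test_functions \<Omega>"
    then have "L2_inner \<Omega> (\<lambda>x. u x - u x) (partial_derivs is \<phi>) = (- 1) ^ length is * L2_inner \<Omega> (\<lambda>x. g x - h x) \<phi>"
      using w unfolding has_weak_deriv_def by blast
    then show "L2_inner \<Omega> (\<lambda>x. g x - h x) \<phi> = 0" by (simp add: L2_inner_def)
  qed
  then show ?thesis by eventually_elim simp
qed

lemma weak_deriv_AE:
  assumes "open \<Omega>" "is \<in> lists Basis" "has_weak_deriv \<Omega> is u g"
  shows "has_weak_deriv \<Omega> is u (weak_deriv \<Omega> is u)" "AE x in lebesgue_on \<Omega>. weak_deriv \<Omega> is u x = g x"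
proof -
  show *: "has_weak_deriv \<Omega> is u (weak_deriv \<Omega> is u)"
    unfolding weak_deriv_def using assms(3) by (rule someI[of "has_weak_deriv \<Omega> is u"])
  show "AE x in lebesgue_on \<Omega>. weak_deriv \<Omega> is u x = g x"
    by (rule has_weak_deriv_unique[OF assms(1,2) * assms(3)])
qed

text \<open>Lebesgue measure is complete, so the arbitrary version of a weak derivative picked by
  \<open>weak_deriv\<close> inherits measurability from any version in L2.\<close>

lemma borel_measurable_lebesgue_on_AE:
  fixes g :: "'a::euclidean_space \<Rightarrow> real"
  assumes \<Omega>: "\<Omega> \<in> sets lebesgue" and g: "g \<in> borel_measurable (lebesgue_on \<Omega>)"
    and eq: "AE x in lebesgue_on \<Omega>. f x = g x"
  shows "f \<in> borel_measurable (lebesgue_on \<Omega>)"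
proof -
  have i: "h \<in> borel_measurable (lebesgue_on \<Omega>) \<longleftrightarrow> (\<lambda>x. indicator \<Omega> x *\<^sub>R h x) \<in> borel_measurable lebesgue" for h :: "'a \<Rightarrow> real"
    using \<Omega> by (intro borel_measurable_restrict_space_iff) simp
  have "AE x in lebesgue. indicator \<Omega> x *\<^sub>R g x = indicator \<Omega> x *\<^sub>R f x"
    using eq \<Omega> by (subst (asm) AE_restrict_space_iff) (auto elim!: eventually_mono simp: indicator_def)
  with g show ?thesis unfolding i by (rule borel_measurable_AE)
qed

lemma L2_AE:
  assumes \<Omega>: "\<Omega> \<in> sets lebesgue" and g: "g \<in> L2 \<Omega>" and eq: "AE x in lebesgue_on \<Omega>. f x = g x"
  shows "f \<in> L2 \<Omega>"
proof -
  have fm: "f \<in> borel_measurable (lebesgue_on \<Omega>)"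
    by (rule borel_measurable_lebesgue_on_AE[OF \<Omega> L2_measurable[OF g] eq])
  have "integrable (lebesgue_on \<Omega>) (\<lambda>x. (f x)\<^sup>2)"
    by (rule Bochner_Integration.integrable_cong_AE_imp[of _ "\<lambda>x. (g x)\<^sup>2"])
      (use g fm eq in \<open>auto simp: L2_def\<close>)
  with fm show ?thesis by (simp add: L2_def)
qed

lemma H_space_weak_deriv:
  assumes \<Omega>: "open \<Omega>" and u: "u \<in> H_space k \<Omega>" and "is": "is \<in> lists Basis" "length is \<le> k"
  shows "has_weak_deriv \<Omega> is u (weak_deriv \<Omega> is u)" "weak_deriv \<Omega> is u \<in> L2 \<Omega>"
proof -
  obtain g where g: "g \<in> L2 \<Omega>" "has_weak_deriv \<Omega> is u g" using u "is" by (auto simp: H_space_def)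
  show "has_weak_deriv \<Omega> is u (weak_deriv \<Omega> is u)" by (rule weak_deriv_AE(1)[OF \<Omega> "is"(1) g(2)])
  show "weak_deriv \<Omega> is u \<in> L2 \<Omega>"
    by (rule L2_AE[OF _ g(1) weak_deriv_AE(2)[OF \<Omega> "is"(1) g(2)]]) (use \<Omega> in simp)
qed

lemma H_space_weak_deriv_diff:
  assumes \<Omega>: "open \<Omega>" and u: "u \<in> H_space k \<Omega>" and v: "v \<in> H_space k \<Omega>" and "is": "is \<in> lists Basis" "length is \<le> k"
  shows "AE x in lebesgue_on \<Omega>. weak_deriv \<Omega> is (\<lambda>x. u x - v x) x = weak_deriv \<Omega> is u x - weak_deriv \<Omega> is v x"
  by (rule weak_deriv_AE(2)[OF \<Omega> "is"(1)
        has_weak_deriv_diff[OF \<Omega> "is"(1) H_space_weak_deriv(1)[OF \<Omega> u "is"] H_space_weak_deriv(1)[OF \<Omega> v "is"]]])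

text \<open>\<open>partial_derivs [i, j]\<close> applies \<open>j\<close> first, so
  \<open>partial_deriv j \<phi>\<close> can serve as a test function for the derivative in direction
  \<open>i\<close>. This fixes the reading of \<open>[i, j]\<close> as the
  \<open>j\<close>-derivative of the \<open>i\<close>-derivative.\<close>

lemma has_weak_deriv_second:
  assumes \<Omega>: "open \<Omega>" and ij: "i \<in> Basis" "j \<in> Basis"
    and g: "has_weak_deriv \<Omega> [i] u g" and h: "has_weak_deriv \<Omega> [i, j] u h"
  shows "has_weak_deriv \<Omega> [j] g h"
  unfolding has_weak_deriv_def
proof (intro conjI ballI)
  show "locally_integrable \<Omega> g" "locally_integrable \<Omega> h" using g h by (auto simp: has_weak_deriv_def)
  fix \<phi> assume \<phi>: "\<phi> \<in> test_functions \<Omega>"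
  have p: "partial_deriv j \<phi> \<in> test_functions \<Omega>" by (rule test_functions_partial[OF \<phi> ij(2)])
  have "L2_inner \<Omega> u (partial_derivs [i] (partial_deriv j \<phi>)) = (- 1) ^ length [i] * L2_inner \<Omega> g (partial_deriv j \<phi>)"
    using g p unfolding has_weak_deriv_def by blast
  moreover have "L2_inner \<Omega> u (partial_derivs [i, j] \<phi>) = (- 1) ^ length [i, j] * L2_inner \<Omega> h \<phi>"
    using h \<phi> unfolding has_weak_deriv_def by blast
  ultimately show "L2_inner \<Omega> g (partial_derivs [j] \<phi>) = (- 1) ^ length [j] * L2_inner \<Omega> h \<phi>" by simp
qed

lemma short_lists_eq: "{is \<in> lists A. length is \<le> 1} = insert [] ((\<lambda>i. [i]) ` A)"
proof (intro set_eqI iffI)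
  fix "is" assume "is \<in> {is \<in> lists A. length is \<le> 1}"
  then show "is \<in> insert [] ((\<lambda>i. [i]) ` A)" by (cases "is") auto
qed auto

lemma sum_short_lists:
  assumes "finite A"
  shows "(\<Sum>is | is \<in> lists A \<and> length is \<le> 1. f is) = f [] + (\<Sum>i\<in>A. f [i])"
proof -
  have "(\<Sum>is | is \<in> lists A \<and> length is \<le> 1. f is) = sum f (insert [] ((\<lambda>i. [i]) ` A))"
    by (simp only: short_lists_eq)
  also have "\<dots> = f [] + sum f ((\<lambda>i. [i]) ` A)" using assms by (subst sum.insert) auto
  also have "sum f ((\<lambda>i. [i]) ` A) = (\<Sum>i\<in>A. f [i])" by (subst sum.reindex) (auto simp: inj_on_def)
  finally show ?thesis .
qed

lemma L2_norm_weak_deriv_le_H_norm: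
  fixes u :: "'a::euclidean_space \<Rightarrow> real"
  assumes "is = [] \<or> (\<exists>i\<in>Basis. is = [i])"
  shows "L2_norm \<Omega> (weak_deriv \<Omega> is u) \<le> H_norm 1 \<Omega> u"
proof (rule power2_le_imp_le)
  have "(H_norm 1 \<Omega> u)\<^sup>2 = (L2_norm \<Omega> (weak_deriv \<Omega> [] u))\<^sup>2 + (\<Sum>i\<in>Basis. (L2_norm \<Omega> (weak_deriv \<Omega> [i] u))\<^sup>2)"
    unfolding H_norm_def by (subst real_sqrt_pow2, intro sum_nonneg, simp, rule sum_short_lists[OF finite_Basis])
  moreover have "(L2_norm \<Omega> (weak_deriv \<Omega> [i] u))\<^sup>2 \<le> (\<Sum>i\<in>Basis. (L2_norm \<Omega> (weak_deriv \<Omega> [i] u))\<^sup>2)" if "i \<in> Basis" for i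
    using that by (intro member_le_sum) auto
  moreover have "0 \<le> (\<Sum>i\<in>Basis. (L2_norm \<Omega> (weak_deriv \<Omega> [i] u))\<^sup>2)" by (intro sum_nonneg) auto
  moreover have "0 \<le> (L2_norm \<Omega> (weak_deriv \<Omega> [] u))\<^sup>2" by simp
  ultimately show "(L2_norm \<Omega> (weak_deriv \<Omega> is u))\<^sup>2 \<le> (H_norm 1 \<Omega> u)\<^sup>2"
    using assms by (metis add_increasing add_increasing2 order_refl)
qed (simp add: H_norm_def sum_nonneg)

text \<open>The norm is a sum of essential suprema, so the value and the gradient share the single
  bound \<open>R\<close> at almost every point; \<open>cubic_pointwise\<close> exploits this through
  the product of the two.\<close>

lemma W1inf_AE_bound:
  fixes a :: "'a::euclidean_space \<Rightarrow> real"
  assumes \<Omega>: "open \<Omega>" and a: "locally_integrable \<Omega> a" and R: "W1inf_norm \<Omega> a \<le> ereal R"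
  shows "AE x in lebesgue_on \<Omega>. \<bar>a x\<bar> + (\<Sum>i\<in>Basis. \<bar>weak_deriv \<Omega> [i] a x\<bar>) \<le> R"
proof -
  have "has_weak_deriv \<Omega> [] a a" using a by (simp add: has_weak_deriv_def)
  then have a0: "AE x in lebesgue_on \<Omega>. weak_deriv \<Omega> [] a x = a x" by (intro weak_deriv_AE(2)[OF \<Omega>]) auto
  let ?f = "\<lambda>is x. ereal \<bar>weak_deriv \<Omega> is a x\<bar>"
  let ?e = "\<lambda>is. esssup (lebesgue_on \<Omega>) (?f is)"
  have "AE x in lebesgue_on \<Omega>. \<forall>i\<in>Basis. ?f [i] x \<le> ?e [i]"
    by (subst AE_finite_all) (auto intro: esssup_AE)
  moreover have "AE x in lebesgue_on \<Omega>. ?f [] x \<le> ?e []" by (rule esssup_AE)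
  ultimately show ?thesis
    using a0
  proof eventually_elim
    case (elim x)
    have "ereal (\<bar>a x\<bar> + (\<Sum>i\<in>Basis. \<bar>weak_deriv \<Omega> [i] a x\<bar>)) = ?f [] x + (\<Sum>i\<in>Basis. ?f [i] x)"
      using elim(3) by simp
    also have "\<dots> \<le> ?e [] + (\<Sum>i\<in>Basis. ?e [i])" using elim by (intro add_mono sum_mono) auto
    also have "\<dots> = W1inf_norm \<Omega> a" unfolding W1inf_norm_def by (rule sum_short_lists[OF finite_Basis, symmetric])
    finally show ?case using R by (metis ereal_less_eq(3) order_trans)
  qed
qed

section \<open>Weak derivatives, traces and cubes on a convex domain\<close>

context convex_domain
begin

lemma L2_locally_integrable: "f \<in> L2 \<Omega> \<Longrightarrow> locally_integrable \<Omega> f"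
  unfolding locally_integrable_def
proof (intro allI impI)
  fix K assume f: "f \<in> L2 \<Omega>" and K: "compact K \<and> K \<subseteq> \<Omega>"
  have Ks: "K \<in> sets lebesgue" using K by (simp add: lmeasurable_compact fmeasurableD)
  have "integrable lebesgue (\<lambda>x. indicator \<Omega> x *\<^sub>R f x)"
    using L2_integrable[OF f] by (simp add: integrable_restrict_space)
  from integrable_mult_indicator[OF Ks this]
  have "integrable lebesgue (\<lambda>x. indicator K x *\<^sub>R indicator \<Omega> x *\<^sub>R f x)" .
  moreover have "(\<lambda>x. indicator K x *\<^sub>R indicator \<Omega> x *\<^sub>R f x) = (\<lambda>x. indicator K x *\<^sub>R f x)"
    using K by (auto simp: indicator_def fun_eq_iff)
  ultimately have "integrable lebesgue (\<lambda>x. indicator K x *\<^sub>R f x)" by simp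
  then show "integrable (lebesgue_on K) f" using Ks by (simp add: integrable_restrict_space)
qed

lemma smooth_C1b:
  assumes "smooth u"
  shows "C1b u (\<lambda>i. partial_deriv i u)"
  unfolding C1b_def
proof (intro conjI ballI)
  show "(u has_derivative (\<lambda>v. \<Sum>i\<in>Basis. v \<bullet> i * partial_deriv i u x)) (at x)" for x by (rule smooth_has_derivative[OF assms])
  have pc: "continuous_on A (partial_deriv i u)" if "i \<in> Basis" for i A
    using smooth_continuous_on[OF assms, of "[i]"] that by simp
  then show "i \<in> Basis \<Longrightarrow> continuous_on \<Omega> (partial_deriv i u)" for i .
  have cb: "\<exists>B. \<forall>x\<in>\<Omega>. \<bar>f x\<bar> \<le> B" if "continuous_on (closure \<Omega>) f" for f :: "'a \<Rightarrow> real"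
  proof -
    have "bounded (f ` closure \<Omega>)" using \<Omega>(2) that by (intro compact_imp_bounded compact_continuous_image) auto
    then show ?thesis using closure_subset by (fastforce simp: bounded_iff)
  qed
  obtain B0 where B0: "\<And>x. x \<in> \<Omega> \<Longrightarrow> \<bar>u x\<bar> \<le> B0"
    using cb[OF smooth_continuous_on[OF assms, of "[]", simplified]] by blast
  have "\<forall>i. \<exists>B. i \<in> Basis \<longrightarrow> (\<forall>x\<in>\<Omega>. \<bar>partial_deriv i u x\<bar> \<le> B)" using cb[OF pc] by blast
  from choice[OF this] obtain B where B: "\<And>i x. i \<in> Basis \<Longrightarrow> x \<in> \<Omega> \<Longrightarrow> \<bar>partial_deriv i u x\<bar> \<le> B i" by blast
  have B00: "B0 \<ge> 0" using order_trans[OF abs_ge_zero B0[OF c_in]] .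
  have Bi: "B i \<ge> 0" if "i \<in> Basis" for i using order_trans[OF abs_ge_zero B[OF that c_in]] .
  show "\<exists>B. \<forall>x\<in>\<Omega>. \<bar>u x\<bar> \<le> B \<and> (\<forall>i\<in>Basis. \<bar>partial_deriv i u x\<bar> \<le> B)"
  proof (intro exI[of _ "B0 + (\<Sum>i\<in>Basis. B i)"] ballI conjI)
    fix x assume x: "x \<in> \<Omega>"
    have "(\<Sum>i\<in>Basis. B i) \<ge> 0" using Bi by (intro sum_nonneg) auto
    then show "\<bar>u x\<bar> \<le> B0 + (\<Sum>i\<in>Basis. B i)" using B0[OF x] by linarith
    fix i :: 'a assume i: "i \<in> Basis"
    have "B i \<le> (\<Sum>i\<in>Basis. B i)" using member_le_sum[OF i, of B] Bi by auto
    then show "\<bar>partial_deriv i u x\<bar> \<le> B0 + (\<Sum>i\<in>Basis. B i)" using B[OF i x] B00 by linarith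
  qed
qed

text \<open>On the compact support of \<phi> the Minkowski functional stays below some
  \<open>m < 1\<close>, so for small \<epsilon> the cutoff is 1 on the support and the layer misses
  it; integration by parts against the cutoff then has no boundary term.\<close>

lemma C1b_has_weak_deriv:
  assumes u: "C1b u U" and i: "i \<in> Basis"
  shows "has_weak_deriv \<Omega> [i] u (U i)"
  unfolding has_weak_deriv_def
proof (intro conjI ballI)
  show "locally_integrable \<Omega> u" "locally_integrable \<Omega> (U i)"
    using C1b_L2[OF u] i by (auto intro: L2_locally_integrable)
  fix \<phi> assume \<phi>: "\<phi> \<in> test_functions \<Omega>"
  let ?K = "closure {x. \<phi> x \<noteq> 0}"
  have K: "compact ?K" "?K \<subseteq> \<Omega>" and s: "smooth \<phi>" using \<phi> by (auto simp: test_functions_def)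
  have zero: "\<phi> x = 0" if "x \<notin> ?K" for x using that closure_subset[of "{x. \<phi> x \<noteq> 0}"] by blast
  have zero': "partial_deriv j \<phi> x = 0" if "x \<notin> ?K" for x j
    by (rule partial_deriv_zero_outside[OF closed_closure zero that])
  obtain m where m: "m < 1" "\<And>x. x \<in> ?K \<Longrightarrow> mink (x - c) \<le> m"
  proof (cases "?K = {}")
    case True
    then show thesis by (intro that[of 0]) auto
  next
    case False
    obtain x0 where "x0 \<in> ?K" "\<And>x. x \<in> ?K \<Longrightarrow> mink (x - c) \<le> mink (x0 - c)"
      using continuous_attains_sup[OF K(1) False mink_continuous] by blast
    then show thesis using K(2) by (intro that[of "mink (x0 - c)"]) (auto simp: in_\<Omega>_iff[symmetric])
  qed
  define \<epsilon> where "\<epsilon> = min (1 / 2) (1 - m)"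
  have \<epsilon>: "0 < \<epsilon>" "\<epsilon> \<le> 1 / 2" "\<epsilon> \<le> 1 - m" using m(1) unfolding \<epsilon>_def by (auto simp: min_def)
  have cut: "cutoff \<epsilon> x = 1" if "x \<in> ?K" for x
    using m(2)[OF that] \<epsilon> by (simp add: cutoff_def le_divide_eq)
  have lay: "x \<notin> layer \<epsilon>" if "x \<in> ?K" for x using m(2)[OF that] \<epsilon> by (auto simp: layer_def)
  note C = C1b_mult[OF u smooth_C1b[OF s]]
  have "(LINT x|M. cutoff \<epsilon> x * (U i x * \<phi> x + u x * partial_deriv i \<phi> x)) = (1 / \<epsilon>) * (LINT x|M. indicator (layer \<epsilon>) x * (dmink i x * (u x * \<phi> x)))"
    by (rule cutoff_integration_by_parts_C1[OF C \<epsilon>(1,2) i])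
  also have "(\<lambda>x. indicator (layer \<epsilon>) x * (dmink i x * (u x * \<phi> x))) = (\<lambda>x. 0)"
  proof
    fix x show "indicator (layer \<epsilon>) x * (dmink i x * (u x * \<phi> x)) = 0"
      using lay[of x] zero[of x] by (cases "x \<in> ?K") auto
  qed
  also have "(\<lambda>x. cutoff \<epsilon> x * (U i x * \<phi> x + u x * partial_deriv i \<phi> x)) = (\<lambda>x. U i x * \<phi> x + u x * partial_deriv i \<phi> x)"
  proof
    fix x show "cutoff \<epsilon> x * (U i x * \<phi> x + u x * partial_deriv i \<phi> x) = U i x * \<phi> x + u x * partial_deriv i \<phi> x"
      using cut[of x] zero[of x] zero'[of x i] by (cases "x \<in> ?K") auto
  qed
  finally have "(LINT x|M. U i x * \<phi> x + u x * partial_deriv i \<phi> x) = 0" by simp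
  moreover have "integrable M (\<lambda>x. U i x * \<phi> x)" "integrable M (\<lambda>x. u x * partial_deriv i \<phi> x)"
    using C1b_L2[OF u] C1b_L2[OF smooth_C1b[OF s]] i by (auto intro!: L2_mult_integrable)
  ultimately show "L2_inner \<Omega> u (partial_derivs [i] \<phi>) = (- 1) ^ length [i] * L2_inner \<Omega> (U i) \<phi>"
    by (simp add: L2_inner_def)
qed

text \<open>\<open>H_norm\<close> of the difference is built from chosen weak derivatives. These
  agree almost everywhere with classical derivatives of \<open>U k\<close> minus \<open>Y\<close>,
  so the norm controls each difference separately.\<close>

lemma has_trace_imp_approx:
  assumes tr: "has_trace \<Omega> X G" and Y: "\<And>j. j \<in> Basis \<Longrightarrow> Y j \<in> L2 \<Omega>" "\<And>j. j \<in> Basis \<Longrightarrow> has_weak_deriv \<Omega> [j] X (Y j)"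
  shows "has_trace_approx X Y G"
proof -
  have XL: "X \<in> L2 \<Omega>" using tr by (simp add: has_trace_def H_space_def)
  obtain U :: "nat \<Rightarrow> 'a \<Rightarrow> real" where U: "\<And>k. smooth (U k)"
    "(\<lambda>k. H_norm 1 \<Omega> (\<lambda>x. U k x - X x)) \<longlonglongrightarrow> 0"
    "(\<lambda>k. \<integral>\<^sup>+x. ennreal ((U k x - G x)\<^sup>2) \<partial>surface_measure \<Omega>) \<longlonglongrightarrow> 0"
    using tr unfolding has_trace_def by blast
  let ?V = "\<lambda>k j. partial_deriv j (U k)"
  have C: "C1b (U k) (?V k)" for k by (rule smooth_C1b[OF U(1)])
  have UL: "U k \<in> L2 \<Omega>" "j \<in> Basis \<Longrightarrow> ?V k j \<in> L2 \<Omega>" for k j using C1b_L2[OF C] by auto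
  have wd: "has_weak_deriv \<Omega> [j] (\<lambda>x. U k x - X x) (\<lambda>x. ?V k j x - Y j x)" if "j \<in> Basis" for j k
    using that by (intro has_weak_deriv_diff \<Omega>(1) C1b_has_weak_deriv[OF C] Y) auto
  have neg: "L2_norm \<Omega> (\<lambda>x. a x - b x) = L2_norm \<Omega> (\<lambda>x. b x - a x)" for a b
    using L2_norm_cmult[of \<Omega> "-1" "\<lambda>x. b x - a x"] by simp
  have n0: "L2_norm \<Omega> (\<lambda>x. X x - U k x) \<le> H_norm 1 \<Omega> (\<lambda>x. U k x - X x)" for k
  proof -
    have L: "(\<lambda>x. U k x - X x) \<in> L2 \<Omega>" by (rule L2_diff[OF UL(1) XL])
    then have "has_weak_deriv \<Omega> [] (\<lambda>x. U k x - X x) (\<lambda>x. U k x - X x)"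
      by (simp add: has_weak_deriv_def L2_locally_integrable)
    then have ae: "AE x in M. weak_deriv \<Omega> [] (\<lambda>x. U k x - X x) x = U k x - X x" by (intro weak_deriv_AE(2) \<Omega>(1)) auto
    have "L2_norm \<Omega> (\<lambda>x. X x - U k x) = L2_norm \<Omega> (weak_deriv \<Omega> [] (\<lambda>x. U k x - X x))"
      unfolding neg[of X] by (rule L2_norm_cong[OF ae, symmetric]) (intro L2_measurable L2_AE[OF _ L ae] L; simp)+
    then show ?thesis using L2_norm_weak_deriv_le_H_norm[of "[]" \<Omega>] by simp
  qed
  have n1: "L2_norm \<Omega> (\<lambda>x. Y j x - ?V k j x) \<le> H_norm 1 \<Omega> (\<lambda>x. U k x - X x)" if j: "j \<in> Basis" for k j
  proof -
    have L: "(\<lambda>x. ?V k j x - Y j x) \<in> L2 \<Omega>" by (rule L2_diff[OF UL(2)[OF j] Y(1)[OF j]])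
    have ae: "AE x in M. weak_deriv \<Omega> [j] (\<lambda>x. U k x - X x) x = ?V k j x - Y j x"
      by (rule weak_deriv_AE(2)[OF \<Omega>(1) _ wd[OF j]]) (use j in simp)
    have "L2_norm \<Omega> (\<lambda>x. Y j x - ?V k j x) = L2_norm \<Omega> (weak_deriv \<Omega> [j] (\<lambda>x. U k x - X x))"
      unfolding neg[of "Y j"] by (rule L2_norm_cong[OF ae, symmetric]) (intro L2_measurable L2_AE[OF _ L ae] L; simp)+
    then show ?thesis using L2_norm_weak_deriv_le_H_norm[of "[j]" \<Omega>] j by simp
  qed
  have "\<exists>L\<ge>0. \<forall>x\<in>closure \<Omega>. \<forall>y\<in>closure \<Omega>. \<bar>U k x - U k y\<bar> \<le> L * norm (x - y)" for k
  proof -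
    have "\<exists>B. \<forall>x\<in>closure \<Omega>. \<bar>?V k i x\<bar> \<le> B" if "i \<in> Basis" for i
    proof -
      have "bounded (?V k i ` closure \<Omega>)"
        using \<Omega>(2) smooth_continuous_on[OF U(1), of "[i]"] that by (intro compact_imp_bounded compact_continuous_image) auto
      then show ?thesis by (fastforce simp: bounded_iff)
    qed
    then have "\<forall>i. \<exists>B. i \<in> Basis \<longrightarrow> (\<forall>x\<in>closure \<Omega>. \<bar>?V k i x\<bar> \<le> B)" by blast
    from choice[OF this] obtain B where B: "\<And>i x. i \<in> Basis \<Longrightarrow> x \<in> closure \<Omega> \<Longrightarrow> \<bar>?V k i x\<bar> \<le> B i" by blast
    have ccl: "c \<in> closure \<Omega>" using c_in closure_subset by blast
    have Bi: "B i \<ge> 0" if "i \<in> Basis" for i using order_trans[OF abs_ge_zero B[OF that ccl]] .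
    have BB: "\<bar>?V k i x\<bar> \<le> (\<Sum>i\<in>Basis. B i)" if "x \<in> closure \<Omega>" "i \<in> Basis" for i x
      using B[OF that(2,1)] member_le_sum[OF that(2), of B] Bi by force
    have "\<bar>U k x - U k y\<bar> \<le> (real DIM('a) * (\<Sum>i\<in>Basis. B i)) * norm (x - y)" if "x \<in> closure \<Omega>" "y \<in> closure \<Omega>" for x y
      by (rule lipschitz_of_partials[OF convex_closure[OF \<Omega>(3)] smooth_has_derivative[OF U(1)] BB that])
    moreover have "real DIM('a) * (\<Sum>i\<in>Basis. B i) \<ge> 0" using Bi by (intro mult_nonneg_nonneg sum_nonneg) auto
    ultimately show ?thesis by blast
  qed
  moreover have "continuous_on UNIV (U k)" for k using smooth_continuous_on[OF U(1), of "[]"] by simp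
  moreover have "H1_approx (\<lambda>x. X x - U k x) (\<lambda>j x. Y j x - ?V k j x)" for k
    using XL UL Y by (intro H1_approx_weak L2_diff has_weak_deriv_diff \<Omega>(1) C1b_has_weak_deriv[OF C]) auto
  moreover have "(\<lambda>k. L2_norm \<Omega> (\<lambda>x. X x - U k x)) \<longlonglongrightarrow> 0"
    by (rule tendsto_sandwich[OF _ _ tendsto_const U(2)]) (rule always_eventually, intro allI L2_norm_nonneg n0)+
  moreover have "(\<lambda>k. L2_norm \<Omega> (\<lambda>x. Y j x - ?V k j x)) \<longlonglongrightarrow> 0" if "j \<in> Basis" for j
    by (rule tendsto_sandwich[OF _ _ tendsto_const U(2)]) (rule always_eventually, intro allI L2_norm_nonneg n1[OF that])+
  moreover have "G \<in> borel_measurable (surface_measure \<Omega>)" using tr by (simp add: has_trace_def)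
  ultimately show ?thesis
    unfolding has_trace_approx_def using U(3) by (intro conjI exI[of _ U] exI[of _ ?V]) auto
qed

text \<open>Write \<open>b k * F k\<close> as \<open>b k * (F k - g)\<close> plus
  \<open>b k * g\<close>: the uniform bound handles the first part, dominated convergence the
  second.\<close>

lemma L2_tendsto_mult_bounded:
  assumes F: "L2_tendsto \<Omega> F g" and b: "\<And>k. b k \<in> borel_measurable M" "\<And>k. AE x in M. \<bar>b k x\<bar> \<le> B"
    and lim: "AE x in M. (\<lambda>k. b k x) \<longlonglongrightarrow> b' x" and b': "b' \<in> borel_measurable M" "AE x in M. \<bar>b' x\<bar> \<le> B"
  shows "L2_tendsto \<Omega> (\<lambda>k x. b k x * F k x) (\<lambda>x. b' x * g x)"
proof -
  note D = L2_tendstoD[OF F]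
  have "L2_tendsto \<Omega> (\<lambda>k x. b k x * g x) (\<lambda>x. b' x * g x)"
  proof (rule L2_tendsto_dominated[OF _ L2_bounded_mult[OF D(2) b'] L2_cmult[OF D(2), of B]])
    show "(\<lambda>x. b k x * g x) \<in> borel_measurable M" for k by (intro borel_measurable_times b L2_measurable D)
    show "AE x in M. (\<lambda>k. b k x * g x) \<longlonglongrightarrow> b' x * g x" using lim by eventually_elim (intro tendsto_intros)
    show "AE x in M. \<bar>b k x * g x\<bar> \<le> \<bar>B * g x\<bar>" for k
      using b(2)[of k]
    proof eventually_elim
      case (elim x)
      then have "\<bar>b k x\<bar> * \<bar>g x\<bar> \<le> \<bar>B\<bar> * \<bar>g x\<bar>" by (intro mult_right_mono) auto
      then show ?case by (simp add: abs_mult)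
    qed
  qed
  moreover have "L2_tendsto \<Omega> (\<lambda>k x. b k x * (F k x - g x)) (\<lambda>x. 0)"
  proof (rule L2_tendsto_squeeze[where e="\<lambda>k. \<bar>B\<bar> * L2_norm \<Omega> (\<lambda>x. F k x - g x)"])
    show "(\<lambda>x. b k x * (F k x - g x)) \<in> L2 \<Omega>" for k by (intro L2_bounded_mult[OF L2_diff[OF D(1,2)] b])
    show "(\<lambda>k. \<bar>B\<bar> * L2_norm \<Omega> (\<lambda>x. F k x - g x)) \<longlonglongrightarrow> 0" by (auto intro!: tendsto_eq_intros D(3))
    show "\<forall>\<^sub>F k in sequentially. L2_norm \<Omega> (\<lambda>x. b k x * (F k x - g x) - 0) \<le> \<bar>B\<bar> * L2_norm \<Omega> (\<lambda>x. F k x - g x)"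
    proof (rule always_eventually, rule allI)
      fix k
      have "L2_norm \<Omega> (\<lambda>x. b k x * (F k x - g x) - 0) \<le> L2_norm \<Omega> (\<lambda>x. B * (F k x - g x))"
      proof (rule L2_norm_mono[OF L2_cmult[OF L2_diff[OF D(1,2)]]])
        show "AE x in M. \<bar>b k x * (F k x - g x) - 0\<bar> \<le> \<bar>B * (F k x - g x)\<bar>"
          using b(2)[of k]
        proof eventually_elim
          case (elim x)
          then have "\<bar>b k x\<bar> * \<bar>F k x - g x\<bar> \<le> \<bar>B\<bar> * \<bar>F k x - g x\<bar>" by (intro mult_right_mono) auto
          then show ?case by (simp add: abs_mult)
        qed
      qed
      then show "L2_norm \<Omega> (\<lambda>x. b k x * (F k x - g x) - 0) \<le> \<bar>B\<bar> * L2_norm \<Omega> (\<lambda>x. F k x - g x)"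
        by (simp add: L2_norm_cmult)
    qed
  qed (simp add: L2_zero)
  ultimately have "L2_tendsto \<Omega> (\<lambda>k x. b k x * (F k x - g x) + b k x * g x) (\<lambda>x. 0 + b' x * g x)"
    by (rule L2_tendsto_add[rotated])
  then show ?thesis by (simp add: distrib_left[symmetric])
qed

lemma L2_tendsto_subseq: "L2_tendsto \<Omega> f g \<Longrightarrow> strict_mono s \<Longrightarrow> L2_tendsto \<Omega> (\<lambda>k. f (s k)) g"
  using LIMSEQ_subseq_LIMSEQ[of "\<lambda>k. L2_norm \<Omega> (\<lambda>x. f k x - g x)" 0 s] by (auto simp: L2_tendsto_def o_def)

text \<open>Averages of \<open>f\<close> obey the same bound \<open>B\<close>, so the squares of the
  smoothings are bounded multipliers that converge almost everywhere along a subsequence.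
  Convergence of the factors in L2 alone would not give convergence of the products in L2.\<close>

lemma H1_approx_cube:
  assumes f: "f \<in> L2 \<Omega>" and g: "\<And>i. i \<in> Basis \<Longrightarrow> g i \<in> L2 \<Omega>" "\<And>i. i \<in> Basis \<Longrightarrow> has_weak_deriv \<Omega> [i] f (g i)"
    and B: "AE x in M. \<bar>f x\<bar> \<le> B"
  shows "H1_approx (\<lambda>x. (f x)\<^sup>2 * f x) (\<lambda>i x. (3 * (f x)\<^sup>2) * g i x)"
proof -
  let ?u = "\<lambda>k. smoothing (scl k) f" and ?U = "\<lambda>k i x. scl k * smoothing (scl k) (g i) x"
  note tu = smoothing_tendsto[OF f]
  obtain s :: "nat \<Rightarrow> nat" where s: "strict_mono s" "AE x in M. (\<lambda>k. ?u (s k) x) \<longlonglongrightarrow> f x"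
    by (rule L2_tendsto_AE_subseq[OF tu], rule that)
  have C: "C1b (?u k) (?U k)" for k by (rule smoothing_C1b[OF f g])
  have uB: "AE x in M. \<bar>?u k x\<bar> \<le> B" for k
    by (rule AE_M) (rule smoothing_abs_le[OF f scl(1,2) _ B])
  have sq: "\<bar>3 * t\<^sup>2\<bar> \<le> 3 * B\<^sup>2" if "\<bar>t\<bar> \<le> B" for t :: real
    using power_mono[OF that, of 2] by simp
  have m: "?u k \<in> borel_measurable M" for k using L2_measurable[OF C1b_L2(1)[OF C]] .
  have tU: "L2_tendsto \<Omega> (\<lambda>k. ?U k i) (g i)" if "i \<in> Basis" for i
    using L2_tendsto_cmult[OF smoothing_tendsto[OF g(1)[OF that]] scl(4)] by simp
  have lim: "AE x in M. (\<lambda>k. 3 * (?u (s k) x)\<^sup>2) \<longlonglongrightarrow> 3 * (f x)\<^sup>2"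
    using s(2) by eventually_elim (intro tendsto_intros)
  have bnd: "AE x in M. \<bar>3 * (?u k x)\<^sup>2\<bar> \<le> 3 * B\<^sup>2" for k using uB[of k] by eventually_elim (rule sq)
  have bnd': "AE x in M. \<bar>3 * (f x)\<^sup>2\<bar> \<le> 3 * B\<^sup>2" using B by eventually_elim (rule sq)
  have mult: "L2_tendsto \<Omega> (\<lambda>k x. (3 * (?u (s k) x)\<^sup>2) * F (s k) x) (\<lambda>x. (3 * (f x)\<^sup>2) * h x)" if "L2_tendsto \<Omega> F h" for F h
    by (rule L2_tendsto_mult_bounded[OF L2_tendsto_subseq[OF that s(1)] _ bnd lim _ bnd'])
      (intro borel_measurable_times borel_measurable_power borel_measurable_const m L2_measurable[OF f])+
  let ?w = "\<lambda>k x. ?u (s k) x * (?u (s k) x * ?u (s k) x)"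
  have CC: "C1b (?w k) (\<lambda>i x. ?U (s k) i x * (?u (s k) x * ?u (s k) x) + ?u (s k) x * (?U (s k) i x * ?u (s k) x + ?u (s k) x * ?U (s k) i x))" for k
    by (intro C1b_mult C)
  have eq: "(\<lambda>i x. ?U (s k) i x * (?u (s k) x * ?u (s k) x) + ?u (s k) x * (?U (s k) i x * ?u (s k) x + ?u (s k) x * ?U (s k) i x))
    = (\<lambda>i x. (3 * (?u (s k) x)\<^sup>2) * ?U (s k) i x)" for k
    by (intro ext) (simp add: power2_eq_square algebra_simps)
  \<comment> \<open>The factor \<open>1 / 3\<close> removes the 3 that \<open>mult\<close> carries
    for the sake of the gradient.\<close>
  have "L2_tendsto \<Omega> ?w (\<lambda>x. (f x)\<^sup>2 * f x)"
    using L2_tendsto_cmult[OF mult[OF tu] tendsto_const[of "1 / 3"]] by (simp add: power2_eq_square mult_ac)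
  then show ?thesis
    unfolding H1_approx_def using CC[unfolded eq] mult[OF tU]
    by (intro exI[of _ ?w] exI[of _ "\<lambda>k i x. (3 * (?u (s k) x)\<^sup>2) * ?U (s k) i x"] conjI allI ballI) auto
qed

lemma C1b_diff: "C1b f F \<Longrightarrow> C1b g G \<Longrightarrow> C1b (\<lambda>x. f x - g x) (\<lambda>i x. F i x - G i x)"
proof -
  assume f: "C1b f F" and g: "C1b g G"
  obtain A where A: "\<And>x. x \<in> \<Omega> \<Longrightarrow> \<bar>f x\<bar> \<le> A \<and> (\<forall>i\<in>Basis. \<bar>F i x\<bar> \<le> A)" using C1bD(3)[OF f] by blast
  obtain B where B: "\<And>x. x \<in> \<Omega> \<Longrightarrow> \<bar>g x\<bar> \<le> B \<and> (\<forall>i\<in>Basis. \<bar>G i x\<bar> \<le> B)" using C1bD(3)[OF g] by blast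
  show ?thesis
    unfolding C1b_def
  proof (intro conjI ballI)
    fix x assume x: "x \<in> \<Omega>"
    from has_derivative_diff[OF C1bD(1)[OF f x] C1bD(1)[OF g x]]
    show "((\<lambda>x. f x - g x) has_derivative (\<lambda>v. \<Sum>i\<in>Basis. v \<bullet> i * (F i x - G i x))) (at x)"
      by (rule has_derivative_eq_rhs) (simp add: fun_eq_iff sum_subtractf right_diff_distrib)
  next
    show "continuous_on \<Omega> (\<lambda>x. F i x - G i x)" if "i \<in> Basis" for i
      by (intro continuous_intros C1bD(2)[OF f that] C1bD(2)[OF g that])
    show "\<exists>B. \<forall>x\<in>\<Omega>. \<bar>f x - g x\<bar> \<le> B \<and> (\<forall>i\<in>Basis. \<bar>F i x - G i x\<bar> \<le> B)"
    proof (intro exI[of _ "A + B"] ballI conjI)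
      fix x assume x: "x \<in> \<Omega>"
      show "\<bar>f x - g x\<bar> \<le> A + B" using A[OF x] B[OF x] by linarith
      fix i :: 'a assume "i \<in> Basis"
      then have "\<bar>F i x\<bar> \<le> A" "\<bar>G i x\<bar> \<le> B" using A[OF x] B[OF x] by auto
      then show "\<bar>F i x - G i x\<bar> \<le> A + B" by linarith
    qed
  qed
qed

lemma H1_approx_diff:
  assumes "H1_approx u U" "H1_approx v V"
  shows "H1_approx (\<lambda>x. u x - v x) (\<lambda>i x. U i x - V i x)"
proof -
  obtain f F where f: "\<And>k. C1b (f k) (F k)" "L2_tendsto \<Omega> f u" "\<And>i. i \<in> Basis \<Longrightarrow> L2_tendsto \<Omega> (\<lambda>k. F k i) (U i)"
    using assms(1) by (auto simp: H1_approx_def)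
  obtain g G where g: "\<And>k. C1b (g k) (G k)" "L2_tendsto \<Omega> g v" "\<And>i. i \<in> Basis \<Longrightarrow> L2_tendsto \<Omega> (\<lambda>k. G k i) (V i)"
    using assms(2) by (auto simp: H1_approx_def)
  show ?thesis
    unfolding H1_approx_def
    by (rule exI[of _ "\<lambda>k x. f k x - g k x"], rule exI[of _ "\<lambda>k i x. F k i x - G k i x"])
      (use f g in \<open>auto intro!: C1b_diff L2_tendsto_diff\<close>)
qed

end

subsection \<open>The energy estimate\<close>

lemma young_quarter:
  fixes t u \<alpha> :: real
  assumes "\<alpha> > 0"
  shows "u * t \<le> \<alpha> * u\<^sup>2 + t\<^sup>2 / (4 * \<alpha>)"
proof -
  have "0 \<le> (2 * \<alpha> * u - t)\<^sup>2" by simp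
  then have "4 * \<alpha> * (u * t) \<le> 4 * \<alpha> * (\<alpha> * u\<^sup>2) + t\<^sup>2" by (simp add: power2_eq_square algebra_simps)
  then have "u * t \<le> (4 * \<alpha> * (\<alpha> * u\<^sup>2) + t\<^sup>2) / (4 * \<alpha>)" using assms by (simp add: le_divide_eq mult.commute)
  also have "\<dots> = \<alpha> * u\<^sup>2 + t\<^sup>2 / (4 * \<alpha>)" using assms by (simp add: add_divide_distrib)
  finally show ?thesis .
qed

text \<open>The integrand of \<open>2 * \<langle>y\<^sup>3 - a\<^sup>3, \<Delta> z\<rangle>\<close> after integration by parts, with \<open>y = a + z\<close>; the gradients of
  \<open>a\<close> and \<open>z\<close> enter as \<open>A\<close> and \<open>Z\<close>. The \<open>R\<^sup>2 / 4\<close> comes from \<open>\<bar>a\<bar> * \<bar>A\<bar> \<le> (\<bar>a\<bar> + \<bar>A\<bar>)\<^sup>2 / 4\<close>.\<close>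

lemma cubic_pointwise:
  fixes a z R \<alpha> :: real and A Z :: "'i \<Rightarrow> real"
  assumes fin: "finite I" and R: "\<bar>a\<bar> + (\<Sum>i\<in>I. \<bar>A i\<bar>) \<le> R" and \<alpha>: "\<alpha> > 0"
  shows "- (2 * (\<Sum>i\<in>I. (3 * (a + z)\<^sup>2 * (A i + Z i) - 3 * a\<^sup>2 * A i) * Z i))
    \<le> (3 / 2 * R\<^sup>2 + 9 * R ^ 4 / (16 * \<alpha>)) * z\<^sup>2 + \<alpha> * (\<Sum>i\<in>I. (Z i)\<^sup>2)"
proof -
  define S where "S = (\<Sum>i\<in>I. \<bar>A i\<bar>)"
  define q where "q = (\<Sum>i\<in>I. (Z i)\<^sup>2)"
  define \<zeta> where "\<zeta> = sqrt q"
  define p where "p = (\<Sum>i\<in>I. A i * Z i)"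
  define y where "y = a + z"
  have q0: "q \<ge> 0" by (simp add: q_def sum_nonneg)
  have \<zeta>: "\<zeta> \<ge> 0" "\<zeta>\<^sup>2 = q" using q0 by (auto simp: \<zeta>_def)
  have S0: "S \<ge> 0" by (simp add: S_def sum_nonneg)
  have SR: "\<bar>a\<bar> + S \<le> R" using R by (simp add: S_def)
  have R0: "R \<ge> 0" using SR S0 by linarith
  have Zi: "\<bar>Z i\<bar> \<le> \<zeta>" if "i \<in> I" for i
  proof -
    have "(Z i)\<^sup>2 \<le> q" unfolding q_def using that fin by (intro member_le_sum) auto
    then show ?thesis unfolding \<zeta>_def by (metis real_sqrt_abs real_sqrt_le_mono)
  qed
  have pS: "\<bar>p\<bar> \<le> S * \<zeta>"
    unfolding p_def S_def sum_distrib_right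
    by (rule order_trans[OF sum_abs], rule sum_mono) (auto simp: abs_mult intro!: mult_left_mono Zi)
  \<comment> \<open>\<open>y\<^sup>2 - a\<^sup>2\<close> is factored as \<open>z * (y + a)\<close>,
    which isolates the favourable square; the remaining cross term is then split into its
    \<open>y\<close> part and its \<open>a\<close> part.\<close>
  have eq: "(\<Sum>i\<in>I. (3 * (a + z)\<^sup>2 * (A i + Z i) - 3 * a\<^sup>2 * A i) * Z i) = 3 * y\<^sup>2 * q + 3 * z * (y + a) * p"
  proof -
    have "(3 * (a + z)\<^sup>2 * (A i + Z i) - 3 * a\<^sup>2 * A i) * Z i = 3 * y\<^sup>2 * (Z i)\<^sup>2 + 3 * z * (y + a) * (A i * Z i)" for i
      by (simp add: y_def power2_eq_square algebra_simps)
    then show ?thesis by (simp add: q_def p_def sum.distrib sum_distrib_left)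
  qed
  \<comment> \<open>The factor \<open>y\<close> allows the whole of \<open>6 * y\<^sup>2 * q\<close>
    to be spent here, leaving only \<open>3 / 2 * R\<^sup>2 * z\<^sup>2\<close>.\<close>
  have 1: "- (6 * (z * y) * p) \<le> 6 * y\<^sup>2 * q + 3 / 2 * R\<^sup>2 * z\<^sup>2"
  proof -
    have "- (6 * (z * y) * p) \<le> 6 * \<bar>z * y\<bar> * \<bar>p\<bar>"
      using abs_ge_minus_self[of "6 * (z * y) * p"] by (simp add: abs_mult)
    also have "\<dots> \<le> 6 * \<bar>z * y\<bar> * (S * \<zeta>)" using pS by (intro mult_left_mono) auto
    also have "\<dots> = 6 * ((\<bar>y\<bar> * \<zeta>) * (\<bar>z\<bar> * S))" by (simp add: abs_mult mult_ac)
    also have "\<dots> \<le> 6 * (1 * (\<bar>y\<bar> * \<zeta>)\<^sup>2 + (\<bar>z\<bar> * S)\<^sup>2 / (4 * 1))"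
      by (intro mult_left_mono young_quarter) auto
    also have "\<dots> = 6 * y\<^sup>2 * q + 3 / 2 * S\<^sup>2 * z\<^sup>2" by (simp add: power_mult_distrib \<zeta>(2))
    also have "\<dots> \<le> 6 * y\<^sup>2 * q + 3 / 2 * R\<^sup>2 * z\<^sup>2"
      using S0 SR by (intro add_left_mono mult_right_mono mult_left_mono power_mono) auto
    finally show ?thesis .
  qed
  \<comment> \<open>Here no \<open>y\<close> is available, so a multiple \<alpha> of the squared
    gradient has to be paid.\<close>
  have 2: "- (6 * (z * a) * p) \<le> \<alpha> * q + 9 * R ^ 4 / (16 * \<alpha>) * z\<^sup>2"
  proof -
    have "0 \<le> (\<bar>a\<bar> - S)\<^sup>2" by simp
    then have "4 * (\<bar>a\<bar> * S) \<le> (\<bar>a\<bar> + S)\<^sup>2" by (simp add: power2_eq_square algebra_simps)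
    also have "\<dots> \<le> R\<^sup>2" using SR S0 by (intro power_mono) auto
    finally have aS: "\<bar>a\<bar> * S \<le> R\<^sup>2 / 4" by simp
    have "- (6 * (z * a) * p) \<le> 6 * \<bar>z * a\<bar> * \<bar>p\<bar>"
      using abs_ge_minus_self[of "6 * (z * a) * p"] by (simp add: abs_mult)
    also have "\<dots> \<le> 6 * \<bar>z * a\<bar> * (S * \<zeta>)" using pS by (intro mult_left_mono) auto
    also have "\<dots> = 6 * (\<bar>z\<bar> * \<zeta>) * (\<bar>a\<bar> * S)" by (simp add: abs_mult mult_ac)
    also have "\<dots> \<le> 6 * (\<bar>z\<bar> * \<zeta>) * (R\<^sup>2 / 4)" using aS \<zeta>(1) by (intro mult_left_mono) auto
    also have "\<dots> = \<zeta> * (3 / 2 * R\<^sup>2 * \<bar>z\<bar>)" by simp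
    also have "\<dots> \<le> \<alpha> * \<zeta>\<^sup>2 + (3 / 2 * R\<^sup>2 * \<bar>z\<bar>)\<^sup>2 / (4 * \<alpha>)" by (rule young_quarter[OF \<alpha>])
    also have "(3 / 2 * R\<^sup>2 * \<bar>z\<bar>)\<^sup>2 / (4 * \<alpha>) = 9 * R ^ 4 / (16 * \<alpha>) * z\<^sup>2"
      using \<alpha> by (simp add: power_mult_distrib power_divide power_mult[symmetric] field_simps)
    finally show ?thesis by (simp add: \<zeta>(2))
  qed
  have "- (2 * (3 * y\<^sup>2 * q + 3 * z * (y + a) * p)) = - (6 * y\<^sup>2 * q) + - (6 * (z * y) * p) + - (6 * (z * a) * p)"
    by (simp add: algebra_simps)
  also have "\<dots> \<le> (3 / 2 * R\<^sup>2 + 9 * R ^ 4 / (16 * \<alpha>)) * z\<^sup>2 + \<alpha> * q"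
    using 1 2 by (simp add: distrib_right)
  finally show ?thesis unfolding eq q_def[symmetric] .
qed

text \<open>This weight \<open>\<alpha>\<close> of the Young inequality makes the two terms \<open>R ^ 4 / \<alpha>\<close> and \<open>\<alpha>\<^sup>2 / \<nu>\<close> proportional.\<close>

lemma C_star_absorb:
  fixes R \<nu> :: real
  assumes "\<nu> > 0" "R > 0"
  defines "\<alpha> \<equiv> (3 * R\<^sup>2) powr (2 / 3) * \<nu> powr (1 / 3)"
  shows "\<alpha> > 0" "3 / 2 * R\<^sup>2 + 9 * R ^ 4 / (16 * \<alpha>) + 3 * \<alpha>\<^sup>2 / (4 * \<nu>) + 3 / (2 * \<nu>) \<le> C_star R \<nu> - 1"
proof -
  define M where "M = 3 * R\<^sup>2"
  have M: "M > 0" using assms by (simp add: M_def)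
  show \<alpha>: "\<alpha> > 0" using M assms by (simp add: \<alpha>_def M_def)
  \<comment> \<open>The power term in the bracket of \<open>C_star\<close>. Then
    \<open>\<alpha>\<^sup>2 = T * \<nu>\<close> and \<open>9 * R ^ 4 = T * \<alpha>\<close>, so the
    two terms amount to \<open>13 / 16 * T\<close>, within the available
    \<open>3 / 2 * T\<close>.\<close>
  define T where "T = M powr (4 / 3) * \<nu> powr (- 1 / 3)"
  have T: "T \<ge> 0" by (simp add: T_def)
  have a: "\<alpha> = M powr (2 / 3) * \<nu> powr (1 / 3)" by (simp add: \<alpha>_def M_def)
  have sq: "(x powr b)\<^sup>2 = x powr (2 * b)" for x b :: real
    by (simp add: power2_eq_square powr_add[symmetric])
  have "\<alpha>\<^sup>2 = M powr (4 / 3) * \<nu> powr (2 / 3)" by (simp add: a power_mult_distrib sq)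
  also have "\<nu> powr (2 / 3) = \<nu> powr (- 1 / 3) * \<nu> powr 1"
    by (simp only: powr_add[symmetric]) simp
  finally have e1: "\<alpha>\<^sup>2 = T * \<nu>" using assms by (simp add: T_def)
  have "T * \<alpha> = (M powr (4 / 3) * M powr (2 / 3)) * (\<nu> powr (- 1 / 3) * \<nu> powr (1 / 3))" by (simp add: T_def a)
  also have "\<dots> = M powr (4 / 3 + 2 / 3) * \<nu> powr (- 1 / 3 + 1 / 3)" by (simp only: powr_add)
  also have "\<dots> = M powr 2" using assms by simp
  also have "\<dots> = M\<^sup>2" using M by (simp add: powr_numeral)
  also have "\<dots> = 9 * R ^ 4" by (simp add: M_def power_mult_distrib power_mult[symmetric])
  finally have e2: "9 * R ^ 4 = T * \<alpha>" by simp
  have "9 * R ^ 4 / (16 * \<alpha>) = T / 16" unfolding e2 using \<alpha> by simp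
  moreover have "3 * \<alpha>\<^sup>2 / (4 * \<nu>) = 3 / 4 * T" unfolding e1 using assms by simp
  moreover have "C_star R \<nu> - 1 = 3 / 2 * R\<^sup>2 + 3 / 2 * T + 3 / (2 * \<nu>)"
    by (simp add: C_star_def T_def M_def distrib_left)
  ultimately show "3 / 2 * R\<^sup>2 + 9 * R ^ 4 / (16 * \<alpha>) + 3 * \<alpha>\<^sup>2 / (4 * \<nu>) + 3 / (2 * \<nu>) \<le> C_star R \<nu> - 1"
    using T by linarith
qed

section \<open>The space H2n and the nonlinear term\<close>

context convex_domain
begin

lemma H2nD:
  assumes v: "v \<in> H2n \<Omega>"
  shows "v \<in> H_space 2 \<Omega>" "v \<in> L2 \<Omega>"
    "\<And>i. i \<in> Basis \<Longrightarrow> weak_deriv \<Omega> [i] v \<in> L2 \<Omega>" "\<And>i. i \<in> Basis \<Longrightarrow> has_weak_deriv \<Omega> [i] v (weak_deriv \<Omega> [i] v)"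
    "\<And>i j. i \<in> Basis \<Longrightarrow> j \<in> Basis \<Longrightarrow> weak_deriv \<Omega> [i, j] v \<in> L2 \<Omega>"
    "\<And>i j. i \<in> Basis \<Longrightarrow> j \<in> Basis \<Longrightarrow> has_weak_deriv \<Omega> [j] (weak_deriv \<Omega> [i] v) (weak_deriv \<Omega> [i, j] v)"
    "laplacian \<Omega> v \<in> L2 \<Omega>"
proof -
  show H: "v \<in> H_space 2 \<Omega>" using v by (simp add: H2n_def)
  then show "v \<in> L2 \<Omega>" by (simp add: H_space_def)
  show w1: "\<And>i. i \<in> Basis \<Longrightarrow> weak_deriv \<Omega> [i] v \<in> L2 \<Omega>" and w2: "\<And>i. i \<in> Basis \<Longrightarrow> has_weak_deriv \<Omega> [i] v (weak_deriv \<Omega> [i] v)"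
    using H_space_weak_deriv[OF \<Omega>(1) H] by auto
  show w3: "\<And>i j. i \<in> Basis \<Longrightarrow> j \<in> Basis \<Longrightarrow> weak_deriv \<Omega> [i, j] v \<in> L2 \<Omega>"
    using H_space_weak_deriv[OF \<Omega>(1) H] by auto
  show "has_weak_deriv \<Omega> [j] (weak_deriv \<Omega> [i] v) (weak_deriv \<Omega> [i, j] v)" if "i \<in> Basis" "j \<in> Basis" for i j
    using that by (intro has_weak_deriv_second[OF \<Omega>(1) _ _ w2] H_space_weak_deriv(1)[OF \<Omega>(1) H]) auto
  show "laplacian \<Omega> v \<in> L2 \<Omega>" unfolding laplacian_def by (intro L2_sum w3)
qed

lemma H2n_bounded:
  assumes "DIM('a) \<le> 3" "v \<in> H2n \<Omega>"
  obtains B where "AE x in M. \<bar>v x\<bar> \<le> B"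
  using sobolev_bounded[OF assms(1) H2nD(2)[OF assms(2)] H2nD(3)[OF assms(2)] H2nD(4)[OF assms(2)]
      H2nD(5)[OF assms(2)] H2nD(6)[OF assms(2)]] by blast

lemma H2n_H1_approx: "v \<in> H2n \<Omega> \<Longrightarrow> H1_approx v (\<lambda>i. weak_deriv \<Omega> [i] v)"
  by (intro H1_approx_weak H2nD)

text \<open>Applied with two functions \<open>w\<close>: the difference of the solutions, which
  expresses its gradient norm through the Laplacian, and the difference of their cubes.\<close>

lemma H2n_green:
  assumes v: "v \<in> H2n \<Omega>" and w: "H1_approx w W" "AE x in M. \<bar>w x\<bar> \<le> B"
  shows "L2_inner \<Omega> w (laplacian \<Omega> v) = - (\<Sum>i\<in>Basis. L2_inner \<Omega> (W i) (weak_deriv \<Omega> [i] v))"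
proof -
  obtain G where G: "\<And>i. i \<in> Basis \<Longrightarrow> has_trace \<Omega> (weak_deriv \<Omega> [i] v) (G i)"
    "AE x in surface_measure \<Omega>. 0 = (\<Sum>i\<in>Basis. G i x * (outer_normal \<Omega> x \<bullet> i))"
    using v unfolding H2n_def has_normal_deriv_def by blast
  note D = H2nD[OF v]
  have z: "(\<Sum>i\<in>Basis. LINT x|M. W i x * weak_deriv \<Omega> [i] v x + w x * weak_deriv \<Omega> [i, i] v x) = 0"
  proof (rule green_formula[OF w _ _ G(2), where Y="\<lambda>i j. weak_deriv \<Omega> [i, j] v"])
    fix i :: 'a assume i: "i \<in> Basis"
    show "H1_approx (weak_deriv \<Omega> [i] v) (\<lambda>j. weak_deriv \<Omega> [i, j] v)" by (intro H1_approx_weak D i)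
    show "has_trace_approx (weak_deriv \<Omega> [i] v) (\<lambda>j. weak_deriv \<Omega> [i, j] v) (G i)"
      by (intro has_trace_imp_approx G D i)
  qed
  have "(LINT x|M. W i x * weak_deriv \<Omega> [i] v x + w x * weak_deriv \<Omega> [i, i] v x)
     = L2_inner \<Omega> (W i) (weak_deriv \<Omega> [i] v) + L2_inner \<Omega> w (weak_deriv \<Omega> [i, i] v)" if i: "i \<in> Basis" for i
    unfolding L2_inner_def
    by (intro Bochner_Integration.integral_add L2_mult_integrable H1_approxD[OF w(1)] D i)
  with z have "(\<Sum>i\<in>Basis. L2_inner \<Omega> (W i) (weak_deriv \<Omega> [i] v)) + (\<Sum>i\<in>Basis. L2_inner \<Omega> w (weak_deriv \<Omega> [i, i] v)) = 0"
    by (simp add: sum.distrib)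
  moreover have "L2_inner \<Omega> w (laplacian \<Omega> v) = (\<Sum>i\<in>Basis. L2_inner \<Omega> w (weak_deriv \<Omega> [i, i] v))"
    unfolding laplacian_def L2_inner_commute[of _ w] by (intro L2_inner_sum_left D H1_approxD(1)[OF w(1)])
  ultimately show ?thesis by linarith
qed

lemma H2n_laplacian_diff:
  assumes "u \<in> H2n \<Omega>" "v \<in> H2n \<Omega>"
  shows "AE x in M. laplacian \<Omega> (\<lambda>x. u x - v x) x = laplacian \<Omega> u x - laplacian \<Omega> v x"
proof -
  have "AE x in M. \<forall>i\<in>Basis. weak_deriv \<Omega> [i, i] (\<lambda>x. u x - v x) x = weak_deriv \<Omega> [i, i] u x - weak_deriv \<Omega> [i, i] v x"
    by (subst AE_finite_all) (auto intro!: H_space_weak_deriv_diff[OF \<Omega>(1) H2nD(1)[OF assms(1)] H2nD(1)[OF assms(2)]])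
  then show ?thesis unfolding laplacian_def by eventually_elim (simp add: sum_subtractf)
qed

text \<open>Both contributions of \<open>phi\<close> are brought back to \<open>zz\<close> and its
  Laplacian by \<open>gz\<close>, which says that the squared gradient \<open>Q\<close> equals
  \<open>- \<langle>zz, \<Delta> zz\<rangle>\<close>. The cubic part is allotted
  \<open>\<nu> / 3\<close> and the linear part \<open>2 * \<nu> / 3\<close> of the squared
  Laplacian.\<close>

lemma nonlinearity_estimate:
  assumes dim: "DIM('a) \<le> 3" and pos: "\<nu> > 0" "R > 0"
    and y: "y \<in> H2n \<Omega>" and a: "a \<in> H2n \<Omega>" and z: "(\<lambda>x. y x - a x) \<in> H2n \<Omega>"
    and R: "W1inf_norm \<Omega> a \<le> ereal R"
  shows "(\<lambda>x. phi (y x)) \<in> L2 \<Omega>" "(\<lambda>x. phi (a x)) \<in> L2 \<Omega>"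
    "2 * L2_inner \<Omega> (\<lambda>x. phi (y x) - phi (a x)) (laplacian \<Omega> (\<lambda>x. y x - a x))
      \<le> \<nu> * (L2_norm \<Omega> (laplacian \<Omega> (\<lambda>x. y x - a x)))\<^sup>2 + (C_star R \<nu> - 1) * (L2_norm \<Omega> (\<lambda>x. y x - a x))\<^sup>2"
proof -
  define zz where "zz x = y x - a x" for x
  note Dy = H2nD[OF y] and Da = H2nD[OF a] and Dz = H2nD[OF z, folded zz_def]
  obtain By where By: "AE x in M. \<bar>y x\<bar> \<le> By" by (rule H2n_bounded[OF dim y])
  obtain Ba where Ba: "AE x in M. \<bar>a x\<bar> \<le> Ba" by (rule H2n_bounded[OF dim a])
  obtain Bz where Bz: "AE x in M. \<bar>zz x\<bar> \<le> Bz" by (rule H2n_bounded[OF dim z, folded zz_def])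
  let ?w = "\<lambda>x. (y x)\<^sup>2 * y x - (a x)\<^sup>2 * a x"
  let ?W = "\<lambda>i x. (3 * (y x)\<^sup>2) * weak_deriv \<Omega> [i] y x - (3 * (a x)\<^sup>2) * weak_deriv \<Omega> [i] a x"
  let ?Z = "\<lambda>i. weak_deriv \<Omega> [i] zz" and ?lap = "laplacian \<Omega> zz"
  have cy: "H1_approx (\<lambda>x. (y x)\<^sup>2 * y x) (\<lambda>i x. (3 * (y x)\<^sup>2) * weak_deriv \<Omega> [i] y x)"
    by (rule H1_approx_cube[OF Dy(2,3,4) By])
  have ca: "H1_approx (\<lambda>x. (a x)\<^sup>2 * a x) (\<lambda>i x. (3 * (a x)\<^sup>2) * weak_deriv \<Omega> [i] a x)"
    by (rule H1_approx_cube[OF Da(2,3,4) Ba])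
  have w: "H1_approx ?w ?W" by (rule H1_approx_diff[OF cy ca])
  show py: "(\<lambda>x. phi (y x)) \<in> L2 \<Omega>"
    using L2_diff[OF H1_approxD(1)[OF cy] Dy(2)] by (simp add: phi_def power3_eq_cube power2_eq_square)
  show pa: "(\<lambda>x. phi (a x)) \<in> L2 \<Omega>"
    using L2_diff[OF H1_approxD(1)[OF ca] Da(2)] by (simp add: phi_def power3_eq_cube power2_eq_square)
  have wB: "AE x in M. \<bar>?w x\<bar> \<le> By\<^sup>2 * By + Ba\<^sup>2 * Ba"
    using By Ba
  proof eventually_elim
    case (elim x)
    have "\<bar>t\<^sup>2 * t\<bar> \<le> b\<^sup>2 * b" if "\<bar>t\<bar> \<le> b" for t b :: real
      unfolding abs_mult using that power_mono[OF that, of 2] by (intro mult_mono) auto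
    from this[OF elim(1)] this[OF elim(2)] show ?case by linarith
  qed
  define N where "N = (L2_norm \<Omega> zz)\<^sup>2"
  define Lp where "Lp = (L2_norm \<Omega> ?lap)\<^sup>2"
  define Q where "Q = (\<Sum>i\<in>Basis. L2_inner \<Omega> (?Z i) (?Z i))"
  define \<alpha> where "\<alpha> = (3 * R\<^sup>2) powr (2 / 3) * \<nu> powr (1 / 3)"
  note \<alpha> = C_star_absorb[OF pos, folded \<alpha>_def]
  define K where "K = 3 / 2 * R\<^sup>2 + 9 * R ^ 4 / (16 * \<alpha>)"
  have gz: "L2_inner \<Omega> zz ?lap = - Q"
    unfolding Q_def by (rule H2n_green[OF z[folded zz_def] H2n_H1_approx[OF z[folded zz_def]] Bz])
  have gw: "L2_inner \<Omega> ?w ?lap = - (\<Sum>i\<in>Basis. L2_inner \<Omega> (?W i) (?Z i))"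
    by (rule H2n_green[OF z[folded zz_def] w wB])
  have cs: "\<bar>L2_inner \<Omega> zz ?lap\<bar> \<le> L2_norm \<Omega> ?lap * L2_norm \<Omega> zz"
    using L2_Cauchy_Schwarz[OF Dz(2,7)] by (simp add: mult.commute)
  have young: "\<bar>L2_inner \<Omega> zz ?lap\<bar> \<le> s * Lp + N / (4 * s)" if "s > 0" for s
    unfolding N_def Lp_def by (rule order_trans[OF cs young_quarter[OF that]])
  have "2 * L2_inner \<Omega> ?w ?lap \<le> K * N + \<alpha> * Q"
  proof -
    have iW: "integrable M (\<lambda>x. ?W i x * ?Z i x)" if "i \<in> Basis" for i
      by (intro L2_mult_integrable H1_approxD(2)[OF w that] Dz that)
    have iZ: "integrable M (\<lambda>x. (?Z i x)\<^sup>2)" if "i \<in> Basis" for i using Dz(3)[OF that] by (simp add: L2_def)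
    have iz: "integrable M (\<lambda>x. (zz x)\<^sup>2)" using Dz(2) by (simp add: L2_def)
    have "2 * L2_inner \<Omega> ?w ?lap = (LINT x|M. - (2 * (\<Sum>i\<in>Basis. ?W i x * ?Z i x)))"
      unfolding gw unfolding L2_inner_def using iW by simp
    also have "\<dots> \<le> (LINT x|M. K * (zz x)\<^sup>2 + \<alpha> * (\<Sum>i\<in>Basis. (?Z i x)\<^sup>2))"
    proof (rule integral_mono_AE)
      show "integrable M (\<lambda>x. - (2 * (\<Sum>i\<in>Basis. ?W i x * ?Z i x)))" using iW by simp
      show "integrable M (\<lambda>x. K * (zz x)\<^sup>2 + \<alpha> * (\<Sum>i\<in>Basis. (?Z i x)\<^sup>2))" using iZ iz by simp
      have "AE x in M. \<forall>i\<in>Basis. ?Z i x = weak_deriv \<Omega> [i] y x - weak_deriv \<Omega> [i] a x"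
        unfolding zz_def by (subst AE_finite_all) (auto intro!: H_space_weak_deriv_diff[OF \<Omega>(1) Dy(1) Da(1)])
      then show "AE x in M. - (2 * (\<Sum>i\<in>Basis. ?W i x * ?Z i x)) \<le> K * (zz x)\<^sup>2 + \<alpha> * (\<Sum>i\<in>Basis. (?Z i x)\<^sup>2)"
        using W1inf_AE_bound[OF \<Omega>(1) L2_locally_integrable[OF Da(2)] R]
      proof eventually_elim
        case (elim x)
        have eqy: "y x = a x + zz x" by (simp add: zz_def)
        have "(\<Sum>i\<in>Basis. ?W i x * ?Z i x) = (\<Sum>i\<in>Basis. (3 * (a x + zz x)\<^sup>2 * (weak_deriv \<Omega> [i] a x + ?Z i x) - 3 * (a x)\<^sup>2 * weak_deriv \<Omega> [i] a x) * ?Z i x)"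
          unfolding eqy using elim(1) by (intro sum.cong refl) simp
        then show ?case
          unfolding K_def using cubic_pointwise[OF finite_Basis elim(2) \<alpha>(1), of "zz x" "\<lambda>i. ?Z i x"] by simp
      qed
    qed
    also have "\<dots> = K * N + \<alpha> * Q"
      using iZ iz by (simp add: N_def Q_def L2_norm_sq_integral L2_inner_def flip: power2_eq_square)
    finally show ?thesis .
  qed
  moreover have "\<alpha> * Q \<le> \<nu> / 3 * Lp + 3 * \<alpha>\<^sup>2 / (4 * \<nu>) * N"
  proof -
    \<comment> \<open>The Young parameter \<open>\<nu> / (3 * \<alpha>)\<close> becomes the allotted
      \<open>\<nu> / 3\<close> after multiplication by \<alpha>.\<close>
    have "Q \<le> \<nu> / (3 * \<alpha>) * Lp + N / (4 * (\<nu> / (3 * \<alpha>)))"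
      using young[of "\<nu> / (3 * \<alpha>)"] pos \<alpha>(1) unfolding gz by simp
    then have "\<alpha> * Q \<le> \<alpha> * (\<nu> / (3 * \<alpha>) * Lp + N / (4 * (\<nu> / (3 * \<alpha>))))" using \<alpha>(1) by (intro mult_left_mono) auto
    also have "\<dots> = \<nu> / 3 * Lp + 3 * \<alpha>\<^sup>2 / (4 * \<nu>) * N"
      using \<alpha>(1) pos by (simp add: distrib_left power2_eq_square field_simps)
    finally show ?thesis .
  qed
  moreover have "- (2 * L2_inner \<Omega> zz ?lap) \<le> 2 * \<nu> / 3 * Lp + 3 / (2 * \<nu>) * N"
  proof -
    have "\<bar>L2_inner \<Omega> zz ?lap\<bar> \<le> \<nu> / 3 * Lp + N / (4 * (\<nu> / 3))" using pos by (intro young) simp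
    moreover have "N / (4 * (\<nu> / 3)) = 3 / (4 * \<nu>) * N" by simp
    ultimately show ?thesis by (simp add: abs_le_iff)
  qed
  moreover have "L2_inner \<Omega> (\<lambda>x. phi (y x) - phi (a x)) ?lap = L2_inner \<Omega> ?w ?lap - L2_inner \<Omega> zz ?lap"
  proof -
    have "(\<lambda>x. phi (y x) - phi (a x)) = (\<lambda>x. ?w x - zz x)"
      by (simp add: fun_eq_iff phi_def zz_def power3_eq_cube power2_eq_square)
    then show ?thesis by (simp add: L2_inner_diff_left[OF H1_approxD(1)[OF w] Dz(2,7)])
  qed
  ultimately have "2 * L2_inner \<Omega> (\<lambda>x. phi (y x) - phi (a x)) ?lap
     \<le> \<nu> * Lp + (K * N + 3 * \<alpha>\<^sup>2 / (4 * \<nu>) * N + 3 / (2 * \<nu>) * N)" by linarith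
  also have "K * N + 3 * \<alpha>\<^sup>2 / (4 * \<nu>) * N + 3 / (2 * \<nu>) * N = (K + 3 * \<alpha>\<^sup>2 / (4 * \<nu>) + 3 / (2 * \<nu>)) * N"
    by (simp add: distrib_right)
  also have "\<nu> * Lp + \<dots> \<le> \<nu> * Lp + (C_star R \<nu> - 1) * N"
    using \<alpha>(2) by (intro add_left_mono mult_right_mono) (auto simp: K_def N_def)
  finally show "2 * L2_inner \<Omega> (\<lambda>x. phi (y x) - phi (a x)) (laplacian \<Omega> (\<lambda>x. y x - a x))
      \<le> \<nu> * (L2_norm \<Omega> (laplacian \<Omega> (\<lambda>x. y x - a x)))\<^sup>2 + (C_star R \<nu> - 1) * (L2_norm \<Omega> (\<lambda>x. y x - a x))\<^sup>2"
    unfolding N_def Lp_def zz_def .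
qed

end

text \<open>\<open>exp (- (\<gamma>' * \<tau>))\<close> is exactly
  \<open>1 / (1 + \<tau> * \<gamma>)\<close>, so one implicit step is one multiplication by
  \<open>q\<close>, and the exponential factor on the initial value loses nothing.\<close>

lemma discrete_gronwall:
  fixes E H :: "nat \<Rightarrow> real"
  assumes pos: "\<tau> > 0" "\<gamma> > 0" and \<gamma>': "\<tau> * \<gamma>' = ln (1 + \<tau> * \<gamma>)" and H: "\<And>k. H k \<ge> 0"
    and step: "\<And>n. (1 + \<tau> * \<gamma>) * E (Suc n) \<le> E n + \<tau> * H (Suc n)"
  shows "E n \<le> exp (- \<gamma>' * (real n * \<tau>)) * E 0 + (\<Sum>k=0..n. \<tau> * exp (- \<gamma>' * (real n * \<tau> - real k * \<tau>)) * H k)"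
proof (induction n)
  case 0
  \<comment> \<open>The sum already contains the nonnegative term \<open>k = 0\<close>.\<close>
  then show ?case using pos H[of 0] by simp
next
  case (Suc n)
  define q where "q = exp (- (\<gamma>' * \<tau>))"
  have tg: "\<tau> * \<gamma> > 0" using pos by simp
  have q: "q * (1 + \<tau> * \<gamma>) = 1"
    using tg \<gamma>' by (simp add: q_def mult.commute[of \<gamma>'] exp_minus)
  have q0: "q > 0" and q1: "q \<le> 1"
    using \<gamma>' tg ln_ge_zero[of "1 + \<tau> * \<gamma>"] by (auto simp: q_def mult.commute[of \<gamma>'])
  have shift: "q * exp (- \<gamma>' * (real n * \<tau> - s)) = exp (- \<gamma>' * (real (Suc n) * \<tau> - s))" for s
    by (simp add: q_def exp_add[symmetric] algebra_simps)
  have "E (Suc n) = q * ((1 + \<tau> * \<gamma>) * E (Suc n))" using q by (simp add: mult.assoc[symmetric])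
  also have "\<dots> \<le> q * (E n + \<tau> * H (Suc n))" using q0 by (intro mult_left_mono step) simp
  \<comment> \<open>The factor \<open>q\<close> in front of the newest source term is given up,
    which matches the plain weight \<tau> of the last index in the claim.\<close>
  also have "\<dots> \<le> q * E n + \<tau> * H (Suc n)"
    using mult_right_mono[OF q1, of "\<tau> * H (Suc n)"] pos H[of "Suc n"] by (simp add: distrib_left)
  also have "q * E n \<le> q * (exp (- \<gamma>' * (real n * \<tau>)) * E 0 + (\<Sum>k=0..n. \<tau> * exp (- \<gamma>' * (real n * \<tau> - real k * \<tau>)) * H k))"
    using q0 by (intro mult_left_mono Suc.IH) simp
  also have "\<dots> = (q * exp (- \<gamma>' * (real n * \<tau> - 0))) * E 0 + (\<Sum>k=0..n. \<tau> * (q * exp (- \<gamma>' * (real n * \<tau> - real k * \<tau>))) * H k)"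
    by (simp add: distrib_left sum_distrib_left mult_ac)
  also have "\<dots> = exp (- \<gamma>' * (real (Suc n) * \<tau>)) * E 0 + (\<Sum>k=0..n. \<tau> * exp (- \<gamma>' * (real (Suc n) * \<tau> - real k * \<tau>)) * H k)"
    unfolding shift by simp
  finally show ?case by simp
qed

section \<open>The stability estimate\<close>

theorem theorem4p3:
  fixes \<Omega> :: "'a::euclidean_space set"
    and \<nu> R \<gamma> \<gamma>' \<tau> :: real
    and F :: "('a \<Rightarrow> real) \<Rightarrow> ('a \<Rightarrow> real) \<Rightarrow> real"
    and V :: "('a \<Rightarrow> real) set"
    and h h\<^sub>r y y\<^sub>r :: "nat \<Rightarrow> 'a \<Rightarrow> real"
    and t :: "nat \<Rightarrow> real"
  assumes dim: "DIM('a) \<le> 3"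
    and domain: "open \<Omega>" "connected \<Omega>" "\<Omega> \<noteq> {}" "bounded \<Omega>" "convex \<Omega>"
    and pos: "\<nu> > 0" "R > 0" "\<gamma> > 0" "\<tau> > 0"
    and F: "linear_continuous_into_dual \<Omega> F"
    and F_nonneg: "\<forall>z\<in>H2n \<Omega>. F z z \<ge> 0"
    and F_coercive: "\<forall>z\<in>H2n \<Omega>.
          \<nu> * (L2_norm \<Omega> (laplacian \<Omega> z))\<^sup>2 + 2 * F z z \<ge> (C_star R \<nu> + \<gamma>) * (L2_norm \<Omega> z)\<^sup>2"
    and V: "V \<subseteq> H2n \<Omega>" "fin_dim_subspace \<Omega> V"
    and t: "\<forall>n. t n = real n * \<tau>"
    and h: "\<forall>n. h n \<in> L2 \<Omega>" "\<forall>n. h\<^sub>r n \<in> L2 \<Omega>"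
    and yr: "\<forall>n. y\<^sub>r n \<in> V"
    and yr_bound: "\<forall>n. y\<^sub>r n \<in> W1inf \<Omega> \<and> W1inf_norm \<Omega> (y\<^sub>r n) \<le> ereal R"
    and yr_eq: "\<forall>n\<ge>1. \<forall>v\<in>V.
          L2_inner \<Omega> (diff_quot \<tau> y\<^sub>r n) v
            + L2_inner \<Omega> (\<lambda>x. \<nu> * laplacian \<Omega> (y\<^sub>r n) x) (laplacian \<Omega> v)
            - L2_inner \<Omega> (\<lambda>x. phi (y\<^sub>r n x)) (laplacian \<Omega> v)
          = L2_inner \<Omega> (h\<^sub>r n) v"
    and y: "\<forall>n. y n \<in> V"
    and y_eq: "\<forall>n\<ge>1. \<forall>v\<in>V.
          L2_inner \<Omega> (diff_quot \<tau> y n) v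
            + L2_inner \<Omega> (\<lambda>x. \<nu> * laplacian \<Omega> (y n) x) (laplacian \<Omega> v)
          = L2_inner \<Omega> (\<lambda>x. phi (y n x)) (laplacian \<Omega> v)
            + L2_inner \<Omega> (h n) v
            - F (\<lambda>x. y n x - y\<^sub>r n x) v"
    and \<gamma>': "\<tau> * \<gamma>' = ln (1 + \<tau> * \<gamma>)"
  shows "(\<forall>n. (L2_norm \<Omega> (\<lambda>x. y n x - y\<^sub>r n x))\<^sup>2
            \<le> exp (- \<gamma>' * t n) * (L2_norm \<Omega> (\<lambda>x. y 0 x - y\<^sub>r 0 x))\<^sup>2
              + (\<Sum>k=0..n. \<tau> * exp (- \<gamma>' * (t n - t k)) * (L2_norm \<Omega> (\<lambda>x. h k x - h\<^sub>r k x))\<^sup>2))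
       \<and> ((\<forall>k. AE x in lebesgue_on \<Omega>. h k x = h\<^sub>r k x) \<longrightarrow>
            \<gamma>' > 0 \<and>
            (\<forall>n. (L2_norm \<Omega> (\<lambda>x. y n x - y\<^sub>r n x))\<^sup>2
                   \<le> exp (- \<gamma>' * t n) * (L2_norm \<Omega> (\<lambda>x. y 0 x - y\<^sub>r 0 x))\<^sup>2))"
proof -
  obtain c where "c \<in> \<Omega>" using domain(3) by auto
  then obtain r where r: "r > 0" "ball c r \<subseteq> \<Omega>" using openE[OF domain(1)] by metis
  interpret convex_domain \<Omega> c r by unfold_locales (use domain r in auto)
  define z where "z n x = y n x - y\<^sub>r n x" for n x
  define H where "H n x = h n x - h\<^sub>r n x" for n x
  \<comment> \<open>Membership in \<open>V\<close> serves twice: \<open>z n\<close> becomes an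
    admissible test function, and it lies in \<open>H2n\<close> together with its boundary
    condition.\<close>
  have zV: "z n \<in> V" for n
  proof -
    have "(\<lambda>x. 1 * y n x + (- 1) * y\<^sub>r n x) \<in> V"
      using V(2) y yr unfolding fin_dim_subspace_def by blast
    then show ?thesis by (simp add: z_def[abs_def])
  qed
  have z2: "z n \<in> H2n \<Omega>" and y2: "y n \<in> H2n \<Omega>" and r2: "y\<^sub>r n \<in> H2n \<Omega>" for n
    using zV y yr V(1) by auto
  have zL: "z n \<in> L2 \<Omega>" for n by (rule H2nD(2)[OF z2])
  have HL: "H n \<in> L2 \<Omega>" for n unfolding H_def[abs_def] using h by (intro L2_diff) auto
  have step: "(1 + \<tau> * \<gamma>) * (L2_norm \<Omega> (z (Suc n)))\<^sup>2 \<le> (L2_norm \<Omega> (z n))\<^sup>2 + \<tau> * (L2_norm \<Omega> (H (Suc n)))\<^sup>2" for n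
  proof -
    let ?N = "Suc n"
    let ?L = "laplacian \<Omega> (z ?N)"
    have Y: "L2_inner \<Omega> (diff_quot \<tau> u ?N) w = (L2_inner \<Omega> (u ?N) w - L2_inner \<Omega> (u n) w) / \<tau>"
      if "u ?N \<in> L2 \<Omega>" "u n \<in> L2 \<Omega>" "w \<in> L2 \<Omega>" for u :: "nat \<Rightarrow> 'a \<Rightarrow> real" and w
      using L2_inner_cmult_left[of \<Omega> "1 / \<tau>" "\<lambda>x. u ?N x - u n x" w] L2_inner_diff_left[OF that]
      by (simp add: diff_quot_def)
    note zN = zL[of ?N] and LL = H2nD(7)[OF z2[of ?N]]
    note Ly = H2nD(7)[OF y2[of ?N]] and Lr = H2nD(7)[OF r2[of ?N]]
    note nl = nonlinearity_estimate[OF dim pos(1,2) y2[of ?N] r2[of ?N] z2[of ?N, unfolded z_def[abs_def]]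
        conjunct2[OF yr_bound[rule_format, of ?N]]]
    have e1: "L2_inner \<Omega> (y ?N) (z ?N) - L2_inner \<Omega> (y\<^sub>r ?N) (z ?N) = (L2_norm \<Omega> (z ?N))\<^sup>2"
      using L2_inner_diff_left[OF H2nD(2)[OF y2[of ?N]] H2nD(2)[OF r2[of ?N]] zN]
      by (simp add: L2_norm_sq z_def[abs_def])
    have e2: "L2_inner \<Omega> (y n) (z ?N) - L2_inner \<Omega> (y\<^sub>r n) (z ?N) = L2_inner \<Omega> (z n) (z ?N)"
      using L2_inner_diff_left[OF H2nD(2)[OF y2[of n]] H2nD(2)[OF r2[of n]] zN]
      by (simp add: z_def[abs_def])
    have e3: "L2_inner \<Omega> (h ?N) (z ?N) - L2_inner \<Omega> (h\<^sub>r ?N) (z ?N) = L2_inner \<Omega> (H ?N) (z ?N)"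
      using L2_inner_diff_left[OF h(1)[rule_format] h(2)[rule_format] zN]
      by (simp add: H_def[abs_def])
    \<comment> \<open>The Laplacian of the difference is the difference of the Laplacians only
      almost everywhere, since each \<open>weak_deriv\<close> is a separate choice.\<close>
    have e4: "L2_inner \<Omega> (laplacian \<Omega> (y ?N)) ?L - L2_inner \<Omega> (laplacian \<Omega> (y\<^sub>r ?N)) ?L = (L2_norm \<Omega> ?L)\<^sup>2"
    proof -
      have "L2_inner \<Omega> (\<lambda>x. laplacian \<Omega> (y ?N) x - laplacian \<Omega> (y\<^sub>r ?N) x) ?L = L2_inner \<Omega> ?L ?L"
      proof (rule L2_inner_cong)
        show "AE x in M. laplacian \<Omega> (y ?N) x - laplacian \<Omega> (y\<^sub>r ?N) x = ?L x"
          using H2n_laplacian_diff[OF y2[of ?N] r2[of ?N]] unfolding z_def[abs_def] by eventually_elim simp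
      qed (use L2_measurable[OF L2_diff[OF Ly Lr]] L2_measurable[OF LL] in auto)
      then show ?thesis using L2_inner_diff_left[OF Ly Lr LL] by (simp add: L2_norm_sq)
    qed
    have e5: "L2_inner \<Omega> (\<lambda>x. phi (y ?N x)) ?L - L2_inner \<Omega> (\<lambda>x. phi (y\<^sub>r ?N x)) ?L
        = L2_inner \<Omega> (\<lambda>x. phi (y ?N x) - phi (y\<^sub>r ?N x)) ?L"
      by (rule L2_inner_diff_left[OF nl(1,2) LL, symmetric])
    have half: "\<bar>L2_inner \<Omega> u w\<bar> \<le> ((L2_norm \<Omega> u)\<^sup>2 + (L2_norm \<Omega> w)\<^sup>2) / 2" if "u \<in> L2 \<Omega>" "w \<in> L2 \<Omega>" for u w
      using L2_Cauchy_Schwarz[OF that] sum_squares_bound[of "L2_norm \<Omega> u" "L2_norm \<Omega> w"] by simp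
    have eqy: "(L2_inner \<Omega> (y ?N) (z ?N) - L2_inner \<Omega> (y n) (z ?N)) / \<tau> + \<nu> * L2_inner \<Omega> (laplacian \<Omega> (y ?N)) ?L
        = L2_inner \<Omega> (\<lambda>x. phi (y ?N x)) ?L + L2_inner \<Omega> (h ?N) (z ?N) - F (z ?N) (z ?N)"
      using y_eq[rule_format, of ?N, OF _ zV[of ?N]] Y[of y, OF H2nD(2)[OF y2] H2nD(2)[OF y2] zN]
      by (simp add: L2_inner_cmult_left z_def[abs_def])
    have eqr: "(L2_inner \<Omega> (y\<^sub>r ?N) (z ?N) - L2_inner \<Omega> (y\<^sub>r n) (z ?N)) / \<tau> + \<nu> * L2_inner \<Omega> (laplacian \<Omega> (y\<^sub>r ?N)) ?L
        = L2_inner \<Omega> (\<lambda>x. phi (y\<^sub>r ?N x)) ?L + L2_inner \<Omega> (h\<^sub>r ?N) (z ?N)"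
      using yr_eq[rule_format, of ?N, OF _ zV[of ?N]] Y[of y\<^sub>r, OF H2nD(2)[OF r2] H2nD(2)[OF r2] zN]
      by (simp add: L2_inner_cmult_left)
    define E E' D where "E = (L2_norm \<Omega> (z ?N))\<^sup>2" and "E' = (L2_norm \<Omega> (z n))\<^sup>2" and "D = (L2_norm \<Omega> (H ?N))\<^sup>2"
    \<comment> \<open>\<open>p\<close> is the difference quotient of \<open>z\<close> tested with
      its new value, and \<open>q\<close> its lower bound from \<open>2 * \<langle>b - a, b\<rangle>
      \<ge> \<parallel>b\<parallel>\<^sup>2 - \<parallel>a\<parallel>\<^sup>2\<close>.\<close>
    define p q where "p = (E - L2_inner \<Omega> (z n) (z ?N)) / \<tau>" and "q = ((E - E') / 2) / \<tau>"
    have "p + \<nu> * (L2_norm \<Omega> ?L)\<^sup>2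
        = L2_inner \<Omega> (\<lambda>x. phi (y ?N x) - phi (y\<^sub>r ?N x)) ?L + L2_inner \<Omega> (H ?N) (z ?N) - F (z ?N) (z ?N)"
      using eqy eqr unfolding p_def E_def e1[symmetric] e2[symmetric] e3[symmetric] e4[symmetric] e5[symmetric]
      by (simp add: diff_divide_distrib right_diff_distrib)
    moreover have "q \<le> p"
      unfolding p_def q_def using half[OF zL[of n] zN] pos(4) by (intro divide_right_mono) (auto simp: E_def E'_def abs_le_iff)
    moreover have "L2_inner \<Omega> (H ?N) (z ?N) \<le> (D + E) / 2"
      using half[OF HL[of ?N] zN] by (simp add: D_def E_def abs_le_iff)
    moreover have "2 * L2_inner \<Omega> (\<lambda>x. phi (y ?N x) - phi (y\<^sub>r ?N x)) ?L \<le> \<nu> * (L2_norm \<Omega> ?L)\<^sup>2 + (C_star R \<nu> - 1) * E"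
      using nl(3) unfolding E_def z_def[abs_def] .
    moreover have "\<nu> * (L2_norm \<Omega> ?L)\<^sup>2 + 2 * F (z ?N) (z ?N) \<ge> (C_star R \<nu> + \<gamma>) * E"
      using F_coercive z2[of ?N] unfolding E_def by blast
    \<comment> \<open>The balance of the doubled identity: one \<open>L\<close> absorbs the
      nonlinearity \<open>P\<close>, the other is handed to coercivity together with
      \<open>2 * f\<close>. The \<open>(C - 1) * E\<close> left by the nonlinearity and the
      \<open>E\<close> left by the source make up the \<open>C * E\<close> that coercivity
      covers.\<close>
    moreover have "2 * q + \<gamma> * E \<le> D"
      if "p + L = P + B - f" "q \<le> p" "B \<le> (D + E) / 2" "2 * P \<le> L + (C - 1) * E" "(C + \<gamma>) * E \<le> L + 2 * f"
      for L P B f C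
      using that by (simp add: distrib_right left_diff_distrib)
    ultimately have "2 * q + \<gamma> * E \<le> D" by blast
    then show ?thesis
      using pos(4) unfolding q_def E_def[symmetric] E'_def[symmetric] D_def[symmetric] by (simp add: field_simps)
  qed
  have est: "(L2_norm \<Omega> (z n))\<^sup>2 \<le> exp (- \<gamma>' * t n) * (L2_norm \<Omega> (z 0))\<^sup>2
      + (\<Sum>k=0..n. \<tau> * exp (- \<gamma>' * (t n - t k)) * (L2_norm \<Omega> (H k))\<^sup>2)" for n
    unfolding t[rule_format]
    by (rule discrete_gronwall[where E="\<lambda>n. (L2_norm \<Omega> (z n))\<^sup>2" and H="\<lambda>n. (L2_norm \<Omega> (H n))\<^sup>2",
        OF pos(4,3) \<gamma>' zero_le_power2 step])
  moreover have "\<gamma>' > 0"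
  proof -
    have "\<tau> * \<gamma>' > 0" unfolding \<gamma>' using mult_pos_pos[OF pos(4,3)] by (intro ln_gt_zero) linarith
    then show ?thesis using pos(4) by (simp add: zero_less_mult_iff)
  qed
  moreover have "(L2_norm \<Omega> (z n))\<^sup>2 \<le> exp (- \<gamma>' * t n) * (L2_norm \<Omega> (z 0))\<^sup>2"
    if eq: "\<forall>k. AE x in lebesgue_on \<Omega>. h k x = h\<^sub>r k x" for n
  proof -
    have "L2_norm \<Omega> (H k) = L2_norm \<Omega> (\<lambda>x. 0)" for k
      by (rule L2_norm_cong) (use eq L2_measurable[OF HL] in \<open>auto simp: H_def\<close>)
    then have "L2_norm \<Omega> (H k) = 0" for k by (simp add: L2_norm_def L2_inner_def)
    then show ?thesis using est[of n] by simp
  qed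
  ultimately show ?thesis unfolding z_def[abs_def] H_def[abs_def] by simp
qed

end
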